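(* Let $G=\mathbf{SL}_4$, let $B$ be the Borel subgroup of upper triangular matrices, let $P$ be a parabolic subgroup of $G$ containing $B$, and let $X_{wP}$ ($w\in W$) be a Schubert variety in $G/P$. If $L(w)$ is a Levi subgroup of $\mathrm{Stab}_G(X_{wP})$, then $X_{wP}$ is a spherical $L(w)$-variety.
   Context: Everything is over $\mathbb{C}$. $T\subset B$ is the diagonal torus and $W=N_G(T)/T\cong S_4$ is the Weyl group. For $w\in W$, $X_{wP}$ is the Zariski closure of $BwP/P$ in $G/P$, equivalently the image of $X_{wB}=\overline{BwB/B}\subset G/B$ under the canonical projection $G/B\to G/P$. $\mathrm{Stab}_G(X_{wP})$ is the stabilizer for the left multiplication action of $G$ on $G/P$; it is a parabolic subgroup. A Levi subgroup of a parabolic subgroup $Q$ is a subgroup $L\subset Q$ with $Q=L\ltimes \mathcal{R}_u(Q)$, where $\mathcal{R}_u(Q)$ is the unipotent radical. For a connected reductive group $H$, a normal variety $Y$ with an algebraic $H$-action is a spherical $H$-variety if a Borel subgroup of $H$ has a dense open orbit in $Y$. *)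

theory Defs
  imports "HOL-Analysis.Analysis" "HOL-Algebra.Group_Action"
    "HOL-Algebra.Left_Coset" "HOL-Algebra.Solvable_Groups"
begin

(* HOL-Algebra uses the same notation for the closure in a generalised order. *)
no_notation eq_closure_of (\<open>closure'_of\<index>\<close>)

section \<open>The special linear group and its Zariski topology\<close>

definition SL :: "(complex^'n^'n::finite) monoid" where
  "SL = \<lparr>carrier = {A. det A = 1}, mult = (**), one = mat 1\<rparr>"

lemma group_SL: "Group.group (SL :: (complex^'n^'n::finite) monoid)"
proof (rule groupI)
  fix x :: "complex^'n^'n"
  assume "x \<in> carrier SL"
  then have d: "det x = 1" by (simp add: SL_def)
  then obtain y where y: "y ** x = mat 1"
    using invertible_det_nz[of x] unfolding invertible_def by auto
  then have "det y * det x = 1" using det_mul[of y x] by simp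
  then have "det y = 1" by (simp add: d)
  with y show "\<exists>y\<in>carrier SL. y \<otimes>\<^bsub>SL\<^esub> x = \<one>\<^bsub>SL\<^esub>" by (auto simp: SL_def)
qed (simp_all add: SL_def det_mul matrix_mul_assoc)

inductive polynomial_fun :: "(complex^'n^'n::finite \<Rightarrow> complex) \<Rightarrow> bool" where
  const: "polynomial_fun (\<lambda>A. c)"
| entry: "polynomial_fun (\<lambda>A. A $ i $ j)"
| add: "polynomial_fun p \<Longrightarrow> polynomial_fun q \<Longrightarrow> polynomial_fun (\<lambda>A. p A + q A)"
| mult: "polynomial_fun p \<Longrightarrow> polynomial_fun q \<Longrightarrow> polynomial_fun (\<lambda>A. p A * q A)"

definition zariski :: "(complex^'n^'n::finite) topology" where
  "zariski = topology (\<lambda>U. \<exists>S \<subseteq> Collect polynomial_fun. U = {A \<in> carrier SL. \<exists>p\<in>S. p A \<noteq> 0})"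

lemma openin_zariski:
  "openin (zariski :: (complex^'n^'n::finite) topology) U \<longleftrightarrow>
     (\<exists>S \<subseteq> Collect polynomial_fun. U = {A \<in> carrier SL. \<exists>p\<in>S. p A \<noteq> 0})"
proof -
  let ?D = "\<lambda>S. {A \<in> carrier SL. \<exists>p\<in>S. p A \<noteq> (0::complex)}"
  have "istopology (\<lambda>U :: (complex^'n^'n) set. \<exists>S \<subseteq> Collect polynomial_fun. U = ?D S)"
    unfolding istopology_def
  proof safe
    fix S T :: "(complex^'n^'n \<Rightarrow> complex) set"
    assume S: "S \<subseteq> Collect polynomial_fun" and T: "T \<subseteq> Collect polynomial_fun"
    let ?R = "(\<lambda>(p, q) A. p A * q A) ` (S \<times> T)"
    have "?R \<subseteq> Collect polynomial_fun"
      using S T by (auto intro: polynomial_fun.mult)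
    moreover have "?D S \<inter> ?D T = ?D ?R" by (simp add: set_eq_iff bex_Un split_beta) blast
    ultimately show "\<exists>R \<subseteq> Collect polynomial_fun. ?D S \<inter> ?D T = ?D R" by blast
  next
    fix K :: "(complex^'n^'n) set set"
    assume "\<forall>U\<in>K. \<exists>S \<subseteq> Collect polynomial_fun. U = ?D S"
    from bchoice[OF this] obtain F where F: "\<forall>U\<in>K. F U \<subseteq> Collect polynomial_fun \<and> U = ?D (F U)" ..
    then have "\<Union>K = ?D (\<Union>(F ` K))" by blast
    with F show "\<exists>S \<subseteq> Collect polynomial_fun. \<Union>K = ?D S" by blast
  qed
  then show ?thesis by (simp add: zariski_def)
qed

lemma topspace_zariski: "topspace (zariski :: (complex^'n^'n::finite) topology) = carrier SL"
proof -
  have "openin zariski (carrier SL :: (complex^'n^'n) set)"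
    unfolding openin_zariski
    by (rule exI[of _ "{\<lambda>A. 1}"]) (auto intro: polynomial_fun.const)
  then show ?thesis
    by (auto simp: topspace_def openin_zariski)
qed

definition closed_subgroup :: "(complex^'n^'n::finite) set \<Rightarrow> bool" where
  "closed_subgroup H \<longleftrightarrow> subgroup H SL \<and> closedin zariski H"

definition unipotent :: "complex^'n^'n::finite \<Rightarrow> bool" where
  "unipotent A \<longleftrightarrow> (\<exists>k. ((\<lambda>M. (A - mat 1) ** M) ^^ k) (mat 1) = 0)"

section \<open>Structure theory of closed subgroups\<close>

definition connected_solvable_subgroup :: "(complex^'n^'n::finite) set \<Rightarrow> bool" where
  "connected_solvable_subgroup H \<longleftrightarrow>
     closed_subgroup H \<and> connectedin zariski H \<and> solvable (SL\<lparr>carrier := H\<rparr>)"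

definition borel_subgroup :: "(complex^'n^'n::finite) set \<Rightarrow> (complex^'n^'n) set \<Rightarrow> bool" where
  "borel_subgroup H B \<longleftrightarrow>
     connected_solvable_subgroup B \<and> B \<subseteq> H \<and>
     (\<forall>C. connected_solvable_subgroup C \<and> B \<subseteq> C \<and> C \<subseteq> H \<longrightarrow> C = B)"

definition parabolic_subgroup :: "(complex^'n^'n::finite) set \<Rightarrow> bool" where
  "parabolic_subgroup P \<longleftrightarrow> closed_subgroup P \<and> (\<exists>B. borel_subgroup (carrier SL) B \<and> B \<subseteq> P)"

definition unipotent_radical :: "(complex^'n^'n::finite) set \<Rightarrow> (complex^'n^'n) set" where
  "unipotent_radical Q = (GREATEST U. closed_subgroup U \<and> connectedin zariski U \<and>
     U \<lhd> SL\<lparr>carrier := Q\<rparr> \<and> (\<forall>u\<in>U. unipotent u))"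

definition connected_reductive :: "(complex^'n^'n::finite) set \<Rightarrow> bool" where
  "connected_reductive H \<longleftrightarrow>
     closed_subgroup H \<and> connectedin zariski H \<and> unipotent_radical H = {\<one>\<^bsub>SL\<^esub>}"

definition levi_subgroup :: "(complex^'n^'n::finite) set \<Rightarrow> (complex^'n^'n) set \<Rightarrow> bool" where
  "levi_subgroup Q L \<longleftrightarrow> closed_subgroup L \<and> L \<subseteq> Q \<and>
     L <#>\<^bsub>SL\<^esub> unipotent_radical Q = Q \<and> L \<inter> unipotent_radical Q = {\<one>\<^bsub>SL\<^esub>}"

section \<open>Normal varieties\<close>

text \<open>A variety is given by a topology together with the predicate \<open>reg U f\<close> saying that
  \<open>f\<close> is a regular function on the open set \<open>U\<close> (values of \<open>f\<close> outside \<open>U\<close> are irrelevant).\<close>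

definition irreducible_space :: "'a topology \<Rightarrow> bool" where
  "irreducible_space X \<longleftrightarrow> topspace X \<noteq> {} \<and>
     (\<forall>C D. closedin X C \<and> closedin X D \<and> C \<union> D = topspace X \<longrightarrow>
        C = topspace X \<or> D = topspace X)"

text \<open>The local ring at \<open>x\<close> is integrally closed in its field of fractions: a fraction \<open>f/g\<close> of
  germs (\<open>g\<close> not the zero germ) that is integral over the local ring is itself a germ \<open>h\<close>. The
  finitely many germs involved are represented on a common neighbourhood \<open>V\<close>, and the integral
  equation for \<open>f/g\<close> is multiplied by \<open>g\<^sup>m\<close>.\<close>

definition integrally_closed_at ::
    "'a topology \<Rightarrow> ('a set \<Rightarrow> ('a \<Rightarrow> complex) \<Rightarrow> bool) \<Rightarrow> 'a \<Rightarrow> bool" where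
  "integrally_closed_at X reg x \<longleftrightarrow>
     (\<forall>V f g (m::nat) a.
        openin X V \<and> x \<in> V \<and> reg V f \<and> reg V g \<and> (\<forall>i<m. reg V (a i)) \<and>
        \<not> (\<exists>V'. openin X V' \<and> x \<in> V' \<and> V' \<subseteq> V \<and> (\<forall>v\<in>V'. g v = 0)) \<and>
        (\<forall>v\<in>V. f v ^ m + (\<Sum>i<m. a i v * f v ^ i * g v ^ (m - i)) = 0) \<longrightarrow>
        (\<exists>V' h. openin X V' \<and> x \<in> V' \<and> V' \<subseteq> V \<and> reg V' h \<and> (\<forall>v\<in>V'. f v = g v * h v)))"

definition normal_variety :: "'a topology \<Rightarrow> ('a set \<Rightarrow> ('a \<Rightarrow> complex) \<Rightarrow> bool) \<Rightarrow> bool" where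
  "normal_variety X reg \<longleftrightarrow>
     irreducible_space X \<and> (\<forall>x\<in>topspace X. integrally_closed_at X reg x)"

section \<open>The variety $G/P$ and its closed subvarieties\<close>

definition regular_SL :: "(complex^'n^'n::finite) set \<Rightarrow> (complex^'n^'n \<Rightarrow> complex) \<Rightarrow> bool" where
  "regular_SL U f \<longleftrightarrow> openin zariski U \<and>
     (\<forall>x\<in>U. \<exists>V p q. openin zariski V \<and> x \<in> V \<and> V \<subseteq> U \<and> polynomial_fun p \<and> polynomial_fun q \<and>
        (\<forall>A\<in>V. q A \<noteq> 0 \<and> f A = p A / q A))"

text \<open>Points of \<open>G/P\<close> are left cosets. Topology and regular functions are those of the
  quotient variety: a set is open, or a function regular, iff its pullback to \<open>G\<close> is.\<close>

definition coset_space :: "(complex^'n^'n::finite) set \<Rightarrow> (complex^'n^'n) set topology" where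
  "coset_space P = topology (\<lambda>U. U \<subseteq> lcosets\<^bsub>SL\<^esub> P \<and>
     openin zariski {g \<in> carrier SL. g <#\<^bsub>SL\<^esub> P \<in> U})"

lemma openin_coset_space:
  "openin (coset_space P) U \<longleftrightarrow>
     U \<subseteq> lcosets\<^bsub>SL\<^esub> P \<and> openin zariski {g \<in> carrier SL. g <#\<^bsub>SL\<^esub> P \<in> U}"
proof -
  let ?pre = "\<lambda>U. {g \<in> carrier SL. g <#\<^bsub>SL\<^esub> P \<in> U}"
  have "istopology (\<lambda>U. U \<subseteq> lcosets\<^bsub>SL\<^esub> P \<and> openin zariski (?pre U))"
    unfolding istopology_def
  proof (rule conjI; intro allI impI conjI)
    fix S T
    assume S: "S \<subseteq> lcosets\<^bsub>SL\<^esub> P \<and> openin zariski (?pre S)"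
      and T: "T \<subseteq> lcosets\<^bsub>SL\<^esub> P \<and> openin zariski (?pre T)"
    from S show "S \<inter> T \<subseteq> lcosets\<^bsub>SL\<^esub> P" by blast
    have "?pre (S \<inter> T) = ?pre S \<inter> ?pre T" by blast
    with S T show "openin zariski (?pre (S \<inter> T))" by (simp only: openin_Int)
  next
    fix K
    assume K: "\<forall>U\<in>K. U \<subseteq> lcosets\<^bsub>SL\<^esub> P \<and> openin zariski (?pre U)"
    then show "\<Union>K \<subseteq> lcosets\<^bsub>SL\<^esub> P" by blast
    have "?pre (\<Union>K) = \<Union>(?pre ` K)" by blast
    moreover have "openin zariski (\<Union>(?pre ` K))"
      using K by (intro openin_Union) blast
    ultimately show "openin zariski (?pre (\<Union>K))" by (simp only:)
  qed
  then show ?thesis by (simp add: coset_space_def)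
qed

lemma topspace_coset_space: "topspace (coset_space P) = lcosets\<^bsub>SL\<^esub> P"
proof -
  have "{g \<in> carrier SL. g <#\<^bsub>SL\<^esub> P \<in> lcosets\<^bsub>SL\<^esub> P} = topspace zariski"
    unfolding topspace_zariski LCOSETS_def by blast
  then have "openin (coset_space P) (lcosets\<^bsub>SL\<^esub> P)"
    unfolding openin_coset_space by (simp only: openin_topspace subset_refl simp_thms)
  moreover have "topspace (coset_space P) \<subseteq> lcosets\<^bsub>SL\<^esub> P"
    using openin_topspace[of "coset_space P"] unfolding openin_coset_space by (rule conjunct1)
  ultimately show ?thesis
    by (intro subset_antisym openin_subset)
qed

definition regular_coset_space ::
    "(complex^'n^'n::finite) set \<Rightarrow> (complex^'n^'n) set set \<Rightarrow> ((complex^'n^'n) set \<Rightarrow> complex) \<Rightarrow> bool"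
  where "regular_coset_space P U f \<longleftrightarrow> openin (coset_space P) U \<and>
     regular_SL {g \<in> carrier SL. g <#\<^bsub>SL\<^esub> P \<in> U} (\<lambda>g. f (g <#\<^bsub>SL\<^esub> P))"

text \<open>The reduced structure on a closed subset \<open>Y\<close> of \<open>G/P\<close>: regular functions are locally
  restrictions of regular functions on \<open>G/P\<close>.\<close>

definition regular_subvariety ::
    "(complex^'n^'n::finite) set \<Rightarrow> (complex^'n^'n) set set \<Rightarrow>
       (complex^'n^'n) set set \<Rightarrow> ((complex^'n^'n) set \<Rightarrow> complex) \<Rightarrow> bool"
  where "regular_subvariety P Y V f \<longleftrightarrow> openin (subtopology (coset_space P) Y) V \<and>
     (\<forall>y\<in>V. \<exists>U h. regular_coset_space P U h \<and> y \<in> U \<and> (\<forall>x\<in>U \<inter> V. f x = h x))"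

text \<open>\<open>H\<close> acts on \<open>G/P\<close> by left multiplication, which is an algebraic action; it restricts to
  an algebraic action on any closed subvariety \<open>Y\<close> stable under \<open>H\<close>.\<close>

abbreviation left_mult :: "complex^'n^'n::finite \<Rightarrow> (complex^'n^'n) set \<Rightarrow> (complex^'n^'n) set" where
  "left_mult g C \<equiv> g <#\<^bsub>SL\<^esub> C"

definition spherical_variety ::
    "(complex^'n^'n::finite) set \<Rightarrow> (complex^'n^'n) set \<Rightarrow> (complex^'n^'n) set set \<Rightarrow> bool"
  where "spherical_variety P H Y \<longleftrightarrow>
     connected_reductive H \<and>
     closedin (coset_space P) Y \<and>
     normal_variety (subtopology (coset_space P) Y) (regular_subvariety P Y) \<and>
     (\<forall>h\<in>H. left_mult h ` Y = Y) \<and>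
     (\<exists>B y. borel_subgroup H B \<and> y \<in> Y \<and>
        openin (subtopology (coset_space P) Y) (orbit (SL\<lparr>carrier := B\<rparr>) left_mult y) \<and>
        (subtopology (coset_space P) Y) closure_of (orbit (SL\<lparr>carrier := B\<rparr>) left_mult y) = Y)"

section \<open>Schubert varieties\<close>

definition upper_triangular :: "(complex^'n::{finite,linorder}^'n::{finite,linorder}) set" where
  "upper_triangular = {A \<in> carrier SL. \<forall>i j. j < i \<longrightarrow> A $ i $ j = 0}"

definition diagonal_torus :: "(complex^'n^'n::finite) set" where
  "diagonal_torus = {A \<in> carrier SL. \<forall>i j. i \<noteq> j \<longrightarrow> A $ i $ j = 0}"

definition weyl_group :: "(complex^'n^'n::finite) set monoid" where
  "weyl_group = SL\<lparr>carrier := normalizer SL diagonal_torus\<rparr> Mod diagonal_torus"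

text \<open>An element \<open>w\<close> of the Weyl group is a coset of the torus, so \<open>n\<close> below ranges over the
  representatives of \<open>w\<close>; the set \<open>BwP/P\<close> does not depend on which one is used.\<close>

definition schubert_variety ::
    "(complex^'n::{finite,linorder}^'n::{finite,linorder}) set \<Rightarrow>
       (complex^'n::{finite,linorder}^'n::{finite,linorder}) set \<Rightarrow>
       (complex^'n::{finite,linorder}^'n::{finite,linorder}) set set" where
  "schubert_variety P w = (coset_space P) closure_of
     {(b \<otimes>\<^bsub>SL\<^esub> n) <#\<^bsub>SL\<^esub> P | b n. b \<in> upper_triangular \<and> n \<in> w}"

definition variety_stabilizer ::
    "(complex^'n^'n::finite) set set \<Rightarrow> (complex^'n^'n) set" where
  "variety_stabilizer X = stabilizer SL (\<lambda>g. image (left_mult g)) X"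

end

(*
  Everything is pulled back to SL_4, where a Schubert variety becomes a set "schub s" cut out by the
  vanishing of Pluecker coordinates; the Bruhat decomposition and irreducibility identify it with the
  closure.

  Normality: B-orbits of the Schubert variety meet the opposite big cell, so it suffices to treat the
  intersection with that cell. This is an affine space, or, for two permutations, an affine space times
  the cone of singular 2x2 matrices. Polynomial rings are integrally closed as domains with greatest
  common divisors, and the cone inherits this as a ring of torus invariants.

  Levi subgroups: a subgroup containing B consists of the matrices with a prescribed zero pattern.
  Every Levi subgroup of such a group is conjugate under the unipotent radical to the standard one,
  since both are centralizers of conjugate generic elements.

  Open orbit: modulo the Borel subgroup of the standard Levi subgroup, a point of the Bruhat cell is a
  unipotent matrix supported on the inversions that lie outside the blocks of left descents. In SL_4
  these inversions can always be reduced to a path, so the torus moves all generic points to a single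
  one, and genericity is detected by semi-invariant Pluecker coordinates. An open orbit in an
  irreducible space is dense.
*)
theory Submission
  imports Defs "HOL-Computational_Algebra.Polynomial_Factorial"
    "HOL-Computational_Algebra.Field_as_Ring" "HOL-Computational_Algebra.Fundamental_Theorem_Algebra"
begin

unbundle no m_inv_syntax

text \<open>The special feature of \<open>SL_4\<close>: an inverted pair of neighbouring values
  \<open>i\<close>, \<open>i + 1\<close> of \<open>s\<close> is itself a left descent and so lies
  inside a block. The inversions outside the blocks are therefore among (0,2), (0,3), (1,3). These
  form a path, and weights along a path are independent, which is what lets the torus normalize a
  generic point.

  Two things are never computed. The permutation \<open>s\<close> describing the preimage of the
  Schubert variety is not read off from \<open>w\<close> and \<open>P\<close>: the irreducible
  double coset BwP is covered by finitely many closed sets \<open>schub s\<close>, hence contained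
  in one of them. The stabilizer is only known to be some \<open>pat R\<close> containing the
  elementary matrices of the left descents. This already places the Borel subgroup of the descent
  blocks inside a Borel subgroup of the Levi subgroup, so transitivity on generic points is
  inherited.

  An arbitrary Levi subgroup is the standard one conjugated by some \<open>u\<close> in the
  stabilizer, and the base point is moved by the same \<open>u\<close>.

  G/P is given only through pullback to G, so openness, regularity and irreducibility are tested on
  polynomial functions of matrices; rational maps enter through Cramer's rule with cleared
  denominators.\<close>

abbreviation minv :: "complex^'n^'n::finite \<Rightarrow> complex^'n^'n" where
  "minv A \<equiv> m_inv SL A"

section \<open>Inverses and subgroups in the special linear group\<close>

lemma mem_SL [simp]: "A \<in> carrier SL \<longleftrightarrow> det A = (1::complex)"
  by (simp add: SL_def)

lemma mult_SL [simp]: "A \<otimes>\<^bsub>SL\<^esub> B = A ** B"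
  by (simp add: SL_def)

lemma one_SL [simp]: "\<one>\<^bsub>SL\<^esub> = mat 1"
  by (simp add: SL_def)

interpretation SL: Group.group SL
  by (rule group_SL)

lemma minv_det: "det A = 1 \<Longrightarrow> det (minv A) = 1"
  using SL.inv_closed[of A] by simp

lemma minv_l: "det A = 1 \<Longrightarrow> minv A ** A = mat 1"
  using SL.l_inv[of A] by simp

lemma minv_r: "det A = 1 \<Longrightarrow> A ** minv A = mat 1"
  using SL.r_inv[of A] by simp

lemma minv_minv: "det A = 1 \<Longrightarrow> minv (minv A) = A"
  using SL.inv_inv[of A] by simp

lemma minv_mult: "det A = 1 \<Longrightarrow> det B = 1 \<Longrightarrow> minv (A ** B) = minv B ** minv A"
  using SL.inv_mult_group[of A B] by simp

lemma minv_unique: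
  assumes "det A = 1" "B ** A = mat 1"
  shows "minv A = B"
proof -
  have "minv A = (B ** A) ** minv A" by (simp add: assms(2))
  also have "\<dots> = B" by (simp add: matrix_mul_assoc[symmetric] minv_r assms(1))
  finally show ?thesis .
qed

lemma minv_l_cancel: "det A = 1 \<Longrightarrow> minv A ** (A ** B) = B"
  by (simp add: matrix_mul_assoc minv_l)

lemma minv_r_cancel: "det A = 1 \<Longrightarrow> A ** (minv A ** B) = B"
  by (simp add: matrix_mul_assoc minv_r)

lemma subgroup_SL_iff: "subgroup H SL \<longleftrightarrow> (\<forall>A\<in>H. det A = 1) \<and> mat 1 \<in> H \<and>
    (\<forall>A\<in>H. \<forall>B\<in>H. A ** B \<in> H) \<and> (\<forall>A\<in>H. minv A \<in> H)"
  unfolding subgroup_def by auto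

lemma subgroup_SLD:
  assumes "subgroup H SL"
  shows "A \<in> H \<Longrightarrow> det A = 1" "mat 1 \<in> H" "A \<in> H \<Longrightarrow> B \<in> H \<Longrightarrow> A ** B \<in> H" "A \<in> H \<Longrightarrow> minv A \<in> H"
  using assms unfolding subgroup_SL_iff by auto

subsection \<open>Polynomial functions\<close>

lemma polynomial_fun_cmult: "polynomial_fun p \<Longrightarrow> polynomial_fun (\<lambda>A. c * p A)"
  by (intro polynomial_fun.intros)

lemma polynomial_fun_minus: "polynomial_fun p \<Longrightarrow> polynomial_fun (\<lambda>A. - p A)"
  using polynomial_fun_cmult[of p "-1"] by simp

lemma polynomial_fun_diff: "polynomial_fun p \<Longrightarrow> polynomial_fun q \<Longrightarrow> polynomial_fun (\<lambda>A. p A - q A)"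
  using polynomial_fun.add[OF _ polynomial_fun_minus, of p q] by simp

lemma polynomial_fun_sum: "(\<And>i. i \<in> I \<Longrightarrow> polynomial_fun (p i)) \<Longrightarrow> polynomial_fun (\<lambda>A. \<Sum>i\<in>I. p i A)"
  by (induction I rule: infinite_finite_induct) (auto intro: polynomial_fun.intros)

lemma polynomial_fun_prod: "(\<And>i. i \<in> I \<Longrightarrow> polynomial_fun (p i)) \<Longrightarrow> polynomial_fun (\<lambda>A. \<Prod>i\<in>I. p i A)"
  by (induction I rule: infinite_finite_induct) (auto intro: polynomial_fun.intros)

lemma polynomial_fun_power: "polynomial_fun p \<Longrightarrow> polynomial_fun (\<lambda>A. p A ^ n)"
  by (induction n) (auto intro: polynomial_fun.intros)

lemma polynomial_fun_if: "polynomial_fun p \<Longrightarrow> polynomial_fun q \<Longrightarrow> polynomial_fun (\<lambda>A. if b then p A else q A)"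
  by (cases b) auto

lemmas polynomial_fun_closure = polynomial_fun.intros polynomial_fun_minus polynomial_fun_diff
  polynomial_fun_sum polynomial_fun_prod polynomial_fun_power polynomial_fun_if

lemma polynomial_fun_compose:
  assumes "polynomial_fun p" "\<And>i j. polynomial_fun (\<lambda>A. f A $ i $ j)"
  shows "polynomial_fun (\<lambda>A. p (f A))"
  using assms(1) by induction (auto intro: assms(2) polynomial_fun.intros)

lemma polynomial_fun_det:
  assumes "\<And>i j. polynomial_fun (\<lambda>A. f A $ i $ j)"
  shows "polynomial_fun (\<lambda>A. det (f A))"
  unfolding det_def by (intro polynomial_fun_closure assms)

lemma polynomial_fun_mult_entry:
  assumes "\<And>i j. polynomial_fun (\<lambda>A. f A $ i $ j)" "\<And>i j. polynomial_fun (\<lambda>A. g A $ i $ j)"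
  shows "polynomial_fun (\<lambda>A. (f A ** g A) $ i $ j)"
  unfolding matrix_matrix_mult_def by (simp, intro polynomial_fun_closure assms)

lemma polynomial_fun_translate:
  assumes "polynomial_fun p" shows "polynomial_fun (\<lambda>A. p (B ** A ** C))"
  by (intro polynomial_fun_compose[OF assms] polynomial_fun_mult_entry polynomial_fun_closure)

lemma polynomial_fun_translate_left:
  assumes "polynomial_fun p" shows "polynomial_fun (\<lambda>A. p (B ** A))"
  using polynomial_fun_translate[OF assms, of B "mat 1"] by simp

lemma polynomial_fun_translate_right:
  assumes "polynomial_fun p" shows "polynomial_fun (\<lambda>A. p (A ** B))"
  using polynomial_fun_translate[OF assms, of "mat 1" B] by simp

text \<open>Cramer's rule: the entry $(i,j)$ of the inverse of $D$ is \<open>cofac D i j / det D\<close>.\<close>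

definition cofac :: "complex^'n^'n::finite \<Rightarrow> 'n \<Rightarrow> 'n \<Rightarrow> complex" where
  "cofac D i j = det (\<chi> k l. if l = i then (if k = j then 1 else 0) else D $ k $ l)"

lemma cofac_col:
  assumes "det D \<noteq> 0"
  shows "D *v (\<chi> i. cofac D i j / det D) = axis j 1"
proof -
  have "(\<chi> i. cofac D i j / det D) = (\<chi> k. det (\<chi> i l. if l = k then axis j 1 $ i else D $ i $ l) / det D)"
    by (simp add: cofac_def axis_def vec_eq_iff if_distrib cong: if_cong)
  then show ?thesis
    using cramer[OF assms, of "(\<chi> i. cofac D i j / det D)" "axis j 1"] by simp
qed

lemma polynomial_fun_cofac:
  assumes "\<And>i j. polynomial_fun (\<lambda>A. f A $ i $ j)"
  shows "polynomial_fun (\<lambda>A. cofac (f A) i j)"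
  unfolding cofac_def by (intro polynomial_fun_det) (auto intro!: polynomial_fun_closure assms)

text \<open>On \<open>SL\<close> the entries of the inverse therefore agree with polynomials, so
  vanishing conditions on \<open>minv A\<close> define closed sets and entries of the inverse may
  serve as coordinates.\<close>

lemma minv_cofac:
  assumes "det A = 1" shows "minv A $ i $ j = cofac A i j"
proof -
  have "A ** (\<chi> i j. cofac A i j) = mat 1"
  proof (subst vec_eq_iff, subst vec_eq_iff, intro allI)
    fix i j
    have "(A ** (\<chi> i j. cofac A i j)) $ i $ j = (A *v (\<chi> i. cofac A i j / det A)) $ i"
      by (simp add: matrix_matrix_mult_def matrix_vector_mult_def assms)
    also have "\<dots> = mat 1 $ i $ j" using assms by (subst cofac_col) (auto simp: axis_def mat_def)
    finally show "(A ** (\<chi> i j. cofac A i j)) $ i $ j = mat 1 $ i $ j" .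
  qed
  then have "minv A = (\<chi> i j. cofac A i j)"
    using minv_l_cancel[OF assms, of "(\<chi> i j. cofac A i j)"] by simp
  then show ?thesis by simp
qed

text \<open>With one common denominator \<open>d\<close> the induction closes, since only its
  exponent changes. This allows polynomials to be composed with the normalization of the determinant
  and with the section of the big cell.\<close>

lemma rational_substitution:
  assumes "polynomial_fun p" and c: "\<And>i j. polynomial_fun (c i j)" and d: "polynomial_fun d"
  shows "\<exists>P N. polynomial_fun P \<and>
    (\<forall>A. d A \<noteq> 0 \<longrightarrow> p (\<chi> i j. c i j A / d A) = P A / d A ^ N)"
  using assms(1)
proof induction
  case (const a)
  have "\<forall>A. d A \<noteq> 0 \<longrightarrow> a = (\<lambda>A. a) A / d A ^ 0" by simp
  then show ?case using polynomial_fun.const by blast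
next
  case (entry i j)
  have "\<forall>A. d A \<noteq> 0 \<longrightarrow> (\<chi> i j. c i j A / d A) $ i $ j = c i j A / d A ^ 1" by simp
  then show ?case using c by blast
next
  case (add p q)
  then obtain P N Q M where "polynomial_fun P" "polynomial_fun Q"
    "\<forall>A. d A \<noteq> 0 \<longrightarrow> p (\<chi> i j. c i j A / d A) = P A / d A ^ N"
    "\<forall>A. d A \<noteq> 0 \<longrightarrow> q (\<chi> i j. c i j A / d A) = Q A / d A ^ M" by blast
  then have "polynomial_fun (\<lambda>A. P A * d A ^ M + Q A * d A ^ N) \<and>
    (\<forall>A. d A \<noteq> 0 \<longrightarrow> p (\<chi> i j. c i j A / d A) + q (\<chi> i j. c i j A / d A) = (P A * d A ^ M + Q A * d A ^ N) / d A ^ (N + M))"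
    by (auto intro!: polynomial_fun_closure d simp: field_simps power_add)
  then show ?case by (intro exI)
next
  case (mult p q)
  then obtain P N Q M where "polynomial_fun P" "polynomial_fun Q"
    "\<forall>A. d A \<noteq> 0 \<longrightarrow> p (\<chi> i j. c i j A / d A) = P A / d A ^ N"
    "\<forall>A. d A \<noteq> 0 \<longrightarrow> q (\<chi> i j. c i j A / d A) = Q A / d A ^ M" by blast
  then have "polynomial_fun (\<lambda>A. P A * Q A) \<and>
    (\<forall>A. d A \<noteq> 0 \<longrightarrow> p (\<chi> i j. c i j A / d A) * q (\<chi> i j. c i j A / d A) = (P A * Q A) / d A ^ (N + M))"
    by (auto intro!: polynomial_fun_closure simp: power_add)
  then show ?case by (intro exI)
qed

subsection \<open>The Zariski topology\<close>

lemma openin_zariski_nonvanishing: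
  assumes "polynomial_fun p" shows "openin zariski {A. det A = 1 \<and> p A \<noteq> 0}"
  unfolding openin_zariski by (rule exI[of _ "{p}"]) (use assms in auto)

lemma openin_zariski_basis:
  assumes "openin zariski U" "A \<in> U"
  obtains p where "polynomial_fun p" "p A \<noteq> 0" "\<And>B. det B = 1 \<Longrightarrow> p B \<noteq> 0 \<Longrightarrow> B \<in> U"
  using assms unfolding openin_zariski by auto

lemma closedin_zariski:
  "closedin zariski S \<longleftrightarrow> (\<exists>F \<subseteq> Collect polynomial_fun. S = {A. det A = 1 \<and> (\<forall>p\<in>F. p A = 0)})"
proof
  assume "closedin zariski S"
  then obtain F where F: "F \<subseteq> Collect polynomial_fun" "carrier SL - S = {A \<in> carrier SL. \<exists>p\<in>F. p A \<noteq> 0}"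
    and S: "S \<subseteq> carrier SL"
    unfolding closedin_def openin_zariski topspace_zariski by auto
  have "x \<in> S \<longleftrightarrow> det x = 1 \<and> (\<forall>p\<in>F. p x = 0)" for x
  proof -
    have "x \<in> S \<Longrightarrow> det x = 1" using S by auto
    moreover have "x \<in> carrier SL - S \<longleftrightarrow> x \<in> {A \<in> carrier SL. \<exists>p\<in>F. p A \<noteq> 0}"
      by (simp only: F(2))
    ultimately show ?thesis by auto
  qed
  then have "S = {A. det A = 1 \<and> (\<forall>p\<in>F. p A = 0)}" by blast
  with F(1) show "\<exists>F \<subseteq> Collect polynomial_fun. S = {A. det A = 1 \<and> (\<forall>p\<in>F. p A = 0)}" by blast
next
  assume "\<exists>F \<subseteq> Collect polynomial_fun. S = {A. det A = 1 \<and> (\<forall>p\<in>F. p A = 0)}"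
  then obtain F where F: "F \<subseteq> Collect polynomial_fun" "S = {A. det A = 1 \<and> (\<forall>p\<in>F. p A = 0)}" by blast
  then show "closedin zariski S"
    unfolding closedin_def openin_zariski topspace_zariski by (intro conjI exI[of _ F]) auto
qed

lemma closedin_zariskiI:
  assumes "\<And>A. A \<in> S \<Longrightarrow> det A = 1"
    and "\<And>A. det A = 1 \<Longrightarrow> A \<notin> S \<Longrightarrow> \<exists>p. polynomial_fun p \<and> (\<forall>B\<in>S. p B = 0) \<and> p A \<noteq> 0"
  shows "closedin zariski S"
  unfolding closedin_zariski
  by (rule exI[of _ "{p. polynomial_fun p \<and> (\<forall>B\<in>S. p B = 0)}"]) (use assms in blast)

lemma closedin_zariskiD:
  assumes "closedin zariski S" "det A = 1" "A \<notin> S"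
  obtains p where "polynomial_fun p" "\<And>B. B \<in> S \<Longrightarrow> p B = 0" "p A \<noteq> 0"
  using assms unfolding closedin_zariski by auto

lemma closedin_zariski_translate:
  assumes S: "closedin zariski S" and "det B = 1" "det C = 1"
  shows "closedin zariski {A. det A = 1 \<and> B ** A ** C \<in> S}"
proof (rule closedin_zariskiI)
  fix A assume A: "det A = 1" "A \<notin> {A. det A = 1 \<and> B ** A ** C \<in> S}"
  then have "B ** A ** C \<notin> S" "det (B ** A ** C) = 1" using assms by (auto simp: det_mul)
  then obtain p where "polynomial_fun p" "\<And>B. B \<in> S \<Longrightarrow> p B = 0" "p (B ** A ** C) \<noteq> 0"
    using closedin_zariskiD[OF S] by metis
  then show "\<exists>p. polynomial_fun p \<and> (\<forall>X\<in>{A. det A = 1 \<and> B ** A ** C \<in> S}. p X = 0) \<and> p A \<noteq> 0"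
    by (intro exI[of _ "\<lambda>A. p (B ** A ** C)"]) (auto intro: polynomial_fun_translate)
qed auto

subsection \<open>Irreducible sets of matrices\<close>

text \<open>The ideal of polynomials vanishing on \<open>S\<close> is prime, or everything when
  \<open>S\<close> is empty. Nothing confines \<open>S\<close> to \<open>SL\<close>, so linear
  spaces of matrices qualify; nonemptiness is asked for separately.\<close>

definition irr :: "(complex^'n^'n::finite) set \<Rightarrow> bool" where
  "irr S \<longleftrightarrow> (\<forall>p q. polynomial_fun p \<and> polynomial_fun q \<and> (\<forall>A\<in>S. p A * q A = 0) \<longrightarrow>
     (\<forall>A\<in>S. p A = 0) \<or> (\<forall>A\<in>S. q A = 0))"

lemma irrI:
  assumes "\<And>p q A B. polynomial_fun p \<Longrightarrow> polynomial_fun q \<Longrightarrow> A \<in> S \<Longrightarrow> B \<in> S \<Longrightarrow> p A \<noteq> 0 \<Longrightarrow> q B \<noteq> 0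
    \<Longrightarrow> \<exists>C\<in>S. p C \<noteq> 0 \<and> q C \<noteq> 0"
  shows "irr S"
  unfolding irr_def
proof (intro allI impI, elim conjE, rule ccontr)
  fix p q assume "polynomial_fun p" "polynomial_fun q" "\<forall>A\<in>S. p A * q A = 0"
   "\<not> ((\<forall>A\<in>S. p A = 0) \<or> (\<forall>A\<in>S. q A = 0))"
  then obtain A B where "A \<in> S" "B \<in> S" "p A \<noteq> 0" "q B \<noteq> 0" by blast
  then obtain C where "C \<in> S" "p C \<noteq> 0" "q C \<noteq> 0"
    using assms \<open>polynomial_fun p\<close> \<open>polynomial_fun q\<close> by blast
  with \<open>\<forall>A\<in>S. p A * q A = 0\<close> show False by auto
qed

lemma irrD:
  assumes "irr S" "polynomial_fun p" "polynomial_fun q" "A \<in> S" "B \<in> S" "p A \<noteq> 0" "q B \<noteq> 0"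
  obtains C where "C \<in> S" "p C \<noteq> 0" "q C \<noteq> 0"
proof -
  have "\<not> (\<forall>A\<in>S. p A * q A = 0)"
    using assms(1)[unfolded irr_def, rule_format, of p q] assms(2-) by blast
  then show ?thesis using that by auto
qed

text \<open>The factors are treated one at a time: with the two right factors frozen a common left
  factor is found, and with that one frozen a common right factor.\<close>

lemma irr_mult:
  assumes S: "irr S" and T: "irr T"
  shows "irr {A ** B | A B. A \<in> S \<and> B \<in> T}"
proof (rule irrI)
  fix p q :: "complex^'a^'a \<Rightarrow> complex" and X Y
  assume pq: "polynomial_fun p" "polynomial_fun q"
    and XY: "X \<in> {A ** B | A B. A \<in> S \<and> B \<in> T}" "Y \<in> {A ** B | A B. A \<in> S \<and> B \<in> T}" "p X \<noteq> 0" "q Y \<noteq> 0"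
  obtain A1 B1 A2 B2 where *: "X = A1 ** B1" "Y = A2 ** B2" "A1 \<in> S" "A2 \<in> S" "B1 \<in> T" "B2 \<in> T"
    using XY by blast
  obtain A where A: "A \<in> S" "p (A ** B1) \<noteq> 0" "q (A ** B2) \<noteq> 0"
    by (rule irrD[OF S polynomial_fun_translate_right[OF pq(1), of B1] polynomial_fun_translate_right[OF pq(2), of B2], of A1 A2])
      (use XY * in auto)
  obtain B where B: "B \<in> T" "p (A ** B) \<noteq> 0" "q (A ** B) \<noteq> 0"
    by (rule irrD[OF T polynomial_fun_translate_left[OF pq(1), of A] polynomial_fun_translate_left[OF pq(2), of A], of B1 B2])
      (use A * in auto)
  show "\<exists>C\<in>{A ** B | A B. A \<in> S \<and> B \<in> T}. p C \<noteq> 0 \<and> q C \<noteq> 0"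
    using A B by blast
qed

lemma irr_singleton: "irr {A}"
  unfolding irr_def by auto

lemma irr_translate:
  fixes B C :: "complex^'n^'n::finite"
  assumes "irr S" shows "irr ((\<lambda>A. B ** A ** C) ` S)"
proof -
  have "(\<lambda>A. B ** A ** C) ` S = {X ** Y | X Y. X \<in> {X ** Y | X Y. X \<in> {B} \<and> Y \<in> S} \<and> Y \<in> {C}}"
    by auto
  then show ?thesis using irr_mult[OF irr_mult[OF irr_singleton[of B] assms] irr_singleton[of C]] by metis
qed

lemma polynomial_fun_on_line:
  fixes A B :: "complex^'n^'n::finite"
  assumes "polynomial_fun p"
  shows "\<exists>P. \<forall>s. poly P s = p (\<chi> i j. (1 - s) * A $ i $ j + s * B $ i $ j)"
  using assms
proof induction
  case (const c)
  have "\<forall>s. poly [:c:] s = c" by simp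
  then show ?case by blast
next
  case (entry i j)
  have "\<forall>s. poly [:A $ i $ j, B $ i $ j - A $ i $ j:] s = (\<chi> i j. (1 - s) * A $ i $ j + s * B $ i $ j) $ i $ j"
    by (simp add: algebra_simps)
  then show ?case by blast
next
  case (add p q)
  then show ?case by (metis poly_add)
next
  case (mult p q)
  then show ?case by (metis poly_mult)
qed

text \<open>Along the complex line through the two points both polynomials become univariate and
  nonzero, so their product is nonzero and has a nonroot.\<close>

lemma irr_convex:
  assumes "\<And>A B s. A \<in> S \<Longrightarrow> B \<in> S \<Longrightarrow> (\<chi> i j. (1 - s) * A $ i $ j + s * B $ i $ j) \<in> S"
  shows "irr S"
proof (rule irrI)
  fix p q :: "complex^'a^'a \<Rightarrow> complex" and A B
  assume pq: "polynomial_fun p" "polynomial_fun q" and *: "A \<in> S" "B \<in> S" "p A \<noteq> 0" "q B \<noteq> 0"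
  let ?l = "\<lambda>s. \<chi> i j. (1 - s) * A $ i $ j + s * B $ i $ j"
  obtain P Q where PQ: "\<And>s. poly P s = p (?l s)" "\<And>s. poly Q s = q (?l s)"
    using polynomial_fun_on_line[OF pq(1), of A B] polynomial_fun_on_line[OF pq(2), of A B] by blast
  have "?l 0 = A" "?l 1 = B" by (simp_all add: vec_eq_iff)
  then have "poly P 0 \<noteq> 0" "poly Q 1 \<noteq> 0" using PQ * by auto
  then have "P * Q \<noteq> 0" by auto
  then obtain s where "poly (P * Q) s \<noteq> 0"
    using poly_all_0_iff_0 by blast
  then show "\<exists>C\<in>S. p C \<noteq> 0 \<and> q C \<noteq> 0"
    using assms[OF *(1,2), of s] PQ by (intro bexI[of _ "?l s"]) auto
qed

lemma irr_connected:
  assumes "irr S" "\<And>A. A \<in> S \<Longrightarrow> det A = 1"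
  shows "connectedin zariski S"
  unfolding connectedin topspace_zariski
proof (intro conjI notI)
  show "S \<subseteq> carrier SL" using assms(2) by auto
next
  assume "\<exists>E1 E2. openin zariski E1 \<and> openin zariski E2 \<and> S \<subseteq> E1 \<union> E2 \<and> E1 \<inter> E2 \<inter> S = {} \<and>
     E1 \<inter> S \<noteq> {} \<and> E2 \<inter> S \<noteq> {}"
  then obtain U V A B where *: "openin zariski U" "openin zariski V" "U \<inter> V \<inter> S = {}"
     "A \<in> U" "A \<in> S" "B \<in> V" "B \<in> S" by blast
  obtain p where p: "polynomial_fun p" "p A \<noteq> 0" "\<And>B. det B = 1 \<Longrightarrow> p B \<noteq> 0 \<Longrightarrow> B \<in> U"
    using openin_zariski_basis[OF *(1,4)] by blast
  obtain q where q: "polynomial_fun q" "q B \<noteq> 0" "\<And>B. det B = 1 \<Longrightarrow> q B \<noteq> 0 \<Longrightarrow> B \<in> V"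
    using openin_zariski_basis[OF *(2,6)] by blast
  obtain C where "C \<in> S" "p C \<noteq> 0" "q C \<noteq> 0"
    using irrD[OF assms(1) p(1) q(1) *(5,7) p(2) q(2)] by blast
  then show False using p(3) q(3) assms(2) *(3) by blast
qed

text \<open>If no \<open>F i\<close> contained \<open>S\<close>, a product of polynomials, one for
  each \<open>F i\<close>, would vanish on every \<open>F i\<close> without vanishing identically on
  the irreducible \<open>S\<close>.\<close>

lemma irr_finite_union:
  assumes "finite I" "irr S" "S \<noteq> {}" "\<And>i. i \<in> I \<Longrightarrow> closedin zariski (F i)" "S \<subseteq> (\<Union>i\<in>I. F i)"
    "\<And>A. A \<in> S \<Longrightarrow> det A = 1"
  shows "\<exists>i\<in>I. S \<subseteq> F i"
proof (rule ccontr)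
  assume a: "\<not> ?thesis"
  have "\<exists>p. polynomial_fun p \<and> (\<exists>A\<in>S. p A \<noteq> 0) \<and> (\<forall>i\<in>I. \<forall>A\<in>F i. p A = 0)"
    using assms(1,4) a
  proof (induction I rule: finite_induct)
    case empty
    show ?case by (rule exI[of _ "\<lambda>A. 1"]) (use assms(3) in \<open>auto intro: polynomial_fun.intros\<close>)
  next
    case (insert i I)
    then obtain p A where p: "polynomial_fun p" "A \<in> S" "p A \<noteq> 0" "\<forall>i\<in>I. \<forall>A\<in>F i. p A = 0" by auto
    from insert.prems obtain B where B: "B \<in> S" "B \<notin> F i" by auto
    obtain q where q: "polynomial_fun q" "\<And>B. B \<in> F i \<Longrightarrow> q B = 0" "q B \<noteq> 0"
      using closedin_zariskiD[of "F i" B] insert.prems(1) assms(6) B by (metis insertI1)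
    obtain C where C: "C \<in> S" "p C \<noteq> 0" "q C \<noteq> 0"
      using irrD[OF assms(2) p(1) q(1) p(2) B(1) p(3) q(3)] by blast
    show ?case
      by (rule exI[of _ "\<lambda>A. p A * q A"]) (use p q C in \<open>auto intro: polynomial_fun.intros\<close>)
  qed
  then show False using assms(5) by blast
qed

section \<open>Normality of sets parametrized by polynomials\<close>

subsection \<open>Polynomial functions in six variables\<close>

text \<open>Six is the number of entries below the diagonal of a 4 by 4 matrix, the dimension of the
  opposite cell of the flag variety.\<close>

inductive pfun :: "((nat \<Rightarrow> complex) \<Rightarrow> complex) \<Rightarrow> bool" where
  const: "pfun (\<lambda>x. c)"
| var: "i < 6 \<Longrightarrow> pfun (\<lambda>x. x i)"
| add: "pfun p \<Longrightarrow> pfun q \<Longrightarrow> pfun (\<lambda>x. p x + q x)"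
| mult: "pfun p \<Longrightarrow> pfun q \<Longrightarrow> pfun (\<lambda>x. p x * q x)"

lemma pfun_minus: "pfun p \<Longrightarrow> pfun (\<lambda>x. - p x)"
  using pfun.mult[OF pfun.const[of "-1"], of p] by simp

lemma pfun_diff: "pfun p \<Longrightarrow> pfun q \<Longrightarrow> pfun (\<lambda>x. p x - q x)"
  using pfun.add[OF _ pfun_minus, of p q] by simp

lemma pfun_compose:
  assumes "polynomial_fun p" "\<And>i j. pfun (\<lambda>x. f x $ i $ j)"
  shows "pfun (\<lambda>x. p (f x))"
  using assms(1) by induction (auto intro: assms(2) pfun.intros)

lemma polynomial_fun_pfun:
  assumes "pfun p" "\<And>i. i < 6 \<Longrightarrow> polynomial_fun (k i)"
  shows "polynomial_fun (\<lambda>A. p (\<lambda>i. k i A))"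
  using assms(1) by induction (auto intro: assms(2) polynomial_fun.intros)

text \<open>A model of the polynomial ring in the first \<open>n\<close> of the six variables: a ring together with
  its evaluation maps and its constants. Iterating univariate polynomials provides such a model
  that is a domain with greatest common divisors.\<close>

definition poly_model :: "nat \<Rightarrow> ((nat \<Rightarrow> complex) \<Rightarrow> 'a::idom \<Rightarrow> complex) \<Rightarrow> (complex \<Rightarrow> 'a) \<Rightarrow> bool" where
  "poly_model n ev emb \<longleftrightarrow>
     (\<forall>x a b. ev x (a + b) = ev x a + ev x b) \<and> (\<forall>x a b. ev x (a * b) = ev x a * ev x b) \<and>
     (\<forall>x c. ev x (emb c) = c) \<and> (\<forall>x y a. (\<forall>i<n. x i = y i) \<longrightarrow> ev x a = ev y a) \<and>
     (\<forall>a. a \<noteq> 0 \<longrightarrow> (\<exists>x. ev x a \<noteq> 0)) \<and> (\<forall>i<n. \<exists>a. \<forall>x. ev x a = x i) \<and> (\<forall>a. pfun (\<lambda>x. ev x a))"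

lemma poly_model_0: "poly_model 0 (\<lambda>x c. c) (\<lambda>c. c)"
  unfolding poly_model_def by (auto intro: pfun.intros)

context
  fixes n ev and emb :: "complex \<Rightarrow> 'a::idom"
  assumes m: "poly_model n ev emb"
begin

lemma poly_model_add: "ev x (a + b) = ev x a + ev x b"
  by (rule m[unfolded poly_model_def, THEN conjunct1, rule_format])

lemma poly_model_mult: "ev x (a * b) = ev x a * ev x b"
  by (rule m[unfolded poly_model_def, THEN conjunct2, THEN conjunct1, rule_format])

lemma poly_model_emb: "ev x (emb c) = c"
  by (rule m[unfolded poly_model_def, THEN conjunct2, THEN conjunct2, THEN conjunct1, rule_format])

lemma poly_model_cong: "(\<And>i. i < n \<Longrightarrow> x i = y i) \<Longrightarrow> ev x a = ev y a"
  using m[unfolded poly_model_def, THEN conjunct2, THEN conjunct2, THEN conjunct2, THEN conjunct1, rule_format] by blast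

lemma poly_model_nonzero: "a \<noteq> 0 \<Longrightarrow> \<exists>x. ev x a \<noteq> 0"
  using m[unfolded poly_model_def, THEN conjunct2, THEN conjunct2, THEN conjunct2, THEN conjunct2, THEN conjunct1, rule_format] by blast

lemma poly_model_var: "i < n \<Longrightarrow> \<exists>a. \<forall>x. ev x a = x i"
  using m[unfolded poly_model_def, THEN conjunct2, THEN conjunct2, THEN conjunct2, THEN conjunct2, THEN conjunct2, THEN conjunct1, rule_format] by blast

lemma poly_model_pfun: "pfun (\<lambda>x. ev x a)"
  by (rule m[unfolded poly_model_def, THEN conjunct2, THEN conjunct2, THEN conjunct2, THEN conjunct2, THEN conjunct2, THEN conjunct2, rule_format])

end

lemmas poly_modelD = poly_model_add poly_model_mult poly_model_emb

lemma poly_model_zero: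
  assumes "poly_model n ev emb" shows "ev x 0 = 0"
  using poly_model_add[OF assms, of x 0 0] by simp

text \<open>A nonzero univariate polynomial over the model has finitely many roots, while
  \<open>emb\<close> supplies infinitely many constants; one of them, assigned to the new variable
  \<open>n\<close>, keeps the value nonzero. The coefficients do not see that variable, so the two
  evaluations do not interfere.\<close>

lemma poly_model_Suc:
  fixes emb :: "complex \<Rightarrow> 'a::idom"
  assumes m: "poly_model n ev emb" and n: "n < 6"
  shows "poly_model (Suc n) (\<lambda>x p. ev x (poly p (emb (x n)))) (\<lambda>c. [:emb c:])"
proof -
  have inj: "inj emb" by (rule injI) (metis poly_model_emb[OF m])
  have nz: "\<exists>x. ev x (poly p (emb (x n))) \<noteq> 0" if "p \<noteq> 0" for p
  proof -
    have "infinite (range emb)" using finite_imageD[OF _ inj] infinite_UNIV_char_0 by auto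
    have "\<exists>c. poly p (emb c) \<noteq> 0"
    proof (rule ccontr)
      assume "\<not> ?thesis"
      then have "range emb \<subseteq> {t. poly p t = 0}" by auto
      then have "finite (range emb)" using poly_roots_finite[OF that] by (rule finite_subset)
      with \<open>infinite (range emb)\<close> show False by contradiction
    qed
    then obtain c where "poly p (emb c) \<noteq> 0" ..
    then obtain x where x: "ev x (poly p (emb c)) \<noteq> 0" using poly_model_nonzero[OF m] by blast
    have "ev (x(n := c)) (poly p (emb c)) = ev x (poly p (emb c))" by (rule poly_model_cong[OF m]) auto
    with x show ?thesis by (intro exI[of _ "x(n := c)"]) simp
  qed
  have var: "\<exists>p. \<forall>x. ev x (poly p (emb (x n))) = x i" if i: "i < Suc n" for i
  proof (cases "i = n")
    case True
    then show ?thesis by (intro exI[of _ "[:0, 1:]"]) (simp add: poly_model_emb[OF m])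
  next
    case False
    then obtain a where "\<forall>x. ev x a = x i" using poly_model_var[OF m, of i] i by auto
    then show ?thesis by (intro exI[of _ "[:a:]"]) simp
  qed
  have pf: "pfun (\<lambda>x. ev x (poly p (emb (x n))))" for p
  proof (induction p)
    case 0
    show ?case using pfun.const[of 0] poly_model_zero[OF m] by simp
  next
    case (pCons a p)
    then show ?case by (auto simp: poly_modelD[OF m] intro!: pfun.intros poly_model_pfun[OF m] n)
  qed
  have ext: "ev x (poly p (emb (x n))) = ev y (poly p (emb (y n)))" if "\<forall>i<Suc n. x i = y i" for x y p
  proof -
    have "x n = y n" "\<forall>i<n. x i = y i" using that by auto
    then show ?thesis using poly_model_cong[OF m, of x y] by simp
  qed
  show ?thesis
    unfolding poly_model_def
    by (intro conjI allI impI; ((rule ext, assumption) | simp add: poly_modelD[OF m] nz var pf))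
qed

lemma poly_model_Suc_ex:
  assumes "\<exists>ev emb. poly_model n ev (emb :: complex \<Rightarrow> 'a::idom)" "n < 6"
  shows "\<exists>ev emb. poly_model (Suc n) ev (emb :: complex \<Rightarrow> 'a poly)"
  using assms poly_model_Suc by blast

text \<open>The sixfold iterated type \<open>poly\<close> over the complex numbers carries the gcd
  classes that \<open>integral_imp_dvd\<close> asks for.\<close>

lemma poly_model_ex:
  "\<exists>ev emb. poly_model 6 ev (emb :: complex \<Rightarrow> complex poly poly poly poly poly poly)"
proof -
  have m: "\<exists>ev emb. poly_model (Suc 0) ev (emb :: complex \<Rightarrow> complex poly)"
    by (rule exI, rule exI, rule poly_model_Suc[OF poly_model_0]) simp
  have "\<exists>ev emb. poly_model (Suc (Suc (Suc (Suc (Suc (Suc 0)))))) ev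
      (emb :: complex \<Rightarrow> complex poly poly poly poly poly poly)"
    by (intro poly_model_Suc_ex m) simp_all
  then show ?thesis by (simp add: numeral_eq_Suc)
qed

text \<open>The rational root argument: after division of \<open>f\<close> and \<open>g\<close> by
  their gcd, and of the equation by its \<open>m\<close>-th power, the reduced denominator divides a
  power of the coprime numerator and so is a unit.\<close>

lemma integral_imp_dvd:
  fixes f g :: "'a::{idom,ring_gcd,semiring_gcd_mult_normalize}"
  assumes eq: "f ^ m + (\<Sum>i<m. a i * f ^ i * g ^ (m - i)) = 0" and g: "g \<noteq> 0"
  shows "g dvd f"
proof -
  obtain f' g' where fg: "f = f' * gcd f g" "g = g' * gcd f g" "coprime f' g'"
    using gcd_coprime_exists[of f g] g by auto
  let ?d = "gcd f g"
  have d: "?d \<noteq> 0" using g by simp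
  have t: "a i * f ^ i * g ^ (m - i) = ?d ^ m * (a i * f' ^ i * g' ^ (m - i))" if "i < m" for i
  proof -
    have "?d ^ m = ?d ^ i * ?d ^ (m - i)" using that by (simp flip: power_add)
    moreover have "f ^ i = f' ^ i * ?d ^ i" "g ^ (m - i) = g' ^ (m - i) * ?d ^ (m - i)"
      by (metis fg(1) power_mult_distrib, metis fg(2) power_mult_distrib)
    ultimately show ?thesis by (simp only: mult_ac)
  qed
  have "f ^ m = ?d ^ m * f' ^ m"
    by (metis fg(1) power_mult_distrib mult.commute)
  with eq have "?d ^ m * f' ^ m + (\<Sum>i<m. ?d ^ m * (a i * f' ^ i * g' ^ (m - i))) = 0"
    using sum.cong[OF refl t, of "{..<m}"] by simp
  then have "?d ^ m * (f' ^ m + (\<Sum>i<m. a i * f' ^ i * g' ^ (m - i))) = 0"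
    by (simp add: distrib_left sum_distrib_left)
  moreover have "?d ^ m \<noteq> 0" using d by (rule power_not_zero)
  ultimately have "f' ^ m + (\<Sum>i<m. a i * f' ^ i * g' ^ (m - i)) = 0"
    using mult_eq_0_iff by blast
  then have "f' ^ m = - (\<Sum>i<m. a i * f' ^ i * g' ^ (m - i))"
    by (simp add: eq_neg_iff_add_eq_0)
  moreover have "g' dvd (\<Sum>i<m. a i * f' ^ i * g' ^ (m - i))"
    by (intro dvd_sum) (auto intro!: dvd_mult dvd_power)
  ultimately have "g' dvd f' ^ m" by simp
  moreover have "coprime g' (f' ^ m)" using fg(3) by (simp add: coprime_commute)
  ultimately have "is_unit g'" using coprime_common_divisor[OF _ dvd_refl] by blast
  then show ?thesis using fg(1,2) by (metis dvd_mult2 dvd_refl mult_dvd_mono unit_imp_dvd)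
qed

lemma pfun_represented:
  assumes m: "poly_model 6 ev emb" and "pfun F"
  shows "\<exists>a. \<forall>x. ev x a = F x"
  using assms(2)
proof induction
  case (const c)
  then show ?case using poly_model_emb[OF m] by blast
next
  case (var i)
  then show ?case using poly_model_var[OF m] by blast
next
  case (add p q)
  then obtain a b where "\<forall>x. ev x a = p x" "\<forall>x. ev x b = q x" by blast
  then have "\<forall>x. ev x (a + b) = p x + q x" by (simp add: poly_modelD(1)[OF m])
  then show ?case by blast
next
  case (mult p q)
  then obtain a b where "\<forall>x. ev x a = p x" "\<forall>x. ev x b = q x" by blast
  then have "\<forall>x. ev x (a * b) = p x * q x" by (simp add: poly_modelD(2)[OF m])
  then show ?case by blast
qed

lemma pfun_domain:
  assumes "pfun F" "pfun G" "F x \<noteq> 0" "G y \<noteq> 0"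
  shows "\<exists>z. F z * G z \<noteq> 0"
proof -
  obtain ev and emb :: "complex \<Rightarrow> complex poly poly poly poly poly poly" where m: "poly_model 6 ev emb"
    using poly_model_ex by blast
  obtain a b where ab: "\<forall>x. ev x a = F x" "\<forall>x. ev x b = G x"
    using pfun_represented[OF m assms(1)] pfun_represented[OF m assms(2)] by blast
  have "a \<noteq> 0" "b \<noteq> 0" using ab assms(3,4) poly_model_zero[OF m] by auto
  then have "a * b \<noteq> 0" by simp
  then obtain z where "ev z (a * b) \<noteq> 0" using poly_model_nonzero[OF m] by blast
  then show ?thesis using ab poly_model_mult[OF m] by auto
qed

lemma pfun_integral_dvd:
  assumes F: "pfun F" and G: "pfun G" "G y \<noteq> 0" and A: "\<And>i. pfun (A i)"
    and eq: "\<And>x. F x ^ m + (\<Sum>i<m. A i x * F x ^ i * G x ^ (m - i)) = 0"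
  shows "\<exists>H. pfun H \<and> (\<forall>x. F x = G x * H x)"
proof -
  obtain ev and emb :: "complex \<Rightarrow> complex poly poly poly poly poly poly" where m: "poly_model 6 ev emb"
    using poly_model_ex by blast
  note e = poly_modelD[OF m]
  have e0: "ev x 0 = 0" for x by (rule poly_model_zero[OF m])
  have e1: "ev x 1 = 1" for x using e(2)[of x 1 "emb 1"] e(3)[of x 1] by simp
  have esum: "ev x (sum a I) = (\<Sum>i\<in>I. ev x (a i))" for x a and I :: "nat set"
    by (induction I rule: infinite_finite_induct) (auto simp: e0 e)
  have epow: "ev x (a ^ n) = ev x a ^ n" for x a n
    by (induction n) (auto simp: e1 e)
  obtain f g where fg: "\<forall>x. ev x f = F x" "\<forall>x. ev x g = G x"
    using pfun_represented[OF m F] pfun_represented[OF m G(1)] by blast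
  obtain a where a: "\<forall>i x. ev x (a i) = A i x"
    using pfun_represented[OF m A] by metis
  let ?p = "f ^ m + (\<Sum>i<m. a i * f ^ i * g ^ (m - i))"
  have "ev x ?p = 0" for x using eq[of x] fg a by (simp add: e esum epow)
  then have "?p = 0" using poly_model_nonzero[OF m] by blast
  moreover have "g \<noteq> 0" using fg(2) G(2) e0[of y] by auto
  ultimately have "g dvd f" by (rule integral_imp_dvd)
  then obtain h where "f = g * h" ..
  then have "F x = G x * ev x h" for x using fg e(2)[of x g h] by auto
  then show ?thesis using poly_model_pfun[OF m] by blast
qed

subsection \<open>Normal sets of matrices\<close>

text \<open>The coordinate ring of \<open>Z\<close> is an integrally closed domain. The integral
  equation of \<open>F/G\<close> is cleared of denominators in the same way as in
  \<open>integrally_closed_at\<close>, so that the two can be matched.\<close>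

definition normset :: "(complex^'n^'n::finite) set \<Rightarrow> bool" where
  "normset Z \<longleftrightarrow> irr Z \<and>
    (\<forall>F G A (m::nat). polynomial_fun F \<and> polynomial_fun G \<and> (\<forall>i. polynomial_fun (A i)) \<and> (\<exists>z\<in>Z. G z \<noteq> 0) \<and>
       (\<forall>z\<in>Z. F z ^ m + (\<Sum>i<m. A i z * F z ^ i * G z ^ (m - i)) = 0) \<longrightarrow>
       (\<exists>h. polynomial_fun h \<and> (\<forall>z\<in>Z. F z = G z * h z)))"

lemma irr_range:
  assumes "\<And>i j. pfun (\<lambda>x. \<phi> x $ i $ j)"
  shows "irr (range \<phi>)"
proof (rule irrI)
  fix p q A B
  assume *: "polynomial_fun p" "polynomial_fun q" "A \<in> range \<phi>" "B \<in> range \<phi>" "p A \<noteq> 0" "q B \<noteq> 0"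
  then obtain x y where "p (\<phi> x) \<noteq> 0" "q (\<phi> y) \<noteq> 0" by auto
  then obtain z where "p (\<phi> z) * q (\<phi> z) \<noteq> 0"
    using pfun_domain[of "\<lambda>x. p (\<phi> x)" "\<lambda>x. q (\<phi> x)" x y] pfun_compose[OF _ assms] *(1,2) by blast
  then show "\<exists>C\<in>range \<phi>. p C \<noteq> 0 \<and> q C \<noteq> 0" by auto
qed

text \<open>Pulled back to the parameters, the equation lives in a polynomial ring, where the
  quotient \<open>H\<close> exists; \<open>desc\<close> is the remaining task of turning
  \<open>H\<close> into a function of the matrix.\<close>

lemma normset_range:
  assumes \<phi>: "\<And>i j. pfun (\<lambda>x. \<phi> x $ i $ j)"
    and desc: "\<And>F G H. polynomial_fun F \<Longrightarrow> polynomial_fun G \<Longrightarrow> pfun H \<Longrightarrow>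
      (\<And>x. F (\<phi> x) = G (\<phi> x) * H x) \<Longrightarrow> \<exists>h. polynomial_fun h \<and> (\<forall>x. F (\<phi> x) = G (\<phi> x) * h (\<phi> x))"
  shows "normset (range \<phi>)"
  unfolding normset_def
proof (intro conjI allI impI; (elim conjE)?)
  show "irr (range \<phi>)" by (rule irr_range[OF \<phi>])
next
  fix F G :: "complex^'a^'a \<Rightarrow> complex" and A and m :: nat
  assume *: "polynomial_fun F" "polynomial_fun G" "\<forall>i. polynomial_fun (A i)" "\<exists>z\<in>range \<phi>. G z \<noteq> 0"
    "\<forall>z\<in>range \<phi>. F z ^ m + (\<Sum>i<m. A i z * F z ^ i * G z ^ (m - i)) = 0"
  then obtain y where y: "G (\<phi> y) \<noteq> 0" by auto
  have "\<exists>H. pfun H \<and> (\<forall>x. F (\<phi> x) = G (\<phi> x) * H x)"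
    using pfun_integral_dvd[of "\<lambda>x. F (\<phi> x)" "\<lambda>x. G (\<phi> x)" y "\<lambda>i x. A i (\<phi> x)" m] pfun_compose[OF _ \<phi>] * y
    by auto
  then show "\<exists>h. polynomial_fun h \<and> (\<forall>z\<in>range \<phi>. F z = G z * h z)"
    using desc[OF *(1,2)] by blast
qed

text \<open>When \<open>k\<close> recovers parameters from the matrix, substituting them into
  \<open>H\<close> is the descent.\<close>

lemma normset_retract:
  assumes \<phi>: "\<And>i j. pfun (\<lambda>x. \<phi> x $ i $ j)"
    and k: "\<And>i. polynomial_fun (k i)" "\<And>x. \<phi> (\<lambda>i. k i (\<phi> x)) = \<phi> x"
  shows "normset (range \<phi>)"
proof (rule normset_range[OF \<phi>])
  fix F G :: "complex^'a^'a \<Rightarrow> complex" and H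
  assume *: "polynomial_fun F" "polynomial_fun G" "pfun H" "\<And>x. F (\<phi> x) = G (\<phi> x) * H x"
  have "F (\<phi> x) = G (\<phi> x) * H (\<lambda>i. k i (\<phi> x))" for x
    using *(4)[of "\<lambda>i. k i (\<phi> x)"] by (simp add: k)
  moreover have "polynomial_fun (\<lambda>A. H (\<lambda>i. k i A))" by (rule polynomial_fun_pfun[OF *(3) k(1)])
  ultimately show "\<exists>h. polynomial_fun h \<and> (\<forall>x. F (\<phi> x) = G (\<phi> x) * h (\<phi> x))" by blast
qed

lemma pfun_monomials:
  assumes "pfun H"
  shows "\<exists>L :: (complex \<times> (nat \<Rightarrow> nat)) list. \<forall>x. H x = (\<Sum>(c, e)\<leftarrow>L. c * (\<Prod>i<6. x i ^ e i))"
  using assms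
proof induction
  case (const c)
  show ?case by (intro exI[of _ "[(c, \<lambda>i. 0)]"]) simp
next
  case (var i)
  have "(\<Prod>j<6. x j ^ (if j = i then 1 else 0)) = x i" for x :: "nat \<Rightarrow> complex"
    using var by (simp add: if_distrib[of "\<lambda>n. _ ^ n"] cong: if_cong)
  then show ?case by (intro exI[of _ "[(1, \<lambda>j. if j = i then 1 else 0)]"]) simp
next
  case (add p q)
  then obtain L M where "\<forall>x. p x = (\<Sum>(c, e)\<leftarrow>L. c * (\<Prod>i<6. x i ^ e i))"
     "\<forall>x. q x = (\<Sum>(c, e)\<leftarrow>M. c * (\<Prod>i<6. x i ^ e i))" by blast
  then show ?case by (intro exI[of _ "L @ M"]) simp
next
  case (mult p q)
  then obtain L M where LM: "\<forall>x. p x = (\<Sum>(c, e)\<leftarrow>L. c * (\<Prod>i<6. x i ^ e i))"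
     "\<forall>x. q x = (\<Sum>(c, e)\<leftarrow>M. c * (\<Prod>i<6. x i ^ e i))" by blast
  have 1: "(\<Sum>(c', e')\<leftarrow>map (\<lambda>(d, f). (c * d, \<lambda>i. e i + f i)) M. c' * (\<Prod>i<6. x i ^ e' i)) =
      c * (\<Prod>i<6. x i ^ e i) * (\<Sum>(c, e)\<leftarrow>M. c * (\<Prod>i<6. x i ^ e i))" for c e and x :: "nat \<Rightarrow> complex"
    by (induction M) (auto simp: algebra_simps power_add prod.distrib)
  have *: "(\<Sum>(c', e')\<leftarrow>concat (map (\<lambda>(c, e). map (\<lambda>(d, f). (c * d, \<lambda>i. e i + f i)) M) L). c' * (\<Prod>i<6. x i ^ e' i)) =
     (\<Sum>(c, e)\<leftarrow>L. c * (\<Prod>i<6. x i ^ e i)) * (\<Sum>(c, e)\<leftarrow>M. c * (\<Prod>i<6. x i ^ e i))" for x :: "nat \<Rightarrow> complex"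
  proof (induction L)
    case (Cons ce L)
    obtain c e where "ce = (c, e)" by force
    with Cons 1[where c=c and e=e and x=x] show ?case
      by (simp add: distrib_right)
  qed simp
  show ?case
    by (intro exI[of _ "concat (map (\<lambda>(c, e). map (\<lambda>(d, f). (c * d, \<lambda>i. e i + f i)) M) L)"])
      (simp only: LM * simp_thms)
qed

text \<open>The invariant ring of the multiplicative group acting with weights $1, 1, -1, -1, 0, 0$ is
  generated by the listed products; taking the weight-zero part replaces the quotient \<open>H\<close>
  by an invariant one.\<close>

lemma normset_cone:
  assumes \<phi>: "\<And>i j. pfun (\<lambda>x. \<phi> x $ i $ j)"
    and inv: "\<And>x y c. c \<noteq> 0 \<Longrightarrow> y 0 = c * x 0 \<Longrightarrow> y 1 = c * x 1 \<Longrightarrow> y 2 = x 2 / c \<Longrightarrow> y 3 = x 3 / c \<Longrightarrow>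
       y 4 = x 4 \<Longrightarrow> y 5 = x 5 \<Longrightarrow> \<phi> y = \<phi> x"
    and k: "\<And>i j. polynomial_fun (k i j)" "\<And>x i j. i \<in> {0,1} \<Longrightarrow> j \<in> {2,3} \<Longrightarrow> k i j (\<phi> x) = x i * x j"
    and l: "\<And>i. polynomial_fun (l i)" "\<And>x. \<exists>x'. \<phi> x' = \<phi> x \<and> (\<forall>i\<in>{4,5}. l i (\<phi> x') = x' i)"
  shows "normset (range \<phi>)"
proof (rule normset_range[OF \<phi>])
  fix F G :: "complex^'a^'a \<Rightarrow> complex" and H
  assume *: "polynomial_fun F" "polynomial_fun G" "pfun H" "\<And>x. F (\<phi> x) = G (\<phi> x) * H x"
  obtain L where L: "\<And>x. H x = (\<Sum>(c, e)\<leftarrow>L. c * (\<Prod>i<6. x i ^ e i))"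
    using pfun_monomials[OF *(3)] by blast
  have six: "(\<Prod>i<6. f i) = f 0 * f 1 * f 2 * f 3 * f 4 * f 5" for f :: "nat \<Rightarrow> complex"
    by (simp add: numeral_eq_Suc)
  define m where "m e x = (\<Prod>i<6. x i ^ e i)" for e :: "nat \<Rightarrow> nat" and x :: "nat \<Rightarrow> complex"
  define w where "w e \<longleftrightarrow> e 0 + e 1 = e 2 + e (3::nat)" for e :: "nat \<Rightarrow> nat"
  define h0 where "h0 x = (\<Sum>(c, e)\<leftarrow>filter (\<lambda>(c, e). w e) L. c * m e x)" for x
  \<comment> \<open>A monomial of weight zero is paired off greedily into the generators:
    \<open>x 0\<close> with \<open>x 2\<close> as often as possible, then the surplus of one of them
    with \<open>x 3\<close> or \<open>x 1\<close>. The minimum makes one of the two surpluses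
    zero.\<close>
  define mk where "mk e A = (let a = min (e 0) (e 2) in
     k 0 2 A ^ a * k 0 3 A ^ (e 0 - a) * k 1 2 A ^ (e 2 - a) * k 1 3 A ^ (e 1 - (e 2 - a)) * l 4 A ^ e 4 * l 5 A ^ e 5)"
    for e :: "nat \<Rightarrow> nat" and A
  define h where "h A = (\<Sum>(c, e)\<leftarrow>filter (\<lambda>(c, e). w e) L. c * mk e A)" for A
  have "polynomial_fun h"
  proof -
    have "polynomial_fun (\<lambda>A. \<Sum>(c, e)\<leftarrow>M. c * mk e A)" for M
      by (induction M) (auto simp: mk_def Let_def split: prod.splits intro!: polynomial_fun_closure k l)
    then show ?thesis unfolding h_def by blast
  qed
  have *: "F (\<phi> x) = G (\<phi> x) * h (\<phi> x)" if lx: "\<forall>i\<in>{4,5}. l i (\<phi> x) = x i" for x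
  proof (cases "G (\<phi> x) = 0")
    case True
    then show ?thesis using *(4)[of x] by simp
  next
    case False
    define N where "N = (\<Sum>(c, e)\<leftarrow>L. e 2 + e (3::nat))"
    define y where "y c i = (if i \<in> {0,1} then c * x i else if i \<in> {2,3} then x i / c else x i)" for c and i :: nat
    have H: "H (y c) = F (\<phi> x) / G (\<phi> x)" if "c \<noteq> 0" for c
    proof -
      have "\<phi> (y c) = \<phi> x" by (rule inv[OF that]) (auto simp: y_def)
      then show ?thesis using *(4)[of "y c"] False by simp
    qed
    \<comment> \<open>For \<open>M = L\<close> and nonzero \<open>t\<close> this is
      \<open>t ^ N * H (y t)\<close> as a polynomial in \<open>t\<close>. No negative weight exceeds
      \<open>N\<close> in size, so the shift clears denominators, and coefficient \<open>N\<close>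
      collects the monomials of weight zero.\<close>
    define P where "P M = (\<Sum>(c, e)\<leftarrow>M. monom (c * m e x) (N + e 0 + e 1 - (e 2 + e (3::nat))))"
      for M :: "(complex \<times> (nat \<Rightarrow> nat)) list"
    have le: "e 2 + e 3 \<le> N" if "(c, e) \<in> set L" for c e
      unfolding N_def by (rule member_le_sum_list) (use that in force)+
    have P: "poly (P M) t = t ^ N * (\<Sum>(c, e)\<leftarrow>M. c * m e (y t))" if "t \<noteq> 0" "set M \<subseteq> set L" for M t
      using that(2)
    proof (induction M)
      case Nil
      then show ?case by (simp add: P_def)
    next
      case (Cons ce M)
      obtain c e where ce: "ce = (c, e)" by force
      have *: "e 2 + e 3 \<le> N" using le Cons.prems ce by auto
      have "t ^ (N + e 0 + e 1 - (e 2 + e 3)) * m e x = t ^ N * m e (y t)"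
      proof -
        have "N + e 0 + e 1 = (N + e 0 + e 1 - (e 2 + e 3)) + e 2 + e 3" using * by simp
        then have "t ^ N * t ^ e 0 * t ^ e 1 = t ^ (N + e 0 + e 1 - (e 2 + e 3)) * t ^ e 2 * t ^ e 3"
          by (metis power_add)
        then have "t ^ (N + e 0 + e 1 - (e 2 + e 3)) = t ^ N * t ^ e 0 * t ^ e 1 / (t ^ e 2 * t ^ e 3)"
          using that(1) by (simp add: field_simps)
        then show ?thesis using that(1)
          by (simp add: m_def six y_def power_mult_distrib power_divide field_simps)
      qed
      then show ?case using Cons ce by (simp add: P_def poly_monom algebra_simps)
    qed
    have cf: "coeff (P M) N = (\<Sum>(c, e)\<leftarrow>filter (\<lambda>(c, e). w e) M. c * m e x)" if "set M \<subseteq> set L" for M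
      using that
    proof (induction M)
      case Nil
      then show ?case by (simp add: P_def)
    next
      case (Cons ce M)
      obtain c e where ce: "ce = (c, e)" by force
      have "e 2 + e 3 \<le> N" using le Cons.prems ce by auto
      then have "N + e 0 + e 1 - (e 2 + e 3) = N \<longleftrightarrow> w e" unfolding w_def by auto
      then show ?case using Cons ce by (simp add: P_def)
    qed
    let ?C = "F (\<phi> x) / G (\<phi> x)"
    \<comment> \<open>All points \<open>y t\<close> have the same image under \<open>\<phi>\<close>,
      so \<open>H\<close> is constant on them; this forces the polynomial to be the single term
      \<open>monom ?C N\<close>.\<close>
    have "poly (P L - monom ?C N) t = 0" if "t \<noteq> 0" for t
      using P[OF that, of L] H[OF that] L[of "y t"] by (simp add: poly_monom m_def)
    then have "UNIV - {0} \<subseteq> {t. poly (P L - monom ?C N) t = 0}" by auto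
    moreover have "infinite (UNIV - {0::complex})" by (simp add: infinite_UNIV_char_0)
    ultimately have "P L - monom ?C N = 0" using poly_roots_finite finite_subset by blast
    then have "coeff (P L) N = ?C" by simp
    then have h0: "h0 x = ?C" using cf[of L] by (simp add: h0_def)
    have "mk e (\<phi> x) = m e x" if "w e" for e
    proof -
      have "mk e (\<phi> x) = (let a = min (e 0) (e 2) in (x 0 * x 2) ^ a * (x 0 * x 3) ^ (e 0 - a) * (x 1 * x 2) ^ (e 2 - a)
         * (x 1 * x 3) ^ (e 1 - (e 2 - a)) * x 4 ^ e 4 * x 5 ^ e 5)"
        unfolding mk_def using lx by (simp add: k)
      also have "\<dots> = m e x"
      proof (cases "e 0 \<le> e 2")
        case True
        then have *: "e 1 - (e 2 - e 0) = e 3" "min (e 0) (e 2) = e 0" using that by (auto simp: w_def)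
        have **: "e 1 = (e 2 - e 0) + e 3" "e 2 = e 0 + (e 2 - e 0)" using True that by (auto simp: w_def)
        have "x 1 ^ e 1 = x 1 ^ (e 2 - e 0) * x 1 ^ e 3" "x 2 ^ e 2 = x 2 ^ e 0 * x 2 ^ (e 2 - e 0)"
          by (metis **(1) power_add, metis **(2) power_add)
        then show ?thesis by (simp add: * m_def six power_mult_distrib Let_def del: One_nat_def)
      next
        case False
        then have *: "e 2 - e 2 = 0" "min (e 0) (e 2) = e 2" by auto
        have **: "e 0 = e 2 + (e 0 - e 2)" "e 3 = (e 0 - e 2) + e 1" using False that by (auto simp: w_def)
        have "x 0 ^ e 0 = x 0 ^ e 2 * x 0 ^ (e 0 - e 2)" "x 3 ^ e 3 = x 3 ^ (e 0 - e 2) * x 3 ^ e 1"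
          by (metis **(1) power_add, metis **(2) power_add)
        then show ?thesis by (simp add: * m_def six power_mult_distrib Let_def del: One_nat_def)
      qed
      finally show ?thesis .
    qed
    then have "h (\<phi> x) = h0 x" unfolding h_def h0_def
      by (intro arg_cong[where f=sum_list] map_cong) auto
    then show ?thesis using h0 False by simp
  qed
  \<comment> \<open>Both sides depend only on the matrix, so \<open>x\<close> may be exchanged for a
    parameter of the same matrix whose last two coordinates are read off correctly by
    \<open>l\<close>.\<close>
  have "F (\<phi> x) = G (\<phi> x) * h (\<phi> x)" for x
  proof -
    obtain x' where "\<phi> x' = \<phi> x" "\<forall>i\<in>{4,5}. l i (\<phi> x') = x' i" using l(2) by blast
    then show ?thesis using *[of x'] by metis
  qed
  with \<open>polynomial_fun h\<close> show "\<exists>h. polynomial_fun h \<and> (\<forall>x. F (\<phi> x) = G (\<phi> x) * h (\<phi> x))" by blast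
qed

section \<open>Groups of matrices with prescribed zeros\<close>

lemma matrix_mul_diff_left: "(A - B) ** C = A ** C - B ** (C :: complex^'n^'n::finite)"
  by (simp add: matrix_matrix_mult_def vec_eq_iff left_diff_distrib sum_subtractf)

lemma matrix_mul_diff_right: "C ** (A - B) = C ** A - C ** (B :: complex^'n^'n::finite)"
  by (simp add: matrix_matrix_mult_def vec_eq_iff right_diff_distrib sum_subtractf)

lemma matrix_mul_scaleR: "(r *\<^sub>R A) ** C = r *\<^sub>R (A ** C)" "A ** (r *\<^sub>R C) = r *\<^sub>R (A ** (C :: complex^'n^'n::finite))"
  by (simp_all add: matrix_matrix_mult_def vec_eq_iff scaleR_sum_right)

lemma mult_entry: "(A ** B) $ i $ j = (\<Sum>k\<in>UNIV. A $ i $ k * B $ k $ j)"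
  by (simp add: matrix_matrix_mult_def)

lemma mult_entry_nonzero:
  assumes "(A ** B) $ i $ j \<noteq> (0::complex)"
  obtains k where "A $ i $ k \<noteq> 0" "B $ k $ j \<noteq> 0"
  using assms unfolding mult_entry by (metis (no_types, lifting) mult_eq_0_iff sum.neutral)

text \<open>For a preorder this is its incidence algebra: \<open>(\<le>)\<close> gives the upper
  triangular matrices, a coarser total preorder the block triangular ones, and the symmetric part
  \<open>sim R\<close> the block diagonal ones.\<close>

definition palg :: "('n \<Rightarrow> 'n \<Rightarrow> bool) \<Rightarrow> (complex^'n^'n::finite) set" where
  "palg R = {A. \<forall>i j. \<not> R i j \<longrightarrow> A $ i $ j = 0}"

definition pat :: "('n \<Rightarrow> 'n \<Rightarrow> bool) \<Rightarrow> (complex^'n^'n::finite) set" where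
  "pat R = {A. det A = 1 \<and> A \<in> palg R}"

definition preorder_rel :: "('n \<Rightarrow> 'n \<Rightarrow> bool) \<Rightarrow> bool" where
  "preorder_rel R \<longleftrightarrow> (\<forall>i. R i i) \<and> (\<forall>i j k. R i j \<longrightarrow> R j k \<longrightarrow> R i k)"

abbreviation sim :: "('n \<Rightarrow> 'n \<Rightarrow> bool) \<Rightarrow> 'n \<Rightarrow> 'n \<Rightarrow> bool" where
  "sim R i j \<equiv> R i j \<and> R j i"

abbreviation str :: "('n \<Rightarrow> 'n \<Rightarrow> bool) \<Rightarrow> 'n \<Rightarrow> 'n \<Rightarrow> bool" where
  "str R i j \<equiv> R i j \<and> \<not> R j i"

lemma preorder_refl: "preorder_rel R \<Longrightarrow> R i i"
  unfolding preorder_rel_def by blast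

lemma preorder_trans: "preorder_rel R \<Longrightarrow> R i j \<Longrightarrow> R j k \<Longrightarrow> R i k"
  unfolding preorder_rel_def by blast

lemma preorder_sim: "preorder_rel R \<Longrightarrow> preorder_rel (sim R)"
  unfolding preorder_rel_def by blast

lemma palgD: "A \<in> palg R \<Longrightarrow> A $ i $ j \<noteq> 0 \<Longrightarrow> R i j"
  unfolding palg_def by auto

lemma palgD0: "A \<in> palg R \<Longrightarrow> \<not> R i j \<Longrightarrow> A $ i $ j = 0"
  unfolding palg_def by auto

lemma palgI: "(\<And>i j. A $ i $ j \<noteq> 0 \<Longrightarrow> R i j) \<Longrightarrow> A \<in> palg R"
  unfolding palg_def by auto

lemma palg_mult_gen:
  assumes "A \<in> palg R" "B \<in> palg S" "\<And>i j k. R i k \<Longrightarrow> S k j \<Longrightarrow> T i j"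
  shows "A ** B \<in> palg T"
proof (rule palgI)
  fix i j assume "(A ** B) $ i $ j \<noteq> 0"
  then obtain k where "A $ i $ k \<noteq> 0" "B $ k $ j \<noteq> 0" by (rule mult_entry_nonzero)
  then show "T i j" using palgD[OF assms(1)] palgD[OF assms(2)] assms(3) by blast
qed

lemma palg_mult: "preorder_rel R \<Longrightarrow> A \<in> palg R \<Longrightarrow> B \<in> palg R \<Longrightarrow> A ** B \<in> palg R"
  using palg_mult_gen[of A R B R R] preorder_trans[of R] by blast

lemma palg_one: "preorder_rel R \<Longrightarrow> mat 1 \<in> palg R"
  by (auto simp: palg_def mat_def preorder_refl)

lemma palg_add: "A \<in> palg R \<Longrightarrow> B \<in> palg R \<Longrightarrow> A + B \<in> palg R"
  unfolding palg_def by auto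

lemma palg_diff: "A \<in> palg R \<Longrightarrow> B \<in> palg R \<Longrightarrow> A - B \<in> palg R"
  unfolding palg_def by auto

lemma palg_mono: "A \<in> palg R \<Longrightarrow> (\<And>i j. R i j \<Longrightarrow> S i j) \<Longrightarrow> A \<in> palg S"
  unfolding palg_def by auto

lemma pat_mono: "A \<in> pat R \<Longrightarrow> (\<And>i j. R i j \<Longrightarrow> S i j) \<Longrightarrow> A \<in> pat S"
  unfolding pat_def using palg_mono by blast

lemma patD: "A \<in> pat R \<Longrightarrow> det A = 1" "A \<in> pat R \<Longrightarrow> A \<in> palg R"
  unfolding pat_def by auto

lemma subspace_palg: "subspace (palg R)"
  unfolding subspace_def palg_def by auto

text \<open>An injective linear endomorphism of a finite-dimensional space is onto; this replaces
  elimination arguments for solving linear matrix equations with prescribed zeros.\<close>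

lemma palg_solve:
  fixes f :: "complex^'n^'n::finite \<Rightarrow> complex^'n^'n"
  assumes f: "linear f" "\<And>A. A \<in> palg S \<Longrightarrow> f A \<in> palg S"
    and inj: "\<And>A. A \<in> palg S \<Longrightarrow> f A = 0 \<Longrightarrow> A = 0" and B: "B \<in> palg S"
  shows "\<exists>A\<in>palg S. f A = B"
proof -
  have span: "span (palg S) = palg S" using subspace_palg by (simp add: span_eq_iff)
  have "inj_on f (span (palg S))"
  proof (rule inj_onI)
    fix A B assume *: "A \<in> span (palg S)" "B \<in> span (palg S)" "f A = f B"
    then have "f (A - B) = 0" by (simp add: linear_diff[OF f(1)])
    moreover have "A - B \<in> palg S" using * palg_diff unfolding span by blast
    ultimately show "A = B" using inj by force
  qed
  then have "dim (f ` palg S) = dim (palg S)" by (rule dim_image_eq[OF f(1)])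
  moreover have "subspace (f ` palg S)" using f(1) subspace_palg by (rule linear_subspace_image)
  moreover have "f ` palg S \<subseteq> palg S" using f(2) by blast
  ultimately have "f ` palg S = palg S"
    using subspace_dim_equal[OF _ subspace_palg] by (metis order_refl)
  then have "B \<in> f ` palg S" using B by simp
  then show ?thesis by blast
qed

lemma linear_matrix_mult_left: "linear (\<lambda>A. B ** (A :: complex^'n^'n::finite))"
  by (rule linearI) (simp_all add: matrix_add_ldistrib matrix_mul_scaleR)

text \<open>Left multiplication by \<open>A\<close> is an injective endomorphism of the
  finite-dimensional \<open>palg R\<close>, so it reaches the identity from inside
  \<open>palg R\<close>.\<close>

lemma pat_minv:
  fixes A :: "complex^'n^'n::finite"
  assumes R: "preorder_rel R" and A: "A \<in> pat R"
  shows "minv A \<in> pat R"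
proof -
  have d: "det A = 1" and p: "A \<in> palg R" using A by (auto simp: pat_def)
  have "\<exists>X\<in>palg R. A ** X = mat 1"
  proof (rule palg_solve)
    show "linear (\<lambda>X :: complex^'n^'n. A ** X)" by (rule linear_matrix_mult_left)
    show "A ** X \<in> palg R" if "X \<in> palg R" for X using R p that by (rule palg_mult)
    show "X = 0" if "A ** X = 0" for X
      using minv_l_cancel[OF d, of X] that by simp
    show "mat 1 \<in> palg R" using R by (rule palg_one)
  qed
  then obtain X where "X \<in> palg R" "A ** X = mat 1" by blast
  moreover from this have "minv A = X" using minv_l_cancel[OF d, of X] by simp
  ultimately show ?thesis using minv_det[OF d] by (simp add: pat_def)
qed

lemma subgroup_pat:
  assumes "preorder_rel R" shows "subgroup (pat R) SL"
  unfolding subgroup_SL_iff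
  using assms pat_minv[OF assms] by (auto simp: pat_def palg_one det_mul intro: palg_mult)

lemma closedin_pat: "closedin zariski (pat R)"
  unfolding closedin_zariski
  by (rule exI[of _ "{\<lambda>A. A $ i $ j | i j. \<not> R i j}"])
    (auto simp: pat_def palg_def intro: polynomial_fun.entry)

lemma irr_palg: "irr (palg R)"
  by (rule irr_convex) (auto simp: palg_def)

text \<open>Irreducibility is carried over from the linear space \<open>palg R\<close> by the
  retraction \<open>N\<close>, which divides the single row \<open>i0\<close> by the determinant;
  \<open>c\<close> writes all entries over that common denominator.\<close>

lemma irr_pat:
  fixes R :: "'n \<Rightarrow> 'n::finite \<Rightarrow> bool"
  assumes R: "preorder_rel R" shows "irr (pat R)"
proof (rule irrI)
  fix p q :: "complex^'n^'n \<Rightarrow> complex" and A B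
  assume pq: "polynomial_fun p" "polynomial_fun q" and AB: "A \<in> pat R" "B \<in> pat R" "p A \<noteq> 0" "q B \<noteq> 0"
  define i0 :: 'n where "i0 = undefined"
  define c where "c i j A = (if i = i0 then A $ i $ j else A $ i $ j * det A)" for i j and A :: "complex^'n^'n"
  define N where "N A = (\<chi> i j. c i j A / det A)" for A
  have c: "polynomial_fun (c i j)" for i j
    unfolding c_def by (intro polynomial_fun_closure polynomial_fun_det)
  have d: "polynomial_fun det" using polynomial_fun_det[of "\<lambda>A. A"] by (simp add: polynomial_fun.entry)
  have N_pat: "N X \<in> pat R" if "X \<in> palg R" "det X \<noteq> 0" for X
  proof -
    have "N X = (\<chi> i. if i = i0 then (1 / det X) *s X $ i else X $ i)"
      using that by (simp add: N_def c_def vec_eq_iff)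
    then have "det (N X) = (1 / det X) * det (\<chi> i. if i = i0 then X $ i else X $ i)"
      by (simp only: det_row_mul)
    then have "det (N X) = 1" using that by simp
    moreover have "N X \<in> palg R" using that(1) by (auto simp: N_def c_def palg_def)
    ultimately show ?thesis by (simp add: pat_def)
  qed
  have N_id: "N X = X" if "det X = 1" for X
    using that by (simp add: N_def c_def vec_eq_iff)
  obtain P n where P: "polynomial_fun P" "\<And>X. det X \<noteq> 0 \<Longrightarrow> p (N X) = P X / det X ^ n"
    using rational_substitution[where c=c, OF pq(1) c d] unfolding N_def by auto
  obtain Q m where Q: "polynomial_fun Q" "\<And>X. det X \<noteq> 0 \<Longrightarrow> q (N X) = Q X / det X ^ m"
    using rational_substitution[where c=c, OF pq(2) c d] unfolding N_def by auto
  have AB': "A \<in> palg R" "B \<in> palg R" "det A = 1" "det B = 1" using AB by (auto simp: pat_def)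
  have "P A \<noteq> 0" "Q B \<noteq> 0" using P(2)[of A] Q(2)[of B] AB AB' N_id by auto
  then obtain C where C: "C \<in> palg R" "P C * det C \<noteq> 0" "Q C \<noteq> 0"
    using irrD[OF irr_palg polynomial_fun.mult[OF P(1) d] Q(1) AB'(1,2)] AB' by auto
  then have "det C \<noteq> 0" by auto
  then have "p (N C) \<noteq> 0" "q (N C) \<noteq> 0" using P(2) Q(2) C by auto
  then show "\<exists>C\<in>pat R. p C \<noteq> 0 \<and> q C \<noteq> 0" using N_pat C(1) \<open>det C \<noteq> 0\<close> by blast
qed

lemma normal_SL_iff:
  assumes Q: "subgroup Q SL"
  shows "U \<lhd> SL\<lparr>carrier := Q\<rparr> \<longleftrightarrow> subgroup U SL \<and> U \<subseteq> Q \<and> (\<forall>A\<in>Q. \<forall>B\<in>U. A ** B ** minv A \<in> U)"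
proof -
  interpret Q: Group.group "SL\<lparr>carrier := Q\<rparr>" using Q by (rule subgroup.subgroup_is_group) (rule group_SL)
  have "subgroup U (SL\<lparr>carrier := Q\<rparr>) \<longleftrightarrow> subgroup U SL \<and> U \<subseteq> Q"
    using SL.subgroup_incl[OF _ Q] SL.incl_subgroup[OF Q] subgroup.subset[of U "SL\<lparr>carrier := Q\<rparr>"] by auto
  then show ?thesis
    unfolding Q.normal_inv_iff using SL.m_inv_consistent[OF Q] by auto
qed

subsection \<open>Traces of unipotent matrices\<close>

text \<open>In the Leibniz formula a permutation other than the identity moves at least two points,
  so its term has a double zero at 0; only the diagonal product contributes to the
  derivative.\<close>

lemma trace_derivative:
  fixes N :: "complex^'n^'n::finite"
  shows "((\<lambda>t. det (\<chi> i j. (if i = j then 1 else 0) + t * N $ i $ j)) has_field_derivative trace N) (at 0)"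
proof -
  define e :: "'n \<Rightarrow> 'n \<Rightarrow> complex" where "e i j = (if i = j then 1 else 0)" for i j
  have T: "((\<lambda>t. of_int (sign p) * (\<Prod>i\<in>UNIV. e i (p i) + t * N $ i $ p i)) has_field_derivative
      (if p = id then trace N else 0)) (at 0)" if "p permutes UNIV" for p
  proof -
    have "((\<lambda>t. \<Prod>i\<in>UNIV. e i (p i) + t * N $ i $ p i) has_field_derivative
      (\<Sum>i\<in>UNIV. N $ i $ p i * (\<Prod>j\<in>UNIV - {i}. e j (p j) + 0 * N $ j $ p j))) (at 0)"
      by (rule has_field_derivative_prod) (auto intro!: derivative_eq_intros)
    moreover have "(\<Sum>i\<in>UNIV. N $ i $ p i * (\<Prod>j\<in>UNIV - {i}. e j (p j) + 0 * N $ j $ p j)) = (if p = id then trace N else 0)"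
    proof (cases "p = id")
      case True
      then show ?thesis by (simp add: e_def trace_def)
    next
      case False
      then obtain a where a: "p a \<noteq> a" by (auto simp: fun_eq_iff)
      have "p (p a) \<noteq> p a" using a permutes_inj[OF that] by (auto dest: injD)
      have "(\<Prod>j\<in>UNIV - {i}. e j (p j) + 0 * N $ j $ p j) = 0" for i
      proof (rule prod_zero)
        show "\<exists>j\<in>UNIV - {i}. e j (p j) + 0 * N $ j $ p j = 0"
          using a \<open>p (p a) \<noteq> p a\<close> by (cases "i = a") (auto simp: e_def intro: bexI[of _ "p a"] bexI[of _ a])
      qed simp
      then show ?thesis using False by (simp only: if_False mult_zero_right sum.neutral_const)
    qed
    ultimately have D: "((\<lambda>t. \<Prod>i\<in>UNIV. e i (p i) + t * N $ i $ p i) has_field_derivative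
      (if p = id then trace N else 0)) (at 0)" by simp
    show ?thesis by (rule DERIV_cong[OF DERIV_cmult[OF D]]) (simp add: sign_id)
  qed
  have "((\<lambda>t. \<Sum>p\<in>{p. p permutes UNIV}. of_int (sign p) * (\<Prod>i\<in>UNIV. e i (p i) + t * N $ i $ p i)) has_field_derivative
      (\<Sum>p\<in>{p. p permutes (UNIV :: 'n set)}. if p = id then trace N else 0)) (at 0)"
    by (rule DERIV_sum) (rule T, simp)
  moreover have "(\<Sum>p\<in>{p. p permutes (UNIV :: 'n set)}. if p = id then trace N else 0) = trace N"
    by (simp add: sum.delta permutes_id finite_permutations)
  ultimately show ?thesis unfolding det_def e_def by simp
qed

lemma funpow_mult_vec:
  assumes "N *v v = c *s (v :: complex^'n::finite)"
  shows "((\<lambda>M. N ** M) ^^ k) (mat 1) *v v = c ^ k *s v"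
proof (induction k)
  case (Suc k)
  have "((\<lambda>M. N ** M) ^^ Suc k) (mat 1) *v v = N *v (c ^ k *s v)"
    by (simp add: matrix_vector_mul_assoc[symmetric] Suc)
  also have "\<dots> = c ^ k *s (N *v v)" by (simp add: vector_scalar_commute)
  finally show ?case by (simp add: assms mult.commute)
qed simp

text \<open>The polynomial \<open>det (1 + t N)\<close> has no zero, as a zero would give
  \<open>N\<close> a nonzero eigenvalue. By the fundamental theorem of algebra it is constant, and
  its derivative at 0 is the trace.\<close>

lemma trace_nilpotent:
  fixes N :: "complex^'n^'n::finite"
  assumes N: "((\<lambda>M. N ** M) ^^ k) (mat 1) = 0"
  shows "trace N = 0"
proof -
  let ?l = "\<lambda>t. \<chi> i j. (if i = j then 1 else 0) + t * N $ i $ j"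
  have nz: "det (?l t) \<noteq> 0" for t
  proof
    assume d: "det (?l t) = 0"
    then have "\<not> invertible (?l t)" by (simp add: invertible_det_nz)
    then obtain v where v: "?l t *v v = 0" "v \<noteq> 0"
      using matrix_left_invertible_ker[of "?l t"] invertible_left_inverse[of "?l t"] by auto
    have "?l t *v v = v + t *s (N *v v)"
      by (simp add: matrix_vector_mult_def vec_eq_iff distrib_right sum.distrib sum_distrib_left mult.assoc
        if_distrib[of "\<lambda>x. x * _"] cong: if_cong)
    then have *: "v + t *s (N *v v) = 0" using v(1) by simp
    then have "t \<noteq> 0" using v(2) by auto
    have "N *v v = (- 1 / t) *s v"
    proof -
      have "t *s (N *v v) = - v" using * by (simp add: eq_neg_iff_add_eq_0 add.commute)
      then have "(1 / t) *s (t *s (N *v v)) = (1 / t) *s (- v)" by simp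
      then show ?thesis using \<open>t \<noteq> 0\<close> by (simp add: vector_smult_assoc)
    qed
    from funpow_mult_vec[OF this, of k] have "(- 1 / t) ^ k *s v = 0" by (simp add: N)
    then show False using v(2) \<open>t \<noteq> 0\<close> by simp
  qed
  have "polynomial_fun det" using polynomial_fun_det[of "\<lambda>A. A"] by (simp add: polynomial_fun.entry)
  from polynomial_fun_on_line[OF this, of "mat 1" "mat 1 + N"] obtain P where
    "\<And>s. poly P s = det (\<chi> i j. (1 - s) * (mat 1 :: complex^'n^'n) $ i $ j + s * (mat 1 + N) $ i $ j)" by blast
  moreover have "(1 - s) * (mat 1 :: complex^'n^'n) $ i $ j + s * (mat 1 + N) $ i $ j = ?l s $ i $ j" for s i j
    by (simp add: mat_def algebra_simps)
  ultimately have P: "\<And>s. poly P s = det (?l s)" by simp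
  then have "constant (poly P)" using fundamental_theorem_of_algebra nz by metis
  then have "det (?l s) = det (?l 0)" for s using P unfolding constant_def by metis
  then have "(\<lambda>t. det (?l t)) = (\<lambda>t. det (?l 0))" by (rule ext)
  then have "((\<lambda>t. det (?l t)) has_field_derivative 0) (at 0)" by simp
  then show ?thesis using trace_derivative DERIV_unique by blast
qed

lemma unipotent_trace:
  fixes A :: "complex^'n^'n::finite"
  assumes "unipotent A" shows "trace A = of_nat CARD('n)"
  using assms trace_nilpotent[where N="A - mat 1"] unfolding unipotent_def
  by (auto simp: trace_sub trace_I)

subsection \<open>Elementary matrices\<close>

definition elem :: "'n \<Rightarrow> 'n \<Rightarrow> complex \<Rightarrow> complex^'n^'n::finite" where
  "elem i j t = (\<chi> a b. (if a = b then 1 else 0) + (if a = i \<and> b = j then t else 0))"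

lemma elem_mult_left: "(elem i j t ** A) $ a $ b = A $ a $ b + (if a = i then t * A $ j $ b else 0)"
  unfolding mult_entry elem_def
  by (simp add: distrib_right sum.distrib if_distrib[of "\<lambda>x. x * _"] if_conn cong: if_cong)

lemma elem_mult_right: "(A ** elem i j t) $ a $ b = A $ a $ b + (if b = j then t * A $ a $ i else 0)"
  unfolding mult_entry elem_def
  by (simp add: distrib_left sum.distrib if_distrib[of "\<lambda>x. _ * x"] if_conn cong: if_cong)

lemma elem_entry: "elem i j t $ a $ b = (if a = b then 1 else 0) + (if a = i \<and> b = j then t else 0)"
  by (simp add: elem_def)

lemma det_elem:
  assumes "i \<noteq> j" shows "det (elem i j t) = 1"
proof -
  have "elem i j t = (\<chi> k. if k = i then row i (mat 1) + t *s row j (mat 1) else row k (mat 1))"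
    using assms by (auto simp: vec_eq_iff elem_def row_def mat_def)
  then show ?thesis using det_row_operation[OF assms, of "mat 1" t] by simp
qed

lemma elem_add: "i \<noteq> j \<Longrightarrow> elem i j s ** elem i j t = elem i j (s + t)"
  by (simp add: vec_eq_iff elem_mult_left) (simp add: elem_def)

lemma elem_0: "elem i j 0 = mat 1"
  by (simp add: vec_eq_iff elem_def mat_def)

lemma minv_elem: "i \<noteq> j \<Longrightarrow> minv (elem i j t) = elem i j (- t)"
  by (rule minv_unique) (simp_all add: det_elem elem_add elem_0)

lemma elem_pat: "preorder_rel R \<Longrightarrow> R i j \<Longrightarrow> i \<noteq> j \<Longrightarrow> elem i j t \<in> pat R"
  by (auto simp: pat_def palg_def det_elem elem_entry preorder_refl)

subsection \<open>The unipotent radical\<close>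

text \<open>For a block triangular group this is the subgroup with identity diagonal blocks, its
  unipotent radical. With \<open>R\<close> reversed the same formula gives the opposite radical,
  which parametrizes the big cell.\<close>

definition rad :: "('n \<Rightarrow> 'n \<Rightarrow> bool) \<Rightarrow> (complex^'n^'n::finite) set" where
  "rad R = {A. det A = 1 \<and> A - mat 1 \<in> palg (str R)}"

lemma rad_subset_pat: "preorder_rel R \<Longrightarrow> rad R \<subseteq> pat R"
proof
  fix A assume R: "preorder_rel R" and A: "A \<in> rad R"
  then have "A - mat 1 \<in> palg R" unfolding rad_def using palg_mono by blast
  then have "(A - mat 1) + mat 1 \<in> palg R" using R by (intro palg_add palg_one)
  then show "A \<in> pat R" using A by (simp add: pat_def rad_def)
qed

lemma subgroup_rad:
  assumes R: "preorder_rel R" shows "subgroup (rad R) SL"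
  unfolding subgroup_SL_iff
proof (intro conjI ballI)
  show "det A = 1" if "A \<in> rad R" for A using that by (simp add: rad_def)
  show "mat 1 \<in> rad R" by (simp add: rad_def palg_def)
next
  fix A B assume AB: "A \<in> rad R" "B \<in> rad R"
  then have "B \<in> palg R" using rad_subset_pat[OF R] by (auto simp: pat_def)
  then have "(A - mat 1) ** B \<in> palg (str R)"
    using AB(1) by (intro palg_mult_gen[of _ "str R" _ R]) (auto simp: rad_def intro: preorder_trans[OF R])
  then have "(A - mat 1) ** B + (B - mat 1) \<in> palg (str R)" using AB(2) by (intro palg_add) (auto simp: rad_def)
  then show "A ** B \<in> rad R" using AB by (simp add: rad_def det_mul matrix_mul_diff_left)
next
  fix A assume A: "A \<in> rad R"
  then have d: "det A = 1" by (simp add: rad_def)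
  have "minv A \<in> palg R" using A rad_subset_pat[OF R] pat_minv[OF R] by (auto simp: pat_def)
  then have "(A - mat 1) ** minv A \<in> palg (str R)"
    using A by (intro palg_mult_gen[of _ "str R" _ R]) (auto simp: rad_def intro: preorder_trans[OF R])
  then have "0 - (A - mat 1) ** minv A \<in> palg (str R)"
    by (intro palg_diff) (auto simp: palg_def)
  then show "minv A \<in> rad R" using d by (simp add: rad_def minv_det matrix_mul_diff_left minv_r)
qed

lemma rad_conj:
  assumes R: "preorder_rel R" and A: "A \<in> pat R" and B: "B \<in> rad R"
  shows "A ** B ** minv A \<in> rad R"
proof -
  have d: "det A = 1" "det B = 1" and p: "A \<in> palg R" "minv A \<in> palg R"
    using A B pat_minv[OF R A] by (auto simp: pat_def rad_def)
  have "A ** (B - mat 1) \<in> palg (str R)"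
    using B p by (intro palg_mult_gen[of _ R _ "str R"]) (auto simp: rad_def intro: preorder_trans[OF R])
  then have "A ** (B - mat 1) ** minv A \<in> palg (str R)"
    by (rule palg_mult_gen[OF _ p(2)]) (auto intro: preorder_trans[OF R])
  moreover have "A ** (B - mat 1) ** minv A = A ** B ** minv A - mat 1"
    using d by (simp add: matrix_mul_diff_left matrix_mul_diff_right minv_r)
  ultimately show ?thesis using d by (simp add: rad_def det_mul minv_det)
qed

lemma closedin_rad: "closedin zariski (rad R)"
proof (rule closedin_zariskiI)
  fix A :: "complex^'a^'a" assume "det A = 1" "A \<notin> rad R"
  then obtain i j where ij: "\<not> str R i j" "(A - mat 1) $ i $ j \<noteq> 0" by (auto simp: rad_def palg_def)
  have "polynomial_fun (\<lambda>A. A $ i $ j - mat 1 $ i $ j)"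
    by (intro polynomial_fun_diff polynomial_fun.entry polynomial_fun.const)
  moreover have "\<forall>B\<in>rad R. B $ i $ j - mat 1 $ i $ j = 0" using ij(1) by (auto simp: rad_def palg_def)
  ultimately show "\<exists>p. polynomial_fun p \<and> (\<forall>B\<in>rad R. p B = 0) \<and> p A \<noteq> 0"
    using ij(2) by (intro exI[of _ "\<lambda>A. A $ i $ j - mat 1 $ i $ j"]) simp
qed (simp add: rad_def)

lemma funpow_palg:
  "preorder_rel R \<Longrightarrow> N \<in> palg R \<Longrightarrow> ((\<lambda>M. N ** M) ^^ k) (mat 1) \<in> palg R"
  by (induction k) (auto intro: palg_one palg_mult)

text \<open>Assumption \<open>s\<close> leaves no closed walk through \<open>i\<close> except
  standing still, so the diagonal entries of a power of \<open>A - 1\<close> are powers of its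
  diagonal entries and vanish by nilpotence.\<close>

lemma diagonal_unipotent:
  assumes R: "preorder_rel R" and A: "A \<in> palg R" and u: "unipotent A"
    and s: "\<And>i j. i \<noteq> j \<Longrightarrow> R i j \<Longrightarrow> A $ j $ i = 0"
  shows "A - mat 1 \<in> palg (str R)"
proof -
  let ?N = "A - mat 1"
  have N: "?N \<in> palg R" using A R by (intro palg_diff palg_one)
  have d: "(((\<lambda>M. ?N ** M) ^^ k) (mat 1)) $ i $ i = (?N $ i $ i) ^ k" for i k
  proof (induction k)
    case (Suc k)
    let ?M = "((\<lambda>M. ?N ** M) ^^ k) (mat 1)"
    have M: "?M \<in> palg R" using R N by (rule funpow_palg)
    have "?N $ i $ l * ?M $ l $ i = 0" if "l \<noteq> i" for l
    proof (rule ccontr)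
      assume "\<not> ?thesis"
      then have "?N $ i $ l \<noteq> 0" "R l i" using palgD[OF M] by auto
      then show False using s[of l i] that by (simp add: mat_def)
    qed
    then have "(?N ** ?M) $ i $ i = (\<Sum>l\<in>{i}. ?N $ i $ l * ?M $ l $ i)"
      unfolding mult_entry by (intro sum.mono_neutral_right) auto
    then show ?case using Suc by simp
  qed (simp add: mat_def)
  obtain k where "((\<lambda>M. ?N ** M) ^^ k) (mat 1) = 0" using u unfolding unipotent_def by blast
  then have z: "?N $ i $ i = 0" for i using d[of k i] by simp
  show ?thesis
  proof (rule palgI)
    fix i j assume nz: "?N $ i $ j \<noteq> 0"
    then have "i \<noteq> j" using z by metis
    then show "str R i j" using s[of j i] nz palgD[OF N nz] by (auto simp: mat_def)
  qed
qed

text \<open>For $x$ in a normal subgroup of unipotent matrices and an elementary matrix $g$ of the group,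
  $x g x g^{-1}$ is unipotent, so its trace is $n$; comparing with $g = 1$, this says that the square
  of an entry of $x$ vanishes.\<close>

lemma normal_unipotent_entry:
  fixes x :: "complex^'n^'n::finite"
  assumes tr: "unipotent x" "unipotent (x ** x)" "unipotent (x ** (elem i j 1 ** x ** elem i j (-1)))"
    and ij: "i \<noteq> j"
  shows "x $ j $ i = 0"
proof -
  have X: "(elem i j 1 ** x ** elem i j (-1)) $ a $ b = x $ a $ b + (if a = i then x $ j $ b else 0)
     - (if b = j then x $ a $ i + (if a = i then x $ j $ i else 0) else 0)" for a b
    by (simp add: elem_mult_left elem_mult_right)
  have "trace (x ** (elem i j 1 ** x ** elem i j (-1))) =
     (\<Sum>a\<in>UNIV. \<Sum>b\<in>UNIV. x $ a $ b * (x $ b $ a + (if b = i then x $ j $ a else 0)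
     - (if a = j then x $ b $ i + (if b = i then x $ j $ i else 0) else 0)))"
    unfolding trace_def mult_entry[of x] X ..
  also have "\<dots> = (\<Sum>a\<in>UNIV. \<Sum>b\<in>UNIV. x $ a $ b * x $ b $ a) + (\<Sum>a\<in>UNIV. x $ a $ i * x $ j $ a)
     - (\<Sum>b\<in>UNIV. x $ j $ b * x $ b $ i) - x $ j $ i * x $ j $ i"
  proof -
    have "(\<Sum>a\<in>UNIV. \<Sum>b\<in>UNIV. x $ a $ b * (x $ b $ a + (if b = i then x $ j $ a else 0)
       - (if a = j then x $ b $ i + (if b = i then x $ j $ i else 0) else 0))) =
      (\<Sum>a\<in>UNIV. \<Sum>b\<in>UNIV. x $ a $ b * x $ b $ a) + (\<Sum>a\<in>UNIV. \<Sum>b\<in>UNIV. if b = i then x $ a $ b * x $ j $ a else 0)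
      - (\<Sum>a\<in>UNIV. \<Sum>b\<in>UNIV. if a = j then x $ a $ b * x $ b $ i else 0)
      - (\<Sum>a\<in>UNIV. \<Sum>b\<in>UNIV. if a = j then (if b = i then x $ a $ b * x $ j $ i else 0) else 0)"
      unfolding sum.distrib[symmetric] sum_subtractf[symmetric]
      by (intro sum.cong refl) (auto simp: algebra_simps)
    moreover have "(\<Sum>a\<in>UNIV. \<Sum>b\<in>UNIV. if a = j then x $ a $ b * x $ b $ i else 0) = (\<Sum>b\<in>UNIV. x $ j $ b * x $ b $ i)"
      by (subst sum.swap) simp
    moreover have "(\<Sum>a\<in>UNIV. \<Sum>b\<in>UNIV. if a = j then (if b = i then x $ a $ b * x $ j $ i else 0) else 0) = x $ j $ i * x $ j $ i"
      by (subst sum.swap) simp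
    ultimately show ?thesis by simp
  qed
  also have "\<dots> = trace (x ** x) - x $ j $ i * x $ j $ i"
    unfolding trace_def mult_entry by (simp add: mult.commute)
  finally show ?thesis using unipotent_trace[OF tr(2)] unipotent_trace[OF tr(3)] by simp
qed

text \<open>Wherever \<open>R i j\<close> holds off the diagonal, the group contains the elementary
  matrices at \<open>(i, j)\<close>, and the trace comparison kills the entry at
  \<open>(j, i)\<close>. This is the maximality half of the unipotent radical, used for block
  triangular and for block diagonal groups.\<close>

lemma normal_unipotent_rad:
  assumes R: "preorder_rel R" and U: "U \<lhd> SL\<lparr>carrier := pat R\<rparr>" "\<And>u. u \<in> U \<Longrightarrow> unipotent u"
  shows "U \<subseteq> rad R"
proof
  fix x assume x: "x \<in> U"
  have *: "subgroup U SL" "U \<subseteq> pat R" "\<And>A B. A \<in> pat R \<Longrightarrow> B \<in> U \<Longrightarrow> A ** B ** minv A \<in> U"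
    using U(1) unfolding normal_SL_iff[OF subgroup_pat[OF R]] by auto
  have xR: "x \<in> palg R" "det x = 1" using * x by (auto simp: pat_def)
  have "x $ j $ i = 0" if "i \<noteq> j" "R i j" for i j
  proof (rule normal_unipotent_entry[OF _ _ _ that(1)])
    show "unipotent x" "unipotent (x ** x)" using U(2) x subgroup_SLD(3)[OF *(1)] by auto
    have "elem i j 1 ** x ** elem i j (-1) \<in> U"
      using *(3)[OF elem_pat[OF R that(2,1), of 1] x] that by (simp add: minv_elem)
    then show "unipotent (x ** (elem i j 1 ** x ** elem i j (-1)))"
      using U(2) x subgroup_SLD(3)[OF *(1)] by blast
  qed
  then have "x - mat 1 \<in> palg (str R)"
    using diagonal_unipotent[OF R xR(1)] U(2)[OF x] by blast
  then show "x \<in> rad R" using xR by (simp add: rad_def)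
qed

lemma matrix_mul_add_left: "(A + B) ** C = A ** C + B ** (C :: complex^'n^'n::finite)"
  by (simp add: matrix_matrix_mult_def vec_eq_iff distrib_right sum.distrib)

section \<open>Levi subgroups of block triangular groups\<close>

definition upper_rel :: "('n::order \<Rightarrow> 'n \<Rightarrow> bool) \<Rightarrow> bool" where
  "upper_rel R \<longleftrightarrow> preorder_rel R \<and> (\<forall>i j. i \<le> j \<longrightarrow> R i j)"

lemma upper_relD: "upper_rel R \<Longrightarrow> preorder_rel R" "upper_rel R \<Longrightarrow> i \<le> j \<Longrightarrow> R i j"
  unfolding upper_rel_def by blast+

lemma upper_str_less:
  fixes i j :: "'n::linorder"
  assumes "upper_rel R" "str R i j" shows "i < j"
  using assms upper_relD(2)[of R j i] by force

lemma preorder_le: "preorder_rel ((\<le>) :: 'n::order \<Rightarrow> 'n \<Rightarrow> bool)"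
  unfolding preorder_rel_def by auto

lemma upper_le: "upper_rel ((\<le>) :: 'n::order \<Rightarrow> 'n \<Rightarrow> bool)"
  unfolding upper_rel_def by (simp add: preorder_le)

lemma upper_triangular_pat: "upper_triangular = pat (\<le>)"
  unfolding upper_triangular_def pat_def palg_def by (auto simp: not_le)

lemma det_unitriangular:
  fixes A :: "complex^'n::{finite,wellorder}^'n::{finite,wellorder}"
  assumes "A - mat 1 \<in> palg (<)" shows "det A = 1"
proof -
  have *: "A $ i $ j = mat 1 $ i $ j" if "\<not> i < j" for i j
    using palgD0[OF assms that] by simp
  have "det A = prod (\<lambda>i. A $ i $ i) UNIV"
  proof (rule det_upperdiagonal)
    show "A $ i $ j = 0" if "i > j" for i j using *[of i j] that by (simp add: mat_def)
  qed
  then show ?thesis using * by (simp add: mat_def)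
qed

lemma det_lower_unitriangular:
  fixes A :: "complex^'n::{finite,wellorder}^'n::{finite,wellorder}"
  assumes "A - mat 1 \<in> palg (>)" shows "det A = 1"
proof -
  have *: "A $ i $ j = mat 1 $ i $ j" if "\<not> i > j" for i j
    using palgD0[OF assms that] by simp
  have "det A = prod (\<lambda>i. A $ i $ i) UNIV"
  proof (rule det_lowerdiagonal)
    show "A $ i $ j = 0" if "i < j" for i j using *[OF less_not_sym[OF that]] that by (auto simp: mat_def)
  qed
  then show ?thesis using * by (simp add: mat_def)
qed

text \<open>The rank \<open>r\<close> rises along every nonzero entry of \<open>A - 1\<close>, so
  the \<open>k\<close>-th power only connects indices whose ranks differ by at least
  \<open>k\<close>.\<close>

lemma unitriangular_unipotent:
  fixes A :: "complex^'n::{finite,linorder}^'n::{finite,linorder}"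
  assumes "A - mat 1 \<in> palg (<)" shows "unipotent A"
proof -
  define r where "r i = card {l. l < i}" for i :: 'n
  have r: "r i < r j" if "i < j" for i j
    unfolding r_def by (rule psubset_card_mono) (use that in auto)
  let ?P = "\<lambda>k. ((\<lambda>M. (A - mat 1) ** M) ^^ k) (mat 1)"
  have *: "?P k $ i $ j \<noteq> 0 \<Longrightarrow> r i + k \<le> r j" for k i j
  proof (induction k arbitrary: i)
    case 0
    then show ?case by (simp add: mat_def split: if_splits)
  next
    case (Suc k)
    then have "((A - mat 1) ** ?P k) $ i $ j \<noteq> 0" by simp
    then obtain l where l: "(A - mat 1) $ i $ l \<noteq> 0" "?P k $ l $ j \<noteq> 0" by (rule mult_entry_nonzero)
    have "r i < r l" using palgD[OF assms l(1)] r by blast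
    moreover have "r l + k \<le> r j" by (rule Suc.IH[OF l(2)])
    ultimately show ?case by simp
  qed
  have "r j < CARD('n)" for j unfolding r_def by (rule psubset_card_mono) auto
  then have "?P CARD('n) $ i $ j = 0" for i j
    using *[of "CARD('n)" i j] by (metis add_leD2 leD)
  then have "?P CARD('n) = 0" by (simp add: vec_eq_iff)
  then show ?thesis unfolding unipotent_def by blast
qed

text \<open>Without the determinant condition \<open>rad R\<close> is visibly an affine space; this
  yields irreducibility and lets elements be built as \<open>1 + X\<close>.\<close>

lemma rad_upper:
  fixes R :: "'n \<Rightarrow> 'n::{finite,wellorder} \<Rightarrow> bool"
  assumes "upper_rel R" shows "rad R = {A. A - mat 1 \<in> palg (str R)}"
proof -
  have "det A = 1" if "A - mat 1 \<in> palg (str R)" for A :: "complex^'n::{finite,wellorder}^'n::{finite,wellorder}"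
    using det_unitriangular[OF palg_mono[OF that]] upper_str_less[OF assms] by blast
  then show ?thesis unfolding rad_def by auto
qed

lemma irr_rad:
  fixes R :: "'n \<Rightarrow> 'n::{finite,wellorder} \<Rightarrow> bool"
  assumes "upper_rel R" shows "irr (rad R)"
  unfolding rad_upper[OF assms]
  by (rule irr_convex) (auto simp: palg_def mat_def algebra_simps)

lemma rad_unipotent:
  fixes R :: "'n \<Rightarrow> 'n::{finite,wellorder} \<Rightarrow> bool"
  assumes "upper_rel R" "A \<in> rad R" shows "unipotent A"
  using assms upper_str_less[OF assms(1)] by (intro unitriangular_unipotent) (auto simp: rad_def intro: palg_mono)

lemma unipotent_radical_pat:
  fixes R :: "'n \<Rightarrow> 'n::{finite,wellorder} \<Rightarrow> bool"
  assumes R: "upper_rel R" shows "unipotent_radical (pat R) = rad R"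
  unfolding unipotent_radical_def
proof (rule Greatest_equality)
  note P = upper_relD(1)[OF R]
  show "closed_subgroup (rad R) \<and> connectedin zariski (rad R) \<and>
     rad R \<lhd> SL\<lparr>carrier := pat R\<rparr> \<and> (\<forall>u\<in>rad R. unipotent u)"
    using subgroup_rad[OF P] closedin_rad[of R] irr_connected[OF irr_rad[OF R]] rad_conj[OF P]
      rad_unipotent[OF R] rad_subset_pat[OF P]
    by (auto simp: closed_subgroup_def normal_SL_iff[OF subgroup_pat[OF P]] rad_def)
next
  fix U assume "closed_subgroup U \<and> connectedin zariski U \<and>
     U \<lhd> SL\<lparr>carrier := pat R\<rparr> \<and> (\<forall>u\<in>U. unipotent u)"
  then show "rad R \<ge> U" using normal_unipotent_rad[OF upper_relD(1)[OF R], of U] by blast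
qed

definition blk :: "('n \<Rightarrow> 'n \<Rightarrow> bool) \<Rightarrow> complex^'n^'n::finite \<Rightarrow> complex^'n^'n" where
  "blk R A = (\<chi> i j. if sim R i j then A $ i $ j else 0)"

text \<open>In a product entry inside a block every intermediate index is squeezed between two
  equivalent ones and therefore lies in the same block.\<close>

lemma blk_mult:
  assumes R: "preorder_rel R" and A: "A \<in> palg R" and B: "B \<in> palg R"
  shows "blk R (A ** B) = blk R A ** blk R B"
proof -
  have "(blk R (A ** B)) $ i $ j = (blk R A ** blk R B) $ i $ j" for i j
  proof (cases "sim R i j")
    case True
    have "A $ i $ k * B $ k $ j = blk R A $ i $ k * blk R B $ k $ j" for k
    proof (cases "A $ i $ k * B $ k $ j = 0")
      case False
      then have "R i k" "R k j" using palgD[OF A] palgD[OF B] by auto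
      then have "sim R i k" "sim R k j" using True preorder_trans[OF R] by blast+
      then show ?thesis by (simp add: blk_def)
    qed (auto simp: blk_def)
    then show ?thesis using True unfolding mult_entry by (simp add: blk_def mult_entry)
  next
    case False
    have "blk R A $ i $ k * blk R B $ k $ j = 0" for k
      using False preorder_trans[OF R] by (auto simp: blk_def)
    then have "(blk R A ** blk R B) $ i $ j = 0" unfolding mult_entry by (intro sum.neutral) blast
    moreover have "blk R (A ** B) $ i $ j = 0" using False by (auto simp: blk_def)
    ultimately show ?thesis by simp
  qed
  then show ?thesis by (simp add: vec_eq_iff)
qed

lemma blk_palg: "blk R A \<in> palg (sim R)"
  by (auto simp: blk_def palg_def)

lemma blk_id: "A \<in> palg (sim R) \<Longrightarrow> blk R A = A"
  by (auto simp: blk_def palg_def vec_eq_iff)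

lemma blk_one: "preorder_rel R \<Longrightarrow> blk R (mat 1) = mat 1"
  by (intro blk_id palg_one preorder_sim)

lemma blk_eq_one:
  assumes R: "preorder_rel R" and A: "A \<in> palg R"
  shows "blk R A = mat 1 \<longleftrightarrow> A - mat 1 \<in> palg (str R)"
proof
  assume *: "blk R A = mat 1"
  show "A - mat 1 \<in> palg (str R)"
  proof (rule palgI)
    fix i j assume nz: "(A - mat 1) $ i $ j \<noteq> 0"
    have "A - mat 1 \<in> palg R" using A palg_one[OF R] by (rule palg_diff)
    from palgD[OF this nz] have "R i j" .
    moreover have "\<not> sim R i j"
    proof
      assume "sim R i j"
      then have "blk R A $ i $ j = A $ i $ j" by (simp add: blk_def)
      then show False using nz * by simp
    qed
    ultimately show "str R i j" by blast
  qed
next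
  assume *: "A - mat 1 \<in> palg (str R)"
  have "blk R A $ i $ j = mat 1 $ i $ j" for i j
  proof (cases "sim R i j")
    case True
    then show ?thesis using palgD0[OF *, of i j] by (simp add: blk_def)
  next
    case False
    then show ?thesis using preorder_refl[OF R] by (auto simp: blk_def mat_def)
  qed
  then show "blk R A = mat 1" by (simp add: vec_eq_iff)
qed

text \<open>The quotient of the block part by \<open>A\<close> has trivial block part, hence is
  unitriangular.\<close>

lemma det_blk:
  fixes R :: "'n \<Rightarrow> 'n::{finite,wellorder} \<Rightarrow> bool"
  assumes R: "upper_rel R" and A: "A \<in> pat R"
  shows "det (blk R A) = 1"
proof -
  note P = upper_relD(1)[OF R]
  let ?r = "blk R A ** minv A"
  have A': "minv A \<in> pat R" by (rule pat_minv[OF P A])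
  have "blk R A \<in> palg R" using palg_mono[OF blk_palg, of R] by blast
  then have r: "?r \<in> palg R" using A' P by (auto simp: pat_def intro: palg_mult)
  have "blk R ?r = blk R (blk R A) ** blk R (minv A)"
    using P \<open>blk R A \<in> palg R\<close> A' by (auto simp: pat_def intro: blk_mult)
  also have "\<dots> = blk R A ** blk R (minv A)" by (simp add: blk_id[OF blk_palg])
  also have "\<dots> = blk R (A ** minv A)" using P A A' by (auto simp: pat_def intro: blk_mult[symmetric])
  finally have "blk R ?r = mat 1" using A P by (simp add: minv_r pat_def blk_one)
  then have "?r \<in> rad R" using blk_eq_one[OF P r] rad_upper[OF R] by blast
  then have "det ?r = 1" by (simp add: rad_def)
  then show ?thesis using patD(1)[OF A] by (simp add: det_mul minv_det)
qed

lemma blk_pat: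
  fixes R :: "'n \<Rightarrow> 'n::{finite,wellorder} \<Rightarrow> bool"
  assumes "upper_rel R" "A \<in> pat R" shows "blk R A \<in> pat (sim R)"
  using det_blk[OF assms] blk_palg by (auto simp: pat_def)

lemma pat_decompose:
  fixes R :: "'n \<Rightarrow> 'n::{finite,wellorder} \<Rightarrow> bool"
  assumes R: "upper_rel R" and A: "A \<in> pat R"
  shows "minv (blk R A) ** A \<in> rad R"
proof -
  note P = upper_relD(1)[OF R]
  have b: "blk R A \<in> pat (sim R)" by (rule blk_pat[OF R A])
  have b': "minv (blk R A) \<in> pat (sim R)" by (rule pat_minv[OF preorder_sim[OF P] b])
  then have b'': "minv (blk R A) \<in> palg R" "A \<in> palg R" using A by (auto simp: pat_def intro: palg_mono)
  have "blk R (minv (blk R A) ** A) = minv (blk R A) ** blk R A"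
    using blk_mult[OF P b''] blk_id[OF patD(2)[OF b']] by simp
  also have "\<dots> = mat 1" using b by (simp add: minv_l pat_def)
  finally show ?thesis using blk_eq_one[OF P palg_mult[OF P b'']] rad_upper[OF R] by blast
qed

text \<open>A generic central element of the block diagonal group: exponentials of a rank
  \<open>c\<close> that is constant on classes and strictly monotone between them, centred by the
  mean \<open>m\<close> so that the product is 1.\<close>

lemma separating_diagonal:
  fixes R :: "'n \<Rightarrow> 'n::{finite,wellorder} \<Rightarrow> bool"
  assumes R: "upper_rel R"
  obtains d :: "'n \<Rightarrow> complex" where "det (\<chi> i j. if i = j then d i else 0) = 1"
    "\<And>i j. d i = d j \<longleftrightarrow> sim R i j"
proof -
  note P = upper_relD(1)[OF R]
  define c where "c i = card {l. R l i}" for i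
  define m where "m = (\<Sum>i\<in>UNIV. real (c i)) / real CARD('n)"
  define d where "d i = complex_of_real (exp (real (c i) - m))" for i
  have c: "c i < c j" if "str R i j" for i j
    unfolding c_def using that preorder_trans[OF P, of _ i j] preorder_refl[OF P]
    by (intro psubset_card_mono) auto
  have "c i = c j" if "sim R i j" for i j
  proof -
    have "{l. R l i} = {l. R l j}" using that preorder_trans[OF P] by blast
    then show ?thesis by (simp add: c_def)
  qed
  moreover have "sim R i j" if "c i = c j" for i j
  proof -
    have "R i j \<or> R j i" using upper_relD(2)[OF R, of i j] upper_relD(2)[OF R, of j i] by (meson linear)
    moreover have "\<not> str R i j" "\<not> str R j i" using c[of i j] c[of j i] that by auto
    ultimately show ?thesis by blast
  qed
  moreover have "d i = d j \<longleftrightarrow> c i = c j" for i j by (simp add: d_def)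
  ultimately have "d i = d j \<longleftrightarrow> sim R i j" for i j by blast
  moreover have "det (\<chi> i j. if i = j then d i else 0) = 1"
  proof -
    have "det (\<chi> i j. if i = j then d i else 0) = (\<Prod>i\<in>UNIV. d i)"
      by (subst det_diagonal) auto
    also have "\<dots> = complex_of_real (exp (\<Sum>i\<in>UNIV. real (c i) - m))"
      unfolding d_def by (simp add: exp_sum)
    also have "(\<Sum>i\<in>UNIV. real (c i) - m) = 0" by (simp add: sum_subtractf m_def)
    finally show ?thesis by simp
  qed
  ultimately show ?thesis using that by blast
qed

text \<open>A Levi subgroup contains an element $z$ lying over a generic central element $z_0$ of the
  standard Levi subgroup. Conjugating $z$ to $z_0$ by the unipotent radical moves the Levi subgroup into
  the centralizer of $z_0$, which is the standard one.\<close>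

lemma levi_conjugate:
  fixes R :: "'n \<Rightarrow> 'n::{finite,wellorder} \<Rightarrow> bool"
  assumes R: "upper_rel R" and L: "levi_subgroup (pat R) L"
  obtains u where "u \<in> rad R" "L = (\<lambda>A. u ** A ** minv u) ` pat (sim R)"
proof -
  note P = upper_relD(1)[OF R]
  have L1: "subgroup L SL" "L \<subseteq> pat R" and L2: "L \<inter> rad R = {mat 1}"
    and LQ: "L <#>\<^bsub>SL\<^esub> rad R = pat R"
    using L unfolding levi_subgroup_def unipotent_radical_pat[OF R] closed_subgroup_def by auto
  have L3: "\<exists>l\<in>L. \<exists>r\<in>rad R. q = l ** r" if "q \<in> pat R" for q
  proof -
    have "q \<in> L <#>\<^bsub>SL\<^esub> rad R" using that LQ by simp
    then show ?thesis unfolding set_mult_def by auto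
  qed
  note Lg = subgroup_SLD[OF L1(1)] and Qg = subgroup_SLD[OF subgroup_pat[OF P]] and Rg = subgroup_SLD[OF subgroup_rad[OF P]]
  have LR: "A \<in> palg R" if "A \<in> L" for A using that L1(2) by (auto simp: pat_def)
  obtain d :: "'n \<Rightarrow> complex" where d: "det (\<chi> i j. if i = j then d i else 0) = 1"
    "\<And>i j. d i = d j \<longleftrightarrow> sim R i j" using separating_diagonal[OF R] by blast
  define z0 where "z0 = (\<chi> i j. if i = j then d i else 0)"
  have z0l: "(z0 ** A) $ i $ j = d i * A $ i $ j" for A i j
    unfolding mult_entry z0_def by (simp add: if_distrib[of "\<lambda>x. x * _"] cong: if_cong)
  have z0r: "(A ** z0) $ i $ j = A $ i $ j * d j" for A i j
    unfolding mult_entry z0_def by (simp add: if_distrib[of "\<lambda>x. _ * x"] cong: if_cong)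
  have z0R: "z0 \<in> pat (sim R)" using d(1) preorder_refl[OF P] by (auto simp: pat_def palg_def z0_def)
  then have z0Q: "z0 \<in> pat R" using pat_mono by blast
  have z0c: "z0 ** A = A ** z0" if "A \<in> palg (sim R)" for A
  proof -
    have "(z0 ** A) $ i $ j = (A ** z0) $ i $ j" for i j
      using palgD[OF that, of i j] d(2)[of i j] unfolding z0l z0r by (cases "A $ i $ j = 0") auto
    then show ?thesis by (simp add: vec_eq_iff)
  qed
  obtain z r where zr: "z \<in> L" "r \<in> rad R" "z0 = z ** r" using L3[OF z0Q] by blast
  have rR: "r \<in> palg R" using zr rad_subset_pat[OF P] by (auto simp: pat_def)
  have "blk R r = mat 1" using blk_eq_one[OF P rR] zr(2) by (simp add: rad_def)
  then have "blk R z0 = blk R z" using blk_mult[OF P LR[OF zr(1)] rR] zr(3) by simp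
  then have zb: "blk R z = z0" using blk_id[OF patD(2)[OF z0R]] by simp
  have z_entry: "z $ i $ j = z0 $ i $ j" if "sim R i j" for i j
    using that arg_cong[OF zb, of "\<lambda>A. A $ i $ j"] by (simp add: blk_def)
  have zz0: "z0 - z \<in> palg (str R)"
  proof (rule palgI)
    fix i j assume nz: "(z0 - z) $ i $ j \<noteq> 0"
    have "z0 - z \<in> palg R" using z0Q LR[OF zr(1)] by (auto simp: pat_def intro: palg_diff)
    from palgD[OF this nz] show "str R i j" using z_entry[of i j] nz by auto
  qed
  \<comment> \<open>With \<open>u = 1 + X\<close> this equation reads
    \<open>z u = u z0\<close>.\<close>
  have "\<exists>X\<in>palg (str R). z ** X - X ** z0 = z0 - z"
  proof (rule palg_solve[OF _ _ _ zz0])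
    show "linear (\<lambda>X. z ** X - X ** z0)"
      by (rule linearI) (simp_all add: matrix_add_ldistrib matrix_mul_add_left matrix_mul_scaleR scaleR_diff_right)
    show "z ** X - X ** z0 \<in> palg (str R)" if X: "X \<in> palg (str R)" for X
    proof (rule palg_diff)
      show "z ** X \<in> palg (str R)"
        by (rule palg_mult_gen[OF LR[OF zr(1)] X]) (auto intro: preorder_trans[OF P])
      show "X ** z0 \<in> palg (str R)"
        by (rule palg_mult_gen[OF X patD(2)[OF z0Q]]) (auto intro: preorder_trans[OF P])
    qed
    show "X = 0" if X: "X \<in> palg (str R)" and eq: "z ** X - X ** z0 = 0" for X
    proof (rule ccontr)
      assume "X \<noteq> 0"
      then obtain a j where "X $ a $ j \<noteq> 0" by (auto simp: vec_eq_iff)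
      define S where "S = {i. X $ i $ j \<noteq> 0}"
      have "S \<noteq> {}" "finite S" using \<open>X $ a $ j \<noteq> 0\<close> by (auto simp: S_def)
      \<comment> \<open>At the lowest nonzero position of column \<open>j\<close> the matrix
        \<open>z\<close> acts through its diagonal entry \<open>d i\<close> alone; comparison with
        \<open>d j\<close> puts \<open>i\<close> and \<open>j\<close> into one block, where
        \<open>X\<close> has no entries.\<close>
      define i where "i = Max S"
      have i: "X $ i $ j \<noteq> 0" "\<And>k. i < k \<Longrightarrow> X $ k $ j = 0"
        using Max_in[OF \<open>finite S\<close> \<open>S \<noteq> {}\<close>] Max_ge[OF \<open>finite S\<close>] unfolding i_def S_def by fastforce+
      have zk: "z $ i $ k * X $ k $ j = 0" if "k \<noteq> i" for k
      proof (rule ccontr)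
        assume nz: "\<not> ?thesis"
        then have "k < i" using i(2)[of k] that by (metis linorder_cases mult_zero_right)
        then have "R k i" using upper_relD(2)[OF R, of k i] by simp
        moreover have "R i k" using palgD[OF LR[OF zr(1)], of i k] nz by auto
        ultimately show False using z_entry[of i k] nz that by (simp add: z0_def)
      qed
      have "(z ** X) $ i $ j = (\<Sum>k\<in>{i}. z $ i $ k * X $ k $ j)"
        unfolding mult_entry using zk by (intro sum.mono_neutral_right) auto
      also have "\<dots> = d i * X $ i $ j" using z_entry[of i i] preorder_refl[OF P] by (simp add: z0_def)
      finally have "(z ** X) $ i $ j = d i * X $ i $ j" .
      moreover have "z ** X = X ** z0" using eq by simp
      ultimately have "d i * X $ i $ j = X $ i $ j * d j" by (simp only: z0r)
      then have "d i = d j" using i(1) by (simp add: mult.commute)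
      then have "sim R i j" using d(2) by blast
      then show False using palgD[OF X i(1)] by blast
    qed
  qed
  then obtain X where X: "X \<in> palg (str R)" "z ** X - X ** z0 = z0 - z" by blast
  define u where "u = mat 1 + X"
  have u: "u \<in> rad R" unfolding rad_upper[OF R] u_def using X(1) by simp
  have du: "det u = 1" using u by (simp add: rad_def)
  have uQ: "u \<in> pat R" using u rad_subset_pat[OF P] by blast
  have zu: "z ** u = u ** z0" unfolding u_def using X(2)
    by (simp add: matrix_add_ldistrib matrix_mul_add_left algebra_simps)
  have dz: "det z = 1" "det z0 = 1" using Lg(1) zr(1) z0Q by (auto simp: pat_def)
  \<comment> \<open>The commutator lies in \<open>L\<close>, and its block part is trivial because
    that of \<open>z\<close> is the central \<open>z0\<close>; so it lies in
    \<open>L \<inter> rad R\<close>.\<close>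
  have comm: "l ** z = z ** l" if l: "l \<in> L" for l
  proof -
    let ?c = "l ** z ** (minv l ** minv z)"
    have dl: "det l = 1" using Lg(1) l by blast
    have c: "?c \<in> L" by (intro Lg(3,4) l zr(1))
    have in_R: "l \<in> palg R" "z \<in> palg R" "minv l \<in> palg R" "minv z \<in> palg R" using LR l zr(1) Lg(4) by auto
    have "blk R ?c = (blk R l ** z0) ** (blk R (minv l) ** blk R (minv z))"
      unfolding blk_mult[OF P palg_mult[OF P in_R(1,2)] palg_mult[OF P in_R(3,4)]]
        blk_mult[OF P in_R(1,2)] blk_mult[OF P in_R(3,4)] zb ..
    also have "\<dots> = blk R l ** (z0 ** blk R (minv l)) ** blk R (minv z)"
      by (simp only: matrix_mul_assoc)
    also have "\<dots> = blk R l ** blk R (minv l) ** (z0 ** blk R (minv z))"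
      unfolding z0c[OF blk_palg[of R "minv l"]] by (simp only: matrix_mul_assoc)
    also have "blk R l ** blk R (minv l) = mat 1"
      using blk_mult[OF P in_R(1,3)] dl by (simp add: minv_r blk_one[OF P])
    also have "z0 ** blk R (minv z) = mat 1"
      using blk_mult[OF P in_R(2,4)] dz by (simp add: minv_r blk_one[OF P] zb)
    finally have "?c \<in> rad R" using blk_eq_one[OF P LR[OF c]] rad_upper[OF R] by simp
    then have "?c = mat 1" using c L2 by blast
    then have "?c ** z ** l = z ** l" by simp
    moreover have "?c ** z ** l = l ** z"
      using dl dz by (simp add: matrix_mul_assoc[symmetric] minv_l)
    ultimately show ?thesis by simp
  qed
  have sub: "minv u ** l ** u \<in> pat (sim R)" if l: "l \<in> L" for l
  proof -
    let ?m = "minv u ** l ** u"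
    have dl: "det l = 1" using Lg(1) l by blast
    have m: "?m \<in> pat R" by (intro Qg(3,4) uQ subsetD[OF L1(2) l])
    have "z0 = minv u ** (z ** u)" unfolding zu by (simp add: minv_l_cancel[OF du])
    then have "z0 ** ?m = minv u ** (z ** l) ** u" "?m ** z0 = minv u ** (l ** z) ** u"
      by (simp_all add: matrix_mul_assoc[symmetric] minv_r_cancel[OF du])
    then have "z0 ** ?m = ?m ** z0" using comm[OF l] by simp
    then have "d i * ?m $ i $ j = ?m $ i $ j * d j" for i j
      by (metis z0l z0r)
    then have "?m $ i $ j \<noteq> 0 \<Longrightarrow> d i = d j" for i j by (metis mult.commute mult_right_cancel)
    then have "?m \<in> palg (sim R)" using d(2) by (intro palgI) blast
    then show ?thesis using m by (simp add: pat_def)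
  qed
  have "L = (\<lambda>A. u ** A ** minv u) ` pat (sim R)"
  proof (intro subset_antisym subsetI)
    fix l assume l: "l \<in> L"
    have "l = u ** (minv u ** l ** u) ** minv u"
      using du by (simp add: matrix_mul_assoc[symmetric] minv_r minv_r_cancel)
    then show "l \<in> (\<lambda>A. u ** A ** minv u) ` pat (sim R)" using sub[OF l] by blast
  next
    fix b assume "b \<in> (\<lambda>A. u ** A ** minv u) ` pat (sim R)"
    then obtain a where a: "a \<in> pat (sim R)" "b = u ** a ** minv u" by blast
    have aQ: "a \<in> pat R" using a(1) pat_mono by blast
    \<comment> \<open>Conjugated back by \<open>u\<close>, both \<open>b\<close> and its factor
      \<open>l\<close> are block diagonal with the same block part, so the radical factor is
      trivial.\<close>
    obtain l r where lr: "l \<in> L" "r \<in> rad R" "b = l ** r" using L3[of b] Qg(3)[OF Qg(3)[OF uQ aQ] Qg(4)[OF uQ]] unfolding a(2) by blast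
    have r': "minv u ** r ** u \<in> rad R" by (intro Rg(3,4) lr(2) u)
    then have r'': "minv u ** r ** u \<in> palg R" using rad_subset_pat[OF P] by (auto simp: pat_def)
    have l': "minv u ** l ** u \<in> pat (sim R)" by (rule sub[OF lr(1)])
    then have l'': "minv u ** l ** u \<in> palg R" by (auto simp: pat_def intro: palg_mono)
    have "a = minv u ** b ** u" unfolding a(2)
      using du by (simp add: matrix_mul_assoc[symmetric] minv_l minv_l_cancel)
    also have "\<dots> = (minv u ** l ** u) ** (minv u ** r ** u)" unfolding lr(3)
      using du by (simp add: matrix_mul_assoc[symmetric] minv_r_cancel)
    finally have eq: "a = (minv u ** l ** u) ** (minv u ** r ** u)" .
    have "blk R a = blk R (minv u ** l ** u) ** blk R (minv u ** r ** u)"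
      unfolding eq by (rule blk_mult[OF P l'' r''])
    also have "blk R (minv u ** r ** u) = mat 1" using blk_eq_one[OF P r''] r' by (simp add: rad_def)
    finally have "a = minv u ** l ** u"
      using blk_id[OF patD(2)[OF a(1)]] blk_id[OF patD(2)[OF l']] by simp
    then have "b = l" unfolding a(2) using du by (simp add: matrix_mul_assoc[symmetric] minv_r minv_r_cancel)
    then show "b \<in> L" using lr(1) by simp
  qed
  then show ?thesis using that u by blast
qed

subsection \<open>Conjugation\<close>

lemma unipotent_conj:
  assumes "unipotent A" "det u = 1" shows "unipotent (minv u ** A ** u)"
proof -
  have e: "minv u ** A ** u - mat 1 = minv u ** (A - mat 1) ** u"
    using assms(2) by (simp add: matrix_mul_diff_left matrix_mul_diff_right minv_l)
  have "((\<lambda>M. (minv u ** A ** u - mat 1) ** M) ^^ k) (mat 1) = minv u ** ((\<lambda>M. (A - mat 1) ** M) ^^ k) (mat 1) ** u" for k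
  proof (induction k)
    case (Suc k)
    then show ?case unfolding e
      using assms(2) by (simp add: matrix_mul_assoc[symmetric] minv_r_cancel)
  qed (use assms(2) in \<open>simp add: minv_l\<close>)
  moreover obtain k where "((\<lambda>M. (A - mat 1) ** M) ^^ k) (mat 1) = 0"
    using assms(1) unfolding unipotent_def by blast
  ultimately have "((\<lambda>M. (minv u ** A ** u - mat 1) ** M) ^^ k) (mat 1) = 0" by simp
  then show ?thesis unfolding unipotent_def by blast
qed

text \<open>A normal unipotent subgroup, conjugated back to the block diagonal group, lies in
  \<open>rad (sim R)\<close>, which is trivial because the relation \<open>sim R\<close> is
  symmetric.\<close>

lemma connected_reductive_levi:
  fixes R :: "'n \<Rightarrow> 'n::{finite,wellorder} \<Rightarrow> bool"
  assumes R: "upper_rel R" and L: "levi_subgroup (pat R) L"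
  shows "connected_reductive L"
proof -
  note P = upper_relD(1)[OF R] and P' = preorder_sim[OF upper_relD(1)[OF R]]
  obtain u where u: "u \<in> rad R" "L = (\<lambda>A. u ** A ** minv u) ` pat (sim R)"
    using levi_conjugate[OF R L] by blast
  have du: "det u = 1" using u by (simp add: rad_def)
  have cl: "closed_subgroup L" using L by (simp add: levi_subgroup_def)
  then have Lg: "subgroup L SL" by (simp add: closed_subgroup_def)
  have Ldet: "det A = 1" if "A \<in> L" for A using subgroup_SLD(1)[OF Lg that] .
  have irr: "irr L" unfolding u(2) by (rule irr_translate[OF irr_pat[OF P']])
  then have co: "connectedin zariski L" using Ldet by (rule irr_connected)
  have Li: "minv u ** A ** u \<in> pat (sim R)" if "A \<in> L" for A
    using that du unfolding u(2) by (auto simp: matrix_mul_assoc[symmetric] minv_l minv_l_cancel)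
  have "unipotent_radical L = {mat 1}"
    unfolding unipotent_radical_def
  proof (rule Greatest_equality)
    let ?one = "{mat 1 :: complex^'n::{finite,wellorder}^'n::{finite,wellorder}}"
    have "subgroup {mat 1 :: complex^'n::{finite,wellorder}^'n::{finite,wellorder}} SL" using SL.triv_subgroup by simp
    moreover have "closedin zariski {mat 1 :: complex^'n::{finite,wellorder}^'n::{finite,wellorder}}"
    proof (rule closedin_zariskiI)
      fix A :: "complex^'n::{finite,wellorder}^'n::{finite,wellorder}" assume "A \<notin> {mat 1}"
      then obtain i j where ij: "A $ i $ j \<noteq> mat 1 $ i $ j" by (auto simp: vec_eq_iff)
      have "polynomial_fun (\<lambda>A. A $ i $ j - mat 1 $ i $ j)"
        by (intro polynomial_fun_diff polynomial_fun.entry polynomial_fun.const)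
      then show "\<exists>p. polynomial_fun p \<and> (\<forall>B\<in>{mat 1}. p B = 0) \<and> p A \<noteq> 0"
        using ij by (intro exI[of _ "\<lambda>A. A $ i $ j - mat 1 $ i $ j"]) simp
    qed simp
    moreover have "connectedin zariski ?one"
      by (rule irr_connected[OF irr_singleton]) simp
    moreover have "unipotent (mat 1 :: complex^'n::{finite,wellorder}^'n::{finite,wellorder})"
      unfolding unipotent_def by (rule exI[of _ 1]) simp
    ultimately show "closed_subgroup ?one \<and> connectedin zariski ?one \<and>
      ?one \<lhd> SL\<lparr>carrier := L\<rparr> \<and> (\<forall>u\<in>?one. unipotent u)"
      using subgroup_SLD(2)[OF Lg] Ldet by (auto simp: closed_subgroup_def normal_SL_iff[OF Lg] minv_r)
  next
    fix U assume U: "closed_subgroup U \<and> connectedin zariski U \<and> U \<lhd> SL\<lparr>carrier := L\<rparr> \<and> (\<forall>u\<in>U. unipotent u)"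
    then have U': "subgroup U SL" "U \<subseteq> L" "\<And>A B. A \<in> L \<Longrightarrow> B \<in> U \<Longrightarrow> A ** B ** minv A \<in> U"
      unfolding normal_SL_iff[OF Lg] by auto
    note Ug = subgroup_SLD[OF U'(1)]
    let ?V = "(\<lambda>A. minv u ** A ** u) ` U"
    have "subgroup ?V SL"
      unfolding subgroup_SL_iff
    proof (intro conjI ballI)
      show "det A = 1" if "A \<in> ?V" for A using that Ug(1) du by (auto simp: det_mul minv_det)
      show "mat 1 \<in> ?V" using Ug(2) du by (intro image_eqI[of _ _ "mat 1"]) (simp add: minv_l)
      show "A ** B \<in> ?V" if AB: "A \<in> ?V" "B \<in> ?V" for A B
      proof -
        obtain a b where "a \<in> U" "b \<in> U" "A = minv u ** a ** u" "B = minv u ** b ** u" using AB by blast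
        then show ?thesis using Ug(3)[of a b] du
          by (intro image_eqI[of _ _ "a ** b"]) (auto simp: matrix_mul_assoc[symmetric] minv_r_cancel)
      qed
      show "minv A \<in> ?V" if A: "A \<in> ?V" for A
      proof -
        obtain a where "a \<in> U" "A = minv u ** a ** u" using A by blast
        then show ?thesis using Ug(1,4)[of a] du
          by (intro image_eqI[of _ _ "minv a"]) (auto simp: minv_mult minv_det det_mul minv_minv matrix_mul_assoc[symmetric])
      qed
    qed
    moreover have "?V \<subseteq> pat (sim R)" using Li U'(2) by blast
    moreover have "A ** B ** minv A \<in> ?V" if A: "A \<in> pat (sim R)" and B: "B \<in> ?V" for A B
    proof -
      obtain b where b: "b \<in> U" "B = minv u ** b ** u" using B by blast
      have "det A = 1" using A by (simp add: pat_def)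
      have "u ** A ** minv u \<in> L" unfolding u(2) using A by blast
      from U'(3)[OF this b(1)] have "(u ** A ** minv u) ** b ** (u ** minv A ** minv u) \<in> U"
        using du \<open>det A = 1\<close> by (simp add: minv_mult det_mul minv_det minv_minv matrix_mul_assoc)
      moreover have "A ** B ** minv A = minv u ** ((u ** A ** minv u) ** b ** (u ** minv A ** minv u)) ** u"
        unfolding b(2) using du by (simp add: matrix_mul_assoc[symmetric] minv_l minv_l_cancel)
      ultimately show ?thesis by blast
    qed
    ultimately have "?V \<lhd> SL\<lparr>carrier := pat (sim R)\<rparr>"
      unfolding normal_SL_iff[OF subgroup_pat[OF P']] by blast
    moreover have "unipotent v" if "v \<in> ?V" for v using that U unipotent_conj[OF _ du] by blast
    ultimately have "?V \<subseteq> rad (sim R)" by (rule normal_unipotent_rad[OF P'])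
    moreover have "rad (sim R) = {mat 1}" by (auto simp: rad_def palg_def vec_eq_iff)
    ultimately have V: "minv u ** A ** u = mat 1" if "A \<in> U" for A using that by blast
    show "U \<subseteq> {mat 1}"
    proof
      fix A assume A: "A \<in> U"
      have "A = u ** (minv u ** A ** u) ** minv u"
        using du by (simp add: matrix_mul_assoc[symmetric] minv_r minv_r_cancel)
      then show "A \<in> {mat 1}" using V[OF A] du by (simp add: minv_r)
    qed
  qed
  then show ?thesis unfolding connected_reductive_def using cl co by simp
qed

section \<open>Bruhat decomposition and standard parabolic subgroups\<close>

definition monomial :: "complex^'n^'n::finite \<Rightarrow> ('n \<Rightarrow> 'n) \<Rightarrow> bool" where
  "monomial A \<sigma> \<longleftrightarrow> det A = 1 \<and> bij \<sigma> \<and> (\<forall>i j. A $ i $ j \<noteq> 0 \<longleftrightarrow> i = \<sigma> j)"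

lemma monomialD:
  "monomial A \<sigma> \<Longrightarrow> det A = 1" "monomial A \<sigma> \<Longrightarrow> bij \<sigma>" "monomial A \<sigma> \<Longrightarrow> A $ i $ j \<noteq> 0 \<longleftrightarrow> i = \<sigma> j"
  unfolding monomial_def by blast+

lemma det_zero_col:
  fixes A :: "complex^'n^'n::finite"
  assumes "\<And>i. A $ i $ c = 0" shows "det A = 0"
proof -
  have "column c A = 0" using assms by (simp add: column_def vec_eq_iff)
  then show ?thesis by (rule det_zero_column)
qed

text \<open>Gaussian elimination on the first untreated column \<open>c\<close>. The pivot is its
  lowest nonzero entry: \<open>b\<close> then clears only entries above it and \<open>b'\<close>
  only entries to its right, so both are upper triangular.\<close>

lemma bruhat_step:
  fixes M :: "complex^'n::{finite,wellorder}^'n::{finite,wellorder}"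
  assumes S: "\<And>j l. j \<in> S \<Longrightarrow> l \<le> j \<Longrightarrow> l \<in> S" and inj: "inj_on \<sigma> S"
    and col: "\<And>j i. j \<in> S \<Longrightarrow> M $ i $ j \<noteq> 0 \<longleftrightarrow> i = \<sigma> j"
    and row: "\<And>j l. j \<in> S \<Longrightarrow> l \<noteq> j \<Longrightarrow> M $ \<sigma> j $ l = 0"
    and c: "c \<notin> S" "\<And>l. l < c \<Longrightarrow> l \<in> S" and d: "det M = 1"
  shows "\<exists>b b' i. b \<in> pat (\<le>) \<and> b' \<in> pat (\<le>) \<and> i \<notin> \<sigma> ` S \<and>
    (\<forall>j\<in>S. \<forall>k. (b ** M ** b') $ k $ j \<noteq> 0 \<longleftrightarrow> k = \<sigma> j) \<and>
    (\<forall>j\<in>S. \<forall>l. l \<noteq> j \<longrightarrow> (b ** M ** b') $ \<sigma> j $ l = 0) \<and>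
    (\<forall>k. (b ** M ** b') $ k $ c \<noteq> 0 \<longleftrightarrow> k = i) \<and> (\<forall>l. l \<noteq> c \<longrightarrow> (b ** M ** b') $ i $ l = 0)"
proof -
  define T where "T = {i. M $ i $ c \<noteq> 0}"
  have "T \<noteq> {}" using det_zero_col[of M c] d unfolding T_def by auto
  define i where "i = Max T"
  have i: "M $ i $ c \<noteq> 0" "\<And>k. i < k \<Longrightarrow> M $ k $ c = 0"
    using Max_in[OF _ \<open>T \<noteq> {}\<close>] Max_ge[of T] unfolding i_def T_def by fastforce+
  have iS: "i \<noteq> \<sigma> j" if "j \<in> S" for j using row[OF that, of c] i(1) c(1) that by metis
  have Mil: "M $ i $ l = 0" if "l \<in> S" for l using col[OF that, of i] iS[OF that] by blast
  have S_less: "l < c" if "l \<in> S" for l using S[OF that, of c] c(1) by force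
  define b where "b = (\<chi> a k. (if a = k then 1 else 0) + (if k = i then (if a < i then - M $ a $ c / M $ i $ c else 0) else 0))"
  define M1 where "M1 = b ** M"
  have M1: "M1 $ a $ l = M $ a $ l + (if a < i then - M $ a $ c / M $ i $ c * M $ i $ l else 0)" for a l
    unfolding M1_def mult_entry b_def
    by (simp add: distrib_right sum.distrib if_distrib[of "\<lambda>x. x * _"] cong: if_cong)
  define b' where "b' = (\<chi> k l. (if k = l then 1 else 0) + (if k = c then (if c < l then - M1 $ i $ l / M1 $ i $ c else 0) else 0))"
  define M2 where "M2 = M1 ** b'"
  have M2: "M2 $ a $ l = M1 $ a $ l + (if c < l then M1 $ a $ c * (- M1 $ i $ l / M1 $ i $ c) else 0)" for a l
    unfolding M2_def mult_entry b'_def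
    by (simp add: distrib_left sum.distrib if_distrib[of "\<lambda>x. _ * x"] cong: if_cong)
  have b: "b \<in> pat (\<le>)"
    unfolding pat_def by (auto simp: palg_def b_def mat_def intro!: det_unitriangular[of b, unfolded b_def])
  have b': "b' \<in> pat (\<le>)"
    unfolding pat_def by (auto simp: palg_def b'_def mat_def intro!: det_unitriangular[of b', unfolded b'_def])
  have "M1 $ a $ l = M $ a $ l" if "l \<in> S" for a l using Mil[OF that] by (simp add: M1)
  then have 1: "M2 $ a $ l = M $ a $ l" if "l \<in> S" for a l using S_less[OF that] that by (simp add: M2)
  have M1c: "M1 $ a $ c = (if a = i then M $ i $ c else 0)" for a
  proof (cases a i rule: linorder_cases)
    case greater
    then show ?thesis using i(2)[of a] by (simp add: M1)
  qed (use i(1) in \<open>simp_all add: M1\<close>)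
  then have 2: "M2 $ a $ c = (if a = i then M $ i $ c else 0)" for a by (simp add: M2)
  have "M1 $ \<sigma> j $ l = M $ \<sigma> j $ l" if "j \<in> S" for j l
    using row[OF that, of c] c(1) that by (auto simp: M1)
  then have 3: "M2 $ \<sigma> j $ l = M $ \<sigma> j $ l" if "j \<in> S" for j l
    using row[OF that, of c] c(1) that by (auto simp: M2)
  have 4: "M2 $ i $ l = 0" if "l \<noteq> c" for l
  proof (cases "l < c")
    case True
    then show ?thesis using c(2)[OF True] 1 Mil by simp
  next
    case False
    then have "c < l" using that by simp
    then show ?thesis using M1c[of i] i(1) by (simp add: M2)
  qed
  have e: "b ** M ** b' = M2" by (simp add: M2_def M1_def)
  show ?thesis
    by (rule exI[of _ b], rule exI[of _ b'], rule exI[of _ i]) (use b b' iS 1 2 3 4 col row i(1) in \<open>auto simp: e\<close>)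
qed

theorem bruhat:
  fixes A :: "complex^'n::{finite,wellorder}^'n::{finite,wellorder}"
  assumes A: "det A = 1"
  obtains b n b' \<sigma> where "b \<in> pat (\<le>)" "b' \<in> pat (\<le>)" "monomial n \<sigma>" "A = b ** n ** b'"
proof -
  note Bg = subgroup_SLD[OF subgroup_pat[OF preorder_le]]
  let ?P = "\<lambda>S. \<exists>b b' \<sigma>. b \<in> pat (\<le>) \<and> b' \<in> pat (\<le>) \<and> inj_on \<sigma> S \<and>
      (\<forall>j\<in>S. \<forall>k. (b ** A ** b') $ k $ j \<noteq> 0 \<longleftrightarrow> k = \<sigma> j) \<and>
      (\<forall>j\<in>S. \<forall>l. l \<noteq> j \<longrightarrow> (b ** A ** b') $ \<sigma> j $ l = 0)"
  have "k \<le> CARD('n) \<Longrightarrow> \<exists>S. card S = k \<and> (\<forall>j\<in>S. \<forall>l\<le>j. l \<in> S) \<and> ?P S" for k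
  proof (induction k)
    case 0
    show ?case
      by (rule exI[of _ "{}"]) (auto intro: Bg(2))
  next
    case (Suc k)
    then obtain S b b' \<sigma> where S: "card S = k" "\<And>j l. j \<in> S \<Longrightarrow> l \<le> j \<Longrightarrow> l \<in> S" "b \<in> pat (\<le>)" "b' \<in> pat (\<le>)" "inj_on \<sigma> S"
      "\<And>j k. j \<in> S \<Longrightarrow> (b ** A ** b') $ k $ j \<noteq> 0 \<longleftrightarrow> k = \<sigma> j"
      "\<And>j l. j \<in> S \<Longrightarrow> l \<noteq> j \<Longrightarrow> (b ** A ** b') $ \<sigma> j $ l = 0" by auto
    have "S \<noteq> UNIV" using S(1) Suc.prems by auto
    then obtain x where "x \<notin> S" by auto
    define c where "c = (LEAST x. x \<notin> S)"
    have c: "c \<notin> S" "\<And>l. l < c \<Longrightarrow> l \<in> S"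
      unfolding c_def using \<open>x \<notin> S\<close> by (rule LeastI) (use not_less_Least in blast)
    let ?M = "b ** A ** b'"
    have dM: "det ?M = 1" using S(3,4) A by (simp add: det_mul pat_def)
    have "\<exists>b1 b1' i. b1 \<in> pat (\<le>) \<and> b1' \<in> pat (\<le>) \<and> i \<notin> \<sigma> ` S \<and>
        (\<forall>j\<in>S. \<forall>k. (b1 ** ?M ** b1') $ k $ j \<noteq> 0 \<longleftrightarrow> k = \<sigma> j) \<and>
        (\<forall>j\<in>S. \<forall>l. l \<noteq> j \<longrightarrow> (b1 ** ?M ** b1') $ \<sigma> j $ l = 0) \<and>
        (\<forall>k. (b1 ** ?M ** b1') $ k $ c \<noteq> 0 \<longleftrightarrow> k = i) \<and> (\<forall>l. l \<noteq> c \<longrightarrow> (b1 ** ?M ** b1') $ i $ l = 0)"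
      by (rule bruhat_step; fact S c dM)
    then obtain b1 b1' i where st: "b1 \<in> pat (\<le>)" "b1' \<in> pat (\<le>)" "i \<notin> \<sigma> ` S"
      "\<forall>j\<in>S. \<forall>k. (b1 ** ?M ** b1') $ k $ j \<noteq> 0 \<longleftrightarrow> k = \<sigma> j"
      "\<forall>j\<in>S. \<forall>l. l \<noteq> j \<longrightarrow> (b1 ** ?M ** b1') $ \<sigma> j $ l = 0"
      "\<forall>k. (b1 ** ?M ** b1') $ k $ c \<noteq> 0 \<longleftrightarrow> k = i" "\<forall>l. l \<noteq> c \<longrightarrow> (b1 ** ?M ** b1') $ i $ l = 0"
      by - (elim exE conjE; rule that; assumption)
    have e: "b1 ** ?M ** b1' = (b1 ** b) ** A ** (b' ** b1')" by (simp add: matrix_mul_assoc)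
    let ?\<sigma> = "\<sigma>(c := i)"
    have s: "?\<sigma> j = \<sigma> j" if "j \<in> S" for j using c(1) that by auto
    have "inj_on ?\<sigma> (insert c S)"
      using S(5) st(3) c(1) by (auto simp: inj_on_def image_iff)
    moreover have "card (insert c S) = Suc k" using c(1) S(1) by simp
    moreover have "\<forall>j\<in>insert c S. \<forall>l\<le>j. l \<in> insert c S" using S(2) c(2) by (auto simp: le_less)
    moreover have "\<forall>j\<in>insert c S. \<forall>k. ((b1 ** b) ** A ** (b' ** b1')) $ k $ j \<noteq> 0 \<longleftrightarrow> k = ?\<sigma> j"
      using st(4,6) s unfolding e by auto
    moreover have "\<forall>j\<in>insert c S. \<forall>l. l \<noteq> j \<longrightarrow> ((b1 ** b) ** A ** (b' ** b1')) $ ?\<sigma> j $ l = 0"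
      using st(5,7) s unfolding e by auto
    ultimately show ?case using Bg(3)[OF st(1) S(3)] Bg(3)[OF S(4) st(2)] by blast
  qed
  from this[of "CARD('n)"] obtain S where S: "card S = CARD('n)" "?P S" by auto
  have "S = UNIV" using S(1) card_seteq[of UNIV S] by simp
  with S(2) obtain b b' \<sigma> where b: "b \<in> pat (\<le>)" "b' \<in> pat (\<le>)" "inj \<sigma>"
    "\<And>j k. (b ** A ** b') $ k $ j \<noteq> 0 \<longleftrightarrow> k = \<sigma> j" by auto
  have db: "det b = 1" "det b' = 1" using b by (auto simp: pat_def)
  have "monomial (b ** A ** b') \<sigma>"
    unfolding monomial_def using b db A finite_UNIV_inj_surj[OF _ b(3)] by (auto simp: bij_def det_mul)
  moreover have "A = minv b ** (b ** A ** b') ** minv b'"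
    using db by (simp add: matrix_mul_assoc[symmetric] minv_l_cancel minv_r)
  ultimately show ?thesis using that[of "minv b" "minv b'"] Bg(4)[OF b(1)] Bg(4)[OF b(2)] by blast
qed

lemma monomial_elem:
  assumes n: "monomial n \<sigma>" and ab: "a \<noteq> b"
  shows "n ** elem a b t ** minv n = elem (\<sigma> a) (\<sigma> b) (n $ \<sigma> a $ a * t / n $ \<sigma> b $ b)"
proof -
  note m = monomialD[OF n]
  have nz: "n $ \<sigma> b $ b \<noteq> 0" using m(3) by blast
  have "(n ** elem a b t) $ x $ y = (elem (\<sigma> a) (\<sigma> b) (n $ \<sigma> a $ a * t / n $ \<sigma> b $ b) ** n) $ x $ y" for x y
  proof -
    have "(if y = b then t * n $ x $ a else 0) = (if x = \<sigma> a then n $ \<sigma> a $ a * t / n $ \<sigma> b $ b * n $ \<sigma> b $ y else 0)"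
    proof (cases "x = \<sigma> a")
      case True
      then show ?thesis using nz m(3)[of "\<sigma> b" y] m(2) by (auto dest: bij_is_inj injD)
    next
      case False
      then show ?thesis using m(3)[of x a] by simp
    qed
    then show ?thesis unfolding elem_mult_left elem_mult_right by simp
  qed
  then have "n ** elem a b t = elem (\<sigma> a) (\<sigma> b) (n $ \<sigma> a $ a * t / n $ \<sigma> b $ b) ** n" by (simp add: vec_eq_iff)
  then show ?thesis using m(1) by (simp add: matrix_mul_assoc[symmetric] minv_r)
qed

lemma elem_commutator:
  assumes "i \<noteq> j" "j \<noteq> k" "i \<noteq> k"
  shows "elem i j t ** elem j k 1 ** elem i j (- t) ** elem j k (- 1) = elem i k t"
  using assms by (simp add: vec_eq_iff elem_mult_right) (auto simp: elem_entry)

lemma elem_swap: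
  assumes "a \<noteq> b"
  shows "(elem a b 1 ** (elem b a (-1) ** (elem a b 1 ** A))) $ x $ y =
    (if x = a then A $ b $ y else if x = b then - A $ a $ y else A $ x $ y)"
  using assms by (simp add: elem_mult_left)

text \<open>\<open>R\<close> records the elementary matrices contained in \<open>H\<close>, and the
  commutator relation makes it transitive. Through the Bruhat decomposition both inclusions become
  statements about monomial matrices.\<close>

theorem subgroup_containing_upper:
  fixes H :: "(complex^'n::{finite,wellorder}^'n::{finite,wellorder}) set"
  assumes H: "subgroup H SL" and B: "pat (\<le>) \<subseteq> H"
  obtains R where "upper_rel R" "H = pat R" "\<And>i j. i \<noteq> j \<Longrightarrow> R i j \<longleftrightarrow> (\<forall>t. elem i j t \<in> H)"
proof -
  note Hg = subgroup_SLD[OF H]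
  define R where "R i j \<longleftrightarrow> i = j \<or> (\<forall>t. elem i j t \<in> H)" for i j
  have R_le: "R i j" if "i \<le> j" for i j
    using elem_pat[OF preorder_le, of i j] that B unfolding R_def by blast
  have R_trans: "R i k" if "R i j" "R j k" for i j k
  proof (cases "i = j \<or> j = k \<or> i = k")
    case False
    then have el: "elem i j t \<in> H" "elem j k t \<in> H" for t using that by (auto simp: R_def)
    have "elem i k t \<in> H" for t
      using Hg(3)[OF Hg(3)[OF Hg(3)[OF el(1) el(2)] el(1)] el(2), of t 1 "-t" "-1"] False
      by (simp add: elem_commutator)
    then show ?thesis by (simp add: R_def)
  qed (use that in \<open>auto simp: R_def\<close>)
  have P: "preorder_rel R" unfolding preorder_rel_def using R_trans by (auto simp: R_def)
  have U: "upper_rel R" unfolding upper_rel_def using P R_le by blast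
  have BR: "pat (\<le>) \<subseteq> pat R" using pat_mono R_le by blast
  note Rg = subgroup_SLD[OF subgroup_pat[OF P]]
  have conj: "R (\<sigma> a) (\<sigma> b)" if n: "n \<in> H" "monomial n \<sigma>" and ab: "a \<noteq> b" "R a b" for n \<sigma> a b
  proof -
    note m = monomialD[OF n(2)]
    have nz: "n $ \<sigma> a $ a \<noteq> 0" "n $ \<sigma> b $ b \<noteq> 0" using m(3) by blast+
    have "elem (\<sigma> a) (\<sigma> b) t \<in> H" for t
    proof -
      have "elem a b (t * n $ \<sigma> b $ b / n $ \<sigma> a $ a) \<in> H" using ab by (auto simp: R_def)
      then have "n ** elem a b (t * n $ \<sigma> b $ b / n $ \<sigma> a $ a) ** minv n \<in> H"
        by (intro Hg(3,4) n(1))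
      then show ?thesis using nz by (simp add: monomial_elem[OF n(2) ab(1)])
    qed
    then show ?thesis by (simp add: R_def)
  qed
  have sub: "A \<in> pat R" if A: "A \<in> H" for A
  proof -
    have dA: "det A = 1" using Hg(1)[OF A] .
    obtain b n b' \<sigma> where br: "b \<in> pat (\<le>)" "b' \<in> pat (\<le>)" "monomial n \<sigma>" "A = b ** n ** b'"
      by (rule bruhat[OF dA])
    have db: "det b = 1" "det b' = 1" using br by (auto simp: pat_def)
    have "n = minv b ** A ** minv b'" unfolding br(4)
      using db by (simp add: matrix_mul_assoc[symmetric] minv_l_cancel minv_r)
    moreover have "minv b \<in> H" "minv b' \<in> H" using br(1,2) B Hg(4) by blast+
    ultimately have nH: "n \<in> H" using A Hg(3) by simp
    note m = monomialD[OF br(3)]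
    have "A \<in> palg R"
    proof (rule palgI)
      fix i j assume "A $ i $ j \<noteq> 0"
      then obtain k where k: "(b ** n) $ i $ k \<noteq> 0" "b' $ k $ j \<noteq> 0" unfolding br(4) by (rule mult_entry_nonzero)
      then obtain l where l: "b $ i $ l \<noteq> 0" "n $ l $ k \<noteq> 0" using mult_entry_nonzero by blast
      have le: "i \<le> l" "k \<le> j" "l = \<sigma> k"
        using br(1,2) l k m(3) palgD[of b "(\<le>)"] palgD[of b' "(\<le>)"] by (auto simp: pat_def)
      show "R i j"
      proof (rule ccontr)
        assume nR: "\<not> R i j"
        \<comment> \<open>The initial segment \<open>D\<close> contains \<open>k\<close> but not
          \<open>\<sigma> k\<close>, so by counting some \<open>a\<close> beyond it is mapped into
          it. Conjugating the upper elementary matrices at \<open>(k, a)\<close> by \<open>n\<close>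
          then relates \<open>\<sigma> k\<close> to an element of \<open>D\<close>.\<close>
        define D where "D = {x. R x j}"
        have down: "x \<in> D" if "y \<in> D" "x \<le> y" for x y
          using that R_trans[OF R_le[OF that(2)]] by (auto simp: D_def)
        have "k \<in> D" using le(2) R_le by (simp add: D_def)
        have "\<sigma> k \<notin> D" using down[of "\<sigma> k" i] le nR by (auto simp: D_def)
        have "\<exists>a. a \<notin> D \<and> \<sigma> a \<in> D"
        proof (rule ccontr)
          assume "\<not> ?thesis"
          then have "\<sigma> ` (- D) \<subseteq> - D" by auto
          moreover have "inj_on \<sigma> (- D)" using m(2) by (meson bij_is_inj inj_on_subset subset_UNIV)
          ultimately have "\<sigma> ` (- D) = - D" by (intro endo_inj_surj) auto
          then have "\<sigma> k \<in> \<sigma> ` (- D)" using \<open>\<sigma> k \<notin> D\<close> by auto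
          then show False using \<open>k \<in> D\<close> m(2) by (auto dest: bij_is_inj injD)
        qed
        then obtain a where a: "a \<notin> D" "\<sigma> a \<in> D" by blast
        have "k < a" using down[OF \<open>k \<in> D\<close>, of a] a(1) by force
        then have "R (\<sigma> k) (\<sigma> a)" using conj[OF nH br(3), of k a] R_le[of k a] by auto
        then have "\<sigma> k \<in> D" using a(2) R_trans by (auto simp: D_def)
        then show False using \<open>\<sigma> k \<notin> D\<close> by simp
      qed
    qed
    then show ?thesis using dA by (simp add: pat_def)
  qed
  \<comment> \<open>Induction on the number of moved points: a lift \<open>?s\<close> of the
    transposition of \<open>a\<close> and \<open>\<sigma> a\<close>, composed of elementary matrices
    in \<open>H\<close>, makes \<open>a\<close> a fixed point.\<close>
  have mono: "n \<in> H" if "monomial n \<sigma>" "n \<in> pat R" for n \<sigma>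
    using that
  proof (induction "card {j. \<sigma> j \<noteq> j}" arbitrary: n \<sigma> rule: less_induct)
    case less
    note m = monomialD[OF less.prems(1)]
    have \<sigma>R: "R (\<sigma> x) x" for x using less.prems(2) m(3)[of "\<sigma> x" x] palgD[of n R] by (auto simp: pat_def)
    show ?case
    proof (cases "\<exists>j. \<sigma> j \<noteq> j")
      case False
      have "n $ i $ j = 0" if "\<not> i \<le> j" for i j using m(3)[of i j] False that by auto
      then have "n \<in> pat (\<le>)" using m(1) by (auto simp: pat_def palg_def)
      then show ?thesis using B by blast
    next
      case True
      then obtain a where a: "\<sigma> a \<noteq> a" by blast
      let ?b = "\<sigma> a"
      define D where "D = {x. R x ?b}"
      \<comment> \<open>\<open>\<sigma>\<close> maps the finite set \<open>D\<close> into, hence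
        onto itself. This supplies the reverse relation \<open>R a (\<sigma> a)\<close>, so the
        elementary matrices on both sides are available.\<close>
      have "\<sigma> ` D \<subseteq> D" using \<sigma>R R_trans by (auto simp: D_def)
      moreover have "inj_on \<sigma> D" using m(2) by (meson bij_is_inj inj_on_subset subset_UNIV)
      ultimately have "\<sigma> ` D = D" by (intro endo_inj_surj) auto
      moreover have "?b \<in> D" by (simp add: D_def R_def)
      ultimately have "a \<in> D" using m(2) by (metis bij_is_inj imageE injD)
      then have "R a ?b" by (simp add: D_def)
      then have el: "elem a ?b t \<in> H" "elem ?b a t \<in> H" for t using a \<sigma>R[of a] by (auto simp: R_def)
      have elR: "elem a ?b t \<in> pat R" "elem ?b a t \<in> pat R" for t
        using elem_pat[OF P] \<open>R a ?b\<close> \<sigma>R[of a] a by metis+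
      let ?s = "elem a ?b 1 ** elem ?b a (-1) ** elem a ?b 1"
      have sH: "?s \<in> H" "?s \<in> pat R" by (intro Hg(3) el, intro Rg(3) elR)
      have ent: "(?s ** n) $ x $ y = (if x = a then n $ ?b $ y else if x = ?b then - n $ a $ y else n $ x $ y)" for x y
        using elem_swap[of a ?b n x y] a by (simp add: matrix_mul_assoc)
      let ?\<tau> = "\<lambda>x. if \<sigma> x = a then ?b else if \<sigma> x = ?b then a else \<sigma> x"
      have tau: "?\<tau> = Transposition.transpose a ?b \<circ> \<sigma>" by (auto simp: Transposition.transpose_def)
      have inj: "\<sigma> x = \<sigma> y \<Longrightarrow> x = y" for x y using m(2) by (meson bij_is_inj injD)
      have mono': "monomial (?s ** n) ?\<tau>"
        unfolding monomial_def
      proof (intro conjI allI)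
        show "det (?s ** n) = 1" using Hg(1)[OF sH(1)] m(1) by (simp add: det_mul)
        show "bij ?\<tau>" unfolding tau using m(2) by (intro bij_comp bij_transpose)
        show "(?s ** n) $ x $ y \<noteq> 0 \<longleftrightarrow> x = ?\<tau> y" for x y
        proof -
          have m3: "n $ i $ j = 0 \<longleftrightarrow> i \<noteq> \<sigma> j" for i j using m(3)[of i j] by blast
          show ?thesis unfolding ent using a by (simp add: m3)
        qed
      qed
      have inR: "?s ** n \<in> pat R" using Rg(3)[OF sH(2) less.prems(2)] .
      have card': "card {j. ?\<tau> j \<noteq> j} < card {j. \<sigma> j \<noteq> j}"
      proof (rule psubset_card_mono)
        have "?\<tau> a = a" using a by simp
        moreover have "?\<tau> x = x" if "\<sigma> x = x" for x
        proof -
          have "x \<noteq> a" "x \<noteq> ?b" using a that inj[of x a] by auto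
          then show ?thesis using that by simp
        qed
        ultimately show "{j. ?\<tau> j \<noteq> j} \<subset> {j. \<sigma> j \<noteq> j}" using a by blast
      qed simp
      have "?s ** n \<in> H" by (rule less.hyps[of ?\<tau> "?s ** n"]; fact card' mono' inR)
      then have "minv ?s ** (?s ** n) \<in> H" by (rule Hg(3)[OF Hg(4)[OF sH(1)]])
      then show ?thesis using minv_l_cancel[OF Hg(1)[OF sH(1)], of n] by simp
    qed
  qed
  have "A \<in> H" if A: "A \<in> pat R" for A
  proof -
    obtain b n b' \<sigma> where br: "b \<in> pat (\<le>)" "b' \<in> pat (\<le>)" "monomial n \<sigma>" "A = b ** n ** b'"
      by (rule bruhat[OF patD(1)[OF A]])
    have db: "det b = 1" "det b' = 1" using br by (auto simp: pat_def)
    have "n = minv b ** A ** minv b'" unfolding br(4)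
      using db by (simp add: matrix_mul_assoc[symmetric] minv_l_cancel minv_r)
    moreover have "minv b \<in> pat R" "minv b' \<in> pat R" using br(1,2) BR Rg(4) by blast+
    ultimately have "n \<in> pat R" using A Rg(3) by simp
    then have "n \<in> H" using mono br(3) by blast
    then show ?thesis unfolding br(4) using br(1,2) B by (intro Hg(3)) auto
  qed
  with sub have "H = pat R" by blast
  then show ?thesis using that[of R] U unfolding R_def by blast
qed

section \<open>Borel subgroups of Levi subgroups\<close>

lemma solvable_SL_subgroup:
  assumes H: "subgroup H SL"
  shows "solvable (SL\<lparr>carrier := H\<rparr>) \<longleftrightarrow> solvable_seq SL H"
proof -
  interpret H: Group.group "SL\<lparr>carrier := H\<rparr>" using H by (rule subgroup.subgroup_is_group) (rule group_SL)
  interpret i: group_hom "SL\<lparr>carrier := H\<rparr>" SL "\<lambda>x. x"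
    using H by unfold_locales (auto simp: hom_def subgroup_SL_iff)
  have HH: "subgroup H (SL\<lparr>carrier := H\<rparr>)" using H.subgroup_self by simp
  show ?thesis
    unfolding solvable_def
    using i.solvable_img_imp_solvable[OF HH] i.solvable_imp_solvable_img[of H] by auto
qed

lemma solvable_conj:
  assumes u: "det u = 1" and H: "solvable_seq SL H"
  shows "solvable_seq SL ((\<lambda>A. u ** A ** minv u) ` H)"
proof -
  interpret c: group_hom SL SL "\<lambda>A. u ** A ** minv u"
    by unfold_locales (use u in \<open>auto simp: hom_def det_mul minv_det matrix_mul_assoc[symmetric] minv_l_cancel\<close>)
  show ?thesis using c.solvable_imp_solvable_img[OF H] .
qed

text \<open>The closure conditions make \<open>palg S\<close> a two-sided ideal of
  \<open>palg R\<close>, and the subgroup is the congruence subgroup of that ideal.\<close>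

lemma subgroup_ideal:
  assumes R: "preorder_rel R" and SR: "\<And>i j. S i j \<Longrightarrow> R i j"
    and SI: "\<And>i j k. R i j \<Longrightarrow> S j k \<Longrightarrow> S i k" "\<And>i j k. S i j \<Longrightarrow> R j k \<Longrightarrow> S i k"
  shows "subgroup {A \<in> pat R. A - mat 1 \<in> palg S} SL"
  unfolding subgroup_SL_iff
proof (intro conjI ballI)
  note Rg = subgroup_SLD[OF subgroup_pat[OF R]]
  show "det A = 1" if "A \<in> {A \<in> pat R. A - mat 1 \<in> palg S}" for A using that by (simp add: pat_def)
  show "mat 1 \<in> {A \<in> pat R. A - mat 1 \<in> palg S}" using Rg(2) by (simp add: palg_def)
  show "A ** B \<in> {A \<in> pat R. A - mat 1 \<in> palg S}"
    if AB: "A \<in> {A \<in> pat R. A - mat 1 \<in> palg S}" "B \<in> {A \<in> pat R. A - mat 1 \<in> palg S}" for A B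
  proof -
    have "(A - mat 1) ** B \<in> palg S"
      using AB by (intro palg_mult_gen[of _ S _ R]) (auto simp: pat_def intro: SI)
    then have "(A - mat 1) ** B + (B - mat 1) \<in> palg S" using AB by (intro palg_add) auto
    then show ?thesis using AB Rg(3) by (simp add: matrix_mul_diff_left)
  qed
  show "minv A \<in> {A \<in> pat R. A - mat 1 \<in> palg S}" if A: "A \<in> {A \<in> pat R. A - mat 1 \<in> palg S}" for A
  proof -
    have "(A - mat 1) ** minv A \<in> palg S"
      using A Rg(4)[of A] by (intro palg_mult_gen[of _ S _ R]) (auto simp: pat_def intro: SI)
    then have "0 - (A - mat 1) ** minv A \<in> palg S" by (intro palg_diff) (auto simp: palg_def)
    then show ?thesis using A Rg(4)[of A] by (simp add: matrix_mul_diff_left minv_r pat_def)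
  qed
qed

lemma commutator_entry:
  assumes "det A = 1" "det B = 1"
  shows "A ** B ** minv A ** minv B - mat 1 = ((A - mat 1) ** (B - mat 1) - (B - mat 1) ** (A - mat 1)) ** (minv A ** minv B)"
proof -
  have "(A - mat 1) ** (B - mat 1) - (B - mat 1) ** (A - mat 1) = A ** B - B ** A"
    by (simp add: matrix_mul_diff_left matrix_mul_diff_right)
  then show ?thesis
    using assms by (simp add: matrix_mul_diff_left matrix_mul_assoc[symmetric] minv_r minv_r_cancel)
qed

lemma solvable_upper:
  fixes H :: "(complex^'n::{finite,wellorder}^'n::{finite,wellorder}) set"
  assumes H: "subgroup H SL" "H \<subseteq> pat (\<le>)"
  shows "solvable_seq SL H"
proof -
  note Bg = subgroup_SLD[OF subgroup_pat[OF preorder_le]]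
  define r where "r i = card {l. l < i}" for i :: 'n
  have r_mono: "r i \<le> r j" if "i \<le> j" for i j
    unfolding r_def by (rule card_mono) (use that in auto)
  have r_less: "r i < r j" if "i < j" for i j
    unfolding r_def by (rule psubset_card_mono) (use that in auto)
  have r_less_iff: "r i < r j \<longleftrightarrow> i < j" for i j using r_mono[of j i] r_less[of i j] by force
  \<comment> \<open>Off-diagonal entries must be at least \<open>k + 1\<close> steps away from the
    diagonal: \<open>F 0\<close> is the unitriangular group and \<open>F CARD('n)\<close> is
    trivial. Every derived subgroup gains at least one step.\<close>
  define F where "F k = {A \<in> pat (\<le>). A - mat 1 \<in> palg (\<lambda>i j. r i + Suc k \<le> r j)}" for k
  have F: "subgroup (F k) SL" for k
    unfolding F_def
  proof (rule subgroup_ideal[OF preorder_le])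
    show "i \<le> j" if "r i + Suc k \<le> r j" for i j using that r_less_iff[of i j] by auto
  qed (use r_mono le_trans add_le_mono1 in \<open>fastforce+\<close>)
  have comm: "derived SL K \<subseteq> F k" if "\<And>A B. A \<in> K \<Longrightarrow> B \<in> K \<Longrightarrow> A ** B ** minv A ** minv B \<in> F k"
     "\<And>A. A \<in> K \<Longrightarrow> det A = 1" for k K
    unfolding derived_def by (rule SL.generate_subgroup_incl[OF _ F]) (use that in auto)
  have "(derived SL ^^ Suc k) H \<subseteq> F k" for k
  proof (induction k)
    case 0
    have "A ** B ** minv A ** minv B \<in> F 0" if "A \<in> H" "B \<in> H" for A B
    proof -
      have AB: "A \<in> pat (\<le>)" "B \<in> pat (\<le>)" using that H(2) by auto
      then have C: "A ** B ** minv A ** minv B \<in> pat (\<le>)" by (intro Bg(3,4))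
      have P: "A \<in> palg (\<le>)" "B \<in> palg (\<le>)" "minv A \<in> palg (\<le>)" "minv B \<in> palg (\<le>)"
        using AB Bg(4) by (auto simp: pat_def)
      have "A ** B - B ** A \<in> palg (<)"
      proof (rule palgI)
        fix i j assume nz: "(A ** B - B ** A) $ i $ j \<noteq> 0"
        have "A ** B - B ** A \<in> palg (\<le>)" using P by (intro palg_diff palg_mult preorder_le)
        from palgD[OF this nz] have "i \<le> j" .
        moreover have "i \<noteq> j"
        proof
          assume "i = j"
          have d: "(X ** Y) $ j $ j = X $ j $ j * Y $ j $ j" if "X \<in> palg (\<le>)" "Y \<in> palg (\<le>)" for X Y :: "complex^'n::{finite,wellorder}^'n::{finite,wellorder}"
          proof -
            have "X $ j $ l * Y $ l $ j = 0" if "l \<noteq> j" for l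
              using palgD0[OF \<open>X \<in> palg (\<le>)\<close>, of j l] palgD0[OF \<open>Y \<in> palg (\<le>)\<close>, of l j] that by force
            then have "(X ** Y) $ j $ j = (\<Sum>l\<in>{j}. X $ j $ l * Y $ l $ j)"
              unfolding mult_entry by (intro sum.mono_neutral_right) auto
            then show ?thesis by simp
          qed
          show False using nz d[OF P(1,2)] d[OF P(2,1)] \<open>i = j\<close> by simp
        qed
        ultimately show "i < j" by simp
      qed
      then have "(A ** B - B ** A) ** (minv A ** minv B) \<in> palg (<)"
        by (rule palg_mult_gen[OF _ palg_mult[OF preorder_le P(3,4)]]) auto
      moreover have "A ** B ** minv A ** minv B - mat 1 = (A ** B - B ** A) ** (minv A ** minv B)"
        using AB by (simp add: pat_def matrix_mul_diff_left matrix_mul_assoc[symmetric] minv_r minv_r_cancel)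
      ultimately have *: "A ** B ** minv A ** minv B - mat 1 \<in> palg (<)" by simp
      have "A ** B ** minv A ** minv B - mat 1 \<in> palg (\<lambda>i j. r i + Suc 0 \<le> r j)"
        by (rule palg_mono[OF *]) (simp add: r_less Suc_leI)
      then show ?thesis using C by (simp add: F_def)
    qed
    then show ?case using comm[of H 0] subgroup_SLD(1)[OF H(1)] by simp
  next
    case (Suc k)
    have "A ** B ** minv A ** minv B \<in> F (Suc k)" if "A \<in> F k" "B \<in> F k" for A B
    proof -
      let ?S = "\<lambda>i j. r i + Suc k \<le> r j"
      have AB: "A \<in> pat (\<le>)" "B \<in> pat (\<le>)" "A - mat 1 \<in> palg ?S" "B - mat 1 \<in> palg ?S" using that by (auto simp: F_def)
      then have C: "A ** B ** minv A ** minv B \<in> pat (\<le>)" by (intro Bg(3,4))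
      have P: "minv A \<in> palg (\<le>)" "minv B \<in> palg (\<le>)" using AB Bg(4) by (auto simp: pat_def)
      have "(A - mat 1) ** (B - mat 1) - (B - mat 1) ** (A - mat 1) \<in> palg (\<lambda>i j. r i + Suc (Suc k) \<le> r j)"
        by (rule palg_diff) (rule palg_mult_gen[OF AB(3,4)], simp, rule palg_mult_gen[OF AB(4,3)], simp)
      then have "((A - mat 1) ** (B - mat 1) - (B - mat 1) ** (A - mat 1)) ** (minv A ** minv B) \<in> palg (\<lambda>i j. r i + Suc (Suc k) \<le> r j)"
        by (rule palg_mult_gen[OF _ palg_mult[OF preorder_le P]]) (use r_mono le_trans in blast)
      then show ?thesis using C AB(1,2) by (simp add: F_def commutator_entry pat_def)
    qed
    moreover have "(derived SL ^^ Suc (Suc k)) H \<subseteq> derived SL (F k)" using SL.mono_derived[OF Suc] by simp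
    moreover have "\<And>A. A \<in> F k \<Longrightarrow> det A = 1" by (simp add: F_def pat_def)
    ultimately show ?case using comm[of "F k" "Suc k"] by blast
  qed
  from this[of "CARD('n)"] have "(derived SL ^^ Suc CARD('n)) H \<subseteq> F CARD('n)" .
  moreover have "F CARD('n) \<subseteq> {mat 1}"
  proof
    fix A assume "A \<in> F CARD('n)"
    moreover have "r j < CARD('n)" for j unfolding r_def by (rule psubset_card_mono) auto
    then have "\<not> r i + Suc CARD('n) \<le> r j" for i j by (metis add_leD2 Suc_leD leD)
    ultimately show "A \<in> {mat 1}" by (auto simp: F_def palg_def vec_eq_iff)
  qed
  moreover have "mat 1 \<in> (derived SL ^^ Suc CARD('n)) H"
    using subgroup_SLD(2)[OF SL.exp_of_derived_is_subgroup[OF H(1)]] .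
  ultimately have "(derived SL ^^ Suc CARD('n)) H = {\<one>\<^bsub>SL\<^esub>}" by auto
  then show ?thesis by (rule SL.trivial_derived_seq_imp_solvable[OF H(1)])
qed

lemma commutator_derived:
  "A \<in> K \<Longrightarrow> B \<in> K \<Longrightarrow> A ** B ** minv A ** minv B \<in> derived SL K"
  unfolding derived_def by (rule generate.incl) auto

text \<open>The two root subgroups survive in every derived subgroup, their elements being
  commutators with \<open>h\<close>.\<close>

lemma not_solvable_elem:
  assumes ab: "a \<noteq> b" and el: "\<And>t. elem a b t \<in> H" "\<And>t. elem b a t \<in> H" and H: "subgroup H SL"
  shows "\<not> solvable_seq SL H"
proof
  assume "solvable_seq SL H"
  then obtain n where n: "(derived SL ^^ n) H = {\<one>\<^bsub>SL\<^esub>}" using SL.solvable_imp_trivial_derived_seq by blast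
  \<comment> \<open>In rows and columns \<open>a\<close>, \<open>b\<close> this product is diag(2,
    1/2). Conjugation by it multiplies the two parameters by 4 and by 1/4, which explains the
    choices \<open>t/3\<close> and \<open>- 4 * t / 3\<close> below.\<close>
  define h where "h = elem a b 1 ** elem b a 1 ** elem a b (-1/2) ** elem b a (-2)"
  have h1: "h ** elem a b t = elem a b (4 * t) ** h" for t
    using ab by (simp add: h_def vec_eq_iff elem_mult_right) (auto simp: elem_entry elem_mult_left elem_mult_right)
  have h2: "h ** elem b a t = elem b a (t / 4) ** h" for t
    using ab by (simp add: h_def vec_eq_iff elem_mult_right) (auto simp: elem_entry elem_mult_left elem_mult_right)
  have dh: "det h = 1" using ab by (simp add: h_def det_mul det_elem)
  have "subgroup ((derived SL ^^ k) H) SL \<and> (\<forall>t. elem a b t \<in> (derived SL ^^ k) H) \<and> (\<forall>t. elem b a t \<in> (derived SL ^^ k) H)" for k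
  proof (induction k)
    case 0
    then show ?case using el H by simp
  next
    case (Suc k)
    let ?K = "(derived SL ^^ k) H"
    note Kg = subgroup_SLD[OF conjunct1[OF Suc]]
    have h: "h \<in> ?K" unfolding h_def using Suc by (intro Kg(3)) auto
    have "elem a b t \<in> derived SL ?K" for t
    proof -
      have "h ** elem a b (t/3) ** minv h ** minv (elem a b (t/3)) = elem a b (4 * (t/3)) ** elem a b (- (t/3))"
        unfolding h1 using ab dh by (simp add: matrix_mul_assoc[symmetric] minv_r_cancel minv_elem)
      also have "\<dots> = elem a b t" using ab by (simp add: elem_add)
      finally show ?thesis using commutator_derived[OF h, of "elem a b (t/3)"] Suc by simp
    qed
    moreover have "elem b a t \<in> derived SL ?K" for t
    proof -
      let ?t = "- 4 * t / 3"
      have "h ** elem b a ?t ** minv h ** minv (elem b a ?t) = elem b a (?t / 4) ** elem b a (- ?t)"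
        unfolding h2 using ab dh by (simp add: matrix_mul_assoc[symmetric] minv_r_cancel minv_elem)
      also have "\<dots> = elem b a t" using ab by (simp add: elem_add)
      finally show ?thesis using commutator_derived[OF h, of "elem b a ?t"] Suc by simp
    qed
    moreover have "subgroup ((derived SL ^^ Suc k) H) SL" using SL.exp_of_derived_is_subgroup[OF H] .
    ultimately show ?case by simp
  qed
  from this[of n] have "elem a b 1 = mat 1" using n by auto
  then have "elem a b 1 $ a $ b = mat 1 $ a $ b" by simp
  then show False using ab by (simp add: elem_entry mat_def)
qed

text \<open>Maximality: a larger connected solvable subgroup would contain, besides the upper
  elementary matrices of a block, also the lower ones at some position, contrary to
  \<open>not_solvable_elem\<close>.\<close>

lemma borel_levi:
  fixes R :: "'n \<Rightarrow> 'n::{finite,wellorder} \<Rightarrow> bool"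
  assumes R: "upper_rel R" and u: "det u = 1"
  shows "borel_subgroup ((\<lambda>A. u ** A ** minv u) ` pat (sim R)) ((\<lambda>A. u ** A ** minv u) ` pat (\<lambda>i j. sim R i j \<and> i \<le> j))"
proof -
  let ?c = "\<lambda>A. u ** A ** minv u" and ?BL = "pat (\<lambda>i j. sim R i j \<and> i \<le> j)"
  note P = upper_relD(1)[OF R] and P' = preorder_sim[OF upper_relD(1)[OF R]]
  have PB: "preorder_rel (\<lambda>i j. sim R i j \<and> i \<le> j)"
    using P unfolding preorder_rel_def by (metis order_refl order_trans)
  note Bg = subgroup_SLD[OF subgroup_pat[OF PB]]
  have cc: "minv u ** ?c A ** u = A" for A
    using u by (simp add: matrix_mul_assoc[symmetric] minv_l minv_l_cancel)
  have cc': "?c (minv u ** A ** u) = A" for A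
    using u by (simp add: matrix_mul_assoc[symmetric] minv_r minv_r_cancel)
  have hom: "?c A ** ?c B = ?c (A ** B)" for A B
    using u by (simp add: matrix_mul_assoc[symmetric] minv_l_cancel)
  interpret c: group_hom SL SL ?c
    by unfold_locales (use u in \<open>auto simp: hom_def det_mul minv_det matrix_mul_assoc[symmetric] minv_l_cancel\<close>)
  have Bsub: "subgroup (?c ` ?BL) SL" using c.subgroup_img_is_subgroup[OF subgroup_pat[OF PB]] .
  have "?c ` ?BL = {A. det A = 1 \<and> minv u ** A ** u \<in> ?BL}"
  proof (intro subset_antisym subsetI)
    fix A assume "A \<in> ?c ` ?BL"
    then show "A \<in> {A. det A = 1 \<and> minv u ** A ** u \<in> ?BL}" using cc u by (auto simp: det_mul minv_det pat_def)
  next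
    fix A assume "A \<in> {A. det A = 1 \<and> minv u ** A ** u \<in> ?BL}"
    then show "A \<in> ?c ` ?BL" using cc'[of A] by (metis (no_types, lifting) image_eqI mem_Collect_eq)
  qed
  then have Bcl: "closedin zariski (?c ` ?BL)"
    using closedin_zariski_translate[OF closedin_pat minv_det[OF u] u] by simp
  have Bco: "connectedin zariski (?c ` ?BL)"
    by (rule irr_connected[OF irr_translate[OF irr_pat[OF PB]]]) (use u in \<open>auto simp: pat_def det_mul minv_det\<close>)
  have "?BL \<subseteq> pat (\<le>)" using pat_mono by blast
  then have "solvable_seq SL ?BL" by (rule solvable_upper[OF subgroup_pat[OF PB]])
  then have Bso: "solvable (SL\<lparr>carrier := ?c ` ?BL\<rparr>)"
    unfolding solvable_SL_subgroup[OF Bsub] by (rule solvable_conj[OF u])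
  have "C = ?c ` ?BL" if C: "connected_solvable_subgroup C" "?c ` ?BL \<subseteq> C" "C \<subseteq> ?c ` pat (sim R)" for C
  proof (rule ccontr)
    assume ne: "C \<noteq> ?c ` ?BL"
    have Cg: "subgroup C SL" "solvable_seq SL C"
      using C(1) solvable_SL_subgroup by (auto simp: connected_solvable_subgroup_def closed_subgroup_def)
    let ?D = "(\<lambda>A. minv u ** A ** minv (minv u)) ` C"
    have Dm: "A \<in> ?D \<longleftrightarrow> ?c A \<in> C" for A
      using cc cc' u by (auto simp: minv_minv) (metis image_eqI)
    have Dsol: "solvable_seq SL ?D" using minv_det[OF u] Cg(2) by (rule solvable_conj)
    then have Dsub: "subgroup ?D SL" by (rule SL.solvable_imp_subgroup)
    note Dg = subgroup_SLD[OF Dsub] and Rg = subgroup_SLD[OF subgroup_rad[OF P]]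
    have BD: "?BL \<subseteq> ?D" using C(2) Dm by blast
    have DL: "?D \<subseteq> pat (sim R)" using C(3) cc u by (auto simp: minv_minv)
    obtain A where A: "A \<in> ?D" "A \<notin> ?BL"
    proof -
      obtain X where X: "X \<in> C" "X \<notin> ?c ` ?BL" using ne C(2) by blast
      have e: "?c (minv u ** X ** u) = X" by (rule cc')
      then have "minv u ** X ** u \<in> ?D" using X(1) Dm[of "minv u ** X ** u"] by simp
      moreover have "minv u ** X ** u \<notin> ?BL"
      proof
        assume "minv u ** X ** u \<in> ?BL"
        then have "?c (minv u ** X ** u) \<in> ?c ` ?BL" by (rule imageI)
        with e X(2) show False by simp
      qed
      ultimately show ?thesis by (rule that)
    qed
    have DR: "?D \<subseteq> pat R" using DL pat_mono by blast
    \<comment> \<open>Adding the unipotent radical yields a subgroup containing all upper triangular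
      matrices, and such a subgroup is governed by a zero pattern.\<close>
    let ?H = "{d ** r | d r. d \<in> ?D \<and> r \<in> rad R}"
    have HR: "?H \<subseteq> pat R"
      using DR rad_subset_pat[OF P] subgroup_SLD(3)[OF subgroup_pat[OF P]] by blast
    have Hsub: "subgroup ?H SL"
      unfolding subgroup_SL_iff
    proof (intro conjI ballI)
      show "det X = 1" if "X \<in> ?H" for X using that HR by (auto simp: pat_def)
      show "mat 1 \<in> ?H" using Dg(2) Rg(2) by (intro CollectI exI[of _ "mat 1"]) simp
      show "X ** Y \<in> ?H" if XY: "X \<in> ?H" "Y \<in> ?H" for X Y
      proof -
        obtain d r d' r' where *: "X = d ** r" "Y = d' ** r'" "d \<in> ?D" "d' \<in> ?D" "r \<in> rad R" "r' \<in> rad R"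
          using XY by blast
        have "minv d' \<in> pat R" using DR Dg(4)[OF *(4)] by blast
        from rad_conj[OF P this *(5)] have "minv d' ** r ** d' \<in> rad R" using Dg(1)[OF *(4)] by (simp add: minv_minv)
        then have "(minv d' ** r ** d') ** r' \<in> rad R" using Rg(3) *(6) by blast
        moreover have "X ** Y = (d ** d') ** ((minv d' ** r ** d') ** r')" unfolding *(1,2)
          using Dg(1)[OF *(4)] by (simp add: matrix_mul_assoc[symmetric] minv_r_cancel)
        ultimately show ?thesis using Dg(3)[OF *(3,4)] by blast
      qed
      show "minv X \<in> ?H" if X: "X \<in> ?H" for X
      proof -
        obtain d r where *: "X = d ** r" "d \<in> ?D" "r \<in> rad R" using X by blast
        have dd: "det d = 1" "det r = 1" using Dg(1)[OF *(2)] Rg(1)[OF *(3)] .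
        have "d ** minv r ** minv d \<in> rad R" using rad_conj[OF P _ Rg(4)[OF *(3)]] DR *(2) by blast
        moreover have "minv X = minv d ** (d ** minv r ** minv d)" unfolding *(1)
          using dd by (simp add: minv_mult matrix_mul_assoc[symmetric] minv_l_cancel)
        ultimately show ?thesis using Dg(4)[OF *(2)] by blast
      qed
    qed
    have "pat (\<le>) \<subseteq> ?H"
    proof
      fix b :: "complex^'n::{finite,wellorder}^'n::{finite,wellorder}" assume b: "b \<in> pat (\<le>)"
      then have bR: "b \<in> pat R" using pat_mono upper_relD(2)[OF R] by blast
      have "blk R b \<in> ?BL" using blk_pat[OF R bR] b by (auto simp: pat_def palg_def blk_def)
      then have "blk R b \<in> ?D" using BD by blast
      moreover have "b = blk R b ** (minv (blk R b) ** b)"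
        using det_blk[OF R bR] by (simp add: minv_r_cancel)
      ultimately show "b \<in> ?H" using pat_decompose[OF R bR] by blast
    qed
    then obtain R' where R': "upper_rel R'" "?H = pat R'" "\<And>i j. i \<noteq> j \<Longrightarrow> R' i j \<longleftrightarrow> (\<forall>t. elem i j t \<in> ?H)"
      using subgroup_containing_upper[OF Hsub] by blast
    have "A \<in> pat (sim R)" using A(1) DL by blast
    then obtain i j where ij: "A $ i $ j \<noteq> 0" "\<not> i \<le> j" "sim R i j" using A(2) by (auto simp: pat_def palg_def)
    have "A = A ** mat 1" by simp
    then have "A \<in> ?H" using A(1) Rg(2) by blast
    then have "R' i j" using ij(1) R'(2) palgD[of A R'] by (auto simp: pat_def)
    then have elH: "elem i j t \<in> ?H" for t using R'(3)[of i j] ij(2) by auto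
    \<comment> \<open>Inside the block diagonal group the radical factor of a product from
      \<open>?H\<close> must be trivial, so membership in \<open>?H\<close> returns to
      \<open>?D\<close>.\<close>
    have "elem i j t \<in> ?D" for t
    proof -
      obtain d r where dr: "elem i j t = d ** r" "d \<in> ?D" "r \<in> rad R" using elH[of t] by blast
      have "elem i j t \<in> pat (sim R)" using elem_pat[OF P' ij(3)] ij(2) by auto
      moreover have "r = minv d ** elem i j t" unfolding dr(1) using Dg(1)[OF dr(2)] by (simp add: minv_l_cancel)
      ultimately have "r \<in> pat (sim R)" using DL dr(2) subgroup_SLD(3,4)[OF subgroup_pat[OF P']] by blast
      then have "r = blk R r" using blk_id[of r R] by (simp add: pat_def)
      also have "\<dots> = mat 1" using dr(3) rad_subset_pat[OF P] blk_eq_one[OF P, of r] by (auto simp: rad_def pat_def)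
      finally show ?thesis using dr by simp
    qed
    moreover have "elem j i t \<in> ?D" for t
      using elem_pat[OF PB, of j i] ij BD by auto
    ultimately show False using not_solvable_elem[of i j ?D] Dsub Dsol ij(2) by auto
  qed
  moreover have "?BL \<subseteq> pat (sim R)" by (intro subsetI) (erule pat_mono, blast)
  then have "?c ` ?BL \<subseteq> ?c ` pat (sim R)" by (rule image_mono)
  moreover have "connected_solvable_subgroup (?c ` ?BL)"
    unfolding connected_solvable_subgroup_def closed_subgroup_def using Bsub Bcl Bco Bso by blast
  ultimately show ?thesis unfolding borel_subgroup_def by blast
qed

section \<open>Homogeneous spaces of block triangular groups\<close>

abbreviation pre :: "(complex^'n^'n::finite) set \<Rightarrow> (complex^'n^'n) set set \<Rightarrow> (complex^'n^'n) set" where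
  "pre P Y \<equiv> {g. det g = 1 \<and> g <#\<^bsub>SL\<^esub> P \<in> Y}"

lemma lcoset_mem: "x \<in> g <#\<^bsub>SL\<^esub> P \<longleftrightarrow> (\<exists>p\<in>P. x = g ** p)"
  unfolding l_coset_def by auto

lemma lcoset_eq_iff:
  assumes P: "subgroup P SL" and d: "det g = 1" "det h = 1"
  shows "g <#\<^bsub>SL\<^esub> P = h <#\<^bsub>SL\<^esub> P \<longleftrightarrow> minv g ** h \<in> P"
proof
  note Pg = subgroup_SLD[OF P]
  assume "g <#\<^bsub>SL\<^esub> P = h <#\<^bsub>SL\<^esub> P"
  moreover have "h \<in> h <#\<^bsub>SL\<^esub> P" unfolding lcoset_mem by (rule bexI[OF _ Pg(2)]) simp
  ultimately have "h \<in> g <#\<^bsub>SL\<^esub> P" by simp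
  then obtain p where "p \<in> P" "h = g ** p" unfolding lcoset_mem by blast
  then show "minv g ** h \<in> P" by (simp add: minv_l_cancel[OF d(1)])
next
  note Pg = subgroup_SLD[OF P]
  assume *: "minv g ** h \<in> P"
  show "g <#\<^bsub>SL\<^esub> P = h <#\<^bsub>SL\<^esub> P"
  proof (intro subset_antisym subsetI)
    fix x assume "x \<in> g <#\<^bsub>SL\<^esub> P"
    then obtain p where p: "p \<in> P" "x = g ** p" unfolding lcoset_mem by blast
    have "x = h ** (minv (minv g ** h) ** p)" unfolding p(2)
      using d by (simp add: minv_mult minv_det minv_minv matrix_mul_assoc[symmetric] minv_r_cancel)
    moreover have "minv (minv g ** h) ** p \<in> P" by (intro Pg(3,4) * p(1))
    ultimately show "x \<in> h <#\<^bsub>SL\<^esub> P" unfolding lcoset_mem by blast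
  next
    fix x assume "x \<in> h <#\<^bsub>SL\<^esub> P"
    then obtain p where p: "p \<in> P" "x = h ** p" unfolding lcoset_mem by blast
    have "x = g ** ((minv g ** h) ** p)" unfolding p(2)
      using d by (simp add: matrix_mul_assoc[symmetric] minv_r_cancel)
    moreover have "(minv g ** h) ** p \<in> P" by (intro Pg(3) * p(1))
    ultimately show "x \<in> g <#\<^bsub>SL\<^esub> P" unfolding lcoset_mem by blast
  qed
qed

lemma lcosets_SL: "lcosets\<^bsub>SL\<^esub> P = {g <#\<^bsub>SL\<^esub> P | g. det g = 1}"
  unfolding LCOSETS_def by auto

lemma openin_coset_pre: "openin (coset_space P) U \<longleftrightarrow> U \<subseteq> lcosets\<^bsub>SL\<^esub> P \<and> openin zariski (pre P U)"
  unfolding openin_coset_space by simp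

lemma closedin_coset_pre: "closedin (coset_space P) Y \<longleftrightarrow> Y \<subseteq> lcosets\<^bsub>SL\<^esub> P \<and> closedin zariski (pre P Y)"
proof -
  have "pre P (lcosets\<^bsub>SL\<^esub> P - Y) = carrier SL - pre P Y"
    unfolding lcosets_SL by auto
  then show ?thesis
    unfolding closedin_def openin_coset_pre topspace_coset_space topspace_zariski
    by auto
qed

lemma irreducible_coset_space:
  assumes Y: "closedin (coset_space P) Y" and irr: "irr (pre P Y)" and ne: "Y \<noteq> {}"
  shows "irreducible_space (subtopology (coset_space P) Y)"
proof -
  have Yl: "Y \<subseteq> lcosets\<^bsub>SL\<^esub> P" using Y by (simp add: closedin_coset_pre)
  have ts: "topspace (subtopology (coset_space P) Y) = Y"
    using Yl by (auto simp: topspace_subtopology topspace_coset_space)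
  show ?thesis
    unfolding irreducible_space_def ts
  proof (intro conjI allI impI; (elim conjE)?)
    show "Y \<noteq> {}" by (rule ne)
  next
    fix C D assume "closedin (subtopology (coset_space P) Y) C" "closedin (subtopology (coset_space P) Y) D"
      and CD: "C \<union> D = Y"
    then have cl: "closedin zariski (pre P C)" "closedin zariski (pre P D)"
      using Y by (auto simp: closedin_closed_subtopology closedin_coset_pre)
    show "C = Y \<or> D = Y"
    proof (rule ccontr)
      assume n: "\<not> (C = Y \<or> D = Y)"
      then obtain c d where cd: "c \<in> Y" "c \<notin> C" "d \<in> Y" "d \<notin> D" using CD by blast
      then obtain g h where gh: "det g = 1" "c = g <#\<^bsub>SL\<^esub> P" "det h = 1" "d = h <#\<^bsub>SL\<^esub> P"
        using Yl unfolding lcosets_SL by blast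
      obtain p where p: "polynomial_fun p" "\<And>B. B \<in> pre P C \<Longrightarrow> p B = 0" "p g \<noteq> 0"
        by (rule closedin_zariskiD[OF cl(1), of g]) (use gh cd in auto)
      obtain q where q: "polynomial_fun q" "\<And>B. B \<in> pre P D \<Longrightarrow> q B = 0" "q h \<noteq> 0"
        by (rule closedin_zariskiD[OF cl(2), of h]) (use gh cd in auto)
      have "g \<in> pre P Y" "h \<in> pre P Y" using gh cd by auto
      then obtain x where "x \<in> pre P Y" "p x \<noteq> 0" "q x \<noteq> 0"
        using irrD[OF irr p(1) q(1) _ _ p(3) q(3)] by blast
      moreover have "pre P Y = pre P C \<union> pre P D" using CD by auto
      ultimately show False using p(2) q(2) by blast
    qed
  qed
qed

subsection \<open>Charts\<close>

text \<open>The opposite big cell: \<open>truncate R j g\<close> keeps the columns of \<open>g\<close> up to the end of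
  the block of \<open>j\<close>, so its determinant is a leading principal minor, and the section
  of the quotient map over the cell is given by Cramer's rule.\<close>

definition truncate :: "('n \<Rightarrow> 'n \<Rightarrow> bool) \<Rightarrow> 'n \<Rightarrow> complex^'n^'n::finite \<Rightarrow> complex^'n^'n" where
  "truncate R j g = (\<chi> i l. if R l j then g $ i $ l else if i = l then 1 else 0)"

definition minors :: "('n \<Rightarrow> 'n \<Rightarrow> bool) \<Rightarrow> complex^'n^'n::finite \<Rightarrow> complex" where
  "minors R g = (\<Prod>j\<in>UNIV. det (truncate R j g))"

text \<open>Every entry is put over the denominator \<open>minors R g\<close>, as
  \<open>rational_substitution\<close> requires; the product over the other columns completes the
  determinant from Cramer's rule.\<close>

definition sec_num :: "('n \<Rightarrow> 'n \<Rightarrow> bool) \<Rightarrow> 'n \<Rightarrow> 'n \<Rightarrow> complex^'n^'n::finite \<Rightarrow> complex" where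
  "sec_num R i j g = (if i = j then minors R g else if R i j then 0
     else - (cofac (truncate R j g) i j * (\<Prod>k\<in>UNIV - {j}. det (truncate R k g))))"

definition sec :: "('n \<Rightarrow> 'n \<Rightarrow> bool) \<Rightarrow> complex^'n^'n::finite \<Rightarrow> complex^'n^'n" where
  "sec R g = (\<chi> i j. sec_num R i j g / minors R g)"

lemma polynomial_fun_truncate: "polynomial_fun (\<lambda>g. truncate R j g $ i $ l)"
  unfolding truncate_def by (simp only: vec_lambda_beta) (intro polynomial_fun_if polynomial_fun.intros)

lemma polynomial_fun_minors: "polynomial_fun (minors R)"
  unfolding minors_def[abs_def] by (intro polynomial_fun_prod polynomial_fun_det polynomial_fun_truncate)

lemma polynomial_fun_sec_num: "polynomial_fun (sec_num R i j)"
  unfolding sec_num_def[abs_def]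
  by (intro polynomial_fun_if polynomial_fun_minus polynomial_fun.mult polynomial_fun_minors polynomial_fun.const
     polynomial_fun_cofac polynomial_fun_prod polynomial_fun_det polynomial_fun_truncate)

text \<open>Cramer's rule solves \<open>truncate R j g *v v = axis j 1\<close>. The unknowns
  belonging to columns of \<open>g\<close> form column \<open>j\<close> of \<open>K\<close>, an
  element of \<open>pat R\<close>; those belonging to unit columns reappear with opposite sign as
  the entries of \<open>g ** K\<close> outside \<open>R\<close>.\<close>

lemma sec_in_cell:
  fixes R :: "'n \<Rightarrow> 'n::{finite,wellorder} \<Rightarrow> bool"
  assumes R: "upper_rel R" and g: "det g = 1" and m: "minors R g \<noteq> 0"
  shows "sec R g \<in> rad (\<lambda>i j. R j i)" "minv g ** sec R g \<in> pat R"
proof -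
  note P = upper_relD(1)[OF R]
  have dj: "det (truncate R j g) \<noteq> 0" for j using m unfolding minors_def by auto
  define v where "v j l = cofac (truncate R j g) l j / det (truncate R j g)" for j l
  have sec: "sec R g $ i $ j = (if i = j then 1 else if R i j then 0 else - v j i)" for i j
  proof -
    have "minors R g = det (truncate R j g) * (\<Prod>k\<in>UNIV - {j}. det (truncate R k g))"
      unfolding minors_def by (rule prod.remove) auto
    moreover have "(\<Prod>k\<in>UNIV - {j}. det (truncate R k g)) \<noteq> 0" using dj by simp
    ultimately show ?thesis using m dj[of j] by (simp add: sec_def sec_num_def v_def)
  qed
  define K where "K = (\<chi> l j. if R l j then v j l else 0)"
  have "(g ** K) $ i $ j = sec R g $ i $ j" for i j
  proof -
    have "(truncate R j g *v (\<chi> l. v j l)) $ i = axis j 1 $ i"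
      unfolding v_def by (subst cofac_col[OF dj]) simp
    moreover have "(truncate R j g *v (\<chi> l. v j l)) $ i =
       (\<Sum>l\<in>UNIV. (if R l j then g $ i $ l * v j l else 0) + (if l = i then (if R l j then 0 else v j l) else 0))"
      unfolding matrix_vector_mult_def truncate_def by (simp, intro sum.cong refl) auto
    moreover have "\<dots> = (\<Sum>l\<in>UNIV. (if R l j then g $ i $ l * v j l else 0)) + (if R i j then 0 else v j i)"
      by (simp add: sum.distrib)
    moreover have "(g ** K) $ i $ j = (\<Sum>l\<in>UNIV. (if R l j then g $ i $ l * v j l else 0))"
      unfolding mult_entry K_def by (intro sum.cong) auto
    ultimately have "(g ** K) $ i $ j + (if R i j then 0 else v j i) = (if i = j then 1 else 0)"
      by (simp add: axis_def)
    then show ?thesis using preorder_refl[OF P, of j] unfolding sec by (auto simp: eq_neg_iff_add_eq_0)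
  qed
  then have gK: "g ** K = sec R g" by (simp add: vec_eq_iff)
  have s: "sec R g - mat 1 \<in> palg (\<lambda>i j. R j i \<and> \<not> R i j)"
  proof (rule palgI)
    fix i j assume "(sec R g - mat 1) $ i $ j \<noteq> 0"
    then have "\<not> R i j" using preorder_refl[OF P, of j] by (auto simp: sec mat_def split: if_splits)
    then show "R j i \<and> \<not> R i j" using upper_relD(2)[OF R, of i j] upper_relD(2)[OF R, of j i] by (meson linear)
  qed
  have "sec R g - mat 1 \<in> palg (>)"
    by (rule palg_mono[OF s]) (use upper_relD(2)[OF R] not_le in blast)
  then have ds: "det (sec R g) = 1" by (rule det_lower_unitriangular)
  show "sec R g \<in> rad (\<lambda>i j. R j i)" using s ds by (simp add: rad_def)
  have "det K = 1" using gK ds g det_mul[of g K] by simp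
  moreover have "K \<in> palg R" by (auto simp: palg_def K_def)
  moreover have "minv g ** sec R g = K" unfolding gK[symmetric] by (simp add: minv_l_cancel[OF g])
  ultimately show "minv g ** sec R g \<in> pat R" by (simp add: pat_def)
qed

lemma preorder_converse: "preorder_rel R \<Longrightarrow> preorder_rel (\<lambda>i j. R j i)"
  unfolding preorder_rel_def by blast

text \<open>Right multiplication by \<open>palg R\<close> mixes a kept column only with columns that
  are kept along with it.\<close>

lemma truncate_mult:
  assumes P: "preorder_rel R" and p: "p \<in> palg R"
  shows "truncate R j (g ** p) = truncate R j g ** truncate R j p"
proof -
  have "truncate R j (g ** p) $ i $ l = (truncate R j g ** truncate R j p) $ i $ l" for i l
  proof (cases "R l j")
    case True
    have "g $ i $ k * p $ k $ l = truncate R j g $ i $ k * truncate R j p $ k $ l" for k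
      using palgD[OF p, of k l] preorder_trans[OF P _ True, of k] True
      by (cases "p $ k $ l = 0") (auto simp: truncate_def)
    then have "(\<Sum>k\<in>UNIV. g $ i $ k * p $ k $ l) = (\<Sum>k\<in>UNIV. truncate R j g $ i $ k * truncate R j p $ k $ l)"
      by (intro sum.cong refl) blast
    moreover have "truncate R j (g ** p) $ i $ l = (g ** p) $ i $ l" using True by (simp add: truncate_def)
    ultimately show ?thesis unfolding mult_entry[of g] mult_entry[of "truncate R j g"] by simp
  next
    case False
    then have "truncate R j g $ i $ k * truncate R j p $ k $ l = (if k = l then truncate R j g $ i $ l else 0)" for k
      by (simp add: truncate_def)
    then show ?thesis using False unfolding mult_entry by (simp add: truncate_def)
  qed
  then show ?thesis by (simp add: vec_eq_iff)
qed

lemma minors_cell: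
  fixes R :: "'n \<Rightarrow> 'n::{finite,wellorder} \<Rightarrow> bool"
  assumes R: "upper_rel R" and u: "u \<in> rad (\<lambda>i j. R j i)" and p: "p \<in> pat R"
  shows "minors R (u ** p) \<noteq> 0"
proof -
  note P = upper_relD(1)[OF R]
  have u1: "u - mat 1 \<in> palg (\<lambda>i j. R j i \<and> \<not> R i j)" using u by (simp add: rad_def)
  have "det (truncate R j (u ** p)) \<noteq> 0" for j
  proof -
    have "truncate R j u - mat 1 \<in> palg (>)"
    proof (rule palgI)
      fix i l assume "(truncate R j u - mat 1) $ i $ l \<noteq> 0"
      then have "(u - mat 1) $ i $ l \<noteq> 0" by (auto simp: truncate_def mat_def split: if_splits)
      from palgD[OF u1 this] show "i > l" using upper_relD(2)[OF R, of i l] not_le by blast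
    qed
    then have 1: "det (truncate R j u) = 1" by (rule det_lower_unitriangular)
    have "truncate R j p ** truncate R j (minv p) = truncate R j (p ** minv p)"
      using truncate_mult[OF P patD(2)[OF pat_minv[OF P p]]] by simp
    also have "\<dots> = mat 1" using p by (simp add: minv_r pat_def truncate_def vec_eq_iff mat_def)
    finally have "det (truncate R j p) * det (truncate R j (minv p)) = 1" by (metis det_I det_mul)
    then have "det (truncate R j p) \<noteq> 0" by auto
    then show ?thesis using 1 by (simp add: truncate_mult[OF P patD(2)[OF p]] det_mul)
  qed
  then show ?thesis unfolding minors_def by simp
qed

lemma cell_unique:
  assumes P: "preorder_rel R" and u: "u \<in> rad (\<lambda>i j. R j i)" "u' \<in> rad (\<lambda>i j. R j i)" and "minv u ** u' \<in> pat R"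
  shows "u = u'"
proof -
  note Rg = subgroup_SLD[OF subgroup_rad[OF preorder_converse[OF P]]]
  have "minv u ** u' \<in> rad (\<lambda>i j. R j i)" by (intro Rg(3,4) u)
  then have "minv u ** u' - mat 1 \<in> palg (\<lambda>i j. R j i \<and> \<not> R i j)" by (simp add: rad_def)
  moreover have "minv u ** u' - mat 1 \<in> palg R" using assms(4) by (intro palg_diff palg_one P) (simp add: pat_def)
  ultimately have "minv u ** u' - mat 1 = 0" by (auto simp: palg_def vec_eq_iff)
  then have "minv u ** u' = mat 1" by simp
  then show ?thesis using minv_r_cancel[OF Rg(1)[OF u(1)], of u'] by simp
qed

subsection \<open>Local rings of closed subvarieties\<close>

lemma regular_germ:
  assumes "regular_subvariety P Y V f" "A0 <#\<^bsub>SL\<^esub> P \<in> V" "det A0 = 1"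
  shows "\<exists>N p q. openin zariski N \<and> A0 \<in> N \<and> polynomial_fun p \<and> polynomial_fun q \<and>
    (\<forall>A\<in>N. q A \<noteq> 0 \<and> (A <#\<^bsub>SL\<^esub> P \<in> V \<longrightarrow> f (A <#\<^bsub>SL\<^esub> P) = p A / q A))"
proof -
  obtain U h where U: "regular_coset_space P U h" "A0 <#\<^bsub>SL\<^esub> P \<in> U" "\<forall>x\<in>U \<inter> V. f x = h x"
    using assms unfolding regular_subvariety_def by blast
  then obtain N p q where "openin zariski N" "A0 \<in> N" "N \<subseteq> {g \<in> carrier SL. g <#\<^bsub>SL\<^esub> P \<in> U}"
     "polynomial_fun p" "polynomial_fun q" "\<forall>A\<in>N. q A \<noteq> 0 \<and> h (A <#\<^bsub>SL\<^esub> P) = p A / q A"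
    using assms(3) unfolding regular_coset_space_def regular_SL_def by auto
  then show ?thesis using U(3) by (intro exI[of _ N] exI[of _ p] exI[of _ q]) auto
qed

text \<open>Translation by \<open>b\<close> brings the point into the big cell, where Cramer's rule
  gives a section. \<open>Z\<close> is only squeezed between the cell part of the variety and its
  full preimage, so one set of lower unitriangular matrices can serve all parabolic
  subgroups.\<close>

lemma integrally_closed_chart:
  fixes R :: "'n \<Rightarrow> 'n::{finite,wellorder} \<Rightarrow> bool"
  assumes R: "upper_rel R" and Z: "normset Z"
    and ZY: "Z \<subseteq> pre (pat R) Y" "pre (pat R) Y \<inter> rad (\<lambda>i j. R j i) \<subseteq> Z"
    and b: "det b = 1" "\<And>g. det g = 1 \<Longrightarrow> b ** g \<in> pre (pat R) Y \<longleftrightarrow> g \<in> pre (pat R) Y"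
    and g0: "det g0 = 1" "minors R (b ** g0) \<noteq> 0" "g0 <#\<^bsub>SL\<^esub> pat R \<in> Y"
  shows "integrally_closed_at (subtopology (coset_space (pat R)) Y) (regular_subvariety (pat R) Y) (g0 <#\<^bsub>SL\<^esub> pat R)"
  unfolding integrally_closed_at_def
proof (intro allI impI, elim conjE)
  let ?P = "pat R" and ?T = "subtopology (coset_space (pat R)) Y" and ?reg = "regular_subvariety (pat R) Y"
  let ?y = "g0 <#\<^bsub>SL\<^esub> pat R" and ?cell = "rad (\<lambda>i j. R j i)"
  note P = upper_relD(1)[OF R]
  note Ps = subgroup_pat[OF P]
  note Pg = subgroup_SLD[OF Ps]
  fix V f g and m :: nat and a
  assume V: "openin ?T V" "?y \<in> V" and f: "?reg V f" and g: "?reg V g" and a: "\<forall>i<m. ?reg V (a i)"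
    and gnz: "\<not> (\<exists>V'. openin ?T V' \<and> ?y \<in> V' \<and> V' \<subseteq> V \<and> (\<forall>v\<in>V'. g v = 0))"
    and eq: "\<forall>v\<in>V. f v ^ m + (\<Sum>i<m. a i v * f v ^ i * g v ^ (m - i)) = 0"
  have m: "m \<noteq> 0"
  proof
    assume "m = 0"
    then show False using eq V(2) by auto
  qed
  have dbg: "det (b ** g0) = 1" using b g0 by (simp add: det_mul)
  define u0 where "u0 = sec R (b ** g0)"
  have u0: "u0 \<in> ?cell" "minv (b ** g0) ** u0 \<in> ?P"
    unfolding u0_def by (rule sec_in_cell[OF R dbg g0(2)])+
  have du: "det u = 1" if "u \<in> ?cell" for u using that by (simp add: rad_def)
  define A0 where "A0 = minv b ** u0"
  have dA0: "det A0 = 1" using b du[OF u0(1)] by (simp add: A0_def det_mul minv_det)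
  have "minv g0 ** A0 \<in> ?P" using u0(2) b g0 by (simp add: A0_def minv_mult matrix_mul_assoc)
  then have yA0: "?y = A0 <#\<^bsub>SL\<^esub> ?P" using lcoset_eq_iff[OF Ps g0(1) dA0] by simp
  obtain V0 where V0: "openin (coset_space ?P) V0" "V = V0 \<inter> Y" using V(1) by (auto simp: openin_subtopology)
  obtain Nf pf qf where Nf: "openin zariski Nf" "A0 \<in> Nf" "polynomial_fun pf" "polynomial_fun qf"
    "\<And>A. A \<in> Nf \<Longrightarrow> qf A \<noteq> 0 \<and> (A <#\<^bsub>SL\<^esub> ?P \<in> V \<longrightarrow> f (A <#\<^bsub>SL\<^esub> ?P) = pf A / qf A)"
    using regular_germ[OF f, of A0] V(2) dA0 unfolding yA0 by auto
  obtain Ng pg qg where Ng: "openin zariski Ng" "A0 \<in> Ng" "polynomial_fun pg" "polynomial_fun qg"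
    "\<And>A. A \<in> Ng \<Longrightarrow> qg A \<noteq> 0 \<and> (A <#\<^bsub>SL\<^esub> ?P \<in> V \<longrightarrow> g (A <#\<^bsub>SL\<^esub> ?P) = pg A / qg A)"
    using regular_germ[OF g, of A0] V(2) dA0 unfolding yA0 by auto
  have "\<exists>t. i < m \<longrightarrow> openin zariski (fst t) \<and> A0 \<in> fst t \<and> polynomial_fun (fst (snd t)) \<and> polynomial_fun (snd (snd t)) \<and>
    (\<forall>A\<in>fst t. snd (snd t) A \<noteq> 0 \<and> (A <#\<^bsub>SL\<^esub> ?P \<in> V \<longrightarrow> a i (A <#\<^bsub>SL\<^esub> ?P) = fst (snd t) A / snd (snd t) A))" for i
  proof (cases "i < m")
    case True
    then have "?reg V (a i)" using a by blast
    from regular_germ[OF this _ dA0] obtain N p q where "openin zariski N \<and> A0 \<in> N \<and> polynomial_fun p \<and> polynomial_fun q \<and>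
      (\<forall>A\<in>N. q A \<noteq> 0 \<and> (A <#\<^bsub>SL\<^esub> ?P \<in> V \<longrightarrow> a i (A <#\<^bsub>SL\<^esub> ?P) = p A / q A))"
      using V(2) unfolding yA0 by auto
    then show ?thesis by (intro exI[of _ "(N, p, q)"]) simp
  qed simp
  then obtain t where t: "\<And>i. i < m \<longrightarrow> openin zariski (fst (t i)) \<and> A0 \<in> fst (t i) \<and> polynomial_fun (fst (snd (t i))) \<and> polynomial_fun (snd (snd (t i))) \<and>
    (\<forall>A\<in>fst (t i). snd (snd (t i)) A \<noteq> 0 \<and> (A <#\<^bsub>SL\<^esub> ?P \<in> V \<longrightarrow> a i (A <#\<^bsub>SL\<^esub> ?P) = fst (snd (t i)) A / snd (snd (t i)) A))"
    by (rule that[OF someI_ex])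
  define Na where "Na i = fst (t i)" for i
  define pa where "pa i = fst (snd (t i))" for i
  define qa where "qa i = snd (snd (t i))" for i
  have Na: "\<And>i. i < m \<Longrightarrow> openin zariski (Na i)" "\<And>i. i < m \<Longrightarrow> A0 \<in> Na i"
     "\<And>i. i < m \<Longrightarrow> polynomial_fun (pa i)" "\<And>i. i < m \<Longrightarrow> polynomial_fun (qa i)"
     "\<And>i A. i < m \<Longrightarrow> A \<in> Na i \<Longrightarrow> qa i A \<noteq> 0 \<and> (A <#\<^bsub>SL\<^esub> ?P \<in> V \<longrightarrow> a i (A <#\<^bsub>SL\<^esub> ?P) = pa i A / qa i A)"
    using t unfolding Na_def pa_def qa_def by simp_all
  define N where "N = pre ?P V0 \<inter> Nf \<inter> Ng \<inter> ((\<Inter>i\<in>{..<m}. Na i) \<inter> topspace zariski)"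
  have opNa: "openin zariski ((\<Inter>i\<in>{..<m}. Na i) \<inter> topspace zariski)"
    by (rule openin_INT) (auto intro: Na(1))
  have "openin zariski (pre ?P V0)" using V0(1) by (simp add: openin_coset_pre)
  from openin_Int[OF openin_Int[OF openin_Int[OF this Nf(1)] Ng(1)] opNa] have opN: "openin zariski N"
    unfolding N_def .
  have A0N: "A0 \<in> N" unfolding N_def topspace_zariski using V(2) V0(2) dA0 Nf(2) Ng(2) Na(2) yA0 by auto
  obtain r where r: "polynomial_fun r" "r A0 \<noteq> 0" "\<And>B. det B = 1 \<Longrightarrow> r B \<noteq> 0 \<Longrightarrow> B \<in> N"
    using openin_zariski_basis[OF opN A0N] by blast
  define r' where "r' z = r (minv b ** z)" for z
  \<comment> \<open>\<open>s\<close> will be a common denominator of \<open>f\<close>,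
    \<open>g\<close> and all coefficients, written in the coordinate \<open>z = b ** A\<close>;
    \<open>F\<close>, \<open>G\<close> and \<open>A i\<close> are the corresponding
    numerators.\<close>
  define Q where "Q z = (\<Prod>k<m. qa k (minv b ** z))" for z
  define s where "s z = qf (minv b ** z) * qg (minv b ** z) * Q z" for z
  define F where "F z = pf (minv b ** z) * qg (minv b ** z) * Q z" for z
  define G where "G z = pg (minv b ** z) * qf (minv b ** z) * Q z" for z
  define A where "A i z = (if i < m then pa i (minv b ** z) * qf (minv b ** z) * qg (minv b ** z) * (\<Prod>k\<in>{..<m} - {i}. qa k (minv b ** z)) else 0)"
    for i z
  have polQ: "polynomial_fun Q" unfolding Q_def[abs_def] by (intro polynomial_fun_prod polynomial_fun_translate_left) (auto intro: Na(4))
  have pol: "polynomial_fun r'" "polynomial_fun s" "polynomial_fun F" "polynomial_fun G"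
    unfolding r'_def[abs_def] s_def[abs_def] F_def[abs_def] G_def[abs_def]
    by (intro polynomial_fun.mult polynomial_fun_translate_left polQ r(1) Nf(3,4) Ng(3,4))+
  have polA: "polynomial_fun (A i)" for i
  proof (cases "i < m")
    case True
    then show ?thesis unfolding A_def[abs_def]
      by (simp, intro polynomial_fun.mult polynomial_fun_translate_left polynomial_fun_prod Nf(4) Ng(4) Na(3,4)) auto
  next
    case False
    then show ?thesis unfolding A_def[abs_def] by (simp add: polynomial_fun.const)
  qed
  have snz: "s z \<noteq> 0" if "det z = 1" "r' z \<noteq> 0" for z
  proof -
    have "minv b ** z \<in> N" using r(3) that b by (simp add: r'_def det_mul minv_det)
    then show ?thesis unfolding s_def Q_def using Nf(5) Ng(5) Na(5) by (auto simp: N_def)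
  qed
  have val: "minv b ** z <#\<^bsub>SL\<^esub> ?P \<in> V" "f (minv b ** z <#\<^bsub>SL\<^esub> ?P) = F z / s z" "g (minv b ** z <#\<^bsub>SL\<^esub> ?P) = G z / s z"
      "\<And>i. i < m \<Longrightarrow> a i (minv b ** z <#\<^bsub>SL\<^esub> ?P) = A i z / s z"
    if z: "det z = 1" "r' z \<noteq> 0" "minv b ** z <#\<^bsub>SL\<^esub> ?P \<in> Y" for z
  proof -
    have zN: "minv b ** z \<in> N" using r(3) z b by (simp add: r'_def det_mul minv_det)
    then show zV: "minv b ** z <#\<^bsub>SL\<^esub> ?P \<in> V" using z(3) V0(2) by (auto simp: N_def)
    have sz: "s z \<noteq> 0" using snz z by blast
    then have nz: "qf (minv b ** z) \<noteq> 0" "qg (minv b ** z) \<noteq> 0" "Q z \<noteq> 0" by (auto simp: s_def)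
    show "f (minv b ** z <#\<^bsub>SL\<^esub> ?P) = F z / s z" using Nf(5)[of "minv b ** z"] zN zV nz by (simp add: N_def F_def s_def)
    show "g (minv b ** z <#\<^bsub>SL\<^esub> ?P) = G z / s z" using Ng(5)[of "minv b ** z"] zN zV nz by (simp add: N_def G_def s_def)
    show "a i (minv b ** z <#\<^bsub>SL\<^esub> ?P) = A i z / s z" if i: "i < m" for i
    proof -
      have "Q z = qa i (minv b ** z) * (\<Prod>k\<in>{..<m} - {i}. qa k (minv b ** z))"
        unfolding Q_def by (rule prod.remove) (use i in auto)
      then show ?thesis using Na(5)[OF i, of "minv b ** z"] zN zV nz i by (auto simp: N_def A_def s_def)
    qed
  qed
  have Zin: "det z = 1" "minv b ** z <#\<^bsub>SL\<^esub> ?P \<in> Y" if "z \<in> Z" for z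
  proof -
    have z: "z \<in> pre ?P Y" using that ZY(1) by blast
    then show dz: "det z = 1" by simp
    have "b ** (minv b ** z) \<in> pre ?P Y" using z minv_r_cancel[OF b(1), of z] by simp
    then show "minv b ** z <#\<^bsub>SL\<^esub> ?P \<in> Y" using b(2)[of "minv b ** z"] dz b(1) by (simp add: det_mul minv_det)
  qed
  have cellZ: "u \<in> Z" if "u \<in> ?cell" "minv b ** u <#\<^bsub>SL\<^esub> ?P \<in> Y" for u
  proof -
    have "minv b ** u \<in> pre ?P Y" using that du b by (simp add: det_mul minv_det)
    then have "b ** (minv b ** u) \<in> pre ?P Y" using b(2)[of "minv b ** u"] by simp
    then have "u \<in> pre ?P Y" by (simp only: minv_r_cancel[OF b(1)])
    then show ?thesis using that(1) ZY(2) by blast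
  qed
  have u0Z: "u0 \<in> Z" using cellZ u0(1) g0(3) yA0 unfolding A0_def by simp
  have r'u0: "r' u0 \<noteq> 0" using r(2) by (simp add: r'_def A0_def)
  \<comment> \<open>The coefficients carry the denominator \<open>s\<close> too, so it is
    \<open>s F / G\<close> that satisfies an equation with polynomial coefficients, obtained by
    multiplying with \<open>s ^ (m + m)\<close>.\<close>
  define A' where "A' i z = A i z * s z ^ (m - Suc i)" for i z
  have E: "(s z * F z) ^ m + (\<Sum>i<m. A' i z * (s z * F z) ^ i * G z ^ (m - i)) = 0" if z: "z \<in> Z" "r' z \<noteq> 0" for z
  proof -
    note v = val[OF Zin(1)[OF z(1)] z(2) Zin(2)[OF z(1)]]
    have sz: "s z \<noteq> 0" using snz Zin(1) z by blast
    have "(F z / s z) ^ m + (\<Sum>i<m. A i z / s z * (F z / s z) ^ i * (G z / s z) ^ (m - i)) = 0"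
      using eq v by (auto simp: atLeast0LessThan)
    then have "s z ^ (m + m) * ((F z / s z) ^ m + (\<Sum>i<m. A i z / s z * (F z / s z) ^ i * (G z / s z) ^ (m - i))) = 0"
      by simp
    moreover have "s z ^ (m + m) * (F z / s z) ^ m = (s z * F z) ^ m"
      using sz by (simp add: power_add power_mult_distrib power_divide)
    moreover have "s z ^ (m + m) * (\<Sum>i<m. A i z / s z * (F z / s z) ^ i * (G z / s z) ^ (m - i)) =
        (\<Sum>i<m. A' i z * (s z * F z) ^ i * G z ^ (m - i))"
      unfolding sum_distrib_left
    proof (intro sum.cong refl)
      fix i assume "i \<in> {..<m}"
      then have i: "m + m = Suc (m - Suc i) + i + i + (m - i)" by auto
      have "s z ^ (m + m) = s z * s z ^ (m - Suc i) * s z ^ i * s z ^ i * s z ^ (m - i)"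
        by (subst i) (simp only: power_add power_Suc)
      then show "s z ^ (m + m) * (A i z / s z * (F z / s z) ^ i * (G z / s z) ^ (m - i)) = A' i z * (s z * F z) ^ i * G z ^ (m - i)"
        using sz by (simp add: A'_def power_mult_distrib power_divide)
    qed
    ultimately show ?thesis by (simp add: distrib_left)
  qed
  have polsF: "polynomial_fun (\<lambda>z. s z * F z)" by (intro polynomial_fun.mult pol)
  have polA': "polynomial_fun (A' i)" for i
    unfolding A'_def[abs_def] by (intro polynomial_fun.mult polynomial_fun_power pol polA)
  have polE: "polynomial_fun (\<lambda>z. (s z * F z) ^ m + (\<Sum>i<m. A' i z * (s z * F z) ^ i * G z ^ (m - i)))"
    by (intro polynomial_fun.add polynomial_fun_sum polynomial_fun.mult polynomial_fun_power pol polA' polsF)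
  have irrZ: "irr Z" using Z by (simp add: normset_def)
  \<comment> \<open>A polynomial identity valid where \<open>r'\<close> is nonzero extends to all of
    \<open>Z\<close> by irreducibility.\<close>
  have E': "(s z * F z) ^ m + (\<Sum>i<m. A' i z * (s z * F z) ^ i * G z ^ (m - i)) = 0" if z: "z \<in> Z" for z
  proof (rule ccontr)
    assume "\<not> ?thesis"
    from irrD[OF irrZ pol(1) polE u0Z z r'u0 this] obtain w where
      "w \<in> Z" "r' w \<noteq> 0" "(s w * F w) ^ m + (\<Sum>i<m. A' i w * (s w * F w) ^ i * G w ^ (m - i)) \<noteq> 0" by blast
    then show False using E[of w] by simp
  qed
  \<comment> \<open>The neighbourhood consists of the cosets whose representative in the translated
    cell satisfies \<open>r' u \<noteq> 0\<close>; \<open>pt\<close> picks that cell element, which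
    is unique by \<open>cell_unique\<close>.\<close>
  define U' where "U' = {C \<in> lcosets\<^bsub>SL\<^esub> ?P. \<exists>u\<in>?cell. minv b ** u \<in> C \<and> r' u \<noteq> 0}"
  define pt where "pt C = (THE u. u \<in> ?cell \<and> minv b ** u \<in> C)" for C
  have pt: "pt (x <#\<^bsub>SL\<^esub> ?P) = u" if x: "det x = 1" and u: "u \<in> ?cell" "minv b ** u \<in> x <#\<^bsub>SL\<^esub> ?P" for x u
    unfolding pt_def
  proof (rule the_equality)
    show "u \<in> ?cell \<and> minv b ** u \<in> x <#\<^bsub>SL\<^esub> ?P" using u by blast
  next
    fix w assume w: "w \<in> ?cell \<and> minv b ** w \<in> x <#\<^bsub>SL\<^esub> ?P"
    obtain p q where pq: "p \<in> ?P" "q \<in> ?P" "minv b ** u = x ** p" "minv b ** w = x ** q"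
      using u(2) w unfolding lcoset_mem by blast
    have dp: "det p = 1" "det q = 1" using Pg(1) pq by auto
    have "u = b ** (x ** p)" "w = b ** (x ** q)"
      unfolding pq(3,4)[symmetric] by (simp_all add: minv_r_cancel[OF b(1)])
    then have "minv w ** u = minv q ** p"
      using b(1) x dp by (simp add: minv_mult det_mul matrix_mul_assoc[symmetric] minv_l_cancel)
    then have "minv w ** u \<in> ?P" using pq(1,2) Pg(3,4) by simp
    then show "w = u" using cell_unique[OF P _ u(1), of w] w by blast
  qed
  have cs: "minv b ** u <#\<^bsub>SL\<^esub> ?P = x <#\<^bsub>SL\<^esub> ?P" if x: "det x = 1" and u: "u \<in> ?cell" "minv b ** u \<in> x <#\<^bsub>SL\<^esub> ?P" for x u
  proof -
    obtain p where p: "p \<in> ?P" "minv b ** u = x ** p" using u(2) unfolding lcoset_mem by blast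
    have "minv x ** (minv b ** u) \<in> ?P" unfolding p(2) using p(1) by (simp add: minv_l_cancel[OF x])
    moreover have "det (minv b ** u) = 1" using du[OF u(1)] b(1) by (simp add: det_mul minv_det)
    ultimately show ?thesis using lcoset_eq_iff[OF Ps x, of "minv b ** u"] by simp
  qed
  have rat: "\<exists>H n. polynomial_fun H \<and> (\<forall>x. minors R x \<noteq> 0 \<longrightarrow> h (sec R x) = H x / minors R x ^ n)"
    if "polynomial_fun h" for h
    unfolding sec_def by (rule rational_substitution[OF that polynomial_fun_sec_num polynomial_fun_minors])
  obtain Hr nr where Hr: "polynomial_fun Hr" "\<And>x. minors R x \<noteq> 0 \<Longrightarrow> r' (sec R x) = Hr x / minors R x ^ nr"
    using rat[OF pol(1)] by blast
  have sec_pt: "sec R (b ** x) \<in> ?cell" "minv b ** sec R (b ** x) \<in> x <#\<^bsub>SL\<^esub> ?P"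
    if x: "det x = 1" "minors R (b ** x) \<noteq> 0" for x
  proof -
    have db: "det (b ** x) = 1" using b x by (simp add: det_mul)
    show "sec R (b ** x) \<in> ?cell" by (rule sec_in_cell(1)[OF R db x(2)])
    have "minv (b ** x) ** sec R (b ** x) \<in> ?P" by (rule sec_in_cell(2)[OF R db x(2)])
    moreover have "minv b ** sec R (b ** x) = x ** (minv (b ** x) ** sec R (b ** x))"
      using b(1) x(1) by (simp add: minv_mult matrix_mul_assoc[symmetric] minv_r_cancel)
    ultimately show "minv b ** sec R (b ** x) \<in> x <#\<^bsub>SL\<^esub> ?P" unfolding lcoset_mem by blast
  qed
  \<comment> \<open>On matrices the condition becomes the nonvanishing of one polynomial, since
    \<open>sec\<close> computes the cell element rationally.\<close>
  have preU': "pre ?P U' = {x. det x = 1 \<and> minors R (b ** x) * Hr (b ** x) \<noteq> 0}"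
  proof (intro subset_antisym subsetI)
    fix x assume "x \<in> pre ?P U'"
    then obtain u where u: "det x = 1" "u \<in> ?cell" "minv b ** u \<in> x <#\<^bsub>SL\<^esub> ?P" "r' u \<noteq> 0" by (auto simp: U'_def)
    obtain p where p: "p \<in> ?P" "minv b ** u = x ** p" using u(3) unfolding lcoset_mem by blast
    have "u = b ** (x ** p)" unfolding p(2)[symmetric] by (simp add: minv_r_cancel[OF b(1)])
    then have "b ** x = u ** minv p" using Pg(1)[OF p(1)] by (simp add: matrix_mul_assoc[symmetric] minv_r)
    then have mn: "minors R (b ** x) \<noteq> 0" using minors_cell[OF R u(2) Pg(4)[OF p(1)]] by simp
    have "sec R (b ** x) = u" using pt[OF u(1) sec_pt[OF u(1) mn]] pt[OF u(1-3)] by simp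
    then have "Hr (b ** x) \<noteq> 0" using Hr(2)[OF mn] u(4) by auto
    then show "x \<in> {x. det x = 1 \<and> minors R (b ** x) * Hr (b ** x) \<noteq> 0}" using mn u(1) by simp
  next
    fix x assume "x \<in> {x. det x = 1 \<and> minors R (b ** x) * Hr (b ** x) \<noteq> 0}"
    then have x: "det x = 1" "minors R (b ** x) \<noteq> 0" "Hr (b ** x) \<noteq> 0" by auto
    have "r' (sec R (b ** x)) \<noteq> 0" using Hr(2)[OF x(2)] x by simp
    then show "x \<in> pre ?P U'" using x(1) sec_pt[OF x(1,2)] by (auto simp: U'_def lcosets_SL)
  qed
  have "polynomial_fun (\<lambda>x. minors R (b ** x) * Hr (b ** x))"
    by (intro polynomial_fun.mult polynomial_fun_translate_left polynomial_fun_minors Hr(1))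
  from openin_zariski_nonvanishing[OF this] have opU': "openin zariski (pre ?P U')" unfolding preU' .
  then have U'op: "openin (coset_space ?P) U'" by (auto simp: openin_coset_pre U'_def)
  define V' where "V' = U' \<inter> Y"
  have V'op: "openin ?T V'" unfolding V'_def openin_subtopology using U'op by blast
  have yV': "?y \<in> V'"
  proof -
    have "minv b ** u0 \<in> ?y" using sec_pt(2)[OF g0(1,2)] by (simp add: u0_def)
    then show ?thesis unfolding V'_def U'_def using g0(1,3) u0(1) r'u0 by (auto simp: lcosets_SL)
  qed
  have V'D: "\<exists>u\<in>Z. u \<in> ?cell \<and> C = minv b ** u <#\<^bsub>SL\<^esub> ?P \<and> r' u \<noteq> 0 \<and> pt C = u" if C: "C \<in> V'" for C
  proof -
    obtain x u where x: "det x = 1" "C = x <#\<^bsub>SL\<^esub> ?P" "u \<in> ?cell" "minv b ** u \<in> C" "r' u \<noteq> 0" "C \<in> Y"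
      using C unfolding V'_def U'_def lcosets_SL by auto
    have "C = minv b ** u <#\<^bsub>SL\<^esub> ?P" using cs[OF x(1,3)] x(2,4) by simp
    moreover have "pt C = u" using pt[OF x(1,3)] x(2,4) by simp
    ultimately show ?thesis using x cellZ by metis
  qed
  have V'V: "V' \<subseteq> V"
  proof
    fix C assume "C \<in> V'"
    then obtain u where u: "u \<in> Z" "C = minv b ** u <#\<^bsub>SL\<^esub> ?P" "r' u \<noteq> 0" using V'D by blast
    then show "C \<in> V" using val(1)[OF Zin(1)[OF u(1)] u(3) Zin(2)[OF u(1)]] by simp
  qed
  have "\<exists>z\<in>Z. G z \<noteq> 0"
  proof (rule ccontr)
    assume n: "\<not> ?thesis"
    have "g C = 0" if "C \<in> V'" for C
    proof -
      obtain u where u: "u \<in> Z" "C = minv b ** u <#\<^bsub>SL\<^esub> ?P" "r' u \<noteq> 0" using V'D \<open>C \<in> V'\<close> by blast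
      then show ?thesis using val(3)[OF Zin(1)[OF u(1)] u(3) Zin(2)[OF u(1)]] n by simp
    qed
    then show False using gnz V'op yV' V'V by blast
  qed
  then obtain h where h: "polynomial_fun h" "\<And>z. z \<in> Z \<Longrightarrow> s z * F z = G z * h z"
    using Z[unfolded normset_def, THEN conjunct2, rule_format, of "\<lambda>z. s z * F z" G A' m] polsF pol(4) polA' E' by auto
  \<comment> \<open>From \<open>f = F / s\<close>, \<open>g = G / s\<close> and
    \<open>s F = G h\<close> the quotient of \<open>f\<close> by \<open>g\<close> is
    \<open>h / s\<close>.\<close>
  define hh where "hh C = h (pt C) / s (pt C)" for C
  obtain Hh nh where Hh: "polynomial_fun Hh" "\<And>x. minors R x \<noteq> 0 \<Longrightarrow> h (sec R x) = Hh x / minors R x ^ nh"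
    using rat[OF h(1)] by blast
  obtain Hs ns where Hs: "polynomial_fun Hs" "\<And>x. minors R x \<noteq> 0 \<Longrightarrow> s (sec R x) = Hs x / minors R x ^ ns"
    using rat[OF pol(2)] by blast
  have "regular_coset_space ?P U' hh"
    unfolding regular_coset_space_def
  proof (intro conjI U'op)
    let ?p = "\<lambda>x. Hh (b ** x) * minors R (b ** x) ^ ns" and ?q = "\<lambda>x. Hs (b ** x) * minors R (b ** x) ^ nh"
    have pq: "polynomial_fun ?p" "polynomial_fun ?q"
      by (intro polynomial_fun.mult polynomial_fun_power polynomial_fun_translate_left polynomial_fun_minors Hh(1) Hs(1))+
    have "?q x \<noteq> 0 \<and> hh (x <#\<^bsub>SL\<^esub> ?P) = ?p x / ?q x" if "x \<in> pre ?P U'" for x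
    proof -
      have x: "det x = 1" "minors R (b ** x) \<noteq> 0" "Hr (b ** x) \<noteq> 0" using that unfolding preU' by auto
      have sx: "r' (sec R (b ** x)) \<noteq> 0" using Hr(2)[OF x(2)] x by simp
      have "s (sec R (b ** x)) \<noteq> 0" using snz[OF du[OF sec_pt(1)[OF x(1,2)]] sx] .
      then have "Hs (b ** x) \<noteq> 0" using Hs(2)[OF x(2)] by auto
      moreover have "pt (x <#\<^bsub>SL\<^esub> ?P) = sec R (b ** x)" using pt[OF x(1) sec_pt[OF x(1,2)]] .
      ultimately show ?thesis using x(2) by (simp add: hh_def Hh(2) Hs(2))
    qed
    then show "regular_SL {g \<in> carrier SL. g <#\<^bsub>SL\<^esub> ?P \<in> U'} (\<lambda>g. hh (g <#\<^bsub>SL\<^esub> ?P))"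
      unfolding regular_SL_def using opU' pq
      by (intro conjI ballI exI[of _ "pre ?P U'"] exI[of _ ?p] exI[of _ ?q]) auto
  qed
  then have "?reg V' hh" unfolding regular_subvariety_def using V'op unfolding V'_def by blast
  moreover have "f C = g C * hh C" if C: "C \<in> V'" for C
  proof -
    obtain u where u: "u \<in> Z" "C = minv b ** u <#\<^bsub>SL\<^esub> ?P" "r' u \<noteq> 0" "pt C = u" using V'D C by blast
    have "s u \<noteq> 0" using snz Zin(1) u by blast
    then have "F u / s u = G u / s u * (h u / s u)" using h(2)[OF u(1)] by (simp add: field_simps)
    then show ?thesis using val(2,3)[OF Zin(1)[OF u(1)] u(3) Zin(2)[OF u(1)]] u by (simp add: hh_def)
  qed
  ultimately show "\<exists>V' h. openin ?T V' \<and> ?y \<in> V' \<and> V' \<subseteq> V \<and> ?reg V' h \<and> (\<forall>v\<in>V'. f v = g v * h v)"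
    using V'op yV' V'V by blast
qed

section \<open>Schubert varieties of $\mathbf{SL}_4$\<close>

lemma UNIV4: "(UNIV :: 4 set) = {0, 1, 2, 3}"
proof -
  have "{1, 2, 3, 4::4} = {0, 1, 2, 3}" by auto
  then show ?thesis by (simp only: UNIV_4)
qed

lemma exhaust4: "i = 0 \<or> i = 1 \<or> i = 2 \<or> i = (3::4)"
  using UNIV4 by auto

lemma all4: "(\<forall>i::4. P i) \<longleftrightarrow> P 0 \<and> P 1 \<and> P 2 \<and> P 3"
  using exhaust4 by metis

lemma sum4: "(\<Sum>i\<in>UNIV. f i) = f 0 + f 1 + f 2 + f (3::4)"
  unfolding UNIV4 by (simp add: add.assoc)

lemma prod4: "(\<Prod>i\<in>UNIV. f i) = f 0 * f 1 * f 2 * f (3::4)"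
  unfolding UNIV4 by (simp add: mult.assoc)

lemma Rep4: "Rep_bit0 (0::4) = 0" "Rep_bit0 (1::4) = 1" "Rep_bit0 (2::4) = 2" "Rep_bit0 (3::4) = 3"
  by (simp_all add: bit0.Rep_0 bit0.Rep_1 bit0.Rep_numeral)

lemma less4 [simp]:
  "(0::4) < 1" "(0::4) < 2" "(0::4) < 3" "(1::4) < 2" "(1::4) < 3" "(2::4) < 3"
  "\<not> (1::4) < 0" "\<not> (2::4) < 0" "\<not> (3::4) < 0" "\<not> (2::4) < 1" "\<not> (3::4) < 1" "\<not> (3::4) < 2"
  by (simp_all add: less_bit0_def Rep4)

lemma le4 [simp]:
  "(0::4) \<le> 1" "(0::4) \<le> 2" "(0::4) \<le> 3" "(1::4) \<le> 2" "(1::4) \<le> 3" "(2::4) \<le> 3"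
  "\<not> (1::4) \<le> 0" "\<not> (2::4) \<le> 0" "\<not> (3::4) \<le> 0" "\<not> (2::4) \<le> 1" "\<not> (3::4) \<le> 1" "\<not> (3::4) \<le> 2"
  by (simp_all add: less_eq_bit0_def Rep4)

lemma neq4:
  "(0::4) \<noteq> 1" "(0::4) \<noteq> 2" "(0::4) \<noteq> 3" "(1::4) \<noteq> 2" "(1::4) \<noteq> 3" "(2::4) \<noteq> 3"
  "(1::4) \<noteq> 0" "(2::4) \<noteq> 0" "(3::4) \<noteq> 0" "(2::4) \<noteq> 1" "(3::4) \<noteq> 1" "(3::4) \<noteq> 2"
  by simp_all

lemma zero_least4: "(0::4) \<le> i" and three_greatest4: "i \<le> (3::4)"
  using exhaust4[of i] by auto

lemma matrix4_eqI:
  fixes A B :: "complex^4^4"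
  assumes "\<forall>i j. A $ i $ j = B $ i $ j" shows "A = B"
  using assms by (simp add: vec_eq_iff)

text \<open>The flag of \<open>A\<close> is determined by its Pluecker coordinates: the entries of the first
  column, the $2\times2$ minors of the first two columns, and the $3\times3$ minors of the first three
  columns, which are up to sign the entries of the last row of the inverse.\<close>

definition p2 :: "complex^4^4 \<Rightarrow> 4 \<Rightarrow> 4 \<Rightarrow> complex" where
  "p2 A i j = A $ i $ 0 * A $ j $ 1 - A $ j $ 0 * A $ i $ 1"

text \<open>Bruhat order on pairs: the comparison of sorted pairs, expressed by a matching.\<close>

definition le2 :: "4 \<Rightarrow> 4 \<Rightarrow> 4 \<Rightarrow> 4 \<Rightarrow> bool" where
  "le2 i j a b \<longleftrightarrow> i \<le> a \<and> j \<le> b \<or> i \<le> b \<and> j \<le> a"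

text \<open>The coordinates required to vanish are those not below the ones of \<open>s\<close> in
  the Bruhat orders of the three Grassmannians. Entry \<open>m\<close> of the last row of the
  inverse is, up to sign, the minor with row \<open>m\<close> omitted, and taking complements
  reverses the order; hence \<open>m < s 3\<close>.\<close>

definition schub :: "(4 \<Rightarrow> 4) \<Rightarrow> (complex^4^4) set" where
  "schub s = {A. det A = 1 \<and> (\<forall>i. s 0 < i \<longrightarrow> A $ i $ 0 = 0) \<and>
     (\<forall>i j. i \<noteq> j \<and> \<not> le2 i j (s 0) (s 1) \<longrightarrow> p2 A i j = 0) \<and> (\<forall>m. m < s 3 \<longrightarrow> minv A $ 3 $ m = 0)}"

lemma p2_mult_left:
  "p2 (b ** A) i j = (\<Sum>k\<in>UNIV. \<Sum>l\<in>UNIV. b $ i $ k * b $ j $ l * p2 A k l)"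
proof -
  have "p2 (b ** A) i j = (\<Sum>k\<in>UNIV. b $ i $ k * A $ k $ 0) * (\<Sum>l\<in>UNIV. b $ j $ l * A $ l $ 1)
     - (\<Sum>l\<in>UNIV. b $ j $ l * A $ l $ 0) * (\<Sum>k\<in>UNIV. b $ i $ k * A $ k $ 1)"
    by (simp add: p2_def mult_entry)
  also have "\<dots> = (\<Sum>k\<in>UNIV. \<Sum>l\<in>UNIV. b $ i $ k * b $ j $ l * p2 A k l)"
    unfolding sum_product
    by (subst (2) sum.swap) (simp add: sum_subtractf[symmetric] p2_def algebra_simps)
  finally show ?thesis .
qed

lemma p2_self [simp]: "p2 A k k = 0"
  by (simp add: p2_def)

lemma upper_right:
  assumes b: "b \<in> pat (\<le>)"
  shows "(A ** b) $ i $ 0 = A $ i $ 0 * b $ 0 $ 0"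
    and "p2 (A ** b) i j = b $ 0 $ 0 * b $ 1 $ 1 * p2 A i j"
    and "det A = 1 \<Longrightarrow> minv (A ** b) $ 3 $ m = minv b $ 3 $ 3 * minv A $ 3 $ m"
    and "b $ 0 $ 0 \<noteq> 0" "b $ 1 $ 1 \<noteq> 0" "minv b $ 3 $ 3 \<noteq> 0"
proof -
  have z: "X $ i $ j = 0" if "X \<in> pat (\<le>)" "j < i" for X :: "complex^4^4" and i j
    using that by (auto simp: pat_def palg_def)
  have d: "det b = 1" using b by (simp add: pat_def)
  have b': "minv b \<in> pat (\<le>)" using pat_minv[OF preorder_le b] .
  show 1: "(A ** b) $ i $ 0 = A $ i $ 0 * b $ 0 $ 0" for i
    by (simp add: mult_entry sum4 z[OF b])
  show "p2 (A ** b) i j = b $ 0 $ 0 * b $ 1 $ 1 * p2 A i j"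
    by (simp add: p2_def mult_entry sum4 z[OF b] algebra_simps)
  show "minv (A ** b) $ 3 $ m = minv b $ 3 $ 3 * minv A $ 3 $ m" if "det A = 1"
    using that d by (simp add: minv_mult mult_entry sum4 z[OF b'])
  have e: "det X = X $ 0 $ 0 * X $ 1 $ 1 * X $ 2 $ 2 * X $ 3 $ 3" if "X \<in> pat (\<le>)" for X :: "complex^4^4"
    by (subst det_upperdiagonal) (simp_all add: z[OF that] prod4)
  show "b $ 0 $ 0 \<noteq> 0" "b $ 1 $ 1 \<noteq> 0" using e[OF b] d by auto
  show "minv b $ 3 $ 3 \<noteq> 0" using e[OF b'] minv_det[OF d] by auto
qed

lemma schub_right:
  assumes "A \<in> schub s" "b \<in> pat (\<le>)" shows "A ** b \<in> schub s"
  using assms patD(1)[OF assms(2)] by (auto simp: schub_def upper_right det_mul)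

text \<open>An upper triangular row operation brings in only coordinates with larger row sets, and
  the vanishing conditions are closed upwards.\<close>

lemma schub_left:
  assumes A: "A \<in> schub s" and b: "b \<in> pat (\<le>)" shows "b ** A \<in> schub s"
  unfolding schub_def
proof (intro CollectI conjI allI impI)
  have dA: "det A = 1" using A by (simp add: schub_def)
  show "det (b ** A) = 1" using dA patD(1)[OF b] by (simp add: det_mul)
  have bz: "b $ i $ k = 0" if "\<not> i \<le> k" for i k using palgD0[OF patD(2)[OF b] that] .
  have bz': "minv b $ i $ k = 0" if "\<not> i \<le> k" for i k using palgD0[OF patD(2)[OF pat_minv[OF preorder_le b]] that] .
  show "(b ** A) $ i $ 0 = 0" if "s 0 < i" for i
    unfolding mult_entry
  proof (intro sum.neutral ballI)
    fix k show "b $ i $ k * A $ k $ 0 = 0"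
      using bz[of i k] A that by (cases "i \<le> k") (auto simp: schub_def)
  qed
  show "p2 (b ** A) i j = 0" if ij: "i \<noteq> j \<and> \<not> le2 i j (s 0) (s 1)" for i j
    unfolding p2_mult_left
  proof (intro sum.neutral ballI)
    fix k l show "b $ i $ k * b $ j $ l * p2 A k l = 0"
    proof (cases "i \<le> k \<and> j \<le> l \<and> k \<noteq> l")
      case True
      then have "\<not> le2 k l (s 0) (s 1)" using ij unfolding le2_def by (meson order_trans)
      then show ?thesis using A True by (auto simp: schub_def)
    next
      case False
      then show ?thesis using bz by auto
    qed
  qed
  show "minv (b ** A) $ 3 $ m = 0" if "m < s 3" for m
    unfolding minv_mult[OF patD(1)[OF b] dA] mult_entry
  proof (intro sum.neutral ballI)
    fix k show "minv A $ 3 $ k * minv b $ k $ m = 0"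
      using bz'[of k m] A that by (cases "k \<le> m") (auto simp: schub_def)
  qed
qed

lemma closedin_schub: "closedin zariski (schub s)"
proof (rule closedin_zariskiI)
  show "det A = 1" if "A \<in> schub s" for A using that by (simp add: schub_def)
  fix A :: "complex^4^4" assume A: "det A = 1" "A \<notin> schub s"
  consider i where "s 0 < i" "A $ i $ 0 \<noteq> 0" | i j where "i \<noteq> j \<and> \<not> le2 i j (s 0) (s 1)" "p2 A i j \<noteq> 0"
    | m where "m < s 3" "cofac A 3 m \<noteq> 0" using A by (auto simp: schub_def minv_cofac)
  then show "\<exists>p. polynomial_fun p \<and> (\<forall>B\<in>schub s. p B = 0) \<and> p A \<noteq> 0"
  proof cases
    case (1 i)
    then show ?thesis by (intro exI[of _ "\<lambda>A. A $ i $ 0"]) (auto simp: schub_def intro: polynomial_fun.entry)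
  next
    case (2 i j)
    have "polynomial_fun (\<lambda>A. p2 A i j)"
      unfolding p2_def by (intro polynomial_fun_diff polynomial_fun.mult polynomial_fun.entry)
    then show ?thesis using 2 by (intro exI[of _ "\<lambda>A. p2 A i j"]) (auto simp: schub_def)
  next
    case (3 m)
    have "polynomial_fun (\<lambda>A :: complex^4^4. cofac A 3 m)"
      by (rule polynomial_fun_cofac) (rule polynomial_fun.entry)
    then show ?thesis using 3 by (intro exI[of _ "\<lambda>A. cofac A 3 m"]) (auto simp: schub_def minv_cofac)
  qed
qed

subsection \<open>Bruhat cells\<close>

lemma monomial_minv:
  assumes n: "monomial n s"
  shows "minv n $ j $ i = (if i = s j then 1 / n $ i $ j else 0)"
proof -
  note m = monomialD[OF n]
  have nz: "n $ s j $ j \<noteq> 0" for j using m(3) by blast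
  have "((\<chi> j i. if i = s j then 1 / n $ i $ j else 0) ** n) $ a $ b = mat 1 $ a $ b" for a b
  proof -
    have "((\<chi> j i. if i = s j then 1 / n $ i $ j else 0) ** n) $ a $ b = 1 / n $ s a $ a * n $ s a $ b"
      unfolding mult_entry by (simp add: if_distrib[of "\<lambda>x. x * _"] cong: if_cong)
    also have "\<dots> = mat 1 $ a $ b" using nz[of a] m(2) m(3)[of "s a" b] by (auto simp: mat_def dest: bij_is_inj injD)
    finally show ?thesis .
  qed
  then have "minv n = (\<chi> j i. if i = s j then 1 / n $ i $ j else 0)"
    by (intro minv_unique[OF m(1)]) (simp add: vec_eq_iff)
  then show ?thesis by simp
qed

lemma monomial_p2:
  assumes n: "monomial n s"
  shows "p2 n i j \<noteq> 0 \<longleftrightarrow> i = s 0 \<and> j = s 1 \<or> j = s 0 \<and> i = s 1"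
proof -
  note m = monomialD[OF n]
  have e: "n $ i $ j = (if i = s j then n $ s j $ j else 0)" for i j using m(3)[of i j] by auto
  have nz: "n $ s j $ j \<noteq> 0" for j using m(3) by blast
  have "s 0 \<noteq> s 1" using m(2) by (metis bij_is_inj injD neq4(1))
  then show ?thesis using nz[of 0] nz[of 1] unfolding p2_def e[of i 0] e[of i 1] e[of j 0] e[of j 1] by auto
qed

lemma monomial_schub:
  assumes n: "monomial n s" shows "n \<in> schub s"
  unfolding schub_def
proof (intro CollectI conjI allI impI)
  show "det n = 1" using monomialD(1)[OF n] .
  show "n $ i $ 0 = 0" if "s 0 < i" for i using monomialD(3)[OF n, of i 0] that by auto
  show "p2 n i j = 0" if "i \<noteq> j \<and> \<not> le2 i j (s 0) (s 1)" for i j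
    using monomial_p2[OF n, of i j] that by (auto simp: le2_def)
  show "minv n $ 3 $ m = 0" if "m < s 3" for m
    using that by (simp add: monomial_minv[OF n])
qed

lemma bij_agree4:
  assumes "bij s" "bij t" "s 0 = t 0" "s 1 = t 1" "s 3 = t (3::4)" shows "s = (t :: 4 \<Rightarrow> 4)"
proof -
  obtain k where k: "t k = s 2" using assms(2) by (metis bij_pointE)
  have "k = 2" using exhaust4[of k] k assms(1,3,4,5) by (metis bij_is_inj injD neq4)
  then have "s i = t i" for i using exhaust4[of i] k assms(3-5) by auto
  then show ?thesis by auto
qed

text \<open>Let \<open>t\<close> be the permutation of the Bruhat cell of \<open>A\<close>.
  Membership in \<open>schub s\<close> bounds its coordinates by those of \<open>s\<close>, the
  three nonvanishing conditions give the reverse bounds, and the coordinates determine the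
  permutation.\<close>

lemma schub_cell:
  assumes A: "A \<in> schub s" and s: "bij s"
    and nz: "A $ s 0 $ 0 \<noteq> 0" "p2 A (s 0) (s 1) \<noteq> 0" "minv A $ 3 $ s 3 \<noteq> 0"
  obtains b n b' where "b \<in> pat (\<le>)" "b' \<in> pat (\<le>)" "monomial n s" "A = b ** n ** b'"
proof -
  have dA: "det A = 1" using A by (simp add: schub_def)
  obtain b n b' t where br: "b \<in> pat (\<le>)" "b' \<in> pat (\<le>)" "monomial n t" "A = b ** n ** b'"
    by (rule bruhat[OF dA])
  note m = monomialD[OF br(3)]
  have db: "det b = 1" "det b' = 1" using br by (auto simp: pat_def)
  have bz: "b $ i $ k = 0" if "\<not> i \<le> k" for i k using palgD0[OF patD(2)[OF br(1)] that] .
  have bz': "minv b $ i $ k = 0" if "\<not> i \<le> k" for i k using palgD0[OF patD(2)[OF pat_minv[OF preorder_le br(1)]] that] .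
  have "n = minv b ** A ** minv b'" unfolding br(4)
    using db by (simp add: matrix_mul_assoc[symmetric] minv_l_cancel minv_r)
  then have nX: "n \<in> schub s" using schub_right schub_left A pat_minv[OF preorder_le] br(1,2) by metis
  have tn: "t 0 \<noteq> t 1" "s 0 \<noteq> s 1" using m(2) s by (metis bij_is_inj injD neq4(1))+
  have "n $ t 0 $ 0 \<noteq> 0" using m(3) by blast
  then have 1: "t 0 \<le> s 0" using nX by (force simp: schub_def)
  have "p2 n (t 0) (t 1) \<noteq> 0" using monomial_p2[OF br(3)] by blast
  then have 2: "le2 (t 0) (t 1) (s 0) (s 1)" using nX tn by (auto simp: schub_def)
  have "minv n $ 3 $ t 3 \<noteq> 0" using monomial_minv[OF br(3)] m(3) by simp
  then have 3: "s 3 \<le> t 3" using nX by (force simp: schub_def)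
  have "(b ** n) $ s 0 $ 0 \<noteq> 0" using nz(1) upper_right(1)[OF br(2)] unfolding br(4) by simp
  then obtain k where "b $ s 0 $ k \<noteq> 0" "n $ k $ 0 \<noteq> 0" by (rule mult_entry_nonzero)
  then have 4: "s 0 \<le> t 0" using bz m(3) by metis
  have "p2 (b ** n) (s 0) (s 1) \<noteq> 0" using nz(2) upper_right(2)[OF br(2)] unfolding br(4) by simp
  then obtain k l where "b $ s 0 $ k * b $ s 1 $ l * p2 n k l \<noteq> 0"
    unfolding p2_mult_left by (meson sum.not_neutral_contains_not_neutral)
  then have "s 0 \<le> k" "s 1 \<le> l" "k = t 0 \<and> l = t 1 \<or> l = t 0 \<and> k = t 1"
    using bz monomial_p2[OF br(3)] by (metis mult_zero_left mult_zero_right)+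
  then have 5: "le2 (s 0) (s 1) (t 0) (t 1)" by (auto simp: le2_def)
  have "minv (b ** n) $ 3 $ s 3 \<noteq> 0"
    using nz(3) upper_right(3)[OF br(2), of "b ** n"] db m(1) unfolding br(4) by (auto simp: det_mul)
  then have "(minv n ** minv b) $ 3 $ s 3 \<noteq> 0" using db m(1) by (simp add: minv_mult)
  then obtain k where "minv n $ 3 $ k \<noteq> 0" "minv b $ k $ s 3 \<noteq> 0" by (rule mult_entry_nonzero)
  then have 6: "t 3 \<le> s 3" using bz'[of k "s 3"] monomial_minv[OF br(3)] by (metis)
  have "t 0 = s 0" "t 3 = s 3" using 1 3 4 6 by auto
  moreover have "t 1 = s 1" using 2 5 \<open>t 0 = s 0\<close> unfolding le2_def by (auto dest: order_antisym)
  ultimately have "t = s" using bij_agree4[OF m(2) s] by auto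
  then show ?thesis using that br by blast
qed

subsection \<open>Every orbit meets the opposite cell\<close>

lemma minors4:
  assumes d: "det A = 1" and nz: "A $ 0 $ 0 \<noteq> 0" "p2 A 0 1 \<noteq> 0" "minv A $ 3 $ 3 \<noteq> 0"
  shows "minors (\<le>) A \<noteq> 0"
proof -
  have ker: "det M \<noteq> 0" if "\<And>v. M *v v = 0 \<Longrightarrow> v = 0" for M :: "complex^4^4"
    using that matrix_left_invertible_ker[of M] by (auto simp: invertible_det_nz[symmetric] invertible_left_inverse)
  have mv: "(M *v v) $ i = M $ i $ 0 * v $ 0 + M $ i $ 1 * v $ 1 + M $ i $ 2 * v $ 2 + M $ i $ 3 * v $ 3"
    for M :: "complex^4^4" and v i by (simp add: matrix_vector_mult_def sum4)
  have "det (truncate (\<le>) 0 A) \<noteq> 0"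
  proof (rule ker)
    fix v assume "truncate (\<le>) 0 A *v v = 0"
    then have "(truncate (\<le>) 0 A *v v) $ i = 0" for i by simp
    from this[of 0] this[of 1] this[of 2] this[of 3] show "v = 0"
      using nz(1) unfolding mv by (simp add: truncate_def vec_eq_iff all4)
  qed
  moreover have "det (truncate (\<le>) 1 A) \<noteq> 0"
  proof (rule ker)
    fix v assume "truncate (\<le>) 1 A *v v = 0"
    then have e: "(truncate (\<le>) 1 A *v v) $ i = 0" for i by simp
    have 1: "A $ 0 $ 0 * v $ 0 + A $ 0 $ 1 * v $ 1 = 0" "A $ 1 $ 0 * v $ 0 + A $ 1 $ 1 * v $ 1 = 0"
      using e[of 0] e[of 1] unfolding mv by (simp_all add: truncate_def)
    have "p2 A 0 1 * v $ 0 = 0" "p2 A 0 1 * v $ 1 = 0" using 1 unfolding p2_def by algebra+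
    then have "v $ 0 = 0" "v $ 1 = 0" using nz(2) by auto
    then show "v = 0" using e[of 2] e[of 3] unfolding mv by (simp add: truncate_def vec_eq_iff all4)
  qed
  moreover have "truncate (\<le>) 2 A = (\<chi> k l. if l = 3 then (if k = 3 then 1 else 0) else A $ k $ l)"
    by (simp add: truncate_def vec_eq_iff all4)
  then have "det (truncate (\<le>) 2 A) \<noteq> 0" using nz(3) minv_cofac[OF d, of 3 3] by (simp add: cofac_def)
  moreover have "truncate (\<le>) 3 A = A" by (simp add: truncate_def vec_eq_iff all4)
  ultimately show ?thesis using d unfolding minors_def prod4 by simp
qed

definition nu :: "4 \<Rightarrow> complex" where
  "nu i = (if i = 0 then 0 else if i = 1 then 1 else if i = 2 then 2 else 3)"

definition sgn4 :: "4 \<Rightarrow> complex" where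
  "sgn4 i = (if i = 0 \<or> i = 2 then 1 else - 1)"

text \<open>All maximal minors of the top rows of the Pascal matrix are nonzero, so multiplying by it
  moves every Bruhat cell into general position.\<close>

definition pascal :: "complex^4^4" where
  "pascal = (\<chi> i j. if i = 0 then 1 else if i = 1 then nu j else if i = 2 then nu j * (nu j - 1) / 2
     else nu j * (nu j - 1) * (nu j - 2) / 6)"

lemma pascal_upper: "pascal \<in> pat (\<le>)"
proof -
  have z: "pascal $ i $ j = 0" if "j < i" for i j
    using that exhaust4[of i] exhaust4[of j] by (auto simp: pascal_def nu_def)
  have "det pascal = 1"
    by (subst det_upperdiagonal) (simp_all add: z prod4, simp add: pascal_def nu_def)
  then show ?thesis using z by (auto simp: pat_def palg_def not_le)
qed

text \<open>Binomial inversion: the entries are the binomial coefficients \<open>j\<close> over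
  \<open>i\<close>, and \<open>sgn4\<close> is the alternating sign.\<close>

lemma minv_pascal: "minv pascal = (\<chi> i j. sgn4 i * sgn4 j * pascal $ i $ j)"
proof (rule minv_unique)
  show "det pascal = 1" using pascal_upper by (simp add: pat_def)
  show "(\<chi> i j. sgn4 i * sgn4 j * pascal $ i $ j) ** pascal = mat 1"
    by (simp add: vec_eq_iff all4 mult_entry sum4 mat_def pascal_def sgn4_def nu_def)
qed

lemma minv_pascal_nonzero: "minv pascal $ k $ 3 \<noteq> 0"
  using exhaust4[of k] unfolding minv_pascal by (auto simp: pascal_def sgn4_def nu_def)

text \<open>Once the left Bruhat factor is removed, only the columns of the Pascal matrix selected
  by \<open>s\<close> matter. Up to nonzero factors the three coordinates become an entry of its
  first row, a difference of two distinct numbers, and an entry of the last column of its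
  inverse.\<close>

lemma minors_ex:
  fixes A :: "complex^4^4"
  assumes A: "det A = 1"
  shows "\<exists>b\<in>pat (\<le>). minors (\<le>) (b ** A) \<noteq> 0"
proof -
  note Bg = subgroup_SLD[OF subgroup_pat[OF preorder_le]]
  obtain b n b' s where br: "b \<in> pat (\<le>)" "b' \<in> pat (\<le>)" "monomial n s" "A = b ** n ** b'"
    by (rule bruhat[OF A])
  note m = monomialD[OF br(3)]
  have e: "n $ i $ j = (if i = s j then n $ s j $ j else 0)" for i j using m(3)[of i j] by auto
  have nz: "n $ s j $ j \<noteq> 0" for j using m(3) by blast
  have dp: "det pascal = 1" and db: "det b = 1" using pascal_upper br(1) by (auto simp: pat_def)
  have pn: "(pascal ** n) $ i $ j = pascal $ i $ s j * n $ s j $ j" for i j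
  proof -
    have "(pascal ** n) $ i $ j = (\<Sum>k\<in>UNIV. if k = s j then pascal $ i $ s j * n $ s j $ j else 0)"
      unfolding mult_entry by (intro sum.cong refl) (subst e, simp)
    then show ?thesis by simp
  qed
  have "s 0 \<noteq> s 1" using m(2) by (metis bij_is_inj injD neq4(1))
  then have nu: "nu (s 1) - nu (s 0) \<noteq> 0" using exhaust4[of "s 0"] exhaust4[of "s 1"] by (auto simp: nu_def)
  have "minors (\<le>) (pascal ** n ** b') \<noteq> 0"
  proof (rule minors4)
    show "det (pascal ** n ** b') = 1" using dp m(1) br(2) by (simp add: det_mul pat_def)
    show "(pascal ** n ** b') $ 0 $ 0 \<noteq> 0"
      using nz[of 0] upper_right(4)[OF br(2)] unfolding upper_right(1)[OF br(2)] pn by (simp add: pascal_def)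
    have "p2 (pascal ** n) 0 1 = n $ s 0 $ 0 * n $ s 1 $ 1 * (nu (s 1) - nu (s 0))"
      unfolding p2_def pn by (simp add: pascal_def algebra_simps)
    then show "p2 (pascal ** n ** b') 0 1 \<noteq> 0"
      using nz nu upper_right(4,5)[OF br(2)] unfolding upper_right(2)[OF br(2)] by simp
    have "minv (pascal ** n) $ 3 $ 3 = (\<Sum>k\<in>UNIV. if k = s 3 then 1 / n $ s 3 $ 3 * minv pascal $ s 3 $ 3 else 0)"
      unfolding minv_mult[OF dp m(1)] mult_entry by (intro sum.cong refl) (simp add: monomial_minv[OF br(3)])
    also have "\<dots> = 1 / n $ s 3 $ 3 * minv pascal $ s 3 $ 3" by simp
    finally have "minv (pascal ** n) $ 3 $ 3 \<noteq> 0"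
      using nz[of 3] minv_pascal_nonzero by simp
    then show "minv (pascal ** n ** b') $ 3 $ 3 \<noteq> 0"
      using upper_right(6)[OF br(2)] upper_right(3)[OF br(2), of "pascal ** n"] dp m(1) by (simp add: det_mul)
  qed
  moreover have "(pascal ** minv b) ** A = pascal ** n ** b'"
    unfolding br(4) using db by (simp add: matrix_mul_assoc[symmetric] minv_l_cancel)
  moreover have "pascal ** minv b \<in> pat (\<le>)" by (intro Bg(3,4) pascal_upper br(1))
  ultimately show ?thesis by metis
qed

text \<open>The columns kept by \<open>truncate R j\<close> form an initial segment, so every
  truncation for \<open>R\<close> already occurs for \<open>(\<le>)\<close>.\<close>

lemma minors_upper_rel:
  fixes R :: "'n \<Rightarrow> 'n::{finite,linorder} \<Rightarrow> bool"
  assumes R: "upper_rel R" and m: "minors (\<le>) g \<noteq> 0"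
  shows "minors R g \<noteq> 0"
proof -
  have "det (truncate R j g) \<noteq> 0" for j
  proof -
    define e where "e = Max {l. R l j}"
    have fin: "finite {l. R l j}" "{l. R l j} \<noteq> {}" using preorder_refl[OF upper_relD(1)[OF R]] by auto
    have "R e j" using Max_in[OF fin] by (simp add: e_def)
    then have *: "R l j \<longleftrightarrow> l \<le> e" for l
      using Max_ge[OF fin(1), of l, folded e_def] preorder_trans[OF upper_relD(1)[OF R], of l e j] upper_relD(2)[OF R, of l e]
      by blast
    have "truncate R j g = truncate (\<le>) e g" unfolding truncate_def by (simp only: *)
    then show ?thesis using m by (simp add: minors_def)
  qed
  then show ?thesis by (simp add: minors_def)
qed

lemma schub_cell_decompose:
  assumes A: "A \<in> schub s"
  shows "\<exists>b\<in>pat (\<le>). \<exists>z\<in>schub s \<inter> rad (\<lambda>i j. j \<le> i). \<exists>b'\<in>pat (\<le>). A = b ** z ** b'"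
proof -
  note Bg = subgroup_SLD[OF subgroup_pat[OF preorder_le]]
  have dA: "det A = 1" using A by (simp add: schub_def)
  obtain b where b: "b \<in> pat (\<le>)" "minors (\<le>) (b ** A) \<noteq> 0" using minors_ex[OF dA] by blast
  have db: "det b = 1" using b by (simp add: pat_def)
  have dbA: "det (b ** A) = 1" using db dA by (simp add: det_mul)
  define z where "z = sec (\<le>) (b ** A)"
  define p where "p = minv (b ** A) ** z"
  have z: "z \<in> rad (\<lambda>i j. j \<le> i)" and p: "p \<in> pat (\<le>)"
    unfolding p_def z_def using sec_in_cell[OF upper_le dbA b(2)] by auto
  have zp: "z = b ** A ** p" by (simp add: p_def minv_r_cancel[OF dbA])
  have "b ** A ** p \<in> schub s" by (intro schub_right schub_left A b(1) p)
  then have "z \<in> schub s" using zp by simp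
  moreover have "minv b ** z ** minv p = A"
    by (subst zp) (use db Bg(1)[OF p] in \<open>simp add: matrix_mul_assoc[symmetric] minv_l_cancel minv_r\<close>)
  ultimately show ?thesis using z Bg(4)[OF b(1)] Bg(4)[OF p] by (metis IntI)
qed

lemma irr_schub:
  assumes "irr (schub s \<inter> rad (\<lambda>i j. j \<le> i))" shows "irr (schub s)"
proof -
  let ?B = "pat (\<le>) :: (complex^4^4) set" and ?Z = "schub s \<inter> rad (\<lambda>i j. j \<le> i)"
  have "schub s = {X ** Y | X Y. X \<in> {b ** z | b z. b \<in> ?B \<and> z \<in> ?Z} \<and> Y \<in> ?B}"
  proof (intro subset_antisym subsetI)
    fix A assume "A \<in> schub s"
    then show "A \<in> {X ** Y | X Y. X \<in> {b ** z | b z. b \<in> ?B \<and> z \<in> ?Z} \<and> Y \<in> ?B}"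
      using schub_cell_decompose[of A s] by blast
  qed (auto intro: schub_left schub_right)
  moreover have "irr {X ** Y | X Y. X \<in> {b ** z | b z. b \<in> ?B \<and> z \<in> ?Z} \<and> Y \<in> ?B}"
    by (intro irr_mult irr_pat preorder_le assms)
  ultimately show ?thesis by simp
qed

subsection \<open>The intersection with the opposite cell\<close>

definition uni :: "(nat \<Rightarrow> complex) \<Rightarrow> complex^4^4" where
  "uni x = (\<chi> i j. if i = j then 1 else if i = 1 \<and> j = 0 then x 0 else if i = 2 \<and> j = 0 then x 1
     else if i = 3 \<and> j = 0 then x 2 else if i = 2 \<and> j = 1 then x 3 else if i = 3 \<and> j = 1 then x 4
     else if i = 3 \<and> j = 2 then x 5 else 0)"

definition coords :: "nat \<Rightarrow> complex^4^4 \<Rightarrow> complex" where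
  "coords i A = [A $ 1 $ 0, A $ 2 $ 0, A $ 3 $ 0, A $ 2 $ 1, A $ 3 $ 1, A $ 3 $ 2] ! i"

lemma less6: "i < 6 \<longleftrightarrow> i = 0 \<or> i = 1 \<or> i = 2 \<or> i = 3 \<or> i = 4 \<or> i = (5::nat)"
  by auto

lemma uni_cong:
  assumes "\<And>i. i < 6 \<Longrightarrow> x i = y i" shows "uni x = uni y"
  using assms[of 0] assms[of 1] assms[of 2] assms[of 3] assms[of 4] assms[of 5]
  by (auto simp: uni_def vec_eq_iff)

lemma coords_uni: "i < 6 \<Longrightarrow> coords i (uni x) = x i"
  by (auto simp: less6 coords_def uni_def)

lemma uni_rad: "uni x \<in> rad (\<lambda>i j. j \<le> i)"
proof -
  have "uni x - mat 1 \<in> palg (>)" by (simp add: palg_def all4 uni_def mat_def)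
  then have "det (uni x) = 1" by (rule det_lower_unitriangular)
  then show ?thesis by (simp add: rad_def palg_def all4 uni_def mat_def)
qed

lemma rad_uni: "A \<in> rad (\<lambda>i j. j \<le> i) \<Longrightarrow> A = uni (\<lambda>i. coords i A)"
  by (simp add: rad_def palg_def all4 uni_def mat_def vec_eq_iff coords_def)

lemma minv_uni:
  "minv (uni x) = uni (\<lambda>i. [- x 0, x 0 * x 3 - x 1, - x 2 + x 0 * x 4 + x 1 * x 5 - x 0 * x 3 * x 5,
     - x 3, x 3 * x 5 - x 4, - x 5] ! i)"
proof (rule minv_unique)
  show "det (uni x) = 1" using uni_rad by (simp add: rad_def)
qed (simp add: vec_eq_iff all4 mult_entry sum4 mat_def uni_def algebra_simps)

text \<open>The conditions of \<open>schub\<close> evaluated on \<open>uni x\<close>, with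
  \<open>a\<close>, \<open>b\<close>, \<open>c\<close> the values of \<open>s\<close> at 0, 1, 3.
  The pair (0,1) is absent because its minor is 1 and always permitted; the last three equations
  come from the last row in \<open>minv_uni\<close>.\<close>

definition cell_eqs :: "4 \<Rightarrow> 4 \<Rightarrow> 4 \<Rightarrow> (nat \<Rightarrow> complex) \<Rightarrow> bool" where
  "cell_eqs a b c x \<longleftrightarrow> (a < 1 \<longrightarrow> x 0 = 0) \<and> (a < 2 \<longrightarrow> x 1 = 0) \<and> (a < 3 \<longrightarrow> x 2 = 0) \<and>
     (\<not> le2 0 2 a b \<longrightarrow> x 3 = 0) \<and> (\<not> le2 0 3 a b \<longrightarrow> x 4 = 0) \<and> (\<not> le2 1 2 a b \<longrightarrow> x 0 * x 3 = x 1) \<and>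
     (\<not> le2 1 3 a b \<longrightarrow> x 0 * x 4 = x 2) \<and> (\<not> le2 2 3 a b \<longrightarrow> x 1 * x 4 = x 2 * x 3) \<and>
     (0 < c \<longrightarrow> x 0 * x 4 + x 1 * x 5 - x 0 * x 3 * x 5 = x 2) \<and> (1 < c \<longrightarrow> x 3 * x 5 = x 4) \<and> (2 < c \<longrightarrow> x 5 = 0)"

lemma le2_01: "a \<noteq> b \<Longrightarrow> le2 0 1 a b \<and> le2 1 0 a b"
  using exhaust4[of a] exhaust4[of b] by (auto simp: le2_def)

lemma le2_sym: "le2 j i a b \<longleftrightarrow> le2 i j a b"
  by (auto simp: le2_def)

lemma uni_schub:
  assumes "s 0 \<noteq> s 1"
  shows "uni x \<in> schub s \<longleftrightarrow> cell_eqs (s 0) (s 1) (s 3) x"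
proof -
  have d: "det (uni x) = 1" using uni_rad[of x] by (simp add: rad_def)
  have 1: "(\<forall>i. s 0 < i \<longrightarrow> uni x $ i $ 0 = 0) \<longleftrightarrow> (s 0 < 1 \<longrightarrow> x 0 = 0) \<and> (s 0 < 2 \<longrightarrow> x 1 = 0) \<and> (s 0 < 3 \<longrightarrow> x 2 = 0)"
    using zero_least4[of "s 0"] unfolding all4 by (auto simp: uni_def)
  have 2: "(\<forall>i j. i \<noteq> j \<and> \<not> le2 i j (s 0) (s 1) \<longrightarrow> p2 (uni x) i j = 0) \<longleftrightarrow>
     (\<not> le2 0 2 (s 0) (s 1) \<longrightarrow> x 3 = 0) \<and> (\<not> le2 0 3 (s 0) (s 1) \<longrightarrow> x 4 = 0) \<and> (\<not> le2 1 2 (s 0) (s 1) \<longrightarrow> x 0 * x 3 = x 1) \<and>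
     (\<not> le2 1 3 (s 0) (s 1) \<longrightarrow> x 0 * x 4 = x 2) \<and> (\<not> le2 2 3 (s 0) (s 1) \<longrightarrow> x 1 * x 4 = x 2 * x 3)"
    unfolding all4 using le2_01[OF assms]
    by (simp add: le2_sym[of 2 0] le2_sym[of 3 0] le2_sym[of 2 1] le2_sym[of 3 1] le2_sym[of 3 2] p2_def uni_def)
      (auto simp: algebra_simps)
  have 3: "(\<forall>m. m < s 3 \<longrightarrow> minv (uni x) $ 3 $ m = 0) \<longleftrightarrow>
     (0 < s 3 \<longrightarrow> x 0 * x 4 + x 1 * x 5 - x 0 * x 3 * x 5 = x 2) \<and> (1 < s 3 \<longrightarrow> x 3 * x 5 = x 4) \<and> (2 < s 3 \<longrightarrow> x 5 = 0)"
    using three_greatest4[of "s 3"] unfolding all4 minv_uni by (auto simp: uni_def algebra_simps not_less)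
  show ?thesis unfolding schub_def cell_eqs_def using d 1 2 3 by simp
qed

lemma pfun_uni:
  assumes "\<And>i. i < 6 \<Longrightarrow> pfun (\<lambda>x. r x i)"
  shows "pfun (\<lambda>x. uni (r x) $ i $ j)"
  using exhaust4[of i] exhaust4[of j] assms[of 0] assms[of 1] assms[of 2] assms[of 3] assms[of 4] assms[of 5]
  by (auto simp: uni_def intro: pfun.const)

lemma polynomial_fun_coords: "i < 6 \<Longrightarrow> polynomial_fun (coords i)"
  unfolding coords_def[abs_def] by (auto simp: less6 intro: polynomial_fun.entry)

text \<open>\<open>r\<close> is the solved form of the equations: it overwrites the dependent
  coordinates by polynomials in the free ones. The cell part is then a graph over an affine space,
  parametrized by its own coordinates.\<close>

lemma normset_cell_retract:
  assumes s: "s 0 \<noteq> s 1" and p: "\<And>i. i < 6 \<Longrightarrow> pfun (\<lambda>x. r x i)"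
    and r: "\<And>x. cell_eqs (s 0) (s 1) (s 3) (r x)"
    and id: "\<And>x i. cell_eqs (s 0) (s 1) (s 3) x \<Longrightarrow> i < 6 \<Longrightarrow> r x i = x i"
  shows "normset (schub s \<inter> rad (\<lambda>i j. j \<le> i))"
proof -
  have rc: "uni (r x) = uni x" if "cell_eqs (s 0) (s 1) (s 3) x" for x
    by (rule uni_cong) (rule id[OF that])
  have "schub s \<inter> rad (\<lambda>i j. j \<le> i) = range (\<lambda>x. uni (r x))"
  proof (intro subset_antisym subsetI)
    fix A assume A: "A \<in> schub s \<inter> rad (\<lambda>i j. j \<le> i)"
    then have "A = uni (\<lambda>i. coords i A)" using rad_uni by blast
    then have "cell_eqs (s 0) (s 1) (s 3) (\<lambda>i. coords i A)" using A uni_schub[OF s] by (metis IntD1)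
    then have "A = uni (r (\<lambda>i. coords i A))" using rc \<open>A = _\<close> by metis
    then show "A \<in> range (\<lambda>x. uni (r x))" by blast
  qed (auto simp: uni_rad uni_schub[of s, OF s] r)
  moreover have "normset (range (\<lambda>x. uni (r x)))"
  proof (rule normset_retract[where k="\<lambda>i A. if i < 6 then coords i A else 0"])
    show "pfun (\<lambda>x. uni (r x) $ i $ j)" for i j by (rule pfun_uni[OF p])
    show "polynomial_fun (\<lambda>A. if i < 6 then coords i A else 0)" for i
      by (cases "i < 6") (simp_all add: polynomial_fun_coords polynomial_fun.const)
    show "uni (r (\<lambda>i. if i < 6 then coords i (uni (r x)) else 0)) = uni (r x)" for x
    proof -
      let ?y = "\<lambda>i. if i < 6 then coords i (uni (r x)) else 0"
      have y: "uni ?y = uni (r x)" by (rule uni_cong) (simp add: coords_uni)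
      then have "uni ?y \<in> schub s" using uni_schub[OF s] r by simp
      then have "cell_eqs (s 0) (s 1) (s 3) ?y" using uni_schub[OF s] by simp
      then show ?thesis using rc y by simp
    qed
  qed
  ultimately show ?thesis by simp
qed

subsection \<open>Normality of the opposite cells\<close>

lemma normset_cell_list:
  assumes "s 0 \<noteq> s 1" "\<And>i. i < 6 \<Longrightarrow> pfun (\<lambda>x. r x ! i)" "\<And>x. cell_eqs (s 0) (s 1) (s 3) (\<lambda>i. r x ! i)"
    "\<And>x i. cell_eqs (s 0) (s 1) (s 3) x \<Longrightarrow> i < 6 \<Longrightarrow> r x ! i = x i"
  shows "normset (schub s \<inter> rad (\<lambda>i j. j \<le> i))"
  using assms by (rule normset_cell_retract[where r="\<lambda>x i. r x ! i"])

lemmas pfun_list = pfun.intros pfun_diff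

text \<open>The two singular cases: at the identity coset the Schubert variety is the product of an affine
  space with the cone of singular $2\times2$ matrices, i.e. of products of a column and a row.\<close>

lemma rank_one:
  fixes b c d e :: complex
  assumes "b * e = c * d"
  obtains s t u v where "b = s * u" "c = s * v" "d = t * u" "e = t * v"
proof (cases "b = 0 \<and> c = 0")
  case True
  then show ?thesis using that[where s=0 and t=1 and u=d and v=e] by simp
next
  case False
  show ?thesis
  proof (cases "b = 0")
    case True
    then show ?thesis using that[where s=1 and t="e / c" and u=0 and v=c] False assms by simp
  next
    case nz: False
    then show ?thesis using that[where s=1 and t="d / b" and u=b and v=c] assms by (simp add: field_simps)
  qed
qed

lemma normset_cone_schub:
  assumes s: "s 0 \<noteq> s 1" and p: "\<And>i. i < 6 \<Longrightarrow> pfun (\<lambda>x. r x ! i)"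
    and r: "\<And>x. cell_eqs (s 0) (s 1) (s 3) (\<lambda>i. r x ! i)"
    and surj: "\<And>x. cell_eqs (s 0) (s 1) (s 3) x \<Longrightarrow> \<exists>y. \<forall>i<6. r y ! i = x i"
    and inv: "\<And>x y c i. c \<noteq> 0 \<Longrightarrow> y 0 = c * x 0 \<Longrightarrow> y 1 = c * x 1 \<Longrightarrow> y 2 = x 2 / c \<Longrightarrow> y 3 = x 3 / c \<Longrightarrow>
       y 4 = x 4 \<Longrightarrow> y 5 = x 5 \<Longrightarrow> i < 6 \<Longrightarrow> r y ! i = r x ! i"
    and k: "\<And>i j. polynomial_fun (k i j)" "\<And>x i j. i \<in> {0,1} \<Longrightarrow> j \<in> {2,3} \<Longrightarrow> k i j (uni (\<lambda>i. r x ! i)) = x i * x j"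
    and l: "\<And>i. polynomial_fun (l i)"
      "\<And>x. \<exists>x'. uni (\<lambda>i. r x' ! i) = uni (\<lambda>i. r x ! i) \<and> (\<forall>i\<in>{4,5}. l i (uni (\<lambda>i. r x' ! i)) = x' i)"
  shows "normset (schub s \<inter> rad (\<lambda>i j. j \<le> i))"
proof -
  let ?\<phi> = "\<lambda>x. uni (\<lambda>i. r x ! i)"
  have "schub s \<inter> rad (\<lambda>i j. j \<le> i) = range ?\<phi>"
  proof (intro subset_antisym subsetI)
    fix A assume A: "A \<in> schub s \<inter> rad (\<lambda>i j. j \<le> i)"
    then have e: "A = uni (\<lambda>i. coords i A)" using rad_uni by blast
    then have "uni (\<lambda>i. coords i A) \<in> schub s" using A by simp
    then have "cell_eqs (s 0) (s 1) (s 3) (\<lambda>i. coords i A)" using uni_schub[OF s] by blast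
    then obtain y where "\<forall>i<6. r y ! i = coords i A" using surj by blast
    then have "?\<phi> y = uni (\<lambda>i. coords i A)" by (intro uni_cong) simp
    then show "A \<in> range ?\<phi>" using e by (metis rangeI)
  qed (auto simp: uni_rad uni_schub[of s, OF s] r)
  moreover have "normset (range ?\<phi>)"
  proof (rule normset_cone[OF _ _ k l])
    show "pfun (\<lambda>x. ?\<phi> x $ i $ j)" for i j by (rule pfun_uni[OF p])
    show "?\<phi> y = ?\<phi> x" if "c \<noteq> 0" "y 0 = c * x 0" "y 1 = c * x 1" "y 2 = x 2 / c" "y 3 = x 3 / c" "y 4 = x 4" "y 5 = x 5" for x y c
      by (rule uni_cong) (rule inv[OF that])
  qed
  ultimately show ?thesis by simp
qed

text \<open>In one-line notation 4231. The only equation left is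
  \<open>x 1 * x 4 = x 2 * x 3\<close>; the parameters 0 to 3 factor this 2 by 2 matrix into a
  column and a row, and the parameters 4 and 5 carry the free coordinates \<open>x 0\<close> and
  \<open>x 5\<close>.\<close>

lemma normset_3120:
  assumes "s 0 = 3" "s 1 = 1" "s 3 = (0::4)"
  shows "normset (schub s \<inter> rad (\<lambda>i j. j \<le> i))"
proof (rule normset_cone_schub[where r="\<lambda>x. [x 4, x 0 * x 2, x 0 * x 3, x 1 * x 2, x 1 * x 3, x 5]"
    and k="\<lambda>i j A. coords (if i = 0 then if j = 2 then 1 else 2 else if j = 2 then 3 else 4) A"
    and l="\<lambda>i A. coords (if i = 4 then 0 else 5) A"])
  let ?r = "\<lambda>x. [x 4, x 0 * x 2, x 0 * x 3, x 1 * x 2, x 1 * x 3, x (5::nat) :: complex]"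
  show "s 0 \<noteq> s 1" using assms by simp
  show "pfun (\<lambda>x. ?r x ! i)" if "i < 6" for i using that by (auto simp: less6 intro!: pfun.intros)
  show "cell_eqs (s 0) (s 1) (s 3) (\<lambda>i. ?r x ! i)" for x by (simp add: assms cell_eqs_def le2_def)
  show "\<exists>y. \<forall>i<6. ?r y ! i = x i" if "cell_eqs (s 0) (s 1) (s 3) x" for x
  proof -
    have "x 1 * x 4 = x 2 * x 3" using that by (simp add: assms cell_eqs_def le2_def)
    then obtain S T U V where "x 1 = S * U" "x 2 = S * V" "x 3 = T * U" "x 4 = T * V" by (rule rank_one)
    then show ?thesis by (intro exI[of _ "\<lambda>i. [S, T, U, V, x 0, x 5] ! i"]) (auto simp: less6)
  qed
  show "?r y ! i = ?r x ! i" if "c \<noteq> 0" "y 0 = c * x 0" "y 1 = c * x 1" "y 2 = x 2 / c" "y 3 = x 3 / c" "y 4 = x 4" "y 5 = x 5" "i < 6"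
    for x y c i using that by (auto simp: less6)
  show "polynomial_fun (\<lambda>A. coords (if i = 0 then if j = 2 then 1 else 2 else if j = 2 then 3 else 4) A)" for i j :: nat
    using polynomial_fun_coords by simp
  show "coords (if i = 0 then if j = 2 then 1 else 2 else if j = 2 then 3 else 4) (uni (\<lambda>i. ?r x ! i)) = x i * x j"
    if "i \<in> {0,1}" "j \<in> {2,3}" for x i j using that by (auto simp: coords_def uni_def)
  show "polynomial_fun (\<lambda>A. coords (if i = 4 then 0 else 5) A)" for i :: nat using polynomial_fun_coords by simp
  show "\<exists>x'. uni (\<lambda>i. ?r x' ! i) = uni (\<lambda>i. ?r x ! i) \<and> (\<forall>i\<in>{4,5}. coords (if i = 4 then 0 else 5) (uni (\<lambda>i. ?r x' ! i)) = x' i)" for x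
    by (rule exI[of _ x]) (simp add: coords_def uni_def)
qed

text \<open>In one-line notation 3412. Besides \<open>x 2 = 0\<close> the equation says that the
  matrix with rows \<open>x 0, x 1\<close> and \<open>x 5, x 3 * x 5 - x 4\<close> is singular.
  Parameter 4 carries the free coordinate \<open>x 3\<close>, and parameter 5 is normalized to 0
  within the fibre.\<close>

lemma normset_2301:
  assumes "s 0 = 2" "s 1 = 3" "s 3 = (1::4)"
  shows "normset (schub s \<inter> rad (\<lambda>i j. j \<le> i))"
proof (rule normset_cone_schub[where r="\<lambda>x. [x 0 * x 2, x 0 * x 3, 0, x 4, x 4 * (x 1 * x 2) - x 1 * x 3, x 1 * x 2]"
    and k="\<lambda>i j A. if i = 0 then if j = 2 then coords 0 A else coords 1 A else if j = 2 then coords 5 A else coords 3 A * coords 5 A - coords 4 A"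
    and l="\<lambda>i A. if i = 4 then coords 3 A else 0"])
  let ?r = "\<lambda>x. [x 0 * x 2, x 0 * x 3, 0, x (4::nat), x 4 * (x 1 * x 2) - x 1 * x 3, x 1 * x 2 :: complex]"
  show "s 0 \<noteq> s 1" using assms by simp
  show "pfun (\<lambda>x. ?r x ! i)" if "i < 6" for i using that by (auto simp: less6 intro!: pfun.intros pfun_diff)
  show "cell_eqs (s 0) (s 1) (s 3) (\<lambda>i. ?r x ! i)" for x by (simp add: assms cell_eqs_def le2_def algebra_simps)
  show "\<exists>y. \<forall>i<6. ?r y ! i = x i" if "cell_eqs (s 0) (s 1) (s 3) x" for x
  proof -
    have x: "x 2 = 0" "x 0 * x 4 + x 1 * x 5 - x 0 * x 3 * x 5 = 0" using that by (simp_all add: assms cell_eqs_def le2_def)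
    then have "x 0 * (x 3 * x 5 - x 4) = x 1 * x 5" by (simp add: algebra_simps)
    then obtain S T U V where *: "x 0 = S * U" "x 1 = S * V" "x 5 = T * U" "x 3 * x 5 - x 4 = T * V" by (rule rank_one)
    then have "x 4 = x 3 * (T * U) - T * V" by (simp add: algebra_simps)
    then show ?thesis using * x(1) by (intro exI[of _ "\<lambda>i. [S, T, U, V, x 3, 0] ! i"]) (auto simp: less6)
  qed
  show "?r y ! i = ?r x ! i" if "c \<noteq> 0" "y 0 = c * x 0" "y 1 = c * x 1" "y 2 = x 2 / c" "y 3 = x 3 / c" "y 4 = x 4" "y 5 = x 5" "i < 6"
    for x y c i using that by (auto simp: less6)
  show "polynomial_fun (\<lambda>A. if i = 0 then if j = 2 then coords 0 A else coords 1 A else if j = 2 then coords 5 A else coords 3 A * coords 5 A - coords 4 A)"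
    for i j :: nat
    by (intro polynomial_fun_if polynomial_fun_diff polynomial_fun.mult polynomial_fun_coords) simp_all
  show "(if i = 0 then if j = 2 then coords 0 (uni (\<lambda>i. ?r x ! i)) else coords 1 (uni (\<lambda>i. ?r x ! i)) else if j = 2 then coords 5 (uni (\<lambda>i. ?r x ! i))
      else coords 3 (uni (\<lambda>i. ?r x ! i)) * coords 5 (uni (\<lambda>i. ?r x ! i)) - coords 4 (uni (\<lambda>i. ?r x ! i))) = x i * x j"
    if "i \<in> {0,1}" "j \<in> {2,3}" for x i j using that by (auto simp: coords_def uni_def)
  show "polynomial_fun (\<lambda>A. if i = 4 then coords 3 A else 0)" for i :: nat
    by (intro polynomial_fun_if polynomial_fun_coords polynomial_fun.const) simp
  show "\<exists>x'. uni (\<lambda>i. ?r x' ! i) = uni (\<lambda>i. ?r x ! i) \<and> (\<forall>i\<in>{4,5}. (if i = 4 then coords 3 (uni (\<lambda>i. ?r x' ! i)) else 0) = x' i)" for x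
    by (rule exI[of _ "x(5 := 0)"]) (simp add: coords_def uni_def)
qed

lemma bij4_cases:
  assumes "bij s"
  shows "s 0 \<noteq> s 1" "s 0 \<noteq> s 2" "s 0 \<noteq> s 3" "s 1 \<noteq> s 2" "s 1 \<noteq> s 3" "s 2 \<noteq> s (3::4)"
  using assms by (metis bij_is_inj injD neq4)+

text \<open>In 22 cases the equations can be solved for some of the coordinates, and
  \<open>r\<close> lists the solution. The other two permutations are 4231 and 3412, those of the
  singular Schubert varieties of the flag variety.\<close>

theorem normset_schub:
  fixes s :: "4 \<Rightarrow> 4"
  assumes s: "bij s"
  shows "normset (schub s \<inter> rad (\<lambda>i j. j \<le> i))"
proof -
  let ?Z = "\<lambda>s :: 4 \<Rightarrow> 4. schub s \<inter> rad (\<lambda>i j. j \<le> i)"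
  have c0: "normset (?Z s)" if "s 0 = 0" "s 1 = 1" "s 3 = 3" for s
    by (rule normset_cell_list[where r="\<lambda>x. [0, 0, 0, 0, 0, 0]"])
      (use that in \<open>auto simp: cell_eqs_def le2_def pfun_list less6 algebra_simps\<close>)
  have c1: "normset (?Z s)" if "s 0 = 0" "s 1 = 1" "s 3 = 2" for s
    by (rule normset_cell_list[where r="\<lambda>x. [0, 0, 0, 0, 0, x 5]"])
      (use that in \<open>auto simp: cell_eqs_def le2_def pfun_list less6 algebra_simps\<close>)
  have c2: "normset (?Z s)" if "s 0 = 0" "s 1 = 2" "s 3 = 3" for s
    by (rule normset_cell_list[where r="\<lambda>x. [0, 0, 0, x 3, 0, 0]"])
      (use that in \<open>auto simp: cell_eqs_def le2_def pfun_list less6 algebra_simps\<close>)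
  have c3: "normset (?Z s)" if "s 0 = 0" "s 1 = 2" "s 3 = 1" for s
    by (rule normset_cell_list[where r="\<lambda>x. [0, 0, 0, x 3, 0, x 5]"])
      (use that in \<open>auto simp: cell_eqs_def le2_def pfun_list less6 algebra_simps\<close>)
  have c4: "normset (?Z s)" if "s 0 = 0" "s 1 = 3" "s 3 = 2" for s
    by (rule normset_cell_list[where r="\<lambda>x. [0, 0, 0, x 3, x 3 * x 5, x 5]"])
      (use that in \<open>auto simp: cell_eqs_def le2_def pfun_list less6 algebra_simps\<close>)
  have c5: "normset (?Z s)" if "s 0 = 0" "s 1 = 3" "s 3 = 1" for s
    by (rule normset_cell_list[where r="\<lambda>x. [0, 0, 0, x 3, x 4, x 5]"])
      (use that in \<open>auto simp: cell_eqs_def le2_def pfun_list less6 algebra_simps\<close>)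
  have c6: "normset (?Z s)" if "s 0 = 1" "s 1 = 0" "s 3 = 3" for s
    by (rule normset_cell_list[where r="\<lambda>x. [x 0, 0, 0, 0, 0, 0]"])
      (use that in \<open>auto simp: cell_eqs_def le2_def pfun_list less6 algebra_simps\<close>)
  have c7: "normset (?Z s)" if "s 0 = 1" "s 1 = 0" "s 3 = 2" for s
    by (rule normset_cell_list[where r="\<lambda>x. [x 0, 0, 0, 0, 0, x 5]"])
      (use that in \<open>auto simp: cell_eqs_def le2_def pfun_list less6 algebra_simps\<close>)
  have c8: "normset (?Z s)" if "s 0 = 1" "s 1 = 2" "s 3 = 3" for s
    by (rule normset_cell_list[where r="\<lambda>x. [x 0, 0, 0, x 3, 0, 0]"])
      (use that in \<open>auto simp: cell_eqs_def le2_def pfun_list less6 algebra_simps\<close>)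
  have c9: "normset (?Z s)" if "s 0 = 1" "s 1 = 2" "s 3 = 0" for s
    by (rule normset_cell_list[where r="\<lambda>x. [x 0, 0, 0, x 3, 0, x 5]"])
      (use that in \<open>auto simp: cell_eqs_def le2_def pfun_list less6 algebra_simps\<close>)
  have c10: "normset (?Z s)" if "s 0 = 1" "s 1 = 3" "s 3 = 2" for s
    by (rule normset_cell_list[where r="\<lambda>x. [x 0, 0, 0, x 3, x 3 * x 5, x 5]"])
      (use that in \<open>auto simp: cell_eqs_def le2_def pfun_list less6 algebra_simps\<close>)
  have c11: "normset (?Z s)" if "s 0 = 1" "s 1 = 3" "s 3 = 0" for s
    by (rule normset_cell_list[where r="\<lambda>x. [x 0, 0, 0, x 3, x 4, x 5]"])
      (use that in \<open>auto simp: cell_eqs_def le2_def pfun_list less6 algebra_simps\<close>)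
  have c12: "normset (?Z s)" if "s 0 = 2" "s 1 = 0" "s 3 = 3" for s
    by (rule normset_cell_list[where r="\<lambda>x. [x 0, x 0 * x 3, 0, x 3, 0, 0]"])
      (use that in \<open>auto simp: cell_eqs_def le2_def pfun_list less6 algebra_simps\<close>)
  have c13: "normset (?Z s)" if "s 0 = 2" "s 1 = 0" "s 3 = 1" for s
    by (rule normset_cell_list[where r="\<lambda>x. [x 0, x 0 * x 3, 0, x 3, 0, x 5]"])
      (use that in \<open>auto simp: cell_eqs_def le2_def pfun_list less6 algebra_simps\<close>)
  have c14: "normset (?Z s)" if "s 0 = 2" "s 1 = 1" "s 3 = 3" for s
    by (rule normset_cell_list[where r="\<lambda>x. [x 0, x 1, 0, x 3, 0, 0]"])
      (use that in \<open>auto simp: cell_eqs_def le2_def pfun_list less6 algebra_simps\<close>)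
  have c15: "normset (?Z s)" if "s 0 = 2" "s 1 = 1" "s 3 = 0" for s
    by (rule normset_cell_list[where r="\<lambda>x. [x 0, x 1, 0, x 3, 0, x 5]"])
      (use that in \<open>auto simp: cell_eqs_def le2_def pfun_list less6 algebra_simps\<close>)
  have c16: "normset (?Z s)" if "s 0 = 2" "s 1 = 3" "s 3 = 0" for s
    by (rule normset_cell_list[where r="\<lambda>x. [x 0, x 1, 0, x 3, x 4, x 5]"])
      (use that in \<open>auto simp: cell_eqs_def le2_def pfun_list less6 algebra_simps\<close>)
  have c17: "normset (?Z s)" if "s 0 = 3" "s 1 = 0" "s 3 = 2" for s
    by (rule normset_cell_list[where r="\<lambda>x. [x 0, x 0 * x 3, x 0 * x 3 * x 5, x 3, x 3 * x 5, x 5]"])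
      (use that in \<open>auto simp: cell_eqs_def le2_def pfun_list less6 algebra_simps\<close>)
  have c18: "normset (?Z s)" if "s 0 = 3" "s 1 = 0" "s 3 = 1" for s
    by (rule normset_cell_list[where r="\<lambda>x. [x 0, x 0 * x 3, x 0 * x 4, x 3, x 4, x 5]"])
      (use that in \<open>auto simp: cell_eqs_def le2_def pfun_list less6 algebra_simps\<close>)
  have c19: "normset (?Z s)" if "s 0 = 3" "s 1 = 1" "s 3 = 2" for s
    by (rule normset_cell_list[where r="\<lambda>x. [x 0, x 1, x 1 * x 5, x 3, x 3 * x 5, x 5]"])
      (use that in \<open>auto simp: cell_eqs_def le2_def pfun_list less6 algebra_simps\<close>)
  have c20: "normset (?Z s)" if "s 0 = 3" "s 1 = 2" "s 3 = 1" for s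
    by (rule normset_cell_list[where r="\<lambda>x. [x 0, x 1, x 0 * x 4 + x 1 * x 5 - x 0 * x 3 * x 5, x 3, x 4, x 5]"])
      (use that in \<open>auto simp: cell_eqs_def le2_def pfun_list less6 algebra_simps\<close>)
  have c21: "normset (?Z s)" if "s 0 = 3" "s 1 = 2" "s 3 = 0" for s
    by (rule normset_cell_list[where r="\<lambda>x. [x 0, x 1, x 2, x 3, x 4, x 5]"])
      (use that in \<open>auto simp: cell_eqs_def le2_def pfun_list less6 algebra_simps\<close>)

  note cases = c0 c1 c2 c3 c4 c5 c6 c7 c8 c9 c10 c11 c12 c13 c14 c15 c16 c17 c18 c19 c20 c21 normset_3120 normset_2301
  show ?thesis
    using exhaust4[of "s 0"] exhaust4[of "s 1"] exhaust4[of "s 2"] exhaust4[of "s 3"] bij4_cases[OF s]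
    by (elim disjE) (simp_all add: cases)
qed

section \<open>Open orbits\<close>

lemma monomial_conj_palg:
  assumes n: "monomial n s" and D: "D \<in> palg S"
  shows "minv n ** D ** n \<in> palg (\<lambda>a b. S (s a) (s b))"
proof (rule palgI)
  fix a b assume "(minv n ** D ** n) $ a $ b \<noteq> 0"
  then obtain k where k: "(minv n ** D) $ a $ k \<noteq> 0" "n $ k $ b \<noteq> 0" by (rule mult_entry_nonzero)
  from k(1) obtain l where l: "minv n $ a $ l \<noteq> 0" "D $ l $ k \<noteq> 0" by (rule mult_entry_nonzero)
  have "l = s a" "k = s b" using l(1) k(2) monomial_minv[OF n] monomialD(3)[OF n] by (auto split: if_splits)
  then show "S (s a) (s b)" using palgD[OF D l(2)] by simp
qed

text \<open>Factorization of a Bruhat cell: modulo the Borel subgroup of the Levi subgroup on the left, a point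
  is described by the entries of \<open>u\<close> at those inversions of \<open>s\<close> that do not lie in a diagonal block.\<close>

lemma cell_factor:
  fixes R :: "'n \<Rightarrow> 'n::{finite,wellorder} \<Rightarrow> bool"
  assumes R: "upper_rel R" and n: "monomial n s" and b: "b \<in> pat (\<le>)"
  shows "\<exists>l u b'. l \<in> pat (\<lambda>i j. sim R i j \<and> i \<le> j) \<and> u - mat 1 \<in> palg (\<lambda>i j. str R i j \<and> inv s j < inv s i) \<and>
    b' \<in> pat (\<le>) \<and> b ** n = l ** u ** n ** b'"
proof -
  note P = upper_relD(1)[OF R]
  have bR: "b \<in> pat R" using pat_mono[OF b] upper_relD(2)[OF R] by blast
  define l where "l = blk R b"
  have dl: "det l = 1" unfolding l_def by (rule det_blk[OF R bR])
  have l: "l \<in> pat (\<lambda>i j. sim R i j \<and> i \<le> j)"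
    using dl b by (auto simp: pat_def palg_def l_def blk_def)
  define r where "r = minv l ** b"
  have r: "r \<in> rad R" unfolding r_def l_def by (rule pat_decompose[OF R bR])
  have dr: "det r = 1" using r by (simp add: rad_def)
  have r': "minv r - mat 1 \<in> palg (str R)"
    using subgroup_SLD(4)[OF subgroup_rad[OF P] r] by (simp add: rad_def)
  let ?S = "\<lambda>i j. str R i j \<and> inv s j < inv s i"
  define part :: "complex^'n::{finite,wellorder}^'n::{finite,wellorder} \<Rightarrow> complex^'n::{finite,wellorder}^'n::{finite,wellorder}"
    where "part M = (\<chi> i j. if ?S i j then M $ i $ j else 0)" for M
  \<comment> \<open>\<open>X\<close> is chosen so that \<open>minv r ** (mat 1 + X)\<close> has no
    entries at the inversions in \<open>?S\<close>. The map on the left is unitriangular on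
    \<open>palg ?S\<close>, hence injective.\<close>
  have "\<exists>X\<in>palg ?S. part (minv r ** X) = part (0 - minv r)"
  proof (rule palg_solve)
    show "linear (\<lambda>X. part (minv r ** X))"
      by (rule linearI) (auto simp: part_def matrix_add_ldistrib matrix_mul_scaleR vec_eq_iff)
    show "part M \<in> palg ?S" for M by (auto simp: part_def palg_def)
    then show "part (0 - minv r) \<in> palg ?S" .
    show "X = 0" if X: "X \<in> palg ?S" and eq: "part (minv r ** X) = 0" for X
    proof (rule ccontr)
      assume "X \<noteq> 0"
      then obtain a j where a: "X $ a $ j \<noteq> 0" by (auto simp: vec_eq_iff)
      define T where "T = {i. X $ i $ j \<noteq> 0}"
      have "T \<noteq> {}" "finite T" using a by (auto simp: T_def)
      define i where "i = Max T"
      have i: "X $ i $ j \<noteq> 0" "\<And>k. i < k \<Longrightarrow> X $ k $ j = 0"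
        using Max_in[OF \<open>finite T\<close> \<open>T \<noteq> {}\<close>] Max_ge[OF \<open>finite T\<close>] unfolding i_def T_def by fastforce+
      have z: "(minv r - mat 1) $ i $ k * X $ k $ j = 0" for k
      proof (rule ccontr)
        assume nz: "\<not> ?thesis"
        then have "str R i k" using palgD[OF r', of i k] by auto
        then have "i < k" by (rule upper_str_less[OF R])
        then show False using i(2) nz by simp
      qed
      have "minv r ** X = (minv r - mat 1) ** X + X" by (simp add: matrix_mul_diff_left)
      moreover have "((minv r - mat 1) ** X) $ i $ j = 0" unfolding mult_entry using z by (intro sum.neutral) blast
      ultimately have "(minv r ** X) $ i $ j = X $ i $ j" by simp
      moreover have "?S i j" using palgD[OF X i(1)] .
      ultimately have "part (minv r ** X) $ i $ j = X $ i $ j" by (simp add: part_def)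
      then show False using eq i(1) by simp
    qed
  qed
  then obtain X where X: "X \<in> palg ?S" "part (minv r ** X) = part (0 - minv r)" by blast
  define u where "u = mat 1 + X"
  have u: "u - mat 1 \<in> palg ?S" using X(1) by (simp add: u_def)
  have "u - mat 1 \<in> palg (<)" by (rule palg_mono[OF u]) (use upper_str_less[OF R] in blast)
  then have du: "det u = 1" by (rule det_unitriangular)
  have "u - mat 1 \<in> palg (str R)" by (rule palg_mono[OF u]) blast
  then have uR: "u \<in> rad R" unfolding rad_upper[OF R] by simp
  define d where "d = minv r ** u"
  have dR: "d \<in> rad R" unfolding d_def by (intro subgroup_SLD(3,4)[OF subgroup_rad[OF P]] r uR)
  have d1: "d - mat 1 \<in> palg (str R)" and dd: "det d = 1" using dR by (auto simp: rad_def)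
  have dq: "d $ i $ j = 0" if "?S i j" for i j
  proof -
    have "part (minv r ** X) $ i $ j = part (0 - minv r) $ i $ j" by (simp only: X(2))
    then have "(minv r ** X) $ i $ j = - minv r $ i $ j" using that by (simp add: part_def)
    then show ?thesis by (simp add: d_def u_def matrix_add_ldistrib)
  qed
  have "inj s" using monomialD(2)[OF n] by (rule bij_is_inj)
  \<comment> \<open>The off-diagonal positions left to \<open>d\<close> are not inversions of
    \<open>s\<close>, so conjugation by \<open>n\<close> keeps them above the diagonal.\<close>
  have "minv n ** d ** n \<in> palg (\<le>)"
  proof (rule palg_mono[OF monomial_conj_palg[OF n, of d "\<lambda>i j. i = j \<or> str R i j \<and> \<not> inv s j < inv s i"]])
    show "d \<in> palg (\<lambda>i j. i = j \<or> str R i j \<and> \<not> inv s j < inv s i)"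
    proof (rule palgI)
      fix i j assume nz: "d $ i $ j \<noteq> 0"
      show "i = j \<or> str R i j \<and> \<not> inv s j < inv s i"
      proof (cases "i = j")
        case False
        then have "(d - mat 1) $ i $ j \<noteq> 0" using nz by (simp add: mat_def)
        then show ?thesis using palgD[OF d1] dq[of i j] nz by blast
      qed simp
    qed
    show "a \<le> b" if "s a = s b \<or> str R (s a) (s b) \<and> \<not> inv s (s b) < inv s (s a)" for a b
      using that inj_eq[OF \<open>inj s\<close>, of a b] by (simp add: inv_f_f[OF \<open>inj s\<close>]) force
  qed
  then have "minv n ** d ** n \<in> pat (\<le>)" using dd monomialD(1)[OF n] by (simp add: pat_def det_mul minv_det)
  then have "minv (minv n ** d ** n) \<in> pat (\<le>)" by (rule pat_minv[OF preorder_le])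
  moreover have "b ** n = l ** u ** n ** minv (minv n ** d ** n)"
  proof -
    have dn: "det n = 1" using monomialD(1)[OF n] .
    have b1: "b = l ** r" unfolding r_def by (simp add: minv_r_cancel[OF dl])
    have "minv (minv n ** d ** n) = minv n ** minv u ** r ** n"
      unfolding d_def using dn dr du by (simp add: minv_mult minv_det det_mul minv_minv matrix_mul_assoc)
    then have "l ** u ** n ** minv (minv n ** d ** n) = l ** r ** n"
      using dn du by (simp add: matrix_mul_assoc[symmetric] minv_r_cancel)
    then show ?thesis using b1 by simp
  qed
  ultimately show ?thesis using l u by blast
qed

subsection \<open>Semi-invariant coordinates\<close>

datatype pcoord = T1 4 | T2 4 4 | T3 4

fun ev :: "pcoord \<Rightarrow> complex^4^4 \<Rightarrow> complex" where
  "ev (T1 i) A = A $ i $ 0"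
| "ev (T2 i j) A = p2 A i j"
| "ev (T3 m) A = minv A $ 3 $ m"

text \<open>Coordinates whose row sets are final segments within each block of \<open>B\<close> are semi-invariant
  under the Borel subgroup of the standard Levi subgroup.\<close>

abbreviation blk_rel :: "(4 \<Rightarrow> nat) \<Rightarrow> 4 \<Rightarrow> 4 \<Rightarrow> bool" where
  "blk_rel B i j \<equiv> B i = B j \<and> i \<le> j"

text \<open>For \<open>T3 m\<close> the row set is the complement of \<open>m\<close>, which is
  final in the block of \<open>m\<close> exactly when \<open>m\<close> is its first element; this is
  why the relation is turned around there.\<close>

fun row_final :: "(4 \<Rightarrow> nat) \<Rightarrow> pcoord \<Rightarrow> bool" where
  "row_final B (T1 i) \<longleftrightarrow> (\<forall>k. blk_rel B i k \<longrightarrow> k = i)"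
| "row_final B (T2 i j) \<longleftrightarrow> i \<noteq> j \<and> (\<forall>k. blk_rel B i k \<or> blk_rel B j k \<longrightarrow> k = i \<or> k = j)"
| "row_final B (T3 m) \<longleftrightarrow> (\<forall>k. blk_rel B k m \<longrightarrow> k = m)"

lemma upper_diagonal_nonzero:
  fixes l :: "complex^'n::{finite,wellorder}^'n::{finite,wellorder}"
  assumes "l \<in> pat (\<le>)" shows "l $ i $ i \<noteq> 0"
proof -
  have "det l = (\<Prod>i\<in>UNIV. l $ i $ i)"
  proof (rule det_upperdiagonal)
    show "l $ i $ j = 0" if "i > j" for i j using assms that by (auto simp: pat_def palg_def)
  qed
  then have "(\<Prod>i\<in>UNIV. l $ i $ i) \<noteq> 0" using assms by (simp add: pat_def)
  then show ?thesis by (simp only: prod_zero_iff finite_class.finite_UNIV) blast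
qed

lemma preorder_blk_rel: "preorder_rel (blk_rel B)"
  unfolding preorder_rel_def by auto

lemma ev_left:
  assumes l: "l \<in> pat (blk_rel B)" and j: "row_final B t"
  shows "\<exists>c. c \<noteq> 0 \<and> (\<forall>A. det A = 1 \<longrightarrow> ev t (l ** A) = c * ev t A)"
proof -
  have lu: "l \<in> pat (\<le>)" using pat_mono[OF l] by blast
  note nz = upper_diagonal_nonzero[OF lu]
  have l0: "l $ i $ k \<noteq> 0 \<Longrightarrow> blk_rel B i k" for i k using palgD[OF patD(2)[OF l]] .
  have dl: "det l = 1" using l by (simp add: pat_def)
  show ?thesis
  proof (cases t)
    case (T1 i)
    have "(l ** A) $ i $ 0 = l $ i $ i * A $ i $ 0" for A
    proof -
      have "(l ** A) $ i $ 0 = (\<Sum>k\<in>{i}. l $ i $ k * A $ k $ 0)"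
        unfolding mult_entry using l0[of i] j T1 by (intro sum.mono_neutral_right) auto
      then show ?thesis by simp
    qed
    then show ?thesis using nz[of i] T1 by auto
  next
    case (T2 i j)
    have "p2 (l ** A) i j = l $ i $ i * l $ j $ j * p2 A i j" for A
    proof -
      have "l $ i $ k * l $ j $ m * p2 A k m = (if k = i then if m = j then l $ i $ i * l $ j $ j * p2 A i j else 0 else 0)" for k m
      proof (cases "l $ i $ k = 0 \<or> l $ j $ m = 0 \<or> k = m")
        case True
        then show ?thesis using \<open>row_final B t\<close> T2 by auto
      next
        case False
        then have "blk_rel B i k" "blk_rel B j m" using l0 by auto
        moreover from this have "k = i \<or> k = j" "m = i \<or> m = j" "i \<noteq> j" using \<open>row_final B t\<close> T2 by auto
        moreover have "k \<noteq> m" using False by blast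
        ultimately have "k = i \<and> m = j" by (metis order_antisym)
        then show ?thesis by simp
      qed
      then have "p2 (l ** A) i j = (\<Sum>k\<in>UNIV. \<Sum>m\<in>UNIV. if k = i then if m = j then l $ i $ i * l $ j $ j * p2 A i j else 0 else 0)"
        unfolding p2_mult_left by (intro sum.cong refl)
      also have "\<dots> = (\<Sum>k\<in>UNIV. if k = i then l $ i $ i * l $ j $ j * p2 A i j else 0)"
        by (intro sum.cong refl) auto
      finally show ?thesis by simp
    qed
    then show ?thesis using nz[of i] nz[of j] T2 by (intro exI[of _ "l $ i $ i * l $ j $ j"]) simp
  next
    case (T3 m)
    have l': "minv l \<in> pat (blk_rel B)" by (rule pat_minv[OF preorder_blk_rel l])
    have l0': "minv l $ i $ k \<noteq> 0 \<Longrightarrow> blk_rel B i k" for i k using palgD[OF patD(2)[OF l']] .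
    have "minv (l ** A) $ 3 $ m = minv l $ m $ m * minv A $ 3 $ m" if "det A = 1" for A
    proof -
      have "minv (l ** A) $ 3 $ m = (\<Sum>k\<in>{m}. minv A $ 3 $ k * minv l $ k $ m)"
        unfolding minv_mult[OF dl that] mult_entry using l0'[of _ m] j T3 by (intro sum.mono_neutral_right) auto
      then show ?thesis by simp
    qed
    moreover have "minv l $ m $ m \<noteq> 0"
      using upper_diagonal_nonzero[of "minv l" m] pat_mono[OF l'] by blast
    ultimately show ?thesis using T3 by auto
  qed
qed

lemma ev_right:
  assumes b: "b \<in> pat (\<le>)" shows "\<exists>c. c \<noteq> 0 \<and> (\<forall>A. det A = 1 \<longrightarrow> ev t (A ** b) = c * ev t A)"
proof (cases t)
  case (T1 i)
  then show ?thesis using upper_right[OF b] by (intro exI[of _ "b $ 0 $ 0"]) simp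
next
  case (T2 i j)
  then show ?thesis using upper_right[OF b] by (intro exI[of _ "b $ 0 $ 0 * b $ 1 $ 1"]) simp
next
  case (T3 m)
  then show ?thesis using upper_right[OF b] by (intro exI[of _ "minv b $ 3 $ 3"]) simp
qed

lemma ev_nonzero:
  assumes "l \<in> pat (blk_rel B)" "row_final B t" "b \<in> pat (\<le>)" "det A = 1"
  shows "ev t (l ** A ** b) \<noteq> 0 \<longleftrightarrow> ev t A \<noteq> 0"
proof -
  obtain c where c: "c \<noteq> 0" "\<And>A. det A = 1 \<Longrightarrow> ev t (l ** A) = c * ev t A" using ev_left[OF assms(1,2)] by blast
  obtain e where e: "e \<noteq> 0" "\<And>A. det A = 1 \<Longrightarrow> ev t (A ** b) = e * ev t A" using ev_right[OF assms(3), of t] by blast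
  have "det (l ** A) = 1" using assms(1,4) by (simp add: det_mul pat_def)
  then show ?thesis using c e assms(4) by simp
qed

lemma polynomial_ev: "\<exists>p. polynomial_fun p \<and> (\<forall>A. det A = 1 \<longrightarrow> ev t A = p A)"
proof (cases t)
  case (T1 i)
  then show ?thesis by (intro exI[of _ "\<lambda>A. A $ i $ 0"]) (simp add: polynomial_fun.entry)
next
  case (T2 i j)
  have "polynomial_fun (\<lambda>A. p2 A i j)"
    unfolding p2_def by (intro polynomial_fun_diff polynomial_fun.mult polynomial_fun.entry)
  then show ?thesis using T2 by (intro exI[of _ "\<lambda>A. p2 A i j"]) simp
next
  case (T3 m)
  have "polynomial_fun (\<lambda>A :: complex^4^4. cofac A 3 m)"
    by (rule polynomial_fun_cofac) (rule polynomial_fun.entry)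
  then show ?thesis using T3 by (intro exI[of _ "\<lambda>A. cofac A 3 m"]) (simp add: minv_cofac)
qed

text \<open>These are the only positions of inversions that can remain outside the blocks. Products
  of two such positions vanish, so the matrices form an abelian group and inversion changes
  signs.\<close>

definition um :: "complex \<Rightarrow> complex \<Rightarrow> complex \<Rightarrow> complex^4^4" where
  "um x y z = (\<chi> i j. if i = j then 1 else if i = 0 \<and> j = 2 then x else if i = 0 \<and> j = 3 then y
     else if i = 1 \<and> j = 3 then z else 0)"

lemma um_entry: "um x y z $ i $ j = (if i = j then 1 else if i = 0 \<and> j = 2 then x else if i = 0 \<and> j = 3 then y
     else if i = 1 \<and> j = 3 then z else 0)"
  by (simp add: um_def)

lemma det_um: "det (um x y z) = 1"
  by (rule det_unitriangular) (simp add: palg_def all4 um_def mat_def)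

lemma minv_um: "minv (um x y z) = um (- x) (- y) (- z)"
  by (rule minv_unique[OF det_um]) (simp add: vec_eq_iff all4 mult_entry sum4 mat_def um_def)

lemma um_upper: "um x y z \<in> pat (\<le>)"
  using det_um by (simp add: pat_def palg_def all4 um_def)

text \<open>Up to a nonzero factor this is the coordinate of \<open>u ** n\<close> for a monomial
  \<open>n\<close> over \<open>s\<close>, whose columns are scaled columns of
  \<open>u\<close>.\<close>

fun evu :: "(4 \<Rightarrow> 4) \<Rightarrow> pcoord \<Rightarrow> complex^4^4 \<Rightarrow> complex" where
  "evu s (T1 i) u = u $ i $ s 0"
| "evu s (T2 i j) u = u $ i $ s 0 * u $ j $ s 1 - u $ j $ s 0 * u $ i $ s 1"
| "evu s (T3 m) u = minv u $ s 3 $ m"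

lemma ev_um:
  assumes n: "monomial n s" and u: "det u = 1"
  shows "ev t (u ** n) \<noteq> 0 \<longleftrightarrow> evu s t u \<noteq> 0"
proof -
  note m = monomialD[OF n]
  have nz: "n $ s j $ j \<noteq> 0" for j using m(3) by blast
  have un: "(u ** n) $ i $ j = u $ i $ s j * n $ s j $ j" for i j
  proof -
    have "(u ** n) $ i $ j = (\<Sum>k\<in>{s j}. u $ i $ k * n $ k $ j)"
      unfolding mult_entry using m(3)[of _ j] by (intro sum.mono_neutral_right) auto
    then show ?thesis by simp
  qed
  show ?thesis
  proof (cases t)
    case (T1 i)
    then show ?thesis using nz by (simp add: un)
  next
    case (T2 i j)
    have "p2 (u ** n) i j = n $ s 0 $ 0 * n $ s 1 $ 1 * evu s t u" by (simp add: p2_def un T2 algebra_simps)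
    then show ?thesis using nz T2 by simp
  next
    case (T3 k)
    have "minv (u ** n) $ 3 $ k = (\<Sum>l\<in>{s 3}. minv n $ 3 $ l * minv u $ l $ k)"
      unfolding minv_mult[OF u m(1)] mult_entry by (intro sum.mono_neutral_right) (auto simp: monomial_minv[OF n])
    then show ?thesis using nz T3 by (simp add: monomial_minv[OF n])
  qed
qed

text \<open>The inversions $(0,2)$, $(0,3)$, $(1,3)$ form a path, so their weights are linearly
  independent and the torus acts transitively on the nonzero values of these entries.\<close>

lemma torus_um:
  obtains d where "d \<in> pat (=)"
    "d ** um x y z = um (if x = 0 then 0 else 1) (if y = 0 then 0 else 1) (if z = 0 then 0 else 1) ** d"
proof -
  \<comment> \<open>Vanishing entries impose nothing on the torus and are replaced by 1.\<close>
  define X where "X = (if x = 0 then 1 else x)"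
  define Y where "Y = (if y = 0 then 1 else y)"
  define Z where "Z = (if z = 0 then 1 else z)"
  have nz: "X \<noteq> 0" "Y \<noteq> 0" "Z \<noteq> 0" by (auto simp: X_def Y_def Z_def)
  \<comment> \<open>The ratios of the diagonal entries are dictated by \<open>X\<close>,
    \<open>Y\<close>, \<open>Z\<close>; the product of the entries is
    \<open>t ^ 4 * X * Y ^ 2 / Z\<close>, so this fourth root makes the determinant 1.\<close>
  define t where "t = csqrt (csqrt (Z / (X * Y * Y)))"
  have "t ^ 4 = (t ^ 2) ^ 2" by (simp flip: power_mult)
  then have t: "t ^ 4 = Z / (X * Y * Y)" by (simp add: t_def)
  define c :: "4 \<Rightarrow> complex" where "c i = (if i = 0 then t else if i = 1 then t * Y / Z else if i = 2 then t * X else t * Y)" for i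
  define d :: "complex^4^4" where "d = (\<chi> i j. if i = j then c i else 0)"
  have "det d = c 0 * c 1 * c 2 * c 3" unfolding d_def by (subst det_diagonal) (simp_all add: prod4)
  also have "\<dots> = t ^ 4 * (X * Y * Y) / Z" by (simp add: c_def power4_eq_xxxx)
  finally have "det d = 1" using t nz by simp
  then have "d \<in> pat (=)" by (simp add: pat_def palg_def d_def)
  moreover have "d ** um x y z = um (if x = 0 then 0 else 1) (if y = 0 then 0 else 1) (if z = 0 then 0 else 1) ** d"
    using nz unfolding vec_eq_iff all4 mult_entry sum4
    by (simp add: d_def um_def c_def) (auto simp: X_def Y_def Z_def)
  ultimately show ?thesis using that by blast
qed

subsection \<open>Stability under the Levi subgroup\<close>

lemma p2_elem:
  assumes "a \<noteq> b" "j \<noteq> l"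
  shows "p2 (elem a b t ** A) j l = p2 A j l + (if j = a then t * p2 A b l else 0) + (if l = a then t * p2 A j b else 0)"
  using assms by (auto simp: p2_def elem_mult_left algebra_simps)

text \<open>Adding a multiple of row \<open>b\<close> to row \<open>a\<close> changes a coordinate
  involving \<open>a\<close> by one in which \<open>b\<close> replaces \<open>a\<close>, so
  vanishing must carry over from \<open>a\<close> to \<open>b\<close>. On the inverse the column
  operation goes the other way, whence the direction of condition \<open>3\<close>.\<close>

lemma schub_elem:
  assumes A: "A \<in> schub s" and ab: "a \<noteq> b"
    and 1: "s 0 < a \<Longrightarrow> s 0 < b" and 2: "\<And>l. l \<noteq> a \<Longrightarrow> \<not> le2 a l (s 0) (s 1) \<Longrightarrow> l = b \<or> \<not> le2 b l (s 0) (s 1)"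
    and 3: "b < s 3 \<Longrightarrow> a < s 3"
  shows "elem a b t ** A \<in> schub s"
  unfolding schub_def
proof (intro CollectI conjI allI impI)
  have dA: "det A = 1" and A1: "\<And>i. s 0 < i \<Longrightarrow> A $ i $ 0 = 0" and A3: "\<And>m. m < s 3 \<Longrightarrow> minv A $ 3 $ m = 0"
    and A2: "\<And>i j. \<not> le2 i j (s 0) (s 1) \<Longrightarrow> p2 A i j = 0"
    using A by (auto simp: schub_def) (metis p2_self)
  show "det (elem a b t ** A) = 1" using dA ab by (simp add: det_mul det_elem)
  show "(elem a b t ** A) $ i $ 0 = 0" if "s 0 < i" for i using that A1 1 by (auto simp: elem_mult_left)
  show "p2 (elem a b t ** A) j l = 0" if jl: "j \<noteq> l \<and> \<not> le2 j l (s 0) (s 1)" for j l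
  proof -
    have "p2 A b l = 0" if "j = a" using 2[of l] jl that A2[of b l] by auto
    moreover have "p2 A j b = 0" if "l = a" using 2[of j] jl that A2[of j b] by (auto simp: le2_sym)
    ultimately show ?thesis using jl A2[of j l] by (simp add: p2_elem[OF ab])
  qed
  show "minv (elem a b t ** A) $ 3 $ m = 0" if "m < s 3" for m
    unfolding minv_mult[OF det_elem[OF ab] dA] minv_elem[OF ab] elem_mult_right using that A3 3 by auto
qed

subsection \<open>The twenty-four cases\<close>

definition fun4 :: "nat \<Rightarrow> nat \<Rightarrow> nat \<Rightarrow> nat \<Rightarrow> 4 \<Rightarrow> nat" where
  "fun4 a b c d i = (if i = 0 then a else if i = 1 then b else if i = 2 then c else d)"

text \<open>\<open>B\<close> describes the blocks of the left descents of \<open>s\<close>, \<open>ed\<close> the remaining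
  inversions, and \<open>ts\<close> semi-invariant coordinates detecting the open orbit.\<close>

definition spherical_data :: "(4 \<Rightarrow> 4) \<Rightarrow> (4 \<Rightarrow> nat) \<Rightarrow> (4 \<times> 4) set \<Rightarrow> pcoord list \<Rightarrow> bool" where
  "spherical_data s B ed ts \<longleftrightarrow>
     B 0 \<le> B 1 \<and> B 1 \<le> B 2 \<and> B 2 \<le> B 3 \<and> ed \<subseteq> {(0,2), (0,3), (1,3)} \<and>
     (\<forall>a b. b < a \<and> B (s a) < B (s b) \<longrightarrow> (s a, s b) \<in> ed) \<and>
     T1 (s 0) \<in> set ts \<and> T2 (s 0) (s 1) \<in> set ts \<and> T3 (s 3) \<in> set ts \<and> (\<forall>t\<in>set ts. row_final B t) \<and>
     (\<forall>t\<in>set ts. evu s t (um (if (0,2) \<in> ed then 1 else 0) (if (0,3) \<in> ed then 1 else 0) (if (1,3) \<in> ed then 1 else 0)) \<noteq> 0) \<and>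
     (\<forall>a b. (a = 1 \<and> b = 0 \<or> a = 2 \<and> b = 1 \<or> a = 3 \<and> b = 2) \<and> B a = B b \<longrightarrow>
        (s 0 < a \<longrightarrow> s 0 < b) \<and> (\<forall>l. l \<noteq> a \<and> \<not> le2 a l (s 0) (s 1) \<longrightarrow> l = b \<or> \<not> le2 b l (s 0) (s 1)) \<and>
        (b < s 3 \<longrightarrow> a < s 3)) \<and>
     (\<forall>x y z. ((0,2) \<notin> ed \<longrightarrow> x = 0) \<and> ((0,3) \<notin> ed \<longrightarrow> y = 0) \<and> ((1,3) \<notin> ed \<longrightarrow> z = 0) \<and>
        (\<forall>t\<in>set ts. evu s t (um x y z) \<noteq> 0) \<longrightarrow>
        ((0,2) \<in> ed \<longrightarrow> x \<noteq> 0) \<and> ((0,3) \<in> ed \<longrightarrow> y \<noteq> 0) \<and> ((1,3) \<in> ed \<longrightarrow> z \<noteq> 0))"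

text \<open>Blocks join neighbouring values that appear in reverse order in \<open>s\<close>, and
  \<open>ed\<close> consists of the inverted pairs in different blocks. The first three members of
  \<open>ts\<close> are the extremal coordinates, which cut out the Bruhat cell; each further one
  is, up to sign, an entry of \<open>um\<close> at a position in \<open>ed\<close>.\<close>

theorem spherical_data_ex:
  assumes s: "bij s"
  shows "\<exists>B ed ts. spherical_data s B ed ts"
proof -
  have c0: "\<exists>B ed ts. spherical_data s B ed ts" if "s 0 = 0" "s 1 = 1" "s 2 = 2" "s 3 = 3"
    by (rule exI[of _ "fun4 0 1 2 3"], rule exI[of _ "{}"], rule exI[of _ "[T1 0, T2 0 1, T3 3]"])
      (simp add: spherical_data_def that all4 fun4_def um_entry minv_um le2_def)
  have c1: "\<exists>B ed ts. spherical_data s B ed ts" if "s 0 = 0" "s 1 = 1" "s 2 = 3" "s 3 = 2"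
    by (rule exI[of _ "fun4 0 1 2 2"], rule exI[of _ "{}"], rule exI[of _ "[T1 0, T2 0 1, T3 2]"])
      (simp add: spherical_data_def that all4 fun4_def um_entry minv_um le2_def)
  have c2: "\<exists>B ed ts. spherical_data s B ed ts" if "s 0 = 0" "s 1 = 2" "s 2 = 1" "s 3 = 3"
    by (rule exI[of _ "fun4 0 1 1 2"], rule exI[of _ "{}"], rule exI[of _ "[T1 0, T2 0 2, T3 3]"])
      (simp add: spherical_data_def that all4 fun4_def um_entry minv_um le2_def)
  have c3: "\<exists>B ed ts. spherical_data s B ed ts" if "s 0 = 0" "s 1 = 2" "s 2 = 3" "s 3 = 1"
    by (rule exI[of _ "fun4 0 1 1 2"], rule exI[of _ "{(1, 3)}"], rule exI[of _ "[T1 0, T2 0 2, T3 1, T3 3]"])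
      (simp add: spherical_data_def that all4 fun4_def um_entry minv_um le2_def)
  have c4: "\<exists>B ed ts. spherical_data s B ed ts" if "s 0 = 0" "s 1 = 3" "s 2 = 1" "s 3 = 2"
    by (rule exI[of _ "fun4 0 1 2 2"], rule exI[of _ "{(1, 3)}"], rule exI[of _ "[T1 0, T2 0 3, T3 2, T2 0 1]"])
      (simp add: spherical_data_def that all4 fun4_def um_entry minv_um le2_def)
  have c5: "\<exists>B ed ts. spherical_data s B ed ts" if "s 0 = 0" "s 1 = 3" "s 2 = 2" "s 3 = 1"
    by (rule exI[of _ "fun4 0 1 1 1"], rule exI[of _ "{}"], rule exI[of _ "[T1 0, T2 0 3, T3 1]"])
      (simp add: spherical_data_def that all4 fun4_def um_entry minv_um le2_def)
  have c6: "\<exists>B ed ts. spherical_data s B ed ts" if "s 0 = 1" "s 1 = 0" "s 2 = 2" "s 3 = 3"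
    by (rule exI[of _ "fun4 0 0 1 2"], rule exI[of _ "{}"], rule exI[of _ "[T1 1, T2 1 0, T3 3]"])
      (simp add: spherical_data_def that all4 fun4_def um_entry minv_um le2_def)
  have c7: "\<exists>B ed ts. spherical_data s B ed ts" if "s 0 = 1" "s 1 = 0" "s 2 = 3" "s 3 = 2"
    by (rule exI[of _ "fun4 0 0 1 1"], rule exI[of _ "{}"], rule exI[of _ "[T1 1, T2 1 0, T3 2]"])
      (simp add: spherical_data_def that all4 fun4_def um_entry minv_um le2_def)
  have c8: "\<exists>B ed ts. spherical_data s B ed ts" if "s 0 = 1" "s 1 = 2" "s 2 = 0" "s 3 = 3"
    by (rule exI[of _ "fun4 0 0 1 2"], rule exI[of _ "{(0, 2)}"], rule exI[of _ "[T1 1, T2 1 2, T3 3, T2 0 1]"])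
      (simp add: spherical_data_def that all4 fun4_def um_entry minv_um le2_def)
  have c9: "\<exists>B ed ts. spherical_data s B ed ts" if "s 0 = 1" "s 1 = 2" "s 2 = 3" "s 3 = 0"
    by (rule exI[of _ "fun4 0 0 1 2"], rule exI[of _ "{(0, 2), (0, 3)}"], rule exI[of _ "[T1 1, T2 1 2, T3 0, T2 0 1, T3 3]"])
      (simp add: spherical_data_def that all4 fun4_def um_entry minv_um le2_def)
  have c10: "\<exists>B ed ts. spherical_data s B ed ts" if "s 0 = 1" "s 1 = 3" "s 2 = 0" "s 3 = 2"
    by (rule exI[of _ "fun4 0 0 1 1"], rule exI[of _ "{(0, 3)}"], rule exI[of _ "[T1 1, T2 1 3, T3 2, T2 0 1]"])
      (simp add: spherical_data_def that all4 fun4_def um_entry minv_um le2_def)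
  have c11: "\<exists>B ed ts. spherical_data s B ed ts" if "s 0 = 1" "s 1 = 3" "s 2 = 2" "s 3 = 0"
    by (rule exI[of _ "fun4 0 0 1 1"], rule exI[of _ "{(0, 2), (0, 3)}"], rule exI[of _ "[T1 1, T2 1 3, T3 0, T3 2, T2 0 1]"])
      (simp add: spherical_data_def that all4 fun4_def um_entry minv_um le2_def)
  have c12: "\<exists>B ed ts. spherical_data s B ed ts" if "s 0 = 2" "s 1 = 0" "s 2 = 1" "s 3 = 3"
    by (rule exI[of _ "fun4 0 1 1 2"], rule exI[of _ "{(0, 2)}"], rule exI[of _ "[T1 2, T2 2 0, T3 3, T1 0]"])
      (simp add: spherical_data_def that all4 fun4_def um_entry minv_um le2_def)
  have c13: "\<exists>B ed ts. spherical_data s B ed ts" if "s 0 = 2" "s 1 = 0" "s 2 = 3" "s 3 = 1"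
    by (rule exI[of _ "fun4 0 1 1 2"], rule exI[of _ "{(0, 2), (1, 3)}"], rule exI[of _ "[T1 2, T2 2 0, T3 1, T1 0, T3 3]"])
      (simp add: spherical_data_def that all4 fun4_def um_entry minv_um le2_def)
  have c14: "\<exists>B ed ts. spherical_data s B ed ts" if "s 0 = 2" "s 1 = 1" "s 2 = 0" "s 3 = 3"
    by (rule exI[of _ "fun4 0 0 0 1"], rule exI[of _ "{}"], rule exI[of _ "[T1 2, T2 2 1, T3 3]"])
      (simp add: spherical_data_def that all4 fun4_def um_entry minv_um le2_def)
  have c15: "\<exists>B ed ts. spherical_data s B ed ts" if "s 0 = 2" "s 1 = 1" "s 2 = 3" "s 3 = 0"
    by (rule exI[of _ "fun4 0 0 0 1"], rule exI[of _ "{(0, 3)}"], rule exI[of _ "[T1 2, T2 2 1, T3 0, T3 3]"])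
      (simp add: spherical_data_def that all4 fun4_def um_entry minv_um le2_def)
  have c16: "\<exists>B ed ts. spherical_data s B ed ts" if "s 0 = 2" "s 1 = 3" "s 2 = 0" "s 3 = 1"
    by (rule exI[of _ "fun4 0 1 1 2"], rule exI[of _ "{(0, 2), (0, 3), (1, 3)}"], rule exI[of _ "[T1 2, T2 2 3, T3 1, T1 0, T2 0 2, T2 1 2]"])
      (simp add: spherical_data_def that all4 fun4_def um_entry minv_um le2_def)
  have c17: "\<exists>B ed ts. spherical_data s B ed ts" if "s 0 = 2" "s 1 = 3" "s 2 = 1" "s 3 = 0"
    by (rule exI[of _ "fun4 0 0 0 1"], rule exI[of _ "{(0, 3), (1, 3)}"], rule exI[of _ "[T1 2, T2 2 3, T3 0, T2 1 2, T3 3]"])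
      (simp add: spherical_data_def that all4 fun4_def um_entry minv_um le2_def)
  have c18: "\<exists>B ed ts. spherical_data s B ed ts" if "s 0 = 3" "s 1 = 0" "s 2 = 1" "s 3 = 2"
    by (rule exI[of _ "fun4 0 1 2 2"], rule exI[of _ "{(0, 3), (1, 3)}"], rule exI[of _ "[T1 3, T2 3 0, T3 2, T1 0, T1 1]"])
      (simp add: spherical_data_def that all4 fun4_def um_entry minv_um le2_def)
  have c19: "\<exists>B ed ts. spherical_data s B ed ts" if "s 0 = 3" "s 1 = 0" "s 2 = 2" "s 3 = 1"
    by (rule exI[of _ "fun4 0 1 1 1"], rule exI[of _ "{(0, 3)}"], rule exI[of _ "[T1 3, T2 3 0, T3 1, T1 0]"])
      (simp add: spherical_data_def that all4 fun4_def um_entry minv_um le2_def)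
  have c20: "\<exists>B ed ts. spherical_data s B ed ts" if "s 0 = 3" "s 1 = 1" "s 2 = 0" "s 3 = 2"
    by (rule exI[of _ "fun4 0 0 1 1"], rule exI[of _ "{(0, 3), (1, 3)}"], rule exI[of _ "[T1 3, T2 3 1, T3 2, T1 1, T2 0 1]"])
      (simp add: spherical_data_def that all4 fun4_def um_entry minv_um le2_def)
  have c21: "\<exists>B ed ts. spherical_data s B ed ts" if "s 0 = 3" "s 1 = 1" "s 2 = 2" "s 3 = 0"
    by (rule exI[of _ "fun4 0 0 1 1"], rule exI[of _ "{(0, 2), (0, 3), (1, 3)}"], rule exI[of _ "[T1 3, T2 3 1, T3 0, T1 1, T2 0 1, T3 2]"])
      (simp add: spherical_data_def that all4 fun4_def um_entry minv_um le2_def)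
  have c22: "\<exists>B ed ts. spherical_data s B ed ts" if "s 0 = 3" "s 1 = 2" "s 2 = 0" "s 3 = 1"
    by (rule exI[of _ "fun4 0 1 1 1"], rule exI[of _ "{(0, 2), (0, 3)}"], rule exI[of _ "[T1 3, T2 3 2, T3 1, T2 0 3, T1 0]"])
      (simp add: spherical_data_def that all4 fun4_def um_entry minv_um le2_def)
  have c23: "\<exists>B ed ts. spherical_data s B ed ts" if "s 0 = 3" "s 1 = 2" "s 2 = 1" "s 3 = 0"
    by (rule exI[of _ "fun4 0 0 0 0"], rule exI[of _ "{}"], rule exI[of _ "[T1 3, T2 3 2, T3 0]"])
      (simp add: spherical_data_def that all4 fun4_def um_entry minv_um le2_def)
  show ?thesis
    using exhaust4[of "s 0"] exhaust4[of "s 1"] exhaust4[of "s 2"] exhaust4[of "s 3"] bij4_cases[OF s]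
    by (elim disjE) (simp_all add: c0 c1 c2 c3 c4 c5 c6 c7 c8 c9 c10 c11 c12 c13 c14 c15 c16 c17 c18 c19 c20 c21 c22 c23)
qed

lemma spherical_dataD:
  assumes "spherical_data s B ed ts"
  shows "B 0 \<le> B 1" "B 1 \<le> B 2" "B 2 \<le> B 3" "ed \<subseteq> {(0,2), (0,3), (1,3)}"
    "\<forall>a b. b < a \<and> B (s a) < B (s b) \<longrightarrow> (s a, s b) \<in> ed"
    "T1 (s 0) \<in> set ts" "T2 (s 0) (s 1) \<in> set ts" "T3 (s 3) \<in> set ts" "\<forall>t\<in>set ts. row_final B t"
    "\<forall>t\<in>set ts. evu s t (um (if (0,2) \<in> ed then 1 else 0) (if (0,3) \<in> ed then 1 else 0) (if (1,3) \<in> ed then 1 else 0)) \<noteq> 0"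
    "\<forall>a b. (a = 1 \<and> b = 0 \<or> a = 2 \<and> b = 1 \<or> a = 3 \<and> b = 2) \<and> B a = B b \<longrightarrow>
        (s 0 < a \<longrightarrow> s 0 < b) \<and> (\<forall>l. l \<noteq> a \<and> \<not> le2 a l (s 0) (s 1) \<longrightarrow> l = b \<or> \<not> le2 b l (s 0) (s 1)) \<and>
        (b < s 3 \<longrightarrow> a < s 3)"
    "\<forall>x y z. ((0,2) \<notin> ed \<longrightarrow> x = 0) \<and> ((0,3) \<notin> ed \<longrightarrow> y = 0) \<and> ((1,3) \<notin> ed \<longrightarrow> z = 0) \<and>
        (\<forall>t\<in>set ts. evu s t (um x y z) \<noteq> 0) \<longrightarrow>
        ((0,2) \<in> ed \<longrightarrow> x \<noteq> 0) \<and> ((0,3) \<in> ed \<longrightarrow> y \<noteq> 0) \<and> ((1,3) \<in> ed \<longrightarrow> z \<noteq> 0)"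
  using assms unfolding spherical_data_def by - (elim conjE, assumption)+

text \<open>The generic points form a single orbit of the two triangular groups:
  \<open>schub_cell\<close> and \<open>cell_factor\<close> reduce such a point to
  \<open>u ** n\<close> with \<open>u - mat 1\<close> supported on \<open>ed\<close>, and the torus
  turns its nonzero entries into 1.\<close>

lemma spherical_orbit:
  assumes data: "spherical_data s B ed ts" and s: "bij s" and n0: "monomial n0 s"
  defines "y \<equiv> um (if (0,2) \<in> ed then 1 else 0) (if (0,3) \<in> ed then 1 else 0) (if (1,3) \<in> ed then 1 else 0) ** n0"
  shows "y \<in> schub s"
    and "\<And>l b t. l \<in> pat (blk_rel B) \<Longrightarrow> b \<in> pat (\<le>) \<Longrightarrow> t \<in> set ts \<Longrightarrow> ev t (l ** y ** b) \<noteq> 0"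
    and "\<And>A. A \<in> schub s \<Longrightarrow> (\<And>t. t \<in> set ts \<Longrightarrow> ev t A \<noteq> 0) \<Longrightarrow>
      \<exists>l\<in>pat (blk_rel B). \<exists>b\<in>pat (\<le>). A = l ** y ** b"
proof -
  let ?u = "um (if (0,2) \<in> ed then 1 else 0) (if (0,3) \<in> ed then 1 else 0) (if (1,3) \<in> ed then 1 else 0)"
  note Bg = subgroup_SLD[OF subgroup_pat[OF preorder_le]]
  note Eg = subgroup_SLD[OF subgroup_pat[OF preorder_blk_rel[of B]]]
  have dn0: "det n0 = 1" using monomialD(1)[OF n0] .
  have dy: "det y = 1" using dn0 by (simp add: y_def det_mul det_um)
  have row_final: "row_final B t" if "t \<in> set ts" for t using spherical_dataD(9)[OF data] that by (rule bspec)
  show "y \<in> schub s" unfolding y_def by (intro schub_left monomial_schub n0 um_upper)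
  have "ev t y \<noteq> 0" if "t \<in> set ts" for t
    unfolding y_def ev_um[OF n0 det_um] using spherical_dataD(10)[OF data] that by (rule bspec)
  then show "ev t (l ** y ** b) \<noteq> 0" if "l \<in> pat (blk_rel B)" "b \<in> pat (\<le>)" "t \<in> set ts" for l b t
    using ev_nonzero[OF that(1) row_final[OF that(3)] that(2) dy] that(3) by blast
  have Bm: "B 0 \<le> B 1" "B 1 \<le> B 2" "B 2 \<le> B 3" by (rule spherical_dataD[OF data])+
  define R where "R i j \<longleftrightarrow> B i \<le> B j" for i j
  have "B i \<le> B j" if "i \<le> j" for i j
    using that exhaust4[of i] exhaust4[of j] Bm by auto
  then have R: "upper_rel R" unfolding upper_rel_def preorder_rel_def R_def by auto
  have simR: "sim R i j \<longleftrightarrow> B i = B j" for i j by (auto simp: R_def)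
  show "\<exists>l\<in>pat (blk_rel B). \<exists>b\<in>pat (\<le>). A = l ** y ** b"
    if A: "A \<in> schub s" and nz: "\<And>t. t \<in> set ts \<Longrightarrow> ev t A \<noteq> 0" for A
  proof -
    note T = spherical_dataD(6-8)[OF data]
    have ex: "A $ s 0 $ 0 \<noteq> 0" "p2 A (s 0) (s 1) \<noteq> 0" "minv A $ 3 $ s 3 \<noteq> 0"
      using nz[of "T1 (s 0)"] nz[of "T2 (s 0) (s 1)"] nz[of "T3 (s 3)"] T by auto
    obtain b n b' where br: "b \<in> pat (\<le>)" "b' \<in> pat (\<le>)" "monomial n s" "A = b ** n ** b'"
      by (rule schub_cell[OF A s ex])
    obtain l u b'' where f: "l \<in> pat (\<lambda>i j. sim R i j \<and> i \<le> j)" "u - mat 1 \<in> palg (\<lambda>i j. str R i j \<and> inv s j < inv s i)"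
      "b'' \<in> pat (\<le>)" "b ** n = l ** u ** n ** b''" using cell_factor[OF R br(3,1)] by blast
    have l: "l \<in> pat (blk_rel B)" using f(1) unfolding simR .
    have dn: "det n = 1" using monomialD(1)[OF br(3)] .
    have inj: "inj s" and surj: "surj s" using s by (auto simp: bij_def)
    have ued: "(i, j) \<in> ed" if "(u - mat 1) $ i $ j \<noteq> 0" for i j
    proof -
      have "str R i j" "inv s j < inv s i" using palgD[OF f(2) that] by auto
      then have "B (s (inv s i)) < B (s (inv s j))" by (auto simp: R_def surj_f_inv_f[OF surj])
      then have "(s (inv s i), s (inv s j)) \<in> ed"
        using spherical_dataD(5)[OF data] \<open>inv s j < inv s i\<close> by blast
      then show ?thesis by (simp add: surj_f_inv_f[OF surj])
    qed
    have edsub: "ed \<subseteq> {(0,2), (0,3), (1,3)}" by (rule spherical_dataD[OF data])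
    define x where "x = u $ 0 $ 2"
    define yy where "yy = u $ 0 $ 3"
    define z where "z = u $ 1 $ 3"
    have uz: "u $ i $ j = mat 1 $ i $ j" if "(i, j) \<notin> ed" for i j using ued[of i j] that by auto
    have uz': "u $ i $ j = mat 1 $ i $ j" if "(i, j) \<notin> {(0,2), (0,3), (1,3)}" for i j
      using uz[of i j] that edsub by blast
    have u: "u = um x yy z"
      by (rule matrix4_eqI) (simp add: all4 um_entry x_def yy_def z_def uz' mat_def)
    have 0: "(0,2) \<notin> ed \<longrightarrow> x = 0" "(0,3) \<notin> ed \<longrightarrow> yy = 0" "(1,3) \<notin> ed \<longrightarrow> z = 0"
      using uz[of 0 2] uz[of 0 3] uz[of 1 3] by (auto simp: x_def yy_def z_def mat_def)
    have "evu s t (um x yy z) \<noteq> 0" if t: "t \<in> set ts" for t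
    proof -
      have "A = l ** (u ** n) ** (b'' ** b')" using br(4) f(4) by (simp add: matrix_mul_assoc)
      moreover have "det (u ** n) = 1" using dn by (simp add: u det_mul det_um)
      ultimately have "ev t (u ** n) \<noteq> 0"
        using ev_nonzero[OF l row_final[OF t] Bg(3)[OF f(3) br(2)]] nz[OF t] by metis
      then show ?thesis using ev_um[OF br(3) det_um] u by metis
    qed
    then have 1: "(0,2) \<in> ed \<longrightarrow> x \<noteq> 0" "(0,3) \<in> ed \<longrightarrow> yy \<noteq> 0" "(1,3) \<in> ed \<longrightarrow> z \<noteq> 0"
      using spherical_dataD(12)[OF data, rule_format, of x yy z] 0 by simp_all
    obtain d where d: "d \<in> pat (=)"
      "d ** um x yy z = um (if x = 0 then 0 else 1) (if yy = 0 then 0 else 1) (if z = 0 then 0 else 1) ** d"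
      by (rule torus_um)
    have dd: "det d = 1" using d by (simp add: pat_def)
    have "(if x = 0 then 0 else 1) = (if (0,2) \<in> ed then 1 else 0 :: complex)"
      "(if yy = 0 then 0 else 1) = (if (0,3) \<in> ed then 1 else 0 :: complex)"
      "(if z = 0 then 0 else 1) = (if (1,3) \<in> ed then 1 else 0 :: complex)" using 0 1 by auto
    then have du: "d ** u = ?u ** d" using d(2) u by simp
    \<comment> \<open>The torus element \<open>d\<close>, carried through \<open>n0\<close>, and the
      diagonal ratio of the two monomial matrices over \<open>s\<close> are absorbed into the upper
      triangular factor on the right.\<close>
    let ?c = "minv n0 ** d ** n0" and ?e = "minv n0 ** n"
    have c: "?c \<in> pat (\<le>)"
    proof -
      have "?c \<in> palg (\<lambda>a b. s a = s b)" by (rule monomial_conj_palg[OF n0 patD(2)[OF d(1)]])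
      then have "?c \<in> palg (\<le>)" by (rule palg_mono) (use inj in \<open>auto dest: injD\<close>)
      then show ?thesis using dd dn0 by (simp add: pat_def det_mul minv_det)
    qed
    have e: "?e \<in> pat (\<le>)"
    proof -
      have "?e \<in> palg (\<le>)"
      proof (rule palgI)
        fix a b assume "?e $ a $ b \<noteq> 0"
        then obtain k where "minv n0 $ a $ k \<noteq> 0" "n $ k $ b \<noteq> 0" by (rule mult_entry_nonzero)
        then have "k = s a" "k = s b" using monomial_minv[OF n0] monomialD(3)[OF br(3)] by (auto split: if_splits)
        then show "a \<le> b" using inj by (auto dest: injD)
      qed
      then show ?thesis using dn dn0 by (simp add: pat_def det_mul minv_det)
    qed
    have d': "minv d \<in> pat (blk_rel B)" by (rule pat_mono[OF pat_minv[OF _ d(1)]]) (auto simp: preorder_rel_def)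
    have "A = (l ** minv d) ** y ** (?c ** ?e ** b'' ** b')"
    proof -
      have "A = l ** u ** n ** b'' ** b'" using br(4) f(4) by simp
      also have "u = minv d ** (?u ** d)" unfolding du[symmetric] by (simp add: minv_l_cancel[OF dd])
      also have "l ** (minv d ** (?u ** d)) ** n ** b'' ** b' = (l ** minv d) ** y ** (?c ** ?e ** b'' ** b')"
        unfolding y_def by (simp add: matrix_mul_assoc[symmetric] minv_r_cancel[OF dn0])
      finally show ?thesis .
    qed
    moreover have "l ** minv d \<in> pat (blk_rel B)" by (intro Eg(3) l d')
    moreover have "?c ** ?e ** b'' ** b' \<in> pat (\<le>)" by (intro Bg(3) c e f(3) br(2))
    ultimately show ?thesis by blast
  qed
qed

section \<open>Weyl group representatives and closures of double cosets\<close>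

text \<open>Conjugation by \<open>n\<close> keeps a diagonal matrix with distinct entries diagonal.
  Hence the nonzero entries in a row of \<open>n\<close> all sit in columns with the same entry of
  that matrix, that is, in a single column.\<close>

lemma normalizer_monomial:
  fixes n :: "complex^'n::{finite,wellorder}^'n::{finite,wellorder}"
  assumes "n \<in> normalizer SL diagonal_torus"
  shows "\<exists>s. monomial n s"
proof -
  let ?T = "diagonal_torus :: (complex^'n::{finite,wellorder}^'n::{finite,wellorder}) set"
  have dn: "det n = 1" and nT: "n <#\<^bsub>SL\<^esub> ?T #>\<^bsub>SL\<^esub> minv n = ?T"
  proof -
    have "?T \<subseteq> carrier SL" by (auto simp: diagonal_torus_def)
    then show "det n = 1" "n <#\<^bsub>SL\<^esub> ?T #>\<^bsub>SL\<^esub> minv n = ?T"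
      using assms unfolding normalizer_def stabilizer_def by simp_all
  qed
  obtain d :: "'n \<Rightarrow> complex" where d: "det (\<chi> i j. if i = j then d i else 0) = 1"
    "\<And>i j. d i = d j \<longleftrightarrow> i = j"
  proof -
    obtain d :: "'n \<Rightarrow> complex" where "det (\<chi> i j. if i = j then d i else 0) = 1" "\<And>i j. d i = d j \<longleftrightarrow> sim (\<le>) i j"
      using separating_diagonal[OF upper_le] by blast
    then show ?thesis using that[of d] by (metis order_antisym order_refl)
  qed
  define z where "z = (\<chi> i j. if i = j then d i else 0)"
  have "z \<in> ?T" using d(1) by (simp add: diagonal_torus_def z_def)
  then have "n ** z ** minv n \<in> n <#\<^bsub>SL\<^esub> ?T #>\<^bsub>SL\<^esub> minv n"
    unfolding l_coset_def r_coset_def by auto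
  then have "n ** z ** minv n \<in> ?T" using nT by simp
  then have off: "(n ** z ** minv n) $ i $ j = 0" if "i \<noteq> j" for i j using that by (auto simp: diagonal_torus_def)
  define e where "e i = (n ** z ** minv n) $ i $ i" for i
  have eq: "n $ i $ j * d j = e i * n $ i $ j" for i j
  proof -
    have "(n ** z) $ i $ j = n $ i $ j * d j"
      unfolding mult_entry z_def by (simp add: if_distrib[of "\<lambda>x. _ * x"] cong: if_cong)
    moreover have "n ** z = (n ** z ** minv n) ** n" using dn by (simp add: matrix_mul_assoc[symmetric] minv_l)
    moreover have "((n ** z ** minv n) ** n) $ i $ j = (\<Sum>k\<in>{i}. (n ** z ** minv n) $ i $ k * n $ k $ j)"
      unfolding mult_entry[of "n ** z ** minv n"] using off by (intro sum.mono_neutral_right) auto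
    ultimately show ?thesis by (simp add: e_def)
  qed
  have row: "j = j'" if "n $ i $ j \<noteq> 0" "n $ i $ j' \<noteq> 0" for i j j'
  proof -
    have "d j = e i" "d j' = e i" using eq[of i j] eq[of i j'] that by auto
    then show ?thesis using d(2) by metis
  qed
  have "\<exists>i. n $ i $ j \<noteq> 0" for j using det_zero_col[of n j] dn by force
  then obtain s where s: "\<And>j. n $ s j $ j \<noteq> 0" by metis
  have inj: "inj s" by (rule injI) (metis row s)
  then have bij: "bij s" by (simp add: bij_def finite_UNIV_inj_surj)
  have "n $ i $ j \<noteq> 0 \<longleftrightarrow> i = s j" for i j
  proof
    assume nz: "n $ i $ j \<noteq> 0"
    obtain k where "i = s k" using bij by (metis bij_pointE)
    then show "i = s j" using row[of i j k] nz s[of k] by simp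
  qed (use s in simp)
  then show ?thesis unfolding monomial_def using dn bij by blast
qed

text \<open>\<open>s\<close> is the largest permutation occurring in the double coset
  \<open>D\<close>, which \<open>w\<close> itself need not be. Since \<open>schub s\<close> is
  closed, stable under \<open>P\<close> and contains \<open>D\<close> as a dense subset, it is the
  full preimage of the closure.\<close>

lemma schubert_closure:
  fixes P w :: "(complex^4^4) set"
  assumes P: "P = pat R" "upper_rel R" and w: "w \<in> carrier weyl_group"
  shows "\<exists>s n. bij s \<and> monomial n s \<and> closedin (coset_space P) (schubert_variety P w) \<and> pre P (schubert_variety P w) = schub s"
proof -
  note PR = upper_relD(1)[OF P(2)]
  have Ps: "subgroup P SL" unfolding P(1) by (rule subgroup_pat[OF PR])
  note Pg = subgroup_SLD[OF Ps] and Bg = subgroup_SLD[OF subgroup_pat[OF preorder_le]]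
  have BP: "pat (\<le>) \<subseteq> P" unfolding P(1) using pat_mono upper_relD(2)[OF P(2)] by blast
  let ?N = "normalizer SL diagonal_torus :: (complex^4^4) set"
  obtain n where n: "n \<in> ?N" "w = diagonal_torus #>\<^bsub>SL\<^esub> n"
    using w unfolding weyl_group_def FactGroup_def RCOSETS_def r_coset_def by auto
  obtain t where "monomial n t" using normalizer_monomial[OF n(1)] by blast
  then have dn: "det n = 1" by (rule monomialD(1))
  define S where "S = {(b \<otimes>\<^bsub>SL\<^esub> m) <#\<^bsub>SL\<^esub> P | b m. b \<in> upper_triangular \<and> m \<in> w}"
  have w_iff: "m \<in> w \<longleftrightarrow> (\<exists>t\<in>diagonal_torus. m = t ** n)" for m unfolding n(2) r_coset_def by auto
  have TB: "diagonal_torus \<subseteq> (pat (\<le>) :: (complex^4^4) set)"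
    by (auto simp: diagonal_torus_def pat_def palg_def)
  have one: "mat 1 \<in> (diagonal_torus :: (complex^4^4) set)" by (simp add: diagonal_torus_def) (simp add: mat_def)
  define D where "D = {X ** p | X p. X \<in> {b ** m | b m. b \<in> pat (\<le>) \<and> m \<in> {n}} \<and> p \<in> P}"
  have D_mem: "g \<in> D \<longleftrightarrow> (\<exists>b\<in>pat (\<le>). \<exists>p\<in>P. g = b ** n ** p)" for g unfolding D_def by blast
  have Ddet: "det g = 1" if "g \<in> D" for g
    using that Pg(1) Bg(1) dn unfolding D_mem by (auto simp: det_mul)
  have SD: "g <#\<^bsub>SL\<^esub> P \<in> S" if g: "g \<in> D" for g
  proof -
    obtain b p where bp: "b \<in> pat (\<le>)" "p \<in> P" "g = b ** n ** p" using g unfolding D_mem by blast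
    have d: "det (b ** n) = 1" using Bg(1)[OF bp(1)] dn by (simp add: det_mul)
    have "minv (b ** n) ** g = p" unfolding bp(3) by (rule minv_l_cancel[OF d])
    then have "b ** n <#\<^bsub>SL\<^esub> P = g <#\<^bsub>SL\<^esub> P" using lcoset_eq_iff[OF Ps d Ddet[OF g]] bp(2) by simp
    moreover have "n \<in> w" unfolding w_iff using one by (intro bexI[of _ "mat 1"]) auto
    ultimately show ?thesis unfolding S_def upper_triangular_pat using bp(1)
      by (intro CollectI exI[of _ b] exI[of _ n]) simp
  qed
  have DS: "\<exists>g\<in>D. C = g <#\<^bsub>SL\<^esub> P" if C: "C \<in> S" for C
  proof -
    obtain b m where bm: "C = b ** m <#\<^bsub>SL\<^esub> P" "b \<in> pat (\<le>)" "m \<in> w"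
      using C unfolding S_def upper_triangular_pat by auto
    obtain t where t: "t \<in> diagonal_torus" "m = t ** n" using bm(3) w_iff by blast
    have "b ** m = (b ** t) ** n ** mat 1" by (simp add: t(2) matrix_mul_assoc)
    moreover have "b ** t \<in> pat (\<le>)" using Bg(3)[OF bm(2)] t(1) TB by blast
    ultimately have "b ** m \<in> D" unfolding D_mem using Pg(2) by (intro bexI[of _ "b ** t"] bexI[of _ "mat 1"])
    then show ?thesis using bm(1) by (rule bexI[rotated])
  qed
  have irr_D: "irr D" unfolding D_def P(1) by (intro irr_mult irr_pat irr_singleton preorder_le PR)
  have nD: "n \<in> D" unfolding D_mem using Bg(2) Pg(2) by (intro bexI[of _ "mat 1"]) auto
  \<comment> \<open>The permutations with a monomial matrix inside \<open>D\<close>. By the Bruhat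
    decomposition their sets \<open>schub s\<close> cover \<open>D\<close>, and an irreducible set
    lies in one member of a finite closed cover.\<close>
  define I where "I = {s. bij s \<and> (\<exists>m. monomial m s \<and> m \<in> D)}"
  have Dp: "b ** g ** p \<in> D" if bpg: "b \<in> pat (\<le>)" "p \<in> P" "g \<in> D" for b g p
  proof -
    obtain b1 p1 where "b1 \<in> pat (\<le>)" "p1 \<in> P" "g = b1 ** n ** p1" using bpg(3) unfolding D_mem by blast
    then have "b ** g ** p = (b ** b1) ** n ** (p1 ** p)" "b ** b1 \<in> pat (\<le>)" "p1 ** p \<in> P"
      using bpg Bg(3) Pg(3) by (auto simp: matrix_mul_assoc)
    then show ?thesis unfolding D_mem by blast
  qed
  have "\<exists>s\<in>I. D \<subseteq> schub s"
  proof (rule irr_finite_union[OF _ irr_D])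
    show "finite I" by simp
    show "D \<noteq> {}" using nD by blast
    show "closedin zariski (schub s)" for s by (rule closedin_schub)
    show "det A = 1" if "A \<in> D" for A using Ddet that .
    show "D \<subseteq> (\<Union>s\<in>I. schub s)"
    proof
      fix g assume g: "g \<in> D"
      obtain b m b' s where br: "b \<in> pat (\<le>)" "b' \<in> pat (\<le>)" "monomial m s" "g = b ** m ** b'"
        by (rule bruhat[OF Ddet[OF g]])
      have db: "det b = 1" "det b' = 1" using br by (auto simp: pat_def)
      have "m = minv b ** g ** minv b'" unfolding br(4)
        using db by (simp add: matrix_mul_assoc[symmetric] minv_l_cancel minv_r)
      then have "m \<in> D" using Dp[OF Bg(4)[OF br(1)] _ g, of "minv b'"] Bg(4)[OF br(2)] BP by auto
      then have "s \<in> I" using br(3) monomialD(2)[OF br(3)] by (auto simp: I_def)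
      moreover have "g \<in> schub s" unfolding br(4) by (intro schub_right schub_left monomial_schub br)
      ultimately show "g \<in> (\<Union>s\<in>I. schub s)" by blast
    qed
  qed
  then obtain s m where s: "bij s" "monomial m s" "m \<in> D" "D \<subseteq> schub s" by (auto simp: I_def)
  have irrX: "irr (schub s)" using irr_schub normset_schub[OF s(1)] by (simp add: normset_def)
  \<comment> \<open>The product \<open>?q\<close> of the extremal coordinates cuts out the Bruhat
    cell of \<open>s\<close> in the irreducible \<open>schub s\<close>, and this cell lies in
    \<open>D\<close> because it is the one of \<open>m\<close>.\<close>
  have dense: "p A = 0" if p: "polynomial_fun p" "\<And>g. g \<in> D \<Longrightarrow> p g = 0" and A: "A \<in> schub s" for p A
  proof (rule ccontr)
    assume nz: "p A \<noteq> 0"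
    let ?q = "\<lambda>A. A $ s 0 $ 0 * (p2 A (s 0) (s 1) * cofac A 3 (s 3))"
    have q: "polynomial_fun ?q" unfolding p2_def
      by (intro polynomial_fun.mult polynomial_fun_diff polynomial_fun.entry polynomial_fun_cofac)
    have "minv m $ 3 $ s 3 \<noteq> 0" using monomial_minv[OF s(2)] monomialD(3)[OF s(2)] by simp
    then have "?q m \<noteq> 0"
      using monomialD[OF s(2)] monomial_p2[OF s(2)] minv_cofac[of m 3 "s 3"] by simp
    from irrD[OF irrX p(1) q A _ nz this] obtain C where C: "C \<in> schub s" "p C \<noteq> 0" "?q C \<noteq> 0"
      using monomial_schub[OF s(2)] by blast
    have "det C = 1" using C(1) by (simp add: schub_def)
    then have ex: "C $ s 0 $ 0 \<noteq> 0" "p2 C (s 0) (s 1) \<noteq> 0" "minv C $ 3 $ s 3 \<noteq> 0"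
      using C(3) by (auto simp: minv_cofac)
    obtain b n' b' where br: "b \<in> pat (\<le>)" "b' \<in> pat (\<le>)" "monomial n' s" "C = b ** n' ** b'"
      by (rule schub_cell[OF C(1) s(1) ex])
    have dm: "det m = 1" using monomialD(1)[OF s(2)] .
    have e: "minv m ** n' \<in> pat (\<le>)"
    proof -
      have "minv m ** n' \<in> palg (\<le>)"
      proof (rule palgI)
        fix a b assume "(minv m ** n') $ a $ b \<noteq> 0"
        then obtain k where "minv m $ a $ k \<noteq> 0" "n' $ k $ b \<noteq> 0" by (rule mult_entry_nonzero)
        then have "k = s a" "k = s b" using monomial_minv[OF s(2)] monomialD(3)[OF br(3)] by (auto split: if_splits)
        then show "a \<le> b" using s(1) by (auto dest: bij_is_inj injD)
      qed
      then show ?thesis using dm monomialD(1)[OF br(3)] by (simp add: pat_def det_mul minv_det)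
    qed
    have "C = b ** m ** ((minv m ** n') ** b')" unfolding br(4)
      by (simp add: matrix_mul_assoc[symmetric] minv_r_cancel[OF dm])
    moreover have "(minv m ** n') ** b' \<in> P" using Bg(3)[OF e br(2)] BP by blast
    ultimately have "C \<in> D" using Dp[OF br(1) _ s(3)] by metis
    then show False using p(2) C(2) by blast
  qed
  \<comment> \<open>Right translation by \<open>p\<close> preserves \<open>D\<close>, and a
    polynomial vanishing on \<open>D\<close> vanishes on \<open>schub s\<close>.\<close>
  have stable: "A ** p \<in> schub s" if A: "A \<in> schub s" and p: "p \<in> P" for A p
  proof (rule ccontr)
    assume n: "A ** p \<notin> schub s"
    have "det (A ** p) = 1" using A Pg(1)[OF p] by (simp add: det_mul schub_def)
    then obtain f where f: "polynomial_fun f" "\<And>B. B \<in> schub s \<Longrightarrow> f B = 0" "f (A ** p) \<noteq> 0"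
      using closedin_zariskiD[OF closedin_schub _ n] by blast
    have "f (g ** p) = 0" if "g \<in> D" for g
      using Dp[OF Bg(2) p that] s(4) f(2) by auto
    then have "f (A ** p) = 0" using dense[OF polynomial_fun_translate_right[OF f(1), of p] _ A] by blast
    then show False using f(3) by simp
  qed
  define Y where "Y = {g <#\<^bsub>SL\<^esub> P | g. g \<in> schub s}"
  have preY: "pre P Y = schub s"
  proof (intro subset_antisym subsetI)
    fix g assume "g \<in> pre P Y"
    then obtain h where h: "det g = 1" "h \<in> schub s" "h <#\<^bsub>SL\<^esub> P = g <#\<^bsub>SL\<^esub> P" by (auto simp: Y_def)
    have dh: "det h = 1" using h(2) by (simp add: schub_def)
    have "minv h ** g \<in> P" using lcoset_eq_iff[OF Ps dh h(1)] h(3) by simp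
    from stable[OF h(2) this] show "g \<in> schub s" by (simp add: minv_r_cancel[OF dh])
  next
    fix g assume "g \<in> schub s"
    then show "g \<in> pre P Y" by (auto simp: Y_def schub_def)
  qed
  have clY: "closedin (coset_space P) Y"
    unfolding closedin_coset_pre preY using closedin_schub by (auto simp: Y_def lcosets_SL schub_def)
  have SY: "S \<subseteq> Y" using DS s(4) by (fastforce simp: Y_def)
  have "schubert_variety P w = (coset_space P) closure_of S" by (simp add: schubert_variety_def S_def)
  also have "\<dots> = Y"
  proof (rule subset_antisym)
    show "(coset_space P) closure_of S \<subseteq> Y" using SY clY by (rule closure_of_minimal)
    show "Y \<subseteq> (coset_space P) closure_of S"
    proof
      fix C assume "C \<in> Y"
      then obtain A where A: "A \<in> schub s" "C = A <#\<^bsub>SL\<^esub> P" by (auto simp: Y_def)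
      have dA: "det A = 1" using A by (simp add: schub_def)
      let ?K = "(coset_space P) closure_of S"
      have "closedin (coset_space P) ?K" by simp
      then have clK: "closedin zariski (pre P ?K)" unfolding closedin_coset_pre by blast
      have Sl: "S \<subseteq> topspace (coset_space P)" using SY clY closedin_subset by blast
      show "C \<in> ?K"
      proof (rule ccontr)
        assume "C \<notin> ?K"
        then have "A \<notin> pre P ?K" using A(2) by simp
        then obtain f where f: "polynomial_fun f" "\<And>B. B \<in> pre P ?K \<Longrightarrow> f B = 0" "f A \<noteq> 0"
          using closedin_zariskiD[OF clK dA] by blast
        have "g \<in> pre P ?K" if "g \<in> D" for g
          using SD[OF that] Ddet[OF that] closure_of_subset[OF Sl] by blast
        then show False using dense[OF f(1) _ A(1)] f(2,3) by blast
      qed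
    qed
  qed
  finally have "schubert_variety P w = Y" .
  then show ?thesis using s(1,2) clY preY by blast
qed

section \<open>Stabilizers of subvarieties of the coset space\<close>

lemma left_mult_coset:
  "left_mult g (h <#\<^bsub>SL\<^esub> P) = (g ** h) <#\<^bsub>SL\<^esub> P"
proof -
  have "x \<in> left_mult g (h <#\<^bsub>SL\<^esub> P) \<longleftrightarrow> x \<in> (g ** h) <#\<^bsub>SL\<^esub> P" for x
    by (auto simp: l_coset_def matrix_mul_assoc)
  then show ?thesis by blast
qed

lemma variety_stabilizer_iff:
  assumes P: "subgroup P SL" and Y: "Y \<subseteq> lcosets\<^bsub>SL\<^esub> P"
  shows "g \<in> variety_stabilizer Y \<longleftrightarrow> det g = 1 \<and> (\<forall>A. det A = 1 \<longrightarrow> (g ** A \<in> pre P Y \<longleftrightarrow> A \<in> pre P Y))"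
proof (cases "det g = 1")
  case True
  have "left_mult g ` Y = Y \<longleftrightarrow> (\<forall>A. det A = 1 \<longrightarrow> (g ** A \<in> pre P Y \<longleftrightarrow> A \<in> pre P Y))"
  proof
    assume eq: "left_mult g ` Y = Y"
    show "\<forall>A. det A = 1 \<longrightarrow> (g ** A \<in> pre P Y \<longleftrightarrow> A \<in> pre P Y)"
    proof (intro allI impI iffI)
      fix A assume A: "det A = 1" "g ** A \<in> pre P Y"
      then have "left_mult g (A <#\<^bsub>SL\<^esub> P) \<in> left_mult g ` Y" by (simp add: left_mult_coset eq)
      then obtain C where C: "C \<in> Y" "left_mult g C = left_mult g (A <#\<^bsub>SL\<^esub> P)" by auto
      obtain h where h: "det h = 1" "C = h <#\<^bsub>SL\<^esub> P" using C(1) Y unfolding lcosets_SL by blast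
      have "left_mult (minv g) (left_mult g (h <#\<^bsub>SL\<^esub> P)) = left_mult (minv g) (left_mult g (A <#\<^bsub>SL\<^esub> P))"
        using C(2) h(2) by simp
      then have "h <#\<^bsub>SL\<^esub> P = A <#\<^bsub>SL\<^esub> P" by (simp only: left_mult_coset minv_l_cancel[OF True])
      then show "A \<in> pre P Y" using C(1) h(2) A(1) by simp
    next
      fix A assume A: "det A = 1" "A \<in> pre P Y"
      then have "left_mult g (A <#\<^bsub>SL\<^esub> P) \<in> Y" using eq by blast
      then show "g ** A \<in> pre P Y" using A True by (simp add: left_mult_coset det_mul)
    qed
  next
    assume *: "\<forall>A. det A = 1 \<longrightarrow> (g ** A \<in> pre P Y \<longleftrightarrow> A \<in> pre P Y)"
    show "left_mult g ` Y = Y"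
    proof (intro subset_antisym subsetI)
      fix C assume "C \<in> left_mult g ` Y"
      then obtain h where h: "det h = 1" "h <#\<^bsub>SL\<^esub> P \<in> Y" "C = left_mult g (h <#\<^bsub>SL\<^esub> P)"
        using Y unfolding lcosets_SL by blast
      then have "g ** h \<in> pre P Y" using * by simp
      then show "C \<in> Y" using h(3) by (simp add: left_mult_coset)
    next
      fix C assume "C \<in> Y"
      then obtain h where h: "det h = 1" "h <#\<^bsub>SL\<^esub> P \<in> Y" "C = h <#\<^bsub>SL\<^esub> P"
        using Y unfolding lcosets_SL by blast
      have "g ** (minv g ** h) \<in> pre P Y" using h by (simp add: minv_r_cancel[OF True])
      then have "minv g ** h \<in> pre P Y" using * h(1) True by (simp add: det_mul minv_det)
      then have "left_mult g (minv g ** h <#\<^bsub>SL\<^esub> P) \<in> left_mult g ` Y" by blast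
      then show "C \<in> left_mult g ` Y" by (simp add: left_mult_coset minv_r_cancel[OF True] h(3))
    qed
  qed
  then show ?thesis using True by (simp add: variety_stabilizer_def stabilizer_def)
qed (simp add: variety_stabilizer_def stabilizer_def)

lemma subgroup_variety_stabilizer:
  assumes P: "subgroup P SL" and Y: "Y \<subseteq> lcosets\<^bsub>SL\<^esub> P"
  shows "subgroup (variety_stabilizer Y) SL"
  unfolding subgroup_SL_iff
proof (intro conjI ballI)
  note iff = variety_stabilizer_iff[OF P Y]
  show "det g = 1" if "g \<in> variety_stabilizer Y" for g using that iff by blast
  show "mat 1 \<in> variety_stabilizer Y" unfolding iff by simp
  show "g ** h \<in> variety_stabilizer Y" if "g \<in> variety_stabilizer Y" "h \<in> variety_stabilizer Y" for g h
    unfolding iff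
  proof (intro conjI allI impI)
    have g: "det g = 1" "\<And>A. det A = 1 \<Longrightarrow> g ** A \<in> pre P Y \<longleftrightarrow> A \<in> pre P Y"
      and h: "det h = 1" "\<And>A. det A = 1 \<Longrightarrow> h ** A \<in> pre P Y \<longleftrightarrow> A \<in> pre P Y" using that unfolding iff by blast+
    show "det (g ** h) = 1" using g(1) h(1) by (simp add: det_mul)
    show "g ** h ** A \<in> pre P Y \<longleftrightarrow> A \<in> pre P Y" if "det A = 1" for A
    proof -
      have "det (h ** A) = 1" using that h(1) by (simp add: det_mul)
      from g(2)[OF this] h(2)[OF that] show ?thesis by (simp only: matrix_mul_assoc)
    qed
  qed
  show "minv g \<in> variety_stabilizer Y" if "g \<in> variety_stabilizer Y" for g
    unfolding iff
  proof (intro conjI allI impI)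
    have g: "det g = 1" "\<And>A. det A = 1 \<Longrightarrow> g ** A \<in> pre P Y \<longleftrightarrow> A \<in> pre P Y" using that unfolding iff by blast+
    show "det (minv g) = 1" using g(1) by (rule minv_det)
    show "minv g ** A \<in> pre P Y \<longleftrightarrow> A \<in> pre P Y" if "det A = 1" for A
    proof -
      have "det (minv g ** A) = 1" using that g(1) by (simp add: det_mul minv_det)
      from g(2)[OF this] show ?thesis by (simp only: minv_r_cancel[OF g(1)])
    qed
  qed
qed

section \<open>Open orbit, density and normality for an arbitrary Levi subgroup\<close>

theorem theorem6p3:
  fixes P L w :: "(complex^4^4) set"
  assumes "parabolic_subgroup P"
    and "upper_triangular \<subseteq> P"
    and "w \<in> carrier weyl_group"
    and "levi_subgroup (variety_stabilizer (schubert_variety P w)) L"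
  shows "spherical_variety P L (schubert_variety P w)"
proof -
  let ?Y = "schubert_variety P w"
  note Bg = subgroup_SLD[OF subgroup_pat[OF preorder_le]]
  have Ps: "subgroup P SL" using assms(1) by (simp add: parabolic_subgroup_def closed_subgroup_def)
  note Pg = subgroup_SLD[OF Ps]
  have BP: "pat (\<le>) \<subseteq> P" using assms(2) by (simp add: upper_triangular_pat)
  obtain RP where RP: "upper_rel RP" "P = pat RP"
    by (rule subgroup_containing_upper[OF Ps BP])
  obtain s n where s: "bij s" "monomial n s" and clY: "closedin (coset_space P) ?Y" and preY: "pre P ?Y = schub s"
    using schubert_closure[OF RP(2,1) assms(3)] by blast
  have Yl: "?Y \<subseteq> lcosets\<^bsub>SL\<^esub> P" using clY by (simp add: closedin_coset_pre)
  have Y_mem: "g <#\<^bsub>SL\<^esub> P \<in> ?Y \<longleftrightarrow> g \<in> schub s" if "det g = 1" for g using that preY by blast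
  have topY: "topspace (subtopology (coset_space P) ?Y) = ?Y"
    using Yl by (auto simp: topspace_subtopology topspace_coset_space)
  have sdet: "det A = 1" if "A \<in> schub s" for A using that by (simp add: schub_def)
  let ?Q = "variety_stabilizer ?Y"
  have Q_iff: "g \<in> ?Q \<longleftrightarrow> det g = 1 \<and> (\<forall>A. det A = 1 \<longrightarrow> (g ** A \<in> schub s \<longleftrightarrow> A \<in> schub s))" for g
    using variety_stabilizer_iff[OF Ps Yl, of g] preY by simp
  have Qs: "subgroup ?Q SL" by (rule subgroup_variety_stabilizer[OF Ps Yl])
  have QI: "g \<in> ?Q" if "det g = 1" "\<And>A. A \<in> schub s \<Longrightarrow> g ** A \<in> schub s" "\<And>A. A \<in> schub s \<Longrightarrow> minv g ** A \<in> schub s" for g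
    unfolding Q_iff using that by (metis minv_l_cancel)
  have BQ: "pat (\<le>) \<subseteq> ?Q"
    using QI schub_left Bg(1,4) by blast
  obtain R where R: "upper_rel R" "?Q = pat R" "\<And>i j. i \<noteq> j \<Longrightarrow> R i j \<longleftrightarrow> (\<forall>t. elem i j t \<in> ?Q)"
  proof (rule subgroup_containing_upper[OF Qs BQ])
    fix R assume "upper_rel R" "?Q = pat R" "\<And>i j. i \<noteq> j \<Longrightarrow> R i j \<longleftrightarrow> (\<forall>t. elem i j t \<in> ?Q)"
    then show thesis by (rule that)
  qed
  have L: "levi_subgroup (pat R) L" using assms(4) R(2) by simp
  obtain u where u: "u \<in> rad R" "L = (\<lambda>A. u ** A ** minv u) ` pat (sim R)" by (rule levi_conjugate[OF R(1) L])
  have du: "det u = 1" using u(1) by (simp add: rad_def)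
  have uQ: "u \<in> ?Q" using u(1) rad_subset_pat[OF upper_relD(1)[OF R(1)]] R(2) by blast
  have LQ: "L \<subseteq> ?Q" using L R(2) by (simp add: levi_subgroup_def)
  obtain B ed ts where data: "spherical_data s B ed ts" using spherical_data_ex[OF s(1)] by blast
  let ?BL = "pat (\<lambda>i j. sim R i j \<and> i \<le> j) :: (complex^4^4) set" and ?E = "pat (blk_rel B) :: (complex^4^4) set"
  \<comment> \<open>Inside a block of \<open>B\<close> the lower elementary matrices at neighbouring
    indices stabilize the variety, so every block of \<open>B\<close> lies in one class of
    \<open>R\<close>.\<close>
  have adj: "R a b" if "a = 1 \<and> b = 0 \<or> a = 2 \<and> b = 1 \<or> a = 3 \<and> b = (2::4)" "B a = B b" for a b
  proof -
    have ab: "a \<noteq> b" using that(1) by auto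
    have c: "s 0 < a \<longrightarrow> s 0 < b" "\<And>l. l \<noteq> a \<and> \<not> le2 a l (s 0) (s 1) \<longrightarrow> l = b \<or> \<not> le2 b l (s 0) (s 1)" "b < s 3 \<longrightarrow> a < s 3"
      using spherical_dataD(11)[OF data, rule_format, of a b] that by blast+
    have "elem a b t ** A \<in> schub s" if "A \<in> schub s" for A t
      by (rule schub_elem[OF that ab]) (use c in auto)
    then have "elem a b t \<in> ?Q" for t
      by (intro QI) (simp_all add: det_elem[OF ab] minv_elem[OF ab])
    then show ?thesis using R(3)[OF ab] by blast
  qed
  have Bm: "B 0 \<le> B 1" "B 1 \<le> B 2" "B 2 \<le> B 3" by (rule spherical_dataD[OF data])+
  have chain: "R j i" if "B i = B j" "i \<le> j" for i j
  proof -
    note t = preorder_trans[OF upper_relD(1)[OF R(1)]] and r = preorder_refl[OF upper_relD(1)[OF R(1)]]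
    have a: "B 0 = B 1 \<Longrightarrow> R 1 0" "B 1 = B 2 \<Longrightarrow> R 2 1" "B 2 = B 3 \<Longrightarrow> R 3 2" using adj by auto
    then have "B 0 = B 2 \<Longrightarrow> R 2 0" "B 1 = B 3 \<Longrightarrow> R 3 1" "B 0 = B 3 \<Longrightarrow> R 3 0" using Bm t by (metis le_antisym order_trans)+
    then show ?thesis using a that r exhaust4[of i] exhaust4[of j] by auto
  qed
  \<comment> \<open>An orbit of the smaller group \<open>?E\<close> thus stays within one orbit of
    \<open>?BL\<close>, whatever the exact stabilizer is.\<close>
  have EB: "?E \<subseteq> ?BL"
  proof
    fix l assume "l \<in> ?E"
    then show "l \<in> ?BL" by (rule pat_mono) (use chain upper_relD(2)[OF R(1)] in blast)
  qed
  have BLs: "subgroup ?BL SL"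
  proof (rule subgroup_pat)
    show "preorder_rel (\<lambda>i j. sim R i j \<and> i \<le> j)"
      using upper_relD(1)[OF R(1)] unfolding preorder_rel_def by (metis order_refl order_trans)
  qed
  note BLg = subgroup_SLD[OF BLs]
  have BLQ: "?BL \<subseteq> ?Q" unfolding R(2) by (intro subsetI) (erule pat_mono, blast)
  define y where "y = um (if (0,2) \<in> ed then 1 else 0) (if (0,3) \<in> ed then 1 else 0) (if (1,3) \<in> ed then 1 else 0) ** n"
  note orb = spherical_orbit[OF data s, folded y_def]
  have dy: "det y = 1" using sdet orb(1) .
  \<comment> \<open>\<open>L\<close> is the standard Levi subgroup conjugated by \<open>u\<close>;
    moving the base point by \<open>u\<close>, which stabilizes the variety, undoes the conjugation
    in the orbit.\<close>
  define y0 where "y0 = (u ** y) <#\<^bsub>SL\<^esub> P"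
  let ?B' = "(\<lambda>A. u ** A ** minv u) ` ?BL"
  have borel: "borel_subgroup L ?B'" unfolding u(2) by (rule borel_levi[OF R(1) du])
  have y0: "y0 \<in> ?Y"
    unfolding y0_def using Y_mem[of "u ** y"] uQ[unfolded Q_iff] orb(1) dy du by (simp add: det_mul)
  let ?O = "orbit (SL\<lparr>carrier := ?B'\<rparr>) left_mult y0"
  have O_eq: "?O = {(u ** l ** y) <#\<^bsub>SL\<^esub> P | l. l \<in> ?BL}"
  proof -
    have "left_mult (u ** l ** minv u) y0 = (u ** l ** y) <#\<^bsub>SL\<^esub> P" for l
      unfolding y0_def left_mult_coset using du by (simp add: matrix_mul_assoc[symmetric] minv_l_cancel)
    then show ?thesis unfolding orbit_def by auto
  qed
  obtain f where f: "\<And>t. polynomial_fun (f t)" "\<And>t A. det A = 1 \<Longrightarrow> ev t A = f t A" using polynomial_ev by metis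
  define F where "F A = (\<Prod>t\<in>set ts. f t A)" for A
  have polF: "polynomial_fun F" unfolding F_def[abs_def] by (intro polynomial_fun_prod f(1))
  have F_nz: "F A \<noteq> 0 \<longleftrightarrow> (\<forall>t\<in>set ts. ev t A \<noteq> 0)" if "det A = 1" for A
    using f(2)[OF that] by (auto simp: F_def)
  have O_open: "openin (subtopology (coset_space P) ?Y) ?O"
  proof -
    \<comment> \<open>Nonvanishing of \<open>F\<close> on the variety is preserved by
      \<open>?E\<close> on the left and upper triangular factors on the right. Letting
      \<open>x\<close> run through the coset and \<open>l\<close> through \<open>?BL\<close> gives a
      condition on cosets that is invariant under the whole Borel subgroup of
      \<open>L\<close>.\<close>
    define U where "U = {C \<in> lcosets\<^bsub>SL\<^esub> P. \<exists>x\<in>C. \<exists>l\<in>?BL. F (minv l ** minv u ** x) \<noteq> 0}"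
    have "pre P U = (\<Union>p\<in>P. \<Union>l\<in>?BL. {g. det g = 1 \<and> F ((minv l ** minv u) ** g ** p) \<noteq> 0})"
      by (auto simp: U_def lcosets_SL l_coset_def matrix_mul_assoc)
    moreover have "openin zariski (\<Union>p\<in>P. \<Union>l\<in>?BL. {g. det g = 1 \<and> F ((minv l ** minv u) ** g ** p) \<noteq> 0})"
      by (intro openin_Union ballI) (auto intro!: openin_zariski_nonvanishing polynomial_fun_translate polF)
    ultimately have "openin (coset_space P) U" by (auto simp: openin_coset_pre U_def)
    moreover have "?O = U \<inter> ?Y"
    proof (intro subset_antisym subsetI)
      fix C assume "C \<in> ?O"
      then obtain l where l: "l \<in> ?BL" "C = (u ** l ** y) <#\<^bsub>SL\<^esub> P" unfolding O_eq by blast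
      have dl: "det l = 1" using BLg(1)[OF l(1)] .
      have d: "det (u ** l ** y) = 1" using du dl dy by (simp add: det_mul)
      have "l ** y \<in> schub s" using subsetD[OF BLQ l(1)] orb(1) dy unfolding Q_iff by blast
      then have "u ** l ** y \<in> schub s" using uQ dl dy unfolding Q_iff by (simp add: matrix_mul_assoc[symmetric] det_mul)
      then have "C \<in> ?Y" using Y_mem[OF d] l(2) by simp
      moreover have "F y \<noteq> 0"
        using orb(2)[OF subgroup_SLD(2)[OF subgroup_pat[OF preorder_blk_rel]] Bg(2)] F_nz[OF dy] by simp
      then have "F (minv l ** minv u ** (u ** l ** y)) \<noteq> 0"
        using du dl by (simp add: matrix_mul_assoc[symmetric] minv_l_cancel)
      moreover have "u ** l ** y \<in> C" unfolding l(2) lcoset_mem by (rule bexI[OF _ Pg(2)]) simp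
      moreover have "C \<in> lcosets\<^bsub>SL\<^esub> P" using l(2) d by (auto simp: lcosets_SL)
      ultimately show "C \<in> U \<inter> ?Y" using l(1) by (auto simp: U_def)
    next
      fix C assume C: "C \<in> U \<inter> ?Y"
      then obtain g x l where g: "det g = 1" "C = g <#\<^bsub>SL\<^esub> P" "x \<in> C" "l \<in> ?BL" "F (minv l ** minv u ** x) \<noteq> 0"
        unfolding U_def lcosets_SL by blast
      have dl: "det l = 1" using BLg(1)[OF g(4)] .
      obtain p where p: "p \<in> P" "x = g ** p" using g(3) unfolding g(2) lcoset_mem by blast
      have dx: "det x = 1" using p g(1) Pg(1) by (simp add: det_mul)
      have Cx: "C = x <#\<^bsub>SL\<^esub> P"
        using lcoset_eq_iff[OF Ps g(1) dx] p minv_l_cancel[OF g(1), of p] g(2) by simp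
      then have "x \<in> schub s" using C Y_mem[OF dx] by simp
      let ?A = "minv l ** minv u ** x"
      have "minv u \<in> ?Q" "minv l \<in> ?Q" using subgroup_SLD(4)[OF Qs] uQ g(4) BLQ by blast+
      then have A: "?A \<in> schub s" using \<open>x \<in> schub s\<close> dx du
        unfolding Q_iff by (simp add: matrix_mul_assoc[symmetric] det_mul minv_det)
      obtain l' b where lb: "l' \<in> ?E" "b \<in> pat (\<le>)" "?A = l' ** y ** b"
        using orb(3)[OF A] F_nz[OF sdet[OF A]] g(5) by blast
      have db: "det b = 1" "det l' = 1" using lb by (auto simp: pat_def)
      have "x = u ** (l ** ?A)" using du dl by (simp add: matrix_mul_assoc[symmetric] minv_r_cancel)
      then have x: "x = (u ** (l ** l') ** y) ** b" unfolding lb(3) by (simp add: matrix_mul_assoc)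
      have d: "det (u ** (l ** l') ** y) = 1" using du dl db dy by (simp add: det_mul)
      have "minv (u ** (l ** l') ** y) ** x \<in> P" unfolding x minv_l_cancel[OF d] using lb(2) BP by blast
      then have "C = (u ** (l ** l') ** y) <#\<^bsub>SL\<^esub> P" using lcoset_eq_iff[OF Ps d dx] Cx by simp
      moreover have "l ** l' \<in> ?BL" using BLg(3)[OF g(4)] lb(1) EB by blast
      ultimately show "C \<in> ?O" unfolding O_eq by blast
    qed
    ultimately show ?thesis unfolding openin_subtopology by blast
  qed
  have irrX: "irr (schub s)" using irr_schub normset_schub[OF s(1)] by (simp add: normset_def)
  have irrY: "irreducible_space (subtopology (coset_space P) ?Y)"
    by (rule irreducible_coset_space[OF clY]) (use irrX preY y0 in auto)
  have y0O: "y0 \<in> ?O" unfolding O_eq using BLg(2) by (intro CollectI exI[of _ "mat 1"]) (simp add: y0_def)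
  have dense: "(subtopology (coset_space P) ?Y) closure_of ?O = ?Y"
  proof -
    let ?X = "subtopology (coset_space P) ?Y"
    have sub: "?O \<subseteq> topspace ?X" by (rule openin_subset[OF O_open])
    have "closedin ?X (?X closure_of ?O)" by simp
    moreover have "closedin ?X (topspace ?X - ?O)" by (rule closedin_diff[OF closedin_topspace O_open])
    moreover have "(?X closure_of ?O) \<union> (topspace ?X - ?O) = topspace ?X"
      using closure_of_subset[OF sub] closure_of_subset_topspace[of ?X ?O] by blast
    ultimately have "?X closure_of ?O = topspace ?X \<or> topspace ?X - ?O = topspace ?X"
      using irrY unfolding irreducible_space_def by blast
    moreover have "topspace ?X - ?O \<noteq> topspace ?X" using y0O sub by blast
    ultimately show ?thesis using topY by simp
  qed
  have normal: "normal_variety (subtopology (coset_space P) ?Y) (regular_subvariety P ?Y)"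
    unfolding normal_variety_def topY
  proof (intro conjI ballI irrY)
    fix C assume C: "C \<in> ?Y"
    then obtain g where g: "det g = 1" "C = g <#\<^bsub>SL\<^esub> P" using Yl unfolding lcosets_SL by blast
    obtain b where b: "b \<in> pat (\<le>)" "minors (\<le>) (b ** g) \<noteq> 0" using minors_ex[OF g(1)] by blast
    have m: "minors RP (b ** g) \<noteq> 0" by (rule minors_upper_rel[OF RP(1) b(2)])
    have bQ: "b \<in> ?Q" using b(1) BQ by blast
    \<comment> \<open>The opposite cell of \<open>P\<close> sits inside the lower unitriangular
      group, where \<open>normset_schub\<close> applies.\<close>
    have "rad (\<lambda>i j. RP j i) \<subseteq> (rad (\<lambda>i j. j \<le> i) :: (complex^4^4) set)"
    proof
      fix A :: "complex^4^4" assume "A \<in> rad (\<lambda>i j. RP j i)"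
      then have A: "det A = 1" "A - mat 1 \<in> palg (\<lambda>i j. RP j i \<and> \<not> RP i j)" by (auto simp: rad_def)
      have "A - mat 1 \<in> palg (\<lambda>i j. j \<le> i \<and> \<not> i \<le> j)"
        by (rule palg_mono[OF A(2)]) (use upper_relD(2)[OF RP(1)] linear in blast)
      then show "A \<in> rad (\<lambda>i j. j \<le> i)" using A(1) by (simp add: rad_def)
    qed
    then have Z: "pre P ?Y \<inter> rad (\<lambda>i j. RP j i) \<subseteq> schub s \<inter> rad (\<lambda>i j. j \<le> i)"
      unfolding preY by blast
    have Z': "schub s \<inter> rad (\<lambda>i j. j \<le> i) \<subseteq> pre P ?Y" unfolding preY by blast
    have bY: "b ** h \<in> pre P ?Y \<longleftrightarrow> h \<in> pre P ?Y" if "det h = 1" for h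
      unfolding preY using bQ that unfolding Q_iff by blast
    have gY: "g <#\<^bsub>SL\<^esub> P \<in> ?Y" using C g(2) by simp
    show "integrally_closed_at (subtopology (coset_space P) ?Y) (regular_subvariety P ?Y) C"
      unfolding g(2)
      by (rule integrally_closed_chart[OF RP(1) normset_schub[OF s(1)], folded RP(2), OF Z' Z Bg(1)[OF b(1)] bY g(1) m gY])
  qed
  show ?thesis
    unfolding spherical_variety_def
  proof (intro conjI)
    show "connected_reductive L" by (rule connected_reductive_levi[OF R(1) L])
    show "closedin (coset_space P) ?Y" by (rule clY)
    show "normal_variety (subtopology (coset_space P) ?Y) (regular_subvariety P ?Y)" by (rule normal)
    show "\<forall>h\<in>L. left_mult h ` ?Y = ?Y"
      using LQ by (auto simp: variety_stabilizer_def stabilizer_def)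
    show "\<exists>B y. borel_subgroup L B \<and> y \<in> ?Y \<and>
        openin (subtopology (coset_space P) ?Y) (orbit (SL\<lparr>carrier := B\<rparr>) left_mult y) \<and>
        (subtopology (coset_space P) ?Y) closure_of (orbit (SL\<lparr>carrier := B\<rparr>) left_mult y) = ?Y"
      using borel y0 O_open dense by blast
  qed
qed

end
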